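(* Assume Assumptions A, B and C (the latter at every point $y\in\mathbb{R}$). Then for each $(x,t)\in\mathbb{R}\times[0,\infty)$, $$\lim_{n\to\infty} n^{-1}\sigma^n_{nt}([nx]) = u(x,t)\quad\text{in probability},$$ where $u(x,t)=u_0(x-bt)$. Moreover, with $\bar y = x-bt$, $$\lim_{n\to\infty}\left\{\frac{\sigma^n_{nt}([nx])-nu(x,t)}{\sqrt n}-\frac{\sigma^n_0([n\bar y])-nu_0(\bar y)}{\sqrt n}\right\}=0\quad\text{in probability}.$$ Furthermore, assume the following specific situation (Example 2.1): $\rho_0=u_0'$ and $v_0$ are bounded, nonnegative, and locally Hölder in the sense that for each bounded interval $[a,b']$ there exist $\beta>1/2$ and $C<\infty$ with $|\rho_0(x)-\rho_0(y)|+|v_0(x)-v_0(y)|\le C|x-y|^\beta$ for all $x,y\in[a,b']$; for each $n$ the $\{\eta^n_0(x):x\in\mathbb{Z}\}$ are independent with $\sup_{n,x}E[\eta^n_0(x)^6]<\infty$, $E\eta^n_0(x)=\rho_0(x/n)$ and $\mathrm{Var}[\eta^n_0(x)]=v_0(x/n)$; and $u_0(0)=\sigma^n_0(0)=0$ for all $n$. Then the processes $\sigma^n_t$ can be constructed on one probability space together with a two-sided standard Brownian motion $B(\cdot)$ such that for all $(x,t)$, with $\bar y=x-bt$, $$\lim_{n\to\infty}\frac{\sigma^n_{nt}([nx])-nu(x,t)}{\sqrt n}=B\Big(\int_0^{\bar y}v_0(s)\,ds\Big)\quad\text{in probability},$$ where $\int_0^{\bar y}=-\int_{\bar y}^0$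 when $\bar y<0$.
   Context: Setting (independent random walk height model). Let $p=\{p(x):x\in\mathbb{Z}\}$ be a probability kernel on $\mathbb{Z}$. Assumption A: for some $\delta>0$, $\sum_{x}e^{\theta x}p(x)<\infty$ for $|\theta|\le\delta$. Set $b=\sum_x xp(x)$, $\kappa_2=\sum_x x^2p(x)$. A "random walk" is a continuous-time random walk on $\mathbb{Z}$ that jumps at rate 1 with increments distributed according to $p$ (transition probability $p_t(x,y)=\sum_{k\ge0}e^{-t}t^kp^{(k)}(y-x)/k!$, $p^{(k)}$ the $k$-fold convolution of $p$). For each $n\in\mathbb{N}$ a random nondecreasing initial height function $\sigma^n_0:\mathbb{Z}\to\mathbb{Z}$ is given; set $\eta^n_0(x)=\sigma^n_0(x)-\sigma^n_0(x-1)\ge0$. Place $\eta^n_0(x)$ particles at each site $x$ at time $0$ and let them evolve as independent random walks, independent of $\sigma^n_0$; write $X^n_i(\cdot)$ for the particle paths. The current is $J^n_t(x)=\#\{i:X^n_i(0)\le x<X^n_i(t)\}-\#\{i:X^n_i(t)\le x<X^n_i(0)\}$ and $\sigma^n_t(x)=\sigma^n_0(x)-J^n_t(x)$. $[\cdot]$ denotes the integer part. Assumption B: for some nondecreasing $C^1$ function $u_0$ on $\mathbb{R}$, $n^{-1}\sigma^n_0([ny])\to u_0(y)$ in probability for every $y\in\mathbb{R}$. Assumption C at a point $\bar y\in\mathbb{R}$: for each $n$ the variables $\{\eta^n_0(x):x\in\mathbb{Z}\}$ are independent and $\sup_{n\in\mathbb{N},x\in\mathbb{Z}}E[\eta^n_0(x)^6]<\infty$;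 write $\rho^n_0(x)=E\eta^n_0(x)$, $v^n_0(x)=\mathrm{Var}[\eta^n_0(x)]$. Bounded nonnegative functions $\rho_0,v_0$ on $\mathbb{R}$ are given (when Assumption B is in force, $\rho_0=u_0'$), and there are positive integers $L=L(n)$ with $n^{-1/4}L(n)\to0$ such that for every finite $A$, $\lim_{n\to\infty}\sup_{|m|\le A\sqrt{n\log n}} n^{1/4}\big|L^{-1}\sum_{j=1}^{L}\rho^n_0([n\bar y]+m+j)-\rho_0(\bar y)\big|=0$, and the same holds with $\rho^n_0,\rho_0$ replaced by $v^n_0,v_0$. *)

theory Defs
  imports "HOL-Probability.Probability"
begin

definition is_kernel :: "(int \<Rightarrow> real) \<Rightarrow> bool" where
  "is_kernel p \<longleftrightarrow> (\<forall>x. 0 \<le> p x) \<and> (p has_sum 1) UNIV"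

definition assumptionA :: "(int \<Rightarrow> real) \<Rightarrow> bool" where
  "assumptionA p \<longleftrightarrow> (\<exists>\<delta>>0. \<forall>\<theta>::real. \<bar>\<theta>\<bar> \<le> \<delta> \<longrightarrow>
      (\<lambda>x. exp (\<theta> * real_of_int x) * p x) summable_on UNIV)"

definition drift :: "(int \<Rightarrow> real) \<Rightarrow> real" where
  "drift p = (\<Sum>\<^sub>\<infinity>x. real_of_int x * p x)"

primrec conv_pow :: "(int \<Rightarrow> real) \<Rightarrow> nat \<Rightarrow> int \<Rightarrow> real" where
  "conv_pow p 0 = (\<lambda>y. if y = 0 then 1 else 0)"
| "conv_pow p (Suc k) = (\<lambda>y. \<Sum>\<^sub>\<infinity>z. conv_pow p k z * p (y - z))"

definition trans_prob :: "(int \<Rightarrow> real) \<Rightarrow> real \<Rightarrow> int \<Rightarrow> int \<Rightarrow> real" where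
  "trans_prob p t x y = (\<Sum>k. exp (- t) * t ^ k / fact k * conv_pow p k (y - x))"

definition is_rw :: "(int \<Rightarrow> real) \<Rightarrow> 'a measure \<Rightarrow> (real \<Rightarrow> 'a \<Rightarrow> int) \<Rightarrow> bool" where
  "is_rw p M Y \<longleftrightarrow>
     (\<forall>t\<ge>0. Y t \<in> measurable M (count_space UNIV)) \<and>
     (\<forall>\<omega>\<in>space M. Y 0 \<omega> = 0) \<and>
     (\<forall>(m::nat) (ts::nat \<Rightarrow> real) (ys::nat \<Rightarrow> int).
        0 \<le> ts 0 \<and> strict_mono_on {..m} ts \<longrightarrow>
        measure M {\<omega>\<in>space M. \<forall>i<m. Y (ts (Suc i)) \<omega> - Y (ts i) \<omega> = ys i}
          = (\<Prod>i<m. trans_prob p (ts (Suc i) - ts i) 0 (ys i)))"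

definition indep_rv :: "'a measure \<Rightarrow> 'b measure \<Rightarrow> ('a \<Rightarrow> 'b) \<Rightarrow> 'c measure \<Rightarrow> ('a \<Rightarrow> 'c) \<Rightarrow> bool" where
  "indep_rv M Ma X Mb Y \<longleftrightarrow>
     X \<in> measurable M Ma \<and> Y \<in> measurable M Mb \<and>
     prob_space.indep_set M
       (sigma_sets (space M) {X -` A \<inter> space M | A. A \<in> sets Ma})
       (sigma_sets (space M) {Y -` A \<inter> space M | A. A \<in> sets Mb})"

text \<open>sigma0 n x = initial height sigma^n_0(x); Y n (z,j) = displacement process of the
  j-th particle (j < eta^n_0(z)) starting at site z, i.e. X(t) = z + Y n (z,j) t.\<close>

definition eta :: "(nat \<Rightarrow> int \<Rightarrow> 'a \<Rightarrow> int) \<Rightarrow> nat \<Rightarrow> int \<Rightarrow> 'a \<Rightarrow> int" where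
  "eta sigma0 n x \<omega> = sigma0 n x \<omega> - sigma0 n (x - 1) \<omega>"

definition current ::
  "(nat \<Rightarrow> int \<Rightarrow> 'a \<Rightarrow> int) \<Rightarrow> (nat \<Rightarrow> int \<times> nat \<Rightarrow> real \<Rightarrow> 'a \<Rightarrow> int) \<Rightarrow>
   nat \<Rightarrow> real \<Rightarrow> int \<Rightarrow> 'a \<Rightarrow> int" where
  "current sigma0 Y n t x \<omega> =
     int (card {(z, j). j < nat (eta sigma0 n z \<omega>) \<and> z \<le> x \<and> x < z + Y n (z, j) t \<omega>})
   - int (card {(z, j). j < nat (eta sigma0 n z \<omega>) \<and> z + Y n (z, j) t \<omega> \<le> x \<and> x < z})"

definition height ::
  "(nat \<Rightarrow> int \<Rightarrow> 'a \<Rightarrow> int) \<Rightarrow> (nat \<Rightarrow> int \<times> nat \<Rightarrow> real \<Rightarrow> 'a \<Rightarrow> int) \<Rightarrow>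
   nat \<Rightarrow> real \<Rightarrow> int \<Rightarrow> 'a \<Rightarrow> int" where
  "height sigma0 Y n t x \<omega> = sigma0 n x \<omega> - current sigma0 Y n t x \<omega>"

definition IRW_setup ::
  "(int \<Rightarrow> real) \<Rightarrow> 'a measure \<Rightarrow> (nat \<Rightarrow> int \<Rightarrow> 'a \<Rightarrow> int) \<Rightarrow>
   (nat \<Rightarrow> int \<times> nat \<Rightarrow> real \<Rightarrow> 'a \<Rightarrow> int) \<Rightarrow> bool" where
  "IRW_setup p M sigma0 Y \<longleftrightarrow> prob_space M \<and>
     (\<forall>n\<ge>1.
        (\<forall>x. sigma0 n x \<in> measurable M (count_space UNIV)) \<and>
        (\<forall>\<omega>\<in>space M. mono (\<lambda>x. sigma0 n x \<omega>)) \<and>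
        (\<forall>i. is_rw p M (Y n i)) \<and>
        prob_space.indep_vars M (\<lambda>_. Pi\<^sub>M {0..} (\<lambda>_. count_space UNIV))
           (\<lambda>i \<omega>. \<lambda>t\<in>{0..}. Y n i t \<omega>) UNIV \<and>
        indep_rv M (Pi\<^sub>M UNIV (\<lambda>_. count_space UNIV)) (\<lambda>\<omega>. \<lambda>x. sigma0 n x \<omega>)
           (Pi\<^sub>M UNIV (\<lambda>_. Pi\<^sub>M {0..} (\<lambda>_. count_space UNIV)))
           (\<lambda>\<omega>. \<lambda>i. \<lambda>t\<in>{0..}. Y n i t \<omega>))"

definition conv_in_prob :: "'a measure \<Rightarrow> (nat \<Rightarrow> 'a \<Rightarrow> real) \<Rightarrow> ('a \<Rightarrow> real) \<Rightarrow> bool" where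
  "conv_in_prob M X Z \<longleftrightarrow>
     (\<forall>\<^sub>F n in sequentially. X n \<in> borel_measurable M) \<and>
     (\<forall>e>0. (\<lambda>n. measure M {\<omega>\<in>space M. e < \<bar>X n \<omega> - Z \<omega>\<bar>}) \<longlonglongrightarrow> 0)"

definition assumptionB ::
  "'a measure \<Rightarrow> (nat \<Rightarrow> int \<Rightarrow> 'a \<Rightarrow> int) \<Rightarrow> (real \<Rightarrow> real) \<Rightarrow> bool" where
  "assumptionB M sigma0 u0 \<longleftrightarrow> mono u0 \<and>
     (\<forall>y. conv_in_prob M (\<lambda>n \<omega>. real_of_int (sigma0 n \<lfloor>real n * y\<rfloor> \<omega>) / real n) (\<lambda>_. u0 y))"

definition mean_eta :: "'a measure \<Rightarrow> (nat \<Rightarrow> int \<Rightarrow> 'a \<Rightarrow> int) \<Rightarrow> nat \<Rightarrow> int \<Rightarrow> real" where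
  "mean_eta M sigma0 n x = integral\<^sup>L M (\<lambda>\<omega>. real_of_int (eta sigma0 n x \<omega>))"

definition var_eta :: "'a measure \<Rightarrow> (nat \<Rightarrow> int \<Rightarrow> 'a \<Rightarrow> int) \<Rightarrow> nat \<Rightarrow> int \<Rightarrow> real" where
  "var_eta M sigma0 n x =
     integral\<^sup>L M (\<lambda>\<omega>. (real_of_int (eta sigma0 n x \<omega>) - mean_eta M sigma0 n x)\<^sup>2)"

definition assumptionC_base ::
  "'a measure \<Rightarrow> (nat \<Rightarrow> int \<Rightarrow> 'a \<Rightarrow> int) \<Rightarrow> (real \<Rightarrow> real) \<Rightarrow> (real \<Rightarrow> real) \<Rightarrow> bool" where
  "assumptionC_base M sigma0 rho0 v0 \<longleftrightarrow>
     (\<forall>n\<ge>1. prob_space.indep_vars M (\<lambda>_. count_space UNIV) (\<lambda>x. eta sigma0 n x) UNIV) \<and>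
     (\<exists>K. \<forall>n\<ge>1. \<forall>x. integrable M (\<lambda>\<omega>. real_of_int (eta sigma0 n x \<omega>) ^ 6) \<and>
                    integral\<^sup>L M (\<lambda>\<omega>. real_of_int (eta sigma0 n x \<omega>) ^ 6) \<le> K) \<and>
     bounded (range rho0) \<and> (\<forall>y. 0 \<le> rho0 y) \<and>
     bounded (range v0) \<and> (\<forall>y. 0 \<le> v0 y)"

text \<open>Assumption C at the point ybar (the supremum over m is expressed by uniform bounds).\<close>
definition assumptionC_at ::
  "'a measure \<Rightarrow> (nat \<Rightarrow> int \<Rightarrow> 'a \<Rightarrow> int) \<Rightarrow> (real \<Rightarrow> real) \<Rightarrow> (real \<Rightarrow> real) \<Rightarrow> real \<Rightarrow> bool" where
  "assumptionC_at M sigma0 rho0 v0 ybar \<longleftrightarrow> assumptionC_base M sigma0 rho0 v0 \<and>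
     (\<exists>L::nat \<Rightarrow> nat. (\<forall>n. 0 < L n) \<and>
        (\<lambda>n. real (L n) / real n powr (1/4)) \<longlonglongrightarrow> 0 \<and>
        (\<forall>A::real. \<forall>e>0. \<forall>\<^sub>F n in sequentially. \<forall>m::int.
           \<bar>real_of_int m\<bar> \<le> A * sqrt (real n * ln (real n)) \<longrightarrow>
             real n powr (1/4) *
               \<bar>(\<Sum>j=1..L n. mean_eta M sigma0 n (\<lfloor>real n * ybar\<rfloor> + m + int j)) / real (L n)
                  - rho0 ybar\<bar> \<le> e \<and>
             real n powr (1/4) *
               \<bar>(\<Sum>j=1..L n. var_eta M sigma0 n (\<lfloor>real n * ybar\<rfloor> + m + int j)) / real (L n)
                  - v0 ybar\<bar> \<le> e))"

definition example21 ::
  "'a measure \<Rightarrow> (nat \<Rightarrow> int \<Rightarrow> 'a \<Rightarrow> int) \<Rightarrow> (real \<Rightarrow> real) \<Rightarrow> (real \<Rightarrow> real) \<Rightarrow> (real \<Rightarrow> real) \<Rightarrow> bool" where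
  "example21 M sigma0 u0 rho0 v0 \<longleftrightarrow> prob_space M \<and>
     (\<forall>n\<ge>1. (\<forall>x. sigma0 n x \<in> measurable M (count_space UNIV)) \<and>
            (\<forall>\<omega>\<in>space M. mono (\<lambda>x. sigma0 n x \<omega>) \<and> sigma0 n 0 \<omega> = 0)) \<and>
     u0 0 = 0 \<and> (\<forall>y. (u0 has_real_derivative rho0 y) (at y)) \<and>
     bounded (range rho0) \<and> (\<forall>y. 0 \<le> rho0 y) \<and>
     bounded (range v0) \<and> (\<forall>y. 0 \<le> v0 y) \<and>
     (\<forall>a b'. \<exists>\<beta>>1/2. \<exists>C. \<forall>x\<in>{a..b'}. \<forall>y\<in>{a..b'}.
        \<bar>rho0 x - rho0 y\<bar> + \<bar>v0 x - v0 y\<bar> \<le> C * \<bar>x - y\<bar> powr \<beta>) \<and>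
     (\<forall>n\<ge>1. prob_space.indep_vars M (\<lambda>_. count_space UNIV) (\<lambda>x. eta sigma0 n x) UNIV) \<and>
     (\<exists>K. \<forall>n\<ge>1. \<forall>x. integrable M (\<lambda>\<omega>. real_of_int (eta sigma0 n x \<omega>) ^ 6) \<and>
                    integral\<^sup>L M (\<lambda>\<omega>. real_of_int (eta sigma0 n x \<omega>) ^ 6) \<le> K) \<and>
     (\<forall>n\<ge>1. \<forall>x. mean_eta M sigma0 n x = rho0 (real_of_int x / real n) \<and>
                var_eta M sigma0 n x = v0 (real_of_int x / real n))"

definition two_sided_BM :: "'a measure \<Rightarrow> (real \<Rightarrow> 'a \<Rightarrow> real) \<Rightarrow> bool" where
  "two_sided_BM N B \<longleftrightarrow> prob_space N \<and>
     (\<forall>t. B t \<in> borel_measurable N) \<and>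
     (\<forall>\<omega>\<in>space N. B 0 \<omega> = 0 \<and> continuous_on UNIV (\<lambda>t. B t \<omega>)) \<and>
     (\<forall>s t. s < t \<longrightarrow> distributed N lborel (\<lambda>\<omega>. B t \<omega> - B s \<omega>) (normal_density 0 (sqrt (t - s)))) \<and>
     (\<forall>(m::nat) (ts::nat \<Rightarrow> real). strict_mono_on {..m} ts \<longrightarrow>
        prob_space.indep_vars N (\<lambda>_. borel) (\<lambda>i \<omega>. B (ts (Suc i)) \<omega> - B (ts i) \<omega>) {..<m})"

definition signed_integral :: "(real \<Rightarrow> real) \<Rightarrow> real \<Rightarrow> real" where
  "signed_integral v y = (if 0 \<le> y then integral {0..y} v else - integral {y..0} v)"

end

theory Submission
  imports Defs "HOL-Real_Asymp.Real_Asymp"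
begin

text \<open>
  The height at time \<open>n t\<close> and site \<open>[n x]\<close> differs from the initial height at \<open>[n (x - b t)]\<close> by
  the net number of particles that cross the characteristic. Given the initial configuration this
  is a difference of two sums of independent indicators. The walks are centred around the
  characteristic and the density is almost constant at distances of order \<open>sqrt n\<close>, so the
  conditional means almost cancel, while the variance is of order \<open>sqrt n\<close>; by Chebyshev's
  inequality the difference is \<open>o (sqrt n)\<close> in probability.

  To couple the initial heights with a Brownian motion \<open>B\<close>, cut the sites into blocks of about
  \<open>n / K\<close> sites. The normalized increments of \<open>B\<close> between the points \<open>\<integral>\<^sub>0\<^bsup>i/K\<^esup> v\<^sub>0\<close> are independent
  standard normal variables. The distribution function of the normal law followed by the quantile
  function of the centred block sum turns such an increment into a block sum with the correct law, from
  which all occupation numbers of the block are decoded. By the central limit theorem this composed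
  function converges to a linear one as \<open>n\<close> grows, so the coupled block sums stay close to the
  increments of \<open>B\<close>; finally \<open>K\<close> tends to infinity slowly with \<open>n\<close>. Independence of the increments
  of all constructed processes is derived from the factorization of characteristic functions.
\<close>

section \<open>Characteristic functions and independence\<close>

text \<open>Every limit is asked for one point at a time and only in probability, so second moments
  and a qualitative central limit theorem suffice; no rate of normal approximation enters. In the
  comparison along the characteristic the obstacle is that densities are controlled only through
  averages over \<open>L\<close> consecutive sites. Since the crossing probability decreases with
  the distance from the characteristic, summation by parts turns control of partial sums of the
  density into control of the mean. In the coupling one Brownian motion must serve every
  \<open>n\<close> at once. The blocks of each \<open>n\<close> read the same path on their own
  grid, and only the independence within a single \<open>n\<close> has to be kept. Where
  \<open>v0\<close> vanishes on a block, the Brownian clock stands still and offers no randomness; a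
  second, independent array of normal variables drives such blocks. All randomness is indexed by a
  countable type and stored in the coordinates of one sequence space.\<close>

lemma (in prob_space) complex_integrable_bounded:
  fixes f :: "'a \<Rightarrow> complex"
  assumes "f \<in> borel_measurable M" "\<And>\<omega>. norm (f \<omega>) \<le> B"
  shows "integrable M f"
  using assms by (intro integrable_const_bound[where B = B]) auto

text \<open>Reweighting: under the probability with density \<open>W / m\<close> the variable
  \<open>X\<close> has the same characteristic function as under \<open>M\<close>, hence the same
  law by Levy's uniqueness theorem. For \<open>m = 0\<close> there is no normalization, but then
  \<open>W\<close> vanishes almost everywhere.\<close>

lemma (in prob_space) char_factor_imp_integral_indicator_nonneg:
  fixes W :: "'a \<Rightarrow> real"
  assumes [measurable]: "W \<in> borel_measurable M" "X \<in> borel_measurable M"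
    and W: "\<And>\<omega>. 0 \<le> W \<omega>" "\<And>\<omega>. W \<omega> \<le> B"
    and fac: "\<And>u. (CLINT \<omega>|M. W \<omega> * iexp (u * X \<omega>)) = (LINT \<omega>|M. W \<omega>) * (CLINT \<omega>|M. iexp (u * X \<omega>))"
    and A: "A \<in> sets borel"
  shows "(LINT \<omega>|M. W \<omega> * indicator A (X \<omega>)) = (LINT \<omega>|M. W \<omega>) * prob (X -` A \<inter> space M)"
proof -
  have intW: "integrable M W"
    using W by (intro integrable_const_bound[where B = B]) auto
  define m where "m = (LINT \<omega>|M. W \<omega>)"
  have m0: "0 \<le> m" unfolding m_def using W by (intro integral_nonneg_AE) auto
  show ?thesis
  proof (cases "m = 0")
    case True
    have "AE \<omega> in M. W \<omega> = 0"
      using integral_nonneg_eq_0_iff_AE[OF intW] W True by (auto simp: m_def)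
    hence "(LINT \<omega>|M. W \<omega> * indicator A (X \<omega>)) = (LINT \<omega>|M. 0)"
      using A by (intro integral_cong_AE) auto
    thus ?thesis using True by (simp add: m_def)
  next
    case False
    hence mpos: "m > 0" using m0 by simp
    define Q where "Q = density M (\<lambda>\<omega>. ennreal (W \<omega> / m))"
    have sQ[simp, measurable_cong]: "sets Q = sets M" by (simp add: Q_def)
    have "emeasure Q (space Q) = (\<integral>\<^sup>+ \<omega>. ennreal (W \<omega> / m) \<partial>M)"
      by (simp add: Q_def emeasure_density cong: nn_integral_cong)
    also have "\<dots> = ennreal (LINT \<omega>|M. W \<omega> / m)"
      using W mpos intW by (intro nn_integral_eq_integral) auto
    also have "\<dots> = 1" using mpos by (simp add: m_def[symmetric])
    finally interpret Q: prob_space Q by (rule prob_spaceI)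
    have d1: "real_distribution (distr Q borel X)" 
      by (intro Q.real_distribution_distr) simp
    have d2: "real_distribution (distr M borel X)" by (intro real_distribution_distr) simp
    have "char (distr Q borel X) u = char (distr M borel X) u" for u
    proof -
      have "char (distr Q borel X) u = (CLINT \<omega>|Q. iexp (u * X \<omega>))"
        unfolding char_def by (intro integral_distr) auto
      also have "\<dots> = (CLINT \<omega>|M. (W \<omega> / m) *\<^sub>R iexp (u * X \<omega>))"
        unfolding Q_def using W mpos by (intro integral_density) auto
      also have "\<dots> = (CLINT \<omega>|M. (W \<omega> * iexp (u * X \<omega>)) / m)"
        by (intro Bochner_Integration.integral_cong) (auto simp: scaleR_conv_of_real)
      also have "\<dots> = (CLINT \<omega>|M. W \<omega> * iexp (u * X \<omega>)) / m"
        by simp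
      also have "\<dots> = (CLINT \<omega>|M. iexp (u * X \<omega>))"
        unfolding fac m_def[symmetric] using mpos by simp
      also have "\<dots> = char (distr M borel X) u"
        unfolding char_def by (intro integral_distr[symmetric]) auto
      finally show ?thesis .
    qed
    hence eq: "distr Q borel X = distr M borel X"
      by (intro Levy_uniqueness d1 d2) auto
    have "prob (X -` A \<inter> space M) = measure (distr M borel X) A"
      using A by (simp add: measure_distr)
    also have "\<dots> = measure (distr Q borel X) A" by (simp add: eq)
    also have "\<dots> = measure Q (X -` A \<inter> space Q)" using A by (subst measure_distr) auto
    also have "\<dots> = (LINT \<omega>|Q. indicator A (X \<omega>))"
    proof -
      have [measurable]: "X -` A \<inter> space Q \<in> sets Q" 
        using A by (intro measurable_sets[where A=borel]) auto
      have "(LINT \<omega>|Q. indicator A (X \<omega>)) = (LINT \<omega>|Q. indicator (X -` A \<inter> space Q) \<omega> :: real)"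
        by (intro Bochner_Integration.integral_cong) (auto simp: indicator_def)
      thus ?thesis by simp
    qed
    also have "\<dots> = (LINT \<omega>|M. (W \<omega> / m) *\<^sub>R indicator A (X \<omega>))"
      unfolding Q_def using W mpos A by (intro integral_density) auto
    also have "\<dots> = (LINT \<omega>|M. W \<omega> * indicator A (X \<omega>)) / m"
      by simp
    finally show ?thesis using mpos by (simp add: m_def[symmetric] field_simps)
  qed
qed

text \<open>A bounded complex weight reduces to nonnegative ones: its real and imaginary parts lie
  in [-1, 1] and become nonnegative after adding 1, a shift that keeps the factorization.\<close>

lemma (in prob_space) char_factor_imp_integral_indicator:
  fixes W :: "'a \<Rightarrow> complex"
  assumes [measurable]: "W \<in> borel_measurable M" "X \<in> borel_measurable M"
    and W: "\<And>\<omega>. norm (W \<omega>) \<le> 1"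
    and fac: "\<And>u. (CLINT \<omega>|M. W \<omega> * iexp (u * X \<omega>)) = (CLINT \<omega>|M. W \<omega>) * (CLINT \<omega>|M. iexp (u * X \<omega>))"
    and A[measurable]: "A \<in> sets borel"
  shows "(CLINT \<omega>|M. W \<omega> * indicator A (X \<omega>)) = (CLINT \<omega>|M. W \<omega>) * prob (X -` A \<inter> space M)"
proof -
  have [measurable]: "cnj \<in> borel_measurable borel"
    by (intro borel_measurable_continuous_onI continuous_intros)
  have iW: "integrable M W" using W by (intro complex_integrable_bounded) auto
  have iWe: "integrable M (\<lambda>\<omega>. W \<omega> * iexp (u * X \<omega>))" for u
    using W by (intro complex_integrable_bounded[where B=1]) (auto simp: norm_mult)
  have iWA: "integrable M (\<lambda>\<omega>. W \<omega> * indicator A (X \<omega>))"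
    using W by (intro complex_integrable_bounded[where B=1]) (auto simp: norm_mult indicator_def)
  have iE: "integrable M (\<lambda>\<omega>. iexp (u * X \<omega>))" for u
    by (intro complex_integrable_bounded[where B=1]) auto
  \<comment> \<open>The hypothesis at \<open>- u\<close>, conjugated. It is needed because real and
    imaginary parts are linear combinations of \<open>W\<close> and \<open>cnj W\<close>.\<close>
  have cfac: "(CLINT \<omega>|M. cnj (W \<omega>) * iexp (u * X \<omega>)) = cnj (CLINT \<omega>|M. W \<omega>) * (CLINT \<omega>|M. iexp (u * X \<omega>))" for u
  proof -
    have e: "cnj (iexp (- u * x)) = iexp (u * x)" for x by (simp add: exp_cnj)
    have "(CLINT \<omega>|M. cnj (W \<omega>) * iexp (u * X \<omega>)) = (CLINT \<omega>|M. cnj (W \<omega> * iexp (- u * X \<omega>)))"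
      by (intro Bochner_Integration.integral_cong refl) (simp only: complex_cnj_mult e)
    also have "\<dots> = cnj ((CLINT \<omega>|M. W \<omega>) * (CLINT \<omega>|M. iexp (- u * X \<omega>)))"
      by (subst Bochner_Integration.integral_cnj) (simp only: fac)
    also have "\<dots> = cnj (CLINT \<omega>|M. W \<omega>) * (CLINT \<omega>|M. cnj (iexp (- u * X \<omega>)))"
      by (simp only: complex_cnj_mult Bochner_Integration.integral_cnj)
    finally show ?thesis by (simp only: e)
  qed
  have real: "(LINT \<omega>|M. R \<omega> * indicator A (X \<omega>)) = (LINT \<omega>|M. R \<omega>) * prob (X -` A \<inter> space M)"
    if [measurable]: "R \<in> borel_measurable M" and R: "\<And>\<omega>. \<bar>R \<omega>\<bar> \<le> 1"
      and f: "\<And>u. (CLINT \<omega>|M. R \<omega> * iexp (u * X \<omega>)) = (LINT \<omega>|M. R \<omega>) * (CLINT \<omega>|M. iexp (u * X \<omega>))"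
    for R :: "'a \<Rightarrow> real"
  proof -
    have iR: "integrable M R" using R by (intro integrable_const_bound[where B=1]) auto
    have iRA: "integrable M (\<lambda>\<omega>. R \<omega> * indicator A (X \<omega>))" 
      using R by (intro integrable_const_bound[where B=1]) (auto simp: indicator_def)
    have iA: "integrable M (\<lambda>\<omega>. indicator A (X \<omega>) :: real)" 
      by (intro integrable_const_bound[where B=1]) (auto simp: indicator_def)
    have iRe: "integrable M (\<lambda>\<omega>. R \<omega> * iexp (u * X \<omega>))" for u
      using R by (intro complex_integrable_bounded[where B=1]) (auto simp: norm_mult)
    have "(LINT \<omega>|M. (R \<omega> + 1) * indicator A (X \<omega>)) = (LINT \<omega>|M. (R \<omega> + 1)) * prob (X -` A \<inter> space M)"
    proof (rule char_factor_imp_integral_indicator_nonneg[where B=2])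
      fix \<omega> show "0 \<le> R \<omega> + 1" "R \<omega> + 1 \<le> 2" using R[of \<omega>] by auto
    next
      fix u
      have "(CLINT \<omega>|M. complex_of_real (R \<omega> + 1) * iexp (u * X \<omega>)) =
        (CLINT \<omega>|M. R \<omega> * iexp (u * X \<omega>) + iexp (u * X \<omega>))"
        by (intro Bochner_Integration.integral_cong) (auto simp: algebra_simps)
      also have "\<dots> = (LINT \<omega>|M. R \<omega>) * (CLINT \<omega>|M. iexp (u * X \<omega>)) + (CLINT \<omega>|M. iexp (u * X \<omega>))"
        by (subst Bochner_Integration.integral_add[OF iRe iE]) (simp only: f)
      also have "\<dots> = complex_of_real (LINT \<omega>|M. R \<omega> + 1) * (CLINT \<omega>|M. iexp (u * X \<omega>))"
        using iR by (simp add: prob_space algebra_simps)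
      finally show "(CLINT \<omega>|M. complex_of_real (R \<omega> + 1) * iexp (u * X \<omega>)) =
        complex_of_real (LINT \<omega>|M. R \<omega> + 1) * (CLINT \<omega>|M. iexp (u * X \<omega>))" .
    qed (use R in auto)
    moreover have "(LINT \<omega>|M. indicator A (X \<omega>)) = prob (X -` A \<inter> space M)"
    proof -
      have "(LINT \<omega>|M. indicator A (X \<omega>)) = (LINT \<omega>|M. indicator (X -` A \<inter> space M) \<omega> :: real)"
        by (intro Bochner_Integration.integral_cong) (auto simp: indicator_def)
      thus ?thesis by simp
    qed
    ultimately show ?thesis using iR iRA iA by (simp add: distrib_right prob_space)
  qed
  have Re: "(LINT \<omega>|M. Re (W \<omega>) * indicator A (X \<omega>)) = (LINT \<omega>|M. Re (W \<omega>)) * prob (X -` A \<inter> space M)"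
  proof (rule real)
    fix u
    have "(CLINT \<omega>|M. Re (W \<omega>) * iexp (u * X \<omega>)) =
        (CLINT \<omega>|M. (W \<omega> * iexp (u * X \<omega>) + cnj (W \<omega>) * iexp (u * X \<omega>)) / 2)"
      by (intro Bochner_Integration.integral_cong refl) (simp add: distrib_right[symmetric] complex_add_cnj)
    also have "\<dots> = ((CLINT \<omega>|M. W \<omega>) * (CLINT \<omega>|M. iexp (u * X \<omega>)) + cnj (CLINT \<omega>|M. W \<omega>) * (CLINT \<omega>|M. iexp (u * X \<omega>))) / 2"
    proof -
      have "integrable M (\<lambda>\<omega>. cnj (W \<omega>) * iexp (u * X \<omega>))"
        using W by (intro complex_integrable_bounded[where B=1]) (auto simp: norm_mult)
      thus ?thesis by (simp only: integral_divide_zero Bochner_Integration.integral_add[OF iWe] fac cfac)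
    qed
    also have "\<dots> = Re (CLINT \<omega>|M. W \<omega>) * (CLINT \<omega>|M. iexp (u * X \<omega>))"
      by (simp add: distrib_right[symmetric] complex_add_cnj)
    finally show "(CLINT \<omega>|M. Re (W \<omega>) * iexp (u * X \<omega>)) = (LINT \<omega>|M. Re (W \<omega>)) * (CLINT \<omega>|M. iexp (u * X \<omega>))"
      using iW by simp
  qed (use order_trans[OF abs_Re_le_cmod W] in simp_all)
  have Im: "(LINT \<omega>|M. Im (W \<omega>) * indicator A (X \<omega>)) = (LINT \<omega>|M. Im (W \<omega>)) * prob (X -` A \<inter> space M)"
  proof (rule real)
    fix u
    have "(CLINT \<omega>|M. Im (W \<omega>) * iexp (u * X \<omega>)) =
        (CLINT \<omega>|M. (W \<omega> * iexp (u * X \<omega>) - cnj (W \<omega>) * iexp (u * X \<omega>)) / (2 * \<i>))"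
    proof (intro Bochner_Integration.integral_cong refl)
      fix \<omega>
      have "complex_of_real (Im (W \<omega>)) = (W \<omega> - cnj (W \<omega>)) / (2 * \<i>)" by (simp add: complex_eq_iff)
      thus "Im (W \<omega>) * iexp (u * X \<omega>) = (W \<omega> * iexp (u * X \<omega>) - cnj (W \<omega>) * iexp (u * X \<omega>)) / (2 * \<i>)"
        by (simp only: left_diff_distrib times_divide_eq_left)
    qed
    also have "\<dots> = ((CLINT \<omega>|M. W \<omega>) * (CLINT \<omega>|M. iexp (u * X \<omega>)) - cnj (CLINT \<omega>|M. W \<omega>) * (CLINT \<omega>|M. iexp (u * X \<omega>))) / (2 * \<i>)"
    proof -
      have "integrable M (\<lambda>\<omega>. cnj (W \<omega>) * iexp (u * X \<omega>))"
        using W by (intro complex_integrable_bounded[where B=1]) (auto simp: norm_mult)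
      thus ?thesis by (simp only: integral_divide_zero Bochner_Integration.integral_diff[OF iWe] fac cfac)
    qed
    also have "\<dots> = Im (CLINT \<omega>|M. W \<omega>) * (CLINT \<omega>|M. iexp (u * X \<omega>))"
    proof -
      have "(z * e - cnj z * e) / (2 * \<i>) = Im z * e" for z e :: complex
      proof -
        have "complex_of_real (Im z) = (z - cnj z) / (2 * \<i>)" by (simp add: complex_eq_iff)
        thus ?thesis by (simp only: left_diff_distrib times_divide_eq_left)
      qed
      thus ?thesis .
    qed
    finally show "(CLINT \<omega>|M. Im (W \<omega>) * iexp (u * X \<omega>)) = (LINT \<omega>|M. Im (W \<omega>)) * (CLINT \<omega>|M. iexp (u * X \<omega>))"
      using iW by simp
  qed (use order_trans[OF abs_Im_le_cmod W] in simp_all)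
  have [simp]: "Re (indicator A x) = indicator A x" "Im (indicator A x) = 0" for x :: real
    by (auto simp: indicator_def)
  show ?thesis
    using integral_Re[OF iWA] integral_Im[OF iWA] integral_Re[OF iW] integral_Im[OF iW] Re Im
    by (intro complex_eqI) simp_all
qed

text \<open>Kac's theorem in an intermediate form that can be proved by induction: exponentials are
  exchanged for indicators one index at a time. \<open>S = {}\<close> is the hypothesis,
  \<open>S = I\<close> the product formula for independent events.\<close>

lemma (in prob_space) kac_indicators:
  fixes X :: "'i \<Rightarrow> 'a \<Rightarrow> real"
  assumes fin: "finite I"
    and [measurable]: "\<And>i. i \<in> I \<Longrightarrow> X i \<in> borel_measurable M"
    and fac: "\<And>u. (CLINT \<omega>|M. iexp (\<Sum>i\<in>I. u i * X i \<omega>)) = (\<Prod>i\<in>I. CLINT \<omega>|M. iexp (u i * X i \<omega>))"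
    and "S \<subseteq> I" and A: "\<And>i. i \<in> I \<Longrightarrow> A i \<in> sets borel"
  shows "(CLINT \<omega>|M. (\<Prod>i\<in>S. indicator (A i) (X i \<omega>)) * iexp (\<Sum>i\<in>I-S. u i * X i \<omega>)) =
    (\<Prod>i\<in>S. complex_of_real (prob (X i -` A i \<inter> space M))) * (\<Prod>i\<in>I-S. CLINT \<omega>|M. iexp (u i * X i \<omega>))"
proof -
  note [measurable] = A
  have "finite S" using fin \<open>S \<subseteq> I\<close> finite_subset by auto
  thus ?thesis using \<open>S \<subseteq> I\<close>
  proof (induction S arbitrary: u rule: finite_induct)
    case empty
    show ?case by (simp only: fac prod.empty mult_1 Diff_empty)
  next
    case (insert k S)
    hence kI[simp]: "k \<in> I" and SI: "S \<subseteq> I" by auto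
    have IS: "I - S = insert k (I - insert k S)" using insert by auto
    have kn: "k \<notin> I - insert k S" "finite (I - insert k S)" using fin by auto
    \<comment> \<open>All factors that do not involve \<open>X k\<close>: the indicators already
      exchanged and the exponentials still waiting.\<close>
    define W where "W \<omega> = (\<Prod>i\<in>S. indicator (A i) (X i \<omega>)) * iexp (\<Sum>i\<in>I-insert k S. u i * X i \<omega>)" for \<omega>
    have [measurable]: "W \<in> borel_measurable M"
    proof -
      have [measurable]: "i \<in> S \<Longrightarrow> i \<in> I" for i using SI by auto
      show ?thesis unfolding W_def by measurable
    qed
    have Wb: "norm (W \<omega>) \<le> 1" for \<omega>
      unfolding W_def norm_mult norm_exp_i_times prod_norm[symmetric]
      by (simp add: prod_le_1 indicator_def)
    define P where "P = (\<Prod>i\<in>S. complex_of_real (prob (X i -` A i \<inter> space M))) * (\<Prod>i\<in>I-insert k S. CLINT \<omega>|M. iexp (u i * X i \<omega>))"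
    have main: "(CLINT \<omega>|M. W \<omega> * iexp (v * X k \<omega>)) = P * (CLINT \<omega>|M. iexp (v * X k \<omega>))" for v
    proof -
      have "(CLINT \<omega>|M. W \<omega> * iexp (v * X k \<omega>)) = 
        (CLINT \<omega>|M. (\<Prod>i\<in>S. indicator (A i) (X i \<omega>)) * iexp (\<Sum>i\<in>I-S. (u(k:=v)) i * X i \<omega>))"
      proof (intro Bochner_Integration.integral_cong refl)
        fix \<omega>
        have "(\<Sum>i\<in>I-S. (u(k:=v)) i * X i \<omega>) = v * X k \<omega> + (\<Sum>i\<in>I-insert k S. u i * X i \<omega>)"
          unfolding IS using kn by (subst sum.insert) (auto intro!: sum.cong)
        thus "W \<omega> * iexp (v * X k \<omega>) = (\<Prod>i\<in>S. indicator (A i) (X i \<omega>)) * iexp (\<Sum>i\<in>I-S. (u(k:=v)) i * X i \<omega>)"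
          by (simp add: W_def exp_add distrib_left mult_ac)
      qed
      also have "\<dots> = (\<Prod>i\<in>S. complex_of_real (prob (X i -` A i \<inter> space M))) * (\<Prod>i\<in>I-S. CLINT \<omega>|M. iexp ((u(k:=v)) i * X i \<omega>))"
        by (rule insert.IH[OF SI])
      also have "(\<Prod>i\<in>I-S. CLINT \<omega>|M. iexp ((u(k:=v)) i * X i \<omega>)) = 
         (CLINT \<omega>|M. iexp (v * X k \<omega>)) * (\<Prod>i\<in>I-insert k S. CLINT \<omega>|M. iexp (u i * X i \<omega>))"
        unfolding IS using kn by (subst prod.insert) (auto intro!: prod.cong)
      finally show ?thesis by (simp add: P_def mult_ac)
    qed
    \<comment> \<open>Putting \<open>v = 0\<close> identifies the constant \<open>P\<close> in
      \<open>main\<close> as the mean of \<open>W\<close>, which makes \<open>main\<close> a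
      factorization.\<close>
    have W1: "(CLINT \<omega>|M. W \<omega>) = P" using main[of 0] by (simp add: prob_space)
    have "(CLINT \<omega>|M. W \<omega> * indicator (A k) (X k \<omega>)) = (CLINT \<omega>|M. W \<omega>) * prob (X k -` A k \<inter> space M)"
      by (rule char_factor_imp_integral_indicator) (use Wb main W1 in auto)
    moreover have "(\<lambda>\<omega>. W \<omega> * indicator (A k) (X k \<omega>)) = (\<lambda>\<omega>. (\<Prod>i\<in>insert k S. indicator (A i) (X i \<omega>)) * iexp (\<Sum>i\<in>I-insert k S. u i * X i \<omega>))"
      using insert.hyps by (simp add: W_def fun_eq_iff mult_ac)
    ultimately show ?case
      using insert.hyps W1 by (simp add: P_def mult_ac)
  qed
qed

theorem (in prob_space) indep_vars_if_char_factor: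
  fixes X :: "'i \<Rightarrow> 'a \<Rightarrow> real"
  assumes fin: "finite I"
    and [measurable]: "\<And>i. i \<in> I \<Longrightarrow> X i \<in> borel_measurable M"
    and fac: "\<And>u. (CLINT \<omega>|M. iexp (\<Sum>i\<in>I. u i * X i \<omega>)) = (\<Prod>i\<in>I. CLINT \<omega>|M. iexp (u i * X i \<omega>))"
  shows "indep_vars (\<lambda>_. borel) X I"
proof (cases "I = {}")
  case True thus ?thesis by (simp add: indep_vars_def2 indep_sets_def)
next
  case False
  show ?thesis unfolding indep_vars_def2
  proof (intro conjI ballI)
    show "indep_sets (\<lambda>i. {X i -` A \<inter> space M |A. A \<in> sets borel}) I"
    proof (subst indep_sets_finite[OF False fin]; (intro ballI)?)
      fix E assume "E \<in> Pi I (\<lambda>i. {X i -` A \<inter> space M |A. A \<in> sets borel})"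
      hence "\<forall>i\<in>I. \<exists>A. A \<in> sets borel \<and> E i = X i -` A \<inter> space M" unfolding Pi_def by blast
      then obtain A where A: "\<And>i. i \<in> I \<Longrightarrow> A i \<in> sets borel" "\<And>i. i \<in> I \<Longrightarrow> E i = X i -` A i \<inter> space M"
        by metis
      have E[measurable]: "E i \<in> sets M" if "i \<in> I" for i
        using A that by (auto intro!: measurable_sets[where A=borel])
      have EI: "(\<Inter>j\<in>I. E j) \<in> sets M" using E fin False by (intro sets.finite_INT) auto
      have "complex_of_real (prob (\<Inter>j\<in>I. E j)) = (CLINT \<omega>|M. indicator (\<Inter>j\<in>I. E j) \<omega>)"
      proof -
        have "(CLINT \<omega>|M. indicator (\<Inter>j\<in>I. E j) \<omega>) = (CLINT \<omega>|M. complex_of_real (indicator (\<Inter>j\<in>I. E j) \<omega>))"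
          by (intro Bochner_Integration.integral_cong) (auto simp: indicator_def)
        also have "\<dots> = complex_of_real (prob (\<Inter>j\<in>I. E j))"
          using EI by (subst integral_complex_of_real) simp
        finally show ?thesis by simp
      qed
      also have "\<dots> = (CLINT \<omega>|M. (\<Prod>i\<in>I. indicator (A i) (X i \<omega>)) * iexp (\<Sum>i\<in>I-I. 0 * X i \<omega>))"
      proof (intro Bochner_Integration.integral_cong refl)
        fix \<omega> assume "\<omega> \<in> space M"
        thus "indicator (\<Inter>j\<in>I. E j) \<omega> = (\<Prod>i\<in>I. indicator (A i) (X i \<omega>)) * iexp (\<Sum>i\<in>I-I. 0 * X i \<omega>)"
          using A fin by (cases "\<forall>i\<in>I. X i \<omega> \<in> A i") (auto simp: indicator_def prod_zero_iff)
      qed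
      also have "\<dots> = (\<Prod>i\<in>I. complex_of_real (prob (E i)))"
        using kac_indicators[of I X I A "\<lambda>_. 0", OF fin _ fac order_refl] A by auto
      finally have "complex_of_real (prob (\<Inter>j\<in>I. E j)) = complex_of_real (\<Prod>i\<in>I. prob (E i))" by simp
      thus "prob (\<Inter>j\<in>I. E j) = (\<Prod>i\<in>I. prob (E i))" using of_real_eq_iff by blast
    next
      fix i assume "i \<in> I"
      show "{X i -` A \<inter> space M |A. A \<in> sets borel} \<subseteq> events" using \<open>i \<in> I\<close> by auto
      show "space M \<in> {X i -` A \<inter> space M |A. A \<in> sets borel}" by (auto intro!: exI[of _ UNIV])
    qed
  qed auto
qed

text \<open>Every countable index type is served by the same sample space of real sequences:
  \<open>to_nat\<close> sends distinct indices to distinct coordinates, and coordinate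
  \<open>k\<close> carries the law belonging to \<open>from_nat k\<close>.\<close>

lemma ex_indep_coordinates:
  fixes \<mu> :: "'i::countable \<Rightarrow> real measure"
  assumes p: "\<And>i. prob_space (\<mu> i)" and s: "\<And>i. sets (\<mu> i) = sets borel"
  obtains N :: "(nat \<Rightarrow> real) measure" and Z where "prob_space N" "space N = UNIV"
    "prob_space.indep_vars N (\<lambda>_. borel) Z UNIV" "\<And>i. distr N borel (Z i) = \<mu> i"
proof -
  define N where "N = Pi\<^sub>M (UNIV :: nat set) (\<lambda>k. \<mu> (from_nat k))"
  have N: "prob_space N" unfolding N_def using p by (intro prob_space_PiM) auto
  interpret N: prob_space N by fact
  define C where "C k \<omega> = (\<omega> k :: real)" for k :: nat and \<omega>
  have sp: "space (\<mu> i) = UNIV" for i using s[of i] sets_eq_imp_space_eq by fastforce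
  have spN: "space N = UNIV" by (simp add: N_def space_PiM sp)
  have sN: "sets N = sets (Pi\<^sub>M UNIV (\<lambda>_. borel))" unfolding N_def by (intro sets_PiM_cong) (auto simp: s)
  have mC[measurable]: "C k \<in> borel_measurable N" for k
    unfolding C_def measurable_cong_sets[OF sN refl] by measurable
  have dC: "distr N borel (C k) = \<mu> (from_nat k)" for k
  proof -
    have "distr N borel (C k) = distr N (\<mu> (from_nat k)) (C k)" by (intro distr_cong) (auto simp: s)
    also have "\<dots> = \<mu> (from_nat k)" unfolding N_def C_def using p by (subst distr_PiM_component) auto
    finally show ?thesis .
  qed
  have "N.indep_vars (\<lambda>_. borel) C UNIV"
  proof (subst N.indep_vars_iff_distr_eq_PiM)
    have "distr N (Pi\<^sub>M UNIV (\<lambda>_. borel)) (\<lambda>x. \<lambda>i\<in>UNIV. C i x) = distr N N (\<lambda>x. x)"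
      by (intro distr_cong) (auto simp: sN C_def)
    also have "\<dots> = N" by simp
    also have "\<dots> = Pi\<^sub>M UNIV (\<lambda>k. distr N borel (C k))" unfolding dC by (simp add: N_def)
    finally show "distr N (Pi\<^sub>M UNIV (\<lambda>_. borel)) (\<lambda>x. \<lambda>i\<in>UNIV. C i x) = Pi\<^sub>M UNIV (\<lambda>k. distr N borel (C k))" .
  qed auto
  hence C': "N.indep_sets (\<lambda>i. {C i -` A \<inter> space N |A. A \<in> sets borel}) UNIV" by (simp add: N.indep_vars_def2)
  have key: "N.prob (\<Inter>j\<in>J. A j) = (\<Prod>j\<in>J. N.prob (A j))"
    if J: "J \<noteq> {}" "finite J" "\<forall>j\<in>J. A j \<in> {C (to_nat j) -` B \<inter> space N |B. B \<in> sets borel}"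
    for A and J :: "'i set"
  proof -
    have "N.prob (\<Inter>k\<in>to_nat ` J. A (from_nat k)) = (\<Prod>k\<in>to_nat ` J. N.prob (A (from_nat k)))"
      by (rule N.indep_setsD[OF C']) (use J in auto)
    thus ?thesis by (simp add: prod.reindex image_comp)
  qed
  have "N.indep_sets (\<lambda>i :: 'i. {C (to_nat i) -` B \<inter> space N |B. B \<in> sets borel}) UNIV"
  proof (rule N.indep_setsI, goal_cases)
    case (2 A J)
    thus ?case by (intro key) simp_all
  qed (auto intro!: measurable_sets[OF mC])
  hence "N.indep_vars (\<lambda>_. borel) (\<lambda>i :: 'i. C (to_nat i)) UNIV"
    by (simp add: N.indep_vars_def2)
  thus ?thesis using that[OF N spN, of "\<lambda>i. C (to_nat i)"] dC by auto
qed

section \<open>Moments of the random walk\<close>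

text \<open>Multiplication by \<open>k\<close> or by \<open>k (k - 1)\<close> cancels against the
  factorial, so each series is a shift of the one for the total mass.\<close>

lemma sums_poisson_moments:
  fixes t :: real
  shows "(\<lambda>k. t ^ k / fact k * exp (- t)) sums 1"
    "(\<lambda>k. real k * (t ^ k / fact k * exp (- t))) sums t"
    "(\<lambda>k. real k * (real k - 1) * (t ^ k / fact k * exp (- t))) sums t\<^sup>2"
proof -
  have "(\<lambda>k. t ^ k / fact k * exp (- t)) sums (exp t * exp (- t))"
    using exp_converges[of t] by (intro sums_mult2) (simp add: divide_inverse mult.commute)
  thus 0: "(\<lambda>k. t ^ k / fact k * exp (- t)) sums 1" by (simp add: exp_minus)
  have 1: "real (Suc k) * (t ^ Suc k / fact (Suc k) * exp (- t)) = t * (t ^ k / fact k * exp (- t))" for k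
    by (simp add: field_simps del: of_nat_Suc)
  have "(\<lambda>k. real (Suc k) * (t ^ Suc k / fact (Suc k) * exp (- t))) sums t"
    unfolding 1 using sums_mult[OF 0, of t] by simp
  from sums_Suc[OF this] show "(\<lambda>k. real k * (t ^ k / fact k * exp (- t))) sums t" by simp
  have 2: "real (Suc (Suc k)) * (real (Suc (Suc k)) - 1) * (t ^ Suc (Suc k) / fact (Suc (Suc k)) * exp (- t)) = 
     t\<^sup>2 * (t ^ k / fact k * exp (- t))" for k
  proof -
    have "(fact (Suc (Suc k)) :: real) = real (Suc (Suc k)) * (real (Suc k) * fact k)" by simp
    moreover have "real (Suc (Suc k)) - 1 = real (Suc k)" by simp
    ultimately show ?thesis by (simp only: power_Suc power2_eq_square) (simp add: divide_simps del: of_nat_Suc)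
  qed
  have "(\<lambda>k. real (Suc (Suc k)) * (real (Suc (Suc k)) - 1) * (t ^ Suc (Suc k) / fact (Suc (Suc k)) * exp (- t))) sums t\<^sup>2"
    unfolding 2 using sums_mult[OF 0, of "t\<^sup>2"] by simp
  from sums_Suc[OF sums_Suc[OF this]]
  show "(\<lambda>k. real k * (real k - 1) * (t ^ k / fact k * exp (- t))) sums t\<^sup>2" by simp
qed

definition kernel_pmf :: "(int \<Rightarrow> real) \<Rightarrow> int pmf" where
  "kernel_pmf p = embed_pmf p"

lemma pmf_kernel_pmf: assumes "is_kernel p" shows "pmf (kernel_pmf p) = p"
proof
  fix x
  have s: "Infinite_Set_Sum.abs_summable_on p UNIV"
    using assms unfolding is_kernel_def abs_summable_equivalent[symmetric] by (auto simp: has_sum_imp_summable)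
  have "(\<integral>\<^sup>+ x. ennreal (p x) \<partial>count_space UNIV) = ennreal (infsetsum p UNIV)"
    using assms s by (intro nn_integral_conv_infsetsum) (auto simp: is_kernel_def)
  also have "infsetsum p UNIV = 1"
    using assms by (simp add: infsetsum_infsum[OF s] is_kernel_def infsumI)
  finally show "pmf (kernel_pmf p) x = p x"
    unfolding kernel_pmf_def using assms by (subst pmf_embed_pmf) (auto simp: is_kernel_def)
qed

primrec rw_steps :: "(int \<Rightarrow> real) \<Rightarrow> nat \<Rightarrow> int pmf" where
  "rw_steps p 0 = return_pmf 0"
| "rw_steps p (Suc k) = bind_pmf (rw_steps p k) (\<lambda>z. map_pmf ((+) z) (kernel_pmf p))"

lemma pmf_rw_steps: assumes "is_kernel p" shows "pmf (rw_steps p k) = conv_pow p k"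
proof (induction k)
  case (Suc k)
  show ?case
  proof
    fix y
    have *: "pmf (map_pmf ((+) z) (kernel_pmf p)) y = p (y - z)" for z
      using pmf_map_inj'[of "(+) z" "kernel_pmf p" "y - z"] by (simp add: pmf_kernel_pmf[OF assms])
    have "pmf (rw_steps p (Suc k)) y = infsetsum (\<lambda>z. conv_pow p k z * p (y - z)) UNIV"
      by (simp add: pmf_bind * pmf_expectation_eq_infsetsum Suc)
    also have "\<dots> = infsum (\<lambda>z. conv_pow p k z * p (y - z)) UNIV"
    proof (intro infsetsum_infsum abs_summable_on_comparison_test[OF pmf_abs_summable[of "rw_steps p k"]])
      fix z
      have "0 \<le> p (y - z)" "p (y - z) \<le> 1" 
        using pmf_nonneg[of "kernel_pmf p"] pmf_le_1[of "kernel_pmf p"] by (auto simp: pmf_kernel_pmf[OF assms])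
      moreover have "0 \<le> conv_pow p k z" using pmf_nonneg[of "rw_steps p k" z] by (simp add: Suc)
      ultimately show "norm (conv_pow p k z * p (y - z)) \<le> norm (pmf (rw_steps p k) z)"
        unfolding Suc by (simp add: abs_mult mult_left_le)
    qed
    finally show "pmf (rw_steps p (Suc k)) y = conv_pow p (Suc k) y" by simp
  qed
qed (auto simp: fun_eq_iff indicator_def)

text \<open>A Poisson law needs a positive rate, so the remaining times get the point mass at
  0.\<close>

definition rw_pmf :: "(int \<Rightarrow> real) \<Rightarrow> real \<Rightarrow> int pmf" where
  "rw_pmf p t = (if t > 0 then bind_pmf (poisson_pmf t) (rw_steps p) else return_pmf 0)"

lemma pmf_rw_pmf: assumes "is_kernel p" "t > 0" shows "pmf (rw_pmf p t) y = trans_prob p t 0 y"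
proof -
  have "pmf (rw_pmf p t) y = infsetsum (\<lambda>k. exp (- t) * t ^ k / fact k * conv_pow p k y) UNIV"
    using assms by (simp add: rw_pmf_def pmf_bind pmf_expectation_eq_infsetsum pmf_rw_steps mult_ac)
  also have "\<dots> = (\<Sum>k. exp (- t) * t ^ k / fact k * conv_pow p k y)"
  proof (intro infsetsum_nat' abs_summable_on_comparison_test[OF pmf_abs_summable[of "poisson_pmf t"]])
    fix k
    have "0 \<le> conv_pow p k y" "conv_pow p k y \<le> 1"
      using pmf_nonneg[of "rw_steps p k" y] pmf_le_1[of "rw_steps p k" y] by (auto simp: pmf_rw_steps assms)
    thus "norm (exp (- t) * t ^ k / fact k * conv_pow p k y) \<le> norm (pmf (poisson_pmf t) k)"
      using assms mult_left_le[of "conv_pow p k y" "t ^ k / fact k * exp (- t)"] by (simp add: abs_mult mult_ac)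
  qed
  finally show ?thesis by (simp add: trans_prob_def)
qed

text \<open>With \<open>z = |d x|\<close> one has
  \<open>z^2 / 2 \<le> exp z \<le> exp (d x) + exp (- d x)\<close>, so the exponential moments at
  \<open>d\<close> and \<open>- d\<close> dominate the square.\<close>

lemma kernel_square_integrable:
  assumes "is_kernel p" "assumptionA p"
  shows "integrable (kernel_pmf p) (\<lambda>x. (real_of_int x)\<^sup>2)"
proof -
  obtain d where d: "d > 0" "\<And>\<theta>. \<bar>\<theta>\<bar> \<le> d \<Longrightarrow> (\<lambda>x. exp (\<theta> * real_of_int x) * p x) summable_on UNIV"
    using assms(2) unfolding assumptionA_def by blast
  have p0: "0 \<le> p x" for x using assms(1) by (simp add: is_kernel_def)
  have a: "integrable (kernel_pmf p) (\<lambda>x. exp (\<theta> * real_of_int x))" if "\<bar>\<theta>\<bar> \<le> d" for \<theta>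
  proof -
    have "Infinite_Set_Sum.abs_summable_on (\<lambda>x. exp (\<theta> * real_of_int x) * p x) UNIV"
      using d(2)[OF that] p0 unfolding abs_summable_equivalent[symmetric] by (simp add: abs_mult)
    hence "integrable (count_space UNIV) (\<lambda>x. p x *\<^sub>R exp (\<theta> * real_of_int x))"
      by (simp add: abs_summable_on_def mult.commute)
    thus ?thesis unfolding measure_pmf_eq_density pmf_kernel_pmf[OF assms(1)]
      using p0 by (subst integrable_density) auto
  qed
  have "integrable (kernel_pmf p) (\<lambda>x. 2 * (exp (d * real_of_int x) + exp ((- d) * real_of_int x)) / d\<^sup>2)"
    by (intro Bochner_Integration.integrable_divide integrable_mult_right Bochner_Integration.integrable_add a) (use d in auto)
  thus ?thesis
  proof (rule Bochner_Integration.integrable_bound; (intro AE_I2)?)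
    fix x
    define z where "z = \<bar>d * real_of_int x\<bar>"
    have "z\<^sup>2 \<le> 2 * exp z" using exp_lower_Taylor_quadratic[of z] by (simp add: z_def)
    moreover have "exp z \<ge> 1 + z" by (rule exp_ge_add_one_self)
    moreover have "exp z + exp (- z) = exp (d * real_of_int x) + exp ((- d) * real_of_int x)"
      by (simp add: z_def abs_if)
    moreover have "z\<^sup>2 = d\<^sup>2 * (real_of_int x)\<^sup>2" by (simp add: z_def power_mult_distrib)
    moreover have "0 \<le> exp (- z)" by simp
    ultimately have "d\<^sup>2 * (real_of_int x)\<^sup>2 \<le> 2 * (exp (d * real_of_int x) + exp ((- d) * real_of_int x))"
      by (metis add.right_neutral add_left_mono distrib_left mult_nonneg_nonneg order_trans zero_le_numeral)
    thus "norm ((real_of_int x)\<^sup>2) \<le> norm (2 * (exp (d * real_of_int x) + exp ((- d) * real_of_int x)) / d\<^sup>2)"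
      using d by (simp add: field_simps)
  qed auto
qed

definition kappa2 :: "(int \<Rightarrow> real) \<Rightarrow> real" where
  "kappa2 p = measure_pmf.expectation (kernel_pmf p) (\<lambda>x. (real_of_int x)\<^sup>2)"

abbreviation "rw_var p \<equiv> kappa2 p - (drift p)\<^sup>2"

lemma kernel_second_moment:
  assumes "is_kernel p" "assumptionA p"
  shows "(\<integral>\<^sup>+x. ennreal ((real_of_int x - m)\<^sup>2) \<partial>kernel_pmf p) = ennreal (rw_var p + (drift p - m)\<^sup>2)"
    and "0 \<le> rw_var p"
proof -
  let ?P = "measure_pmf (kernel_pmf p)"
  note i2 = kernel_square_integrable[OF assms]
  have i1: "integrable ?P real_of_int"
    using i2 by (rule measure_pmf.square_integrable_imp_integrable[rotated]) simp
  have p0: "0 \<le> p x" for x using assms(1) by (simp add: is_kernel_def)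
  have dens: "?P = density (count_space UNIV) (\<lambda>x. ennreal (p x))"
    by (simp only: measure_pmf_eq_density pmf_kernel_pmf[OF assms(1)])
  have "integrable (count_space UNIV) (\<lambda>x. p x *\<^sub>R real_of_int x)"
    using i1 p0 unfolding dens by (subst (asm) integrable_density) simp_all
  hence as: "Infinite_Set_Sum.abs_summable_on (\<lambda>x. p x * real_of_int x) UNIV"
    by (simp add: abs_summable_on_def)
  have "measure_pmf.expectation (kernel_pmf p) real_of_int = infsetsum (\<lambda>x. p x * real_of_int x) UNIV"
    by (simp only: pmf_expectation_eq_infsetsum pmf_kernel_pmf[OF assms(1)])
  also have "\<dots> = infsum (\<lambda>x. real_of_int x * p x) UNIV"
    unfolding infsetsum_infsum[OF as] by (intro infsum_cong) simp
  finally have b: "measure_pmf.expectation (kernel_pmf p) real_of_int = drift p"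
    by (simp only: drift_def)
  have eq: "integral\<^sup>L ?P (\<lambda>x. (real_of_int x - m)\<^sup>2) = rw_var p + (drift p - m)\<^sup>2" for m
    using i1 i2 by (simp add: power2_diff b kappa2_def algebra_simps)
  have "integrable ?P (\<lambda>x. (real_of_int x - m)\<^sup>2)" using i1 i2 by (simp add: power2_diff)
  thus "(\<integral>\<^sup>+x. ennreal ((real_of_int x - m)\<^sup>2) \<partial>kernel_pmf p) = ennreal (rw_var p + (drift p - m)\<^sup>2)"
    by (subst nn_integral_eq_integral) (auto simp: eq)
  have "0 \<le> integral\<^sup>L ?P (\<lambda>x. (real_of_int x - drift p)\<^sup>2)" by simp
  thus "0 \<le> rw_var p" unfolding eq by simp
qed

text \<open>Conditioning on the position \<open>z\<close> after \<open>k\<close> steps moves the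
  centre of the last step to \<open>m - z\<close>; hence the induction runs over all centres
  \<open>m\<close>.\<close>

lemma rw_steps_second_moment:
  assumes "is_kernel p" "assumptionA p"
  shows "(\<integral>\<^sup>+x. ennreal ((real_of_int x - m)\<^sup>2) \<partial>rw_steps p k) = ennreal (real k * rw_var p + (real k * drift p - m)\<^sup>2)"
proof (induction k arbitrary: m)
  case (Suc k)
  note v0 = kernel_second_moment(2)[OF assms]
  have "(\<integral>\<^sup>+x. ennreal ((real_of_int x - m)\<^sup>2) \<partial>rw_steps p (Suc k)) =
    (\<integral>\<^sup>+z. \<integral>\<^sup>+x. ennreal ((real_of_int x - (m - z))\<^sup>2) \<partial>kernel_pmf p \<partial>rw_steps p k)"
    by (simp add: algebra_simps)
  also have "\<dots> = (\<integral>\<^sup>+z. ennreal (rw_var p) + ennreal ((real_of_int z - (m - drift p))\<^sup>2) \<partial>rw_steps p k)"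
  proof (intro nn_integral_cong)
    fix z
    have "drift p - (m - real_of_int z) = real_of_int z - (m - drift p)" by simp
    thus "(\<integral>\<^sup>+x. ennreal ((real_of_int x - (m - z))\<^sup>2) \<partial>kernel_pmf p) = ennreal (rw_var p) + ennreal ((real_of_int z - (m - drift p))\<^sup>2)"
      unfolding kernel_second_moment(1)[OF assms] \<open>drift p - (m - real_of_int z) = _\<close>
      using v0 by (intro ennreal_plus) simp_all
  qed
  also have "\<dots> = ennreal (rw_var p) + (\<integral>\<^sup>+z. ennreal ((real_of_int z - (m - drift p))\<^sup>2) \<partial>rw_steps p k)"
    by (subst nn_integral_add) (auto simp: measure_pmf.emeasure_space_1)
  also have "\<dots> = ennreal (real (Suc k) * rw_var p + (real (Suc k) * drift p - m)\<^sup>2)"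
  proof -
    have "real k * drift p - (m - drift p) = real (Suc k) * drift p - m" by (simp add: algebra_simps)
    moreover have "rw_var p + (real k * rw_var p + c) = real (Suc k) * rw_var p + c" for c by (simp add: algebra_simps)
    ultimately show ?thesis using v0 unfolding Suc by (subst ennreal_plus[symmetric]) (simp_all only: zero_le_power2 add_nonneg_nonneg mult_nonneg_nonneg of_nat_0_le_iff)
  qed
  finally show ?case .
qed auto

text \<open>The number of jumps is random with variance \<open>t\<close>. This adds \<open>t\<close>
  times the squared drift and turns the variance of a jump into its second moment
  \<open>kappa2\<close>.\<close>

lemma rw_pmf_second_moment:
  assumes "is_kernel p" "assumptionA p" "0 \<le> t"
  shows "(\<integral>\<^sup>+x. ennreal ((real_of_int x - m)\<^sup>2) \<partial>rw_pmf p t) = ennreal (t * kappa2 p + (t * drift p - m)\<^sup>2)"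
proof (cases "t > 0")
  case False
  thus ?thesis using assms(3) by (simp add: rw_pmf_def)
next
  case True
  let ?f = "\<lambda>k::nat. t ^ k / fact k * exp (- t)"
  note v0 = kernel_second_moment(2)[OF assms(1,2)]
  have "(\<integral>\<^sup>+x. ennreal ((real_of_int x - m)\<^sup>2) \<partial>rw_pmf p t) =
    (\<integral>\<^sup>+k. ennreal (real k * rw_var p + (real k * drift p - m)\<^sup>2) \<partial>poisson_pmf t)"
    using True by (simp add: rw_pmf_def rw_steps_second_moment[OF assms(1,2)])
  also have "\<dots> = (\<Sum>k. ennreal (?f k * (real k * rw_var p + (real k * drift p - m)\<^sup>2)))"
    unfolding nn_integral_measure_pmf nn_integral_count_space_nat pmf_poisson[OF True]
    using True v0 by (intro suminf_cong ennreal_mult[symmetric]) auto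
  also have "\<dots> = ennreal (t * kappa2 p + (t * drift p - m)\<^sup>2)"
  proof (intro suminf_ennreal_eq)
    show "0 \<le> ?f k * (real k * rw_var p + (real k * drift p - m)\<^sup>2)" for k
      using True v0 by simp
    have s1: "(\<lambda>k. (kappa2 p - 2 * m * drift p) * (real k * ?f k) + (drift p)\<^sup>2 * (real k * (real k - 1) * ?f k) + m\<^sup>2 * ?f k)
       sums ((kappa2 p - 2 * m * drift p) * t + (drift p)\<^sup>2 * t\<^sup>2 + m\<^sup>2 * 1)"
      by (intro sums_add sums_mult sums_poisson_moments)
    have s2: "(kappa2 p - 2 * m * drift p) * (real k * q) + (drift p)\<^sup>2 * (real k * (real k - 1) * q) + m\<^sup>2 * q
      = q * (real k * rw_var p + (real k * drift p - m)\<^sup>2)" for k q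
      by (simp add: power2_eq_square algebra_simps)
    have s3: "(kappa2 p - 2 * m * drift p) * t + (drift p)\<^sup>2 * t\<^sup>2 + m\<^sup>2 * 1 = t * kappa2 p + (t * drift p - m)\<^sup>2"
      by (simp add: power2_eq_square algebra_simps)
    show "(\<lambda>k. ?f k * (real k * rw_var p + (real k * drift p - m)\<^sup>2)) sums (t * kappa2 p + (t * drift p - m)\<^sup>2)"
      using s1 unfolding s2 s3 .
  qed
  finally show ?thesis .
qed

lemma kappa2_nonneg: "0 \<le> kappa2 p"
  unfolding kappa2_def by (intro integral_nonneg_AE) auto

lemma is_rw_measurable: "is_rw p M Y \<Longrightarrow> 0 \<le> t \<Longrightarrow> Y t \<in> measurable M (count_space UNIV)"
  unfolding is_rw_def by blast

lemma is_rw_zero: "is_rw p M Y \<Longrightarrow> \<omega> \<in> space M \<Longrightarrow> Y 0 \<omega> = 0"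
  unfolding is_rw_def by (drule conjunct2, drule conjunct1, erule (1) bspec)
lemma is_rw_increments:
  assumes "is_rw p M Y" "0 \<le> ts 0" "strict_mono_on {..m} ts"
  shows "measure M {\<omega>\<in>space M. \<forall>i<m. Y (ts (Suc i)) \<omega> - Y (ts i) \<omega> = ys i}
          = (\<Prod>i<m. trans_prob p (ts (Suc i) - ts i) 0 (ys i))"
proof -
  from assms(1) have "\<forall>(m::nat) (ts::nat \<Rightarrow> real) (ys::nat \<Rightarrow> int).
        0 \<le> ts 0 \<and> strict_mono_on {..m} ts \<longrightarrow>
        measure M {\<omega>\<in>space M. \<forall>i<m. Y (ts (Suc i)) \<omega> - Y (ts i) \<omega> = ys i}
          = (\<Prod>i<m. trans_prob p (ts (Suc i) - ts i) 0 (ys i))"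
    unfolding is_rw_def by (elim conjE)
  from spec[OF spec[OF spec[OF this, of m], of ts], of ys] show ?thesis using assms(2,3) by (rule_tac mp) (simp_all only: simp_thms)
qed

lemma is_rw_distr:
  assumes "is_kernel p" "is_rw p M Y" "prob_space M" "0 \<le> t"
  shows "distr M (count_space UNIV) (Y t) = measure_pmf (rw_pmf p t)"
proof -
  interpret prob_space M by fact
  have [measurable]: "Y s \<in> measurable M (count_space UNIV)" if "s \<ge> 0" for s
    using is_rw_measurable[OF assms(2) that] .
  have Y0: "Y 0 \<omega> = 0" if "\<omega> \<in> space M" for \<omega> using is_rw_zero[OF assms(2) that] .
  have eq: "prob {\<omega>\<in>space M. Y t \<omega> = y} = pmf (rw_pmf p t) y" for y
  proof (cases "t = 0")
    case True
    have "{\<omega>\<in>space M. Y t \<omega> = y} = (if y = 0 then space M else {})" using True Y0 by auto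
    thus ?thesis using True by (simp add: rw_pmf_def prob_space indicator_def)
  next
    case False
    hence t: "t > 0" using assms(4) by simp
    \<comment> \<open>A single increment starting at time 0. Time points must increase strictly,
      hence the separate case \<open>t = 0\<close>.\<close>
    define ts where "ts i = (if i = 0 then 0 else t)" for i :: nat
    have sm: "strict_mono_on {..1} ts" using t by (simp add: ts_def strict_mono_on_def)
    from this have "prob {\<omega>\<in>space M. \<forall>i<1. Y (ts (Suc i)) \<omega> - Y (ts i) \<omega> = y} = (\<Prod>i<(1::nat). trans_prob p (ts (Suc i) - ts i) 0 y)"
      by (intro is_rw_increments[OF assms(2) _ sm]) (simp add: ts_def)
    moreover have "{\<omega>\<in>space M. \<forall>i<1. Y (ts (Suc i)) \<omega> - Y (ts i) \<omega> = y} = {\<omega>\<in>space M. Y t \<omega> = y}"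
      using Y0 by (auto simp: ts_def)
    ultimately show ?thesis using pmf_rw_pmf[OF assms(1) t] by (simp add: ts_def)
  qed
  show ?thesis
  proof (rule measure_eqI_countable[where A=UNIV])
    fix y
    have "emeasure (distr M (count_space UNIV) (Y t)) {y} = ennreal (prob {\<omega>\<in>space M. Y t \<omega> = y})"
      using assms(4) by (subst emeasure_distr) (auto simp: emeasure_eq_measure intro!: arg_cong[where f=prob])
    thus "emeasure (distr M (count_space UNIV) (Y t)) {y} = emeasure (measure_pmf (rw_pmf p t)) {y}"
      by (simp add: eq emeasure_pmf_single)
  qed auto
qed

lemma is_rw_moments:
  assumes "is_kernel p" "assumptionA p" "is_rw p M Y" "prob_space M" "0 \<le> t"
  shows "integrable M (\<lambda>\<omega>. (real_of_int (Y t \<omega>))\<^sup>2)" "integrable M (\<lambda>\<omega>. real_of_int (Y t \<omega>))"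
    "(LINT \<omega>|M. (real_of_int (Y t \<omega>) - m)\<^sup>2) = t * kappa2 p + (t * drift p - m)\<^sup>2"
    "(LINT \<omega>|M. real_of_int (Y t \<omega>)) = t * drift p"
proof -
  interpret prob_space M by fact
  have [measurable]: "Y t \<in> measurable M (count_space UNIV)"
    using is_rw_measurable[OF assms(3,5)] .
  have nn: "(\<integral>\<^sup>+\<omega>. ennreal ((real_of_int (Y t \<omega>) - m)\<^sup>2) \<partial>M) = ennreal (t * kappa2 p + (t * drift p - m)\<^sup>2)" for m
    using rw_pmf_second_moment[OF assms(1,2,5), of m]
    unfolding is_rw_distr[OF assms(1,3,4,5), symmetric] by (subst (asm) nn_integral_distr) auto
  have i: "integrable M (\<lambda>\<omega>. (real_of_int (Y t \<omega>) - m)\<^sup>2)" for m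
    by (intro integrableI_nonneg) (auto simp: nn)
  have eq: "(LINT \<omega>|M. (real_of_int (Y t \<omega>) - m)\<^sup>2) = t * kappa2 p + (t * drift p - m)\<^sup>2" for m
    using nn[of m] assms(5) kappa2_nonneg[of p] by (subst integral_eq_nn_integral) (auto simp del: ennreal_plus)
  thus "(LINT \<omega>|M. (real_of_int (Y t \<omega>) - m)\<^sup>2) = t * kappa2 p + (t * drift p - m)\<^sup>2" .
  show i2: "integrable M (\<lambda>\<omega>. (real_of_int (Y t \<omega>))\<^sup>2)" using i[of 0] by simp
  show i1: "integrable M (\<lambda>\<omega>. real_of_int (Y t \<omega>))"
    using i2 by (rule square_integrable_imp_integrable[rotated]) simp
  \<comment> \<open>The second moments about 0 and about 1 are both known; their difference
    determines the mean.\<close>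
  have "(LINT \<omega>|M. (real_of_int (Y t \<omega>) - 1)\<^sup>2) = (LINT \<omega>|M. (real_of_int (Y t \<omega>))\<^sup>2) - 2 * (LINT \<omega>|M. real_of_int (Y t \<omega>)) + 1"
    using i1 i2 by (simp add: power2_diff prob_space)
  moreover have "t * kappa2 p + (t * drift p - 1)\<^sup>2 = t * kappa2 p + (t * drift p - 0)\<^sup>2 - 2 * (t * drift p) + 1"
    by (simp add: power2_diff)
  ultimately show "(LINT \<omega>|M. real_of_int (Y t \<omega>)) = t * drift p" using eq[of 0] eq[of 1] by simp
qed

section \<open>Displacement counts of independent particles\<close>

lemma (in prob_space) prob_ge_le_of_nn_integral:
  assumes [measurable]: "u \<in> borel_measurable M" and "\<And>\<omega>. 0 \<le> u \<omega>"
    and le: "(\<integral>\<^sup>+\<omega>. ennreal (u \<omega>) \<partial>M) \<le> ennreal B" and "0 < d" "0 \<le> B"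
  shows "prob {\<omega>\<in>space M. d \<le> u \<omega>} \<le> B / d"
proof -
  have i: "integrable M u"
  proof (rule integrableI_nonneg)
    show "(\<integral>\<^sup>+\<omega>. ennreal (u \<omega>) \<partial>M) < \<infinity>" using le_less_trans[OF le ennreal_less_top] by simp
  qed (use assms in auto)
  have "(\<integral>\<omega>. u \<omega> \<partial>M) \<le> B"
    using le nn_integral_eq_integral[OF i] assms by (simp add: ennreal_le_iff)
  moreover have "prob {\<omega>\<in>space M. d \<le> u \<omega>} \<le> (\<integral>\<omega>. u \<omega> \<partial>M) / d"
    by (rule integral_Markov_inequality_measure[OF i, of "{}"]) (use assms in auto)
  ultimately show ?thesis using \<open>0 < d\<close> by (meson divide_right_mono less_imp_le order_trans)
qed

lemma (in prob_space) expectation_square_sum_indep: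
  fixes X :: "'i \<Rightarrow> 'a \<Rightarrow> real"
  assumes "finite I" "indep_vars (\<lambda>_. borel) X I"
    and "\<And>i. i \<in> I \<Longrightarrow> integrable M (\<lambda>\<omega>. (X i \<omega>)\<^sup>2)" "\<And>i. i \<in> I \<Longrightarrow> expectation (X i) = 0"
  shows "integrable M (\<lambda>\<omega>. (\<Sum>i\<in>I. X i \<omega>)\<^sup>2) \<and>
    expectation (\<lambda>\<omega>. (\<Sum>i\<in>I. X i \<omega>)\<^sup>2) = (\<Sum>i\<in>I. expectation (\<lambda>\<omega>. (X i \<omega>)\<^sup>2))"
  using assms
proof (induction I rule: finite_induct)
  case (insert i I)
  let ?S = "\<lambda>\<omega>. \<Sum>i\<in>I. X i \<omega>"
  have rv: "X j \<in> borel_measurable M" if "j \<in> insert i I" for j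
    using insert.prems(1) that by (auto simp: indep_vars_def2)
  have IH: "integrable M (\<lambda>\<omega>. (?S \<omega>)\<^sup>2)" "expectation (\<lambda>\<omega>. (?S \<omega>)\<^sup>2) = (\<Sum>i\<in>I. expectation (\<lambda>\<omega>. (X i \<omega>)\<^sup>2))"
    using insert.IH[OF indep_vars_subset[OF insert.prems(1)]] insert.prems by auto
  have i1: "integrable M (X j)" if "j \<in> insert i I" for j
    by (rule square_integrable_imp_integrable[OF rv[OF that] insert.prems(2)[OF that]])
  have iS: "integrable M ?S" by (intro Bochner_Integration.integrable_sum i1) auto
  have iv: "indep_var borel (X i) borel ?S"
    by (rule indep_vars_sum[OF insert.hyps insert.prems(1)])
  have ip: "integrable M (\<lambda>\<omega>. X i \<omega> * ?S \<omega>)"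
    by (rule indep_var_integrable[OF iv i1 iS]) simp
  have "expectation (\<lambda>\<omega>. X i \<omega> * ?S \<omega>) = expectation (X i) * expectation ?S"
    by (rule indep_var_lebesgue_integral[OF iv i1 iS]) simp
  hence e0: "expectation (\<lambda>\<omega>. X i \<omega> * ?S \<omega>) = 0" using insert.prems(3) by simp
  have eq: "(\<Sum>j\<in>insert i I. X j \<omega>)\<^sup>2 = (X i \<omega>)\<^sup>2 + (2 * (X i \<omega> * ?S \<omega>) + (?S \<omega>)\<^sup>2)" for \<omega>
    using insert.hyps by (simp add: power2_sum)
  have iX: "integrable M (\<lambda>\<omega>. (X i \<omega>)\<^sup>2)" using insert.prems(2) by simp
  show ?case unfolding eq
    using insert.hyps IH iX ip e0 by simp
qed simp

lemma sets_Collect_count_space: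
  "f \<in> measurable M (count_space UNIV) \<Longrightarrow> {\<omega>\<in>space M. Q (f \<omega>)} \<in> sets M"
  using measurable_sets[of f M "count_space UNIV" "{x. Q x}"] by (simp add: vimage_def Int_def conj_commute)

lemma borel_measurable_card_countable:
  fixes P :: "'i::countable \<Rightarrow> 'a \<Rightarrow> bool"
  assumes P[measurable]: "\<And>i. {\<omega>\<in>space M. P i \<omega>} \<in> sets M"
  shows "(\<lambda>\<omega>. real (card {i. P i \<omega>})) \<in> borel_measurable M"
proof -
  define T where "T m = {i::'i. to_nat i < m}" for m
  have finT: "finite (T m)" for m
  proof (rule finite_imageD)
    show "finite (to_nat ` T m)" by (rule finite_subset[of _ "{..<m}"]) (auto simp: T_def)
  qed (simp add: inj_on_def)
  have [measurable]: "Measurable.pred M (P i)" for i using P by (simp add: pred_def)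
  define B where "B m \<omega> \<longleftrightarrow> (\<forall>i. P i \<omega> \<longrightarrow> i \<in> T m)" for m \<omega>
  have [measurable]: "Measurable.pred M (B m)" for m unfolding B_def by measurable
  define f where "f m \<omega> = (\<Sum>i\<in>T m. indicator {\<omega>\<in>space M. P i \<omega>} \<omega> :: real)" for m \<omega>
  have [measurable]: "f m \<in> borel_measurable M" for m unfolding f_def by measurable
  have "(\<lambda>\<omega>. f (LEAST m. B m \<omega>) \<omega>) \<in> borel_measurable M"
    by (rule measurable_compose_countable) measurable
  hence "(\<lambda>\<omega>. if \<exists>m. B m \<omega> then f (LEAST m. B m \<omega>) \<omega> else 0) \<in> borel_measurable M" by measurable
  moreover have "real (card {i. P i \<omega>}) = (if \<exists>m. B m \<omega> then f (LEAST m. B m \<omega>) \<omega> else 0)" if w: "\<omega> \<in> space M" for \<omega>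
  proof (cases "\<exists>m. B m \<omega>")
    case True
    define m where "m = (LEAST m. B m \<omega>)"
    have "B m \<omega>" unfolding m_def using True by (rule LeastI_ex)
    hence "{i. P i \<omega>} = {i\<in>T m. P i \<omega>}" by (auto simp: B_def)
    moreover have "f m \<omega> = (\<Sum>i\<in>T m. if P i \<omega> then 1 else 0)"
      unfolding f_def using w by (intro sum.cong) (auto simp: indicator_def)
    ultimately have "real (card {i. P i \<omega>}) = f m \<omega>" using finT[of m] by (simp add: sum.If_cases Int_def)
    thus ?thesis using True by (simp add: m_def)
  next
    case False
    have "infinite {i. P i \<omega>}"
    proof
      assume fin: "finite {i. P i \<omega>}"
      define m where "m = Suc (Max (to_nat ` {i. P i \<omega>}))"
      have "B m \<omega>" unfolding B_def T_def m_def using fin by (auto simp: less_Suc_eq_le intro!: Max_ge)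
      thus False using False by blast
    qed
    thus ?thesis using False by simp
  qed
  ultimately show ?thesis by (subst measurable_cong) auto
qed

lemma (in prob_space) indep_rv_prob_Int:
  assumes "indep_rv M S X T Y" "A \<in> sets S" "B \<in> sets T"
  shows "prob ((X -` A \<inter> space M) \<inter> (Y -` B \<inter> space M)) = prob (X -` A \<inter> space M) * prob (Y -` B \<inter> space M)"
  using assms by (auto simp: indep_rv_def intro!: indep_setD sigma_sets.Basic)

lemma (in prob_space) indep_rv_distr_pair:
  assumes ind: "indep_rv M S X T Y"
  shows "distr M S X \<Otimes>\<^sub>M distr M T Y = distr M (S \<Otimes>\<^sub>M T) (\<lambda>\<omega>. (X \<omega>, Y \<omega>))"
proof (rule pair_measure_eqI)
  have X: "X \<in> measurable M S" and Y: "Y \<in> measurable M T" using ind by (auto simp: indep_rv_def)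
  show "sigma_finite_measure (distr M S X)" "sigma_finite_measure (distr M T Y)"
    using prob_space_distr[OF X] prob_space_distr[OF Y] by (auto intro: prob_space_imp_sigma_finite)
  fix A B assume "A \<in> sets (distr M S X)" "B \<in> sets (distr M T Y)"
  hence A: "A \<in> sets S" and B: "B \<in> sets T" by auto
  have "emeasure (distr M (S \<Otimes>\<^sub>M T) (\<lambda>\<omega>. (X \<omega>, Y \<omega>))) (A \<times> B) = emeasure M ((X -` A \<inter> space M) \<inter> (Y -` B \<inter> space M))"
    using A B X Y by (subst emeasure_distr) (auto intro!: arg_cong[where f="emeasure M"])
  also have "\<dots> = emeasure (distr M S X) A * emeasure (distr M T Y) B"
    using A B X Y by (simp add: emeasure_distr emeasure_eq_measure indep_rv_prob_Int[OF ind A B] ennreal_mult)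
  finally show "emeasure (distr M S X) A * emeasure (distr M T Y) B = emeasure (distr M (S \<Otimes>\<^sub>M T) (\<lambda>\<omega>. (X \<omega>, Y \<omega>))) (A \<times> B)" ..
qed simp

lemma (in prob_space) indep_rv_compose:
  assumes ind: "indep_rv M S X T Y" and f: "f \<in> measurable S S'" and g: "g \<in> measurable T T'"
  shows "indep_rv M S' (\<lambda>\<omega>. f (X \<omega>)) T' (\<lambda>\<omega>. g (Y \<omega>))"
proof -
  have X: "X \<in> measurable M S" and Y: "Y \<in> measurable M T"
    and I: "indep_set (sigma_sets (space M) {X -` A \<inter> space M | A. A \<in> sets S}) (sigma_sets (space M) {Y -` A \<inter> space M | A. A \<in> sets T})"
    using ind by (auto simp: indep_rv_def)
  have 1: "sigma_sets (space M) {(\<lambda>\<omega>. f (X \<omega>)) -` A \<inter> space M | A. A \<in> sets S'} \<subseteq> sigma_sets (space M) {X -` A \<inter> space M | A. A \<in> sets S}"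
  proof (rule sigma_sets_mono', safe)
    fix A assume A: "A \<in> sets S'"
    have "(\<lambda>\<omega>. f (X \<omega>)) -` A \<inter> space M = X -` (f -` A \<inter> space S) \<inter> space M"
      using measurable_space[OF X] by auto
    moreover have "f -` A \<inter> space S \<in> sets S" by (rule measurable_sets[OF f A])
    ultimately show "\<exists>A'. (\<lambda>\<omega>. f (X \<omega>)) -` A \<inter> space M = X -` A' \<inter> space M \<and> A' \<in> sets S" by blast
  qed
  have 2: "sigma_sets (space M) {(\<lambda>\<omega>. g (Y \<omega>)) -` A \<inter> space M | A. A \<in> sets T'} \<subseteq> sigma_sets (space M) {Y -` A \<inter> space M | A. A \<in> sets T}"
  proof (rule sigma_sets_mono', safe)
    fix A assume A: "A \<in> sets T'"
    have "(\<lambda>\<omega>. g (Y \<omega>)) -` A \<inter> space M = Y -` (g -` A \<inter> space T) \<inter> space M"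
      using measurable_space[OF Y] by auto
    moreover have "g -` A \<inter> space T \<in> sets T" by (rule measurable_sets[OF g A])
    ultimately show "\<exists>A'. (\<lambda>\<omega>. g (Y \<omega>)) -` A \<inter> space M = Y -` A' \<inter> space M \<and> A' \<in> sets T" by blast
  qed
  have "indep_set (sigma_sets (space M) {(\<lambda>\<omega>. f (X \<omega>)) -` A \<inter> space M | A. A \<in> sets S'}) (sigma_sets (space M) {(\<lambda>\<omega>. g (Y \<omega>)) -` A \<inter> space M | A. A \<in> sets T'})"
    using I 1 2 unfolding indep_sets2_eq by blast
  thus ?thesis using measurable_compose[OF X f] measurable_compose[OF Y g] by (simp add: indep_rv_def)
qed

section \<open>Particles observed at one fixed time\<close>

text \<open>The index \<open>n\<close> and the time are frozen: \<open>e\<close> holds the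
  occupation numbers and \<open>W (z, j)\<close> the displacement of particle \<open>j\<close> at
  site \<open>z\<close>. A displacement exists for every \<open>j\<close>, and only those with
  \<open>j < nat (e z)\<close> are counted; in this way \<open>W\<close> can be independent of
  \<open>e\<close>.\<close>

locale marked_particles = prob_space M for M :: "'a measure" +
  fixes e :: "int \<Rightarrow> 'a \<Rightarrow> int" and W :: "int \<times> nat \<Rightarrow> 'a \<Rightarrow> int" and K :: real
  assumes e_meas[measurable]: "\<And>z. e z \<in> measurable M (count_space UNIV)"
    and e_nonneg: "\<And>z \<omega>. \<omega> \<in> space M \<Longrightarrow> 0 \<le> e z \<omega>"
    and e_indep: "indep_vars (\<lambda>_. count_space UNIV) e UNIV"
    and e_square: "\<And>z. integrable M (\<lambda>\<omega>. (real_of_int (e z \<omega>))\<^sup>2)"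
    and e_square_le: "\<And>z. expectation (\<lambda>\<omega>. (real_of_int (e z \<omega>))\<^sup>2) \<le> K"
    and W_meas[measurable]: "\<And>i. W i \<in> measurable M (count_space UNIV)"
    and W_indep: "indep_vars (\<lambda>_. count_space UNIV) W UNIV"
    and W_distr: "\<And>i j. distr M (count_space UNIV) (W i) = distr M (count_space UNIV) (W j)"
    and eW: "indep_rv M (Pi\<^sub>M UNIV (\<lambda>_. count_space UNIV)) (\<lambda>\<omega> z. e z \<omega>) (Pi\<^sub>M UNIV (\<lambda>_. count_space UNIV)) (\<lambda>\<omega> i. W i \<omega>)"
begin

text \<open>All displacements share one law, so particle \<open>(0,0)\<close> represents every
  particle.\<close>

definition q :: "int set \<Rightarrow> real" where "q S = prob {\<omega>\<in>space M. W (0,0) \<omega> \<in> S}"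

definition rho :: "int \<Rightarrow> real" where "rho z = expectation (\<lambda>\<omega>. real_of_int (e z \<omega>))"

definition cnt :: "int \<Rightarrow> int set \<Rightarrow> 'a \<Rightarrow> real" where
  "cnt z S \<omega> = (\<Sum>j<nat (e z \<omega>). indicator S (W (z, j) \<omega>))"

lemma q_nonneg: "0 \<le> q S" and q_le_1: "q S \<le> 1" by (auto simp: q_def)

lemma expectation_indicator_W: "expectation (\<lambda>\<omega>. indicator S (W i \<omega>)) = q S"
proof -
  have *: "expectation (\<lambda>\<omega>. indicator S (W i \<omega>)) = (LINT x|distr M (count_space UNIV) (W i). indicator S x :: real)" for i
    by (rule integral_distr[symmetric]) auto
  have "expectation (\<lambda>\<omega>. indicator S (W i \<omega>)) = expectation (\<lambda>\<omega>. indicator S (W (0,0) \<omega>) :: real)"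
    unfolding *[of i] *[of "(0,0)"] by (simp only: W_distr[of i "(0,0)"])
  also have "\<dots> = expectation (indicator {\<omega>\<in>space M. W (0,0) \<omega> \<in> S})"
    by (intro Bochner_Integration.integral_cong) (auto simp: indicator_def)
  finally show ?thesis by (simp add: q_def sets_Collect_count_space)
qed

lemma integrable_e: "integrable M (\<lambda>\<omega>. real_of_int (e z \<omega>))"
  by (rule square_integrable_imp_integrable[OF _ e_square]) simp

lemma rho_nonneg: "0 \<le> rho z" unfolding rho_def
  by (intro integral_nonneg_AE AE_I2) (simp add: e_nonneg)

lemma rho_le: "rho z \<le> K"
proof -
  have "rho z \<le> expectation (\<lambda>\<omega>. (real_of_int (e z \<omega>))\<^sup>2)" unfolding rho_def
  proof (intro integral_mono integrable_e e_square)
    fix \<omega> assume "\<omega> \<in> space M"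
    hence "e z \<omega> \<le> (e z \<omega>)\<^sup>2" using e_nonneg[of \<omega> z] by (cases "e z \<omega> = 0") (auto simp: power2_eq_square)
    thus "real_of_int (e z \<omega>) \<le> (real_of_int (e z \<omega>))\<^sup>2" by (metis of_int_le_iff of_int_power)
  qed
  thus ?thesis using e_square_le[of z] by simp
qed

lemma K_nonneg: "0 \<le> K" using rho_nonneg[of 0] rho_le[of 0] by simp

text \<open>Fubini's theorem for the independent pair: the occupation numbers stay frozen at
  \<open>\<omega>\<close> while the displacements are integrated over a separate copy
  \<open>\<omega>'\<close>.\<close>

lemma nn_integral_pair_eW:
  assumes f: "f \<in> borel_measurable (Pi\<^sub>M UNIV (\<lambda>_. count_space UNIV) \<Otimes>\<^sub>M Pi\<^sub>M UNIV (\<lambda>_. count_space UNIV))"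
  shows "(\<integral>\<^sup>+\<omega>. f (\<lambda>z. e z \<omega>, \<lambda>i. W i \<omega>) \<partial>M) = (\<integral>\<^sup>+\<omega>. (\<integral>\<^sup>+\<omega>'. f (\<lambda>z. e z \<omega>, \<lambda>i. W i \<omega>') \<partial>M) \<partial>M)"
proof -
  let ?S = "Pi\<^sub>M UNIV (\<lambda>_::int. count_space (UNIV::int set))"
  let ?T = "Pi\<^sub>M UNIV (\<lambda>_::int\<times>nat. count_space (UNIV::int set))"
  have X: "(\<lambda>\<omega> z. e z \<omega>) \<in> measurable M ?S" and Y: "(\<lambda>\<omega> i. W i \<omega>) \<in> measurable M ?T"
    using eW unfolding indep_rv_def by blast+
  note XY = measurable_Pair[OF X Y]
  have d: "distr M (?S \<Otimes>\<^sub>M ?T) (\<lambda>\<omega>. (\<lambda>z. e z \<omega>, \<lambda>i. W i \<omega>)) = distr M ?S (\<lambda>\<omega> z. e z \<omega>) \<Otimes>\<^sub>M distr M ?T (\<lambda>\<omega> i. W i \<omega>)"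
    by (rule indep_rv_distr_pair[OF eW, symmetric])
  interpret T: prob_space "distr M ?T (\<lambda>\<omega> i. W i \<omega>)" by (rule prob_space_distr[OF Y])
  have f': "f \<in> borel_measurable (distr M ?S (\<lambda>\<omega> z. e z \<omega>) \<Otimes>\<^sub>M distr M ?T (\<lambda>\<omega> i. W i \<omega>))"
    using f by simp
  have "(\<integral>\<^sup>+\<omega>. f (\<lambda>z. e z \<omega>, \<lambda>i. W i \<omega>) \<partial>M) = (\<integral>\<^sup>+x. f x \<partial>distr M (?S \<Otimes>\<^sub>M ?T) (\<lambda>\<omega>. (\<lambda>z. e z \<omega>, \<lambda>i. W i \<omega>)))"
    by (subst nn_integral_distr[OF XY]) (use f in simp_all)
  also have "\<dots> = (\<integral>\<^sup>+x. \<integral>\<^sup>+y. f (x, y) \<partial>distr M ?T (\<lambda>\<omega> i. W i \<omega>) \<partial>distr M ?S (\<lambda>\<omega> z. e z \<omega>))"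
    unfolding d by (rule T.nn_integral_fst[OF f', symmetric])
  also have "\<dots> = (\<integral>\<^sup>+x. \<integral>\<^sup>+\<omega>'. f (x, \<lambda>i. W i \<omega>') \<partial>M \<partial>distr M ?S (\<lambda>\<omega> z. e z \<omega>))"
    by (intro nn_integral_cong nn_integral_distr[OF Y]) (use f in \<open>auto intro: measurable_compose[OF _ f] simp: space_PiM\<close>)
  also have "\<dots> = (\<integral>\<^sup>+\<omega>. \<integral>\<^sup>+\<omega>'. f (\<lambda>z. e z \<omega>, \<lambda>i. W i \<omega>') \<partial>M \<partial>M)"
  proof (intro nn_integral_distr[OF X])
    have "(\<lambda>(x, \<omega>'). f (x, \<lambda>i. W i \<omega>')) \<in> borel_measurable (?S \<Otimes>\<^sub>M M)"
    proof -
      have "(\<lambda>p. (fst p, \<lambda>i. W i (snd p))) \<in> measurable (?S \<Otimes>\<^sub>M M) (?S \<Otimes>\<^sub>M ?T)"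
        by (intro measurable_Pair measurable_fst measurable_compose[OF measurable_snd Y])
      from measurable_compose[OF this f] show ?thesis by (simp add: case_prod_beta)
    qed
    thus "(\<lambda>x. \<integral>\<^sup>+\<omega>'. f (x, \<lambda>i. W i \<omega>') \<partial>M) \<in> borel_measurable (distr M ?S (\<lambda>\<omega> z. e z \<omega>))"
      by simp
  qed
  finally show ?thesis .
qed

lemma measurable_component_fst:
  "(\<lambda>x. fst x z) \<in> measurable (Pi\<^sub>M UNIV (\<lambda>_::int. count_space (UNIV::int set)) \<Otimes>\<^sub>M Pi\<^sub>M UNIV (\<lambda>_::int\<times>nat. count_space (UNIV::int set))) (count_space UNIV)"
  by (rule measurable_compose[OF measurable_fst measurable_component_singleton]) simp

lemma measurable_component_snd:
  "(\<lambda>x. snd x i) \<in> measurable (Pi\<^sub>M UNIV (\<lambda>_::int. count_space (UNIV::int set)) \<Otimes>\<^sub>M Pi\<^sub>M UNIV (\<lambda>_::int\<times>nat. count_space (UNIV::int set))) (count_space UNIV)"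
  by (rule measurable_compose[OF measurable_snd measurable_component_singleton]) simp

lemma measurable_random_sum:
  "(\<lambda>x. \<Sum>j<nat (fst x z). (h :: int \<Rightarrow> real) (snd x (z, j))) \<in> borel_measurable (Pi\<^sub>M UNIV (\<lambda>_::int. count_space (UNIV::int set)) \<Otimes>\<^sub>M Pi\<^sub>M UNIV (\<lambda>_::int\<times>nat. count_space (UNIV::int set)))"
proof (rule measurable_compose_countable[where g = "\<lambda>x. fst x z" and f = "\<lambda>i x. \<Sum>j<nat i. h (snd x (z, j))"])
  show "(\<lambda>x. \<Sum>j<nat i. h (snd x (z, j))) \<in> borel_measurable (Pi\<^sub>M UNIV (\<lambda>_::int. count_space (UNIV::int set)) \<Otimes>\<^sub>M Pi\<^sub>M UNIV (\<lambda>_::int\<times>nat. count_space (UNIV::int set)))" for i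
    by (intro borel_measurable_sum measurable_compose[OF measurable_component_snd]) simp
qed (rule measurable_component_fst)

lemma cnt_measurable[measurable]: "cnt z S \<in> borel_measurable M"
proof -
  have "(\<lambda>\<omega>. \<Sum>j<nat (e z \<omega>). indicator S (W (z, j) \<omega>) :: real) \<in> borel_measurable M"
    by (rule measurable_compose_countable[where g = "\<lambda>\<omega>. e z \<omega>" and f = "\<lambda>i \<omega>. \<Sum>j<nat i. indicator S (W (z, j) \<omega>) :: real"])
       (auto intro!: borel_measurable_sum measurable_compose[OF W_meas])
  thus ?thesis by (simp add: cnt_def[abs_def])
qed

lemma cnt_nonneg: "0 \<le> cnt z S \<omega>" by (auto simp: cnt_def intro!: sum_nonneg)

text \<open>Wald's identity: given the occupation number, the count is a sum of that many indicators
  of mean \<open>q S\<close>.\<close>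

lemma nn_integral_cnt: "(\<integral>\<^sup>+\<omega>. ennreal (cnt z S \<omega>) \<partial>M) = ennreal (rho z * q S)"
proof -
  let ?f = "\<lambda>x. ennreal (\<Sum>j<nat (fst x z). indicator S (snd x (z, j)))"
  have "(\<integral>\<^sup>+\<omega>. ennreal (cnt z S \<omega>) \<partial>M) = (\<integral>\<^sup>+\<omega>. ?f (\<lambda>z. e z \<omega>, \<lambda>i. W i \<omega>) \<partial>M)" by (simp add: cnt_def)
  also have "\<dots> = (\<integral>\<^sup>+\<omega>. (\<integral>\<^sup>+\<omega>'. ?f (\<lambda>z. e z \<omega>, \<lambda>i. W i \<omega>') \<partial>M) \<partial>M)"
    by (rule nn_integral_pair_eW) (intro measurable_compose[OF measurable_random_sum measurable_ennreal] measurable_count_space)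
  also have "\<dots> = (\<integral>\<^sup>+\<omega>. ennreal (real_of_int (e z \<omega>) * q S) \<partial>M)"
  proof (intro nn_integral_cong)
    fix \<omega> assume w: "\<omega> \<in> space M"
    have i: "integrable M (\<lambda>\<omega>'. indicator S (W i \<omega>') :: real)" for i
      by (intro integrable_const_bound[where B=1]) auto
    have "(\<integral>\<^sup>+\<omega>'. ?f (\<lambda>z. e z \<omega>, \<lambda>i. W i \<omega>') \<partial>M) = ennreal (expectation (\<lambda>\<omega>'. \<Sum>j<nat (e z \<omega>). indicator S (W (z, j) \<omega>')))"
      by (simp only: fst_conv snd_conv, intro nn_integral_eq_integral Bochner_Integration.integrable_sum i) (auto intro!: sum_nonneg)
    also have "expectation (\<lambda>\<omega>'. \<Sum>j<nat (e z \<omega>). indicator S (W (z, j) \<omega>')) = real (nat (e z \<omega>)) * q S"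
      by (subst Bochner_Integration.integral_sum) (auto simp: i expectation_indicator_W)
    also have "real (nat (e z \<omega>)) = real_of_int (e z \<omega>)" using e_nonneg[OF w] by simp
    finally show "(\<integral>\<^sup>+\<omega>'. ?f (\<lambda>z. e z \<omega>, \<lambda>i. W i \<omega>') \<partial>M) = ennreal (real_of_int (e z \<omega>) * q S)" .
  qed
  also have "\<dots> = ennreal (expectation (\<lambda>\<omega>. real_of_int (e z \<omega>) * q S))"
    using integrable_e q_nonneg e_nonneg by (intro nn_integral_eq_integral) auto
  finally show ?thesis by (simp add: rho_def)
qed

text \<open>The fluctuation caused by the displacements. Given the occupation numbers, the summands
  are independent and centred, and an indicator has variance at most its probability.\<close>

lemma nn_integral_marks_square:
  assumes F: "finite F" and s: "\<And>z. \<bar>s z\<bar> \<le> 1"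
  shows "(\<integral>\<^sup>+\<omega>. ennreal ((\<Sum>z\<in>F. s z * (cnt z (S z) \<omega> - real_of_int (e z \<omega>) * q (S z)))\<^sup>2) \<partial>M) \<le> ennreal (K * (\<Sum>z\<in>F. q (S z)))"
proof -
  let ?g = "\<lambda>x z. \<Sum>j<nat (fst x z). indicator (S z) (snd x (z, j)) - q (S z)"
  let ?f = "\<lambda>x. ennreal ((\<Sum>z\<in>F. s z * ?g x z)\<^sup>2)"
  have "(\<integral>\<^sup>+\<omega>. ennreal ((\<Sum>z\<in>F. s z * (cnt z (S z) \<omega> - real_of_int (e z \<omega>) * q (S z)))\<^sup>2) \<partial>M) = (\<integral>\<^sup>+\<omega>. ?f (\<lambda>z. e z \<omega>, \<lambda>i. W i \<omega>) \<partial>M)"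
  proof (intro nn_integral_cong)
    fix \<omega> assume w: "\<omega> \<in> space M"
    have "cnt z (S z) \<omega> - real_of_int (e z \<omega>) * q (S z) = ?g (\<lambda>z. e z \<omega>, \<lambda>i. W i \<omega>) z" for z
      using e_nonneg[OF w, of z] by (simp add: cnt_def sum_subtractf)
    thus "ennreal ((\<Sum>z\<in>F. s z * (cnt z (S z) \<omega> - real_of_int (e z \<omega>) * q (S z)))\<^sup>2) = ?f (\<lambda>z. e z \<omega>, \<lambda>i. W i \<omega>)" by simp
  qed
  also have "\<dots> = (\<integral>\<^sup>+\<omega>. (\<integral>\<^sup>+\<omega>'. ?f (\<lambda>z. e z \<omega>, \<lambda>i. W i \<omega>') \<partial>M) \<partial>M)"
    by (rule nn_integral_pair_eW)
       (intro measurable_compose[OF _ measurable_ennreal] borel_measurable_power borel_measurable_sum borel_measurable_times borel_measurable_const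
          measurable_random_sum measurable_count_space)
  also have "\<dots> \<le> (\<integral>\<^sup>+\<omega>. ennreal (\<Sum>z\<in>F. real_of_int (e z \<omega>) * q (S z)) \<partial>M)"
  proof (intro nn_integral_mono)
    fix \<omega> assume w: "\<omega> \<in> space M"
    \<comment> \<open>The particles actually present at the sites of \<open>F\<close>; this random
      index set is fixed once \<open>\<omega>\<close> is frozen.\<close>
    define I where "I = (SIGMA z:F. {..<nat (e z \<omega>)})"
    have finI: "finite I" unfolding I_def using F by auto
    define X where "X i \<omega>' = s (fst i) * (indicator (S (fst i)) (W i \<omega>') - q (S (fst i)))" for i \<omega>'
    have Xm: "X i \<in> borel_measurable M" for i unfolding X_def[abs_def]
      by (rule measurable_compose[OF W_meas]) simp
    have Xb: "\<bar>X i \<omega>'\<bar> \<le> 1" for i \<omega>'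
      unfolding X_def abs_mult using s[of "fst i"] q_nonneg[of "S (fst i)"] q_le_1[of "S (fst i)"]
      by (intro mult_le_one) (auto simp: indicator_def)
    have iX: "integrable M (X i)" for i using Xm Xb by (intro integrable_const_bound[where B=1]) auto
    have iX2: "integrable M (\<lambda>\<omega>'. (X i \<omega>')\<^sup>2)" for i
      using Xm Xb by (intro integrable_const_bound[where B=1]) (auto simp: abs_square_le_1)
    have iI: "integrable M (\<lambda>\<omega>'. indicator T (W i \<omega>') :: real)" for i T
      by (intro integrable_const_bound[where B=1]) auto
    have X0: "expectation (X i) = 0" for i
      unfolding X_def using iI by (simp add: expectation_indicator_W prob_space)
    have X2: "expectation (\<lambda>\<omega>'. (X i \<omega>')\<^sup>2) \<le> q (S (fst i))" for i
    proof -
      have "(X i \<omega>')\<^sup>2 = (s (fst i))\<^sup>2 * ((1 - 2 * q (S (fst i))) * indicator (S (fst i)) (W i \<omega>') + (q (S (fst i)))\<^sup>2)" for \<omega>'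
        by (simp add: X_def power2_eq_square indicator_def algebra_simps)
      hence "expectation (\<lambda>\<omega>'. (X i \<omega>')\<^sup>2) = (s (fst i))\<^sup>2 * ((1 - 2 * q (S (fst i))) * q (S (fst i)) + (q (S (fst i)))\<^sup>2)"
        using iI by (simp add: expectation_indicator_W prob_space)
      also have "\<dots> = (s (fst i))\<^sup>2 * (q (S (fst i)) - (q (S (fst i)))\<^sup>2)" by (simp add: power2_eq_square algebra_simps)
      also have "\<dots> \<le> 1 * q (S (fst i))"
      proof (intro mult_mono)
        show "(s (fst i))\<^sup>2 \<le> 1" using s[of "fst i"] by (simp add: abs_square_le_1)
      qed (use q_nonneg[of "S (fst i)"] q_le_1[of "S (fst i)"] in \<open>auto simp: power2_eq_square mult_left_le\<close>)
      finally show ?thesis by simp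
    qed
    have ind: "indep_vars (\<lambda>_. borel) X I"
      unfolding X_def[abs_def] by (rule indep_vars_compose2[OF indep_vars_subset[OF W_indep]]) auto
    have sq: "integrable M (\<lambda>\<omega>'. (\<Sum>i\<in>I. X i \<omega>')\<^sup>2)"
      "expectation (\<lambda>\<omega>'. (\<Sum>i\<in>I. X i \<omega>')\<^sup>2) = (\<Sum>i\<in>I. expectation (\<lambda>\<omega>'. (X i \<omega>')\<^sup>2))"
      using expectation_square_sum_indep[OF finI ind iX2 X0] by auto
    have "(\<Sum>z\<in>F. s z * ?g (\<lambda>z. e z \<omega>, \<lambda>i. W i \<omega>') z) = (\<Sum>i\<in>I. X i \<omega>')" for \<omega>'
      unfolding I_def X_def using F
      unfolding fst_conv snd_conv sum_distrib_left by (subst sum.Sigma) (auto simp: case_prod_beta' intro!: sum.cong)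
    hence "(\<integral>\<^sup>+\<omega>'. ?f (\<lambda>z. e z \<omega>, \<lambda>i. W i \<omega>') \<partial>M) = (\<integral>\<^sup>+\<omega>'. ennreal ((\<Sum>i\<in>I. X i \<omega>')\<^sup>2) \<partial>M)" by (simp only:)
    also have "\<dots> = ennreal (\<Sum>i\<in>I. expectation (\<lambda>\<omega>'. (X i \<omega>')\<^sup>2))"
      by (subst nn_integral_eq_integral[OF sq(1)]) (auto simp: sq(2))
    also have "\<dots> \<le> ennreal (\<Sum>i\<in>I. q (S (fst i)))"
      by (intro ennreal_leI sum_mono X2)
    also have "(\<Sum>i\<in>I. q (S (fst i))) = (\<Sum>z\<in>F. real_of_int (e z \<omega>) * q (S z))"
    proof -
      have "(\<Sum>z\<in>F. real_of_int (e z \<omega>) * q (S z)) = (\<Sum>z\<in>F. \<Sum>j<nat (e z \<omega>). q (S z))"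
        using e_nonneg[OF w] by simp
      also have "\<dots> = (\<Sum>i\<in>I. q (S (fst i)))"
        unfolding I_def using F by (subst sum.Sigma) (auto simp: case_prod_beta' intro!: sum.cong)
      finally show ?thesis ..
    qed
    finally show "(\<integral>\<^sup>+\<omega>'. ?f (\<lambda>z. e z \<omega>, \<lambda>i. W i \<omega>') \<partial>M) \<le> ennreal (\<Sum>z\<in>F. real_of_int (e z \<omega>) * q (S z))" .
  qed
  also have "\<dots> = ennreal (expectation (\<lambda>\<omega>. \<Sum>z\<in>F. real_of_int (e z \<omega>) * q (S z)))"
    using integrable_e q_nonneg e_nonneg by (intro nn_integral_eq_integral) (auto intro!: sum_nonneg)
  also have "expectation (\<lambda>\<omega>. \<Sum>z\<in>F. real_of_int (e z \<omega>) * q (S z)) = (\<Sum>z\<in>F. rho z * q (S z))"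
    using integrable_e by (subst Bochner_Integration.integral_sum) (auto simp: rho_def)
  also have "ennreal (\<Sum>z\<in>F. rho z * q (S z)) \<le> ennreal (K * (\<Sum>z\<in>F. q (S z)))"
    unfolding sum_distrib_left by (intro ennreal_leI sum_mono mult_right_mono rho_le q_nonneg)
  finally show ?thesis .
qed

text \<open>The fluctuation caused by the occupation numbers: sites are independent with variance at
  most \<open>K\<close>, and \<open>q^2 \<le> q\<close> brings the bound into the same form as the
  one for displacements.\<close>

lemma nn_integral_sites_square:
  assumes F: "finite F" and s: "\<And>z. \<bar>s z\<bar> \<le> 1"
  shows "(\<integral>\<^sup>+\<omega>. ennreal ((\<Sum>z\<in>F. s z * ((real_of_int (e z \<omega>) - rho z) * q (S z)))\<^sup>2) \<partial>M) \<le> ennreal (K * (\<Sum>z\<in>F. q (S z)))"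
proof -
  define X where "X z \<omega> = s z * ((real_of_int (e z \<omega>) - rho z) * q (S z))" for z \<omega>
  have ind: "indep_vars (\<lambda>_. borel) X F"
    unfolding X_def[abs_def] by (rule indep_vars_compose2[OF indep_vars_subset[OF e_indep]]) auto
  have sqc: "integrable M (\<lambda>\<omega>. (real_of_int (e z \<omega>) - rho z)\<^sup>2)"
    "expectation (\<lambda>\<omega>. (real_of_int (e z \<omega>) - rho z)\<^sup>2) \<le> K" for z
  proof -
    show "integrable M (\<lambda>\<omega>. (real_of_int (e z \<omega>) - rho z)\<^sup>2)"
      using integrable_e e_square by (simp add: power2_diff)
    have "expectation (\<lambda>\<omega>. (real_of_int (e z \<omega>) - rho z)\<^sup>2) =
        expectation (\<lambda>\<omega>. (real_of_int (e z \<omega>))\<^sup>2) + (rho z)\<^sup>2 - 2 * expectation (\<lambda>\<omega>. real_of_int (e z \<omega>)) * rho z"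
      using integrable_e e_square by (simp add: power2_diff prob_space)
    also have "\<dots> = expectation (\<lambda>\<omega>. (real_of_int (e z \<omega>))\<^sup>2) - (rho z)\<^sup>2"
      unfolding rho_def[symmetric] by (simp add: power2_eq_square)
    also have "\<dots> \<le> K" using e_square_le[of z] by (simp add: add_increasing2 diff_le_eq)
    finally show "expectation (\<lambda>\<omega>. (real_of_int (e z \<omega>) - rho z)\<^sup>2) \<le> K" .
  qed
  have X0: "expectation (X z) = 0" for z
    unfolding X_def using integrable_e by (simp add: rho_def[symmetric] prob_space)
  have Xeq: "(X z \<omega>)\<^sup>2 = ((s z)\<^sup>2 * (q (S z))\<^sup>2) * (real_of_int (e z \<omega>) - rho z)\<^sup>2" for z \<omega>
    by (simp add: X_def power_mult_distrib)
  have iX2: "integrable M (\<lambda>\<omega>. (X z \<omega>)\<^sup>2)" for z unfolding Xeq by (intro integrable_mult_right sqc)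
  have X2: "expectation (\<lambda>\<omega>. (X z \<omega>)\<^sup>2) \<le> K * q (S z)" for z
  proof -
    have "expectation (\<lambda>\<omega>. (X z \<omega>)\<^sup>2) = ((s z)\<^sup>2 * (q (S z))\<^sup>2) * expectation (\<lambda>\<omega>. (real_of_int (e z \<omega>) - rho z)\<^sup>2)"
      unfolding Xeq by simp
    also have "\<dots> \<le> (1 * q (S z)) * K"
    proof (intro mult_mono sqc(2))
      show "(s z)\<^sup>2 \<le> 1" using s[of z] by (simp add: abs_square_le_1)
      show "(q (S z))\<^sup>2 \<le> q (S z)" using q_nonneg[of "S z"] q_le_1[of "S z"] by (simp add: power2_eq_square mult_left_le)
    qed (auto simp: q_nonneg)
    finally show ?thesis by (simp add: mult.commute)
  qed
  have sq: "integrable M (\<lambda>\<omega>. (\<Sum>z\<in>F. X z \<omega>)\<^sup>2)"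
      "expectation (\<lambda>\<omega>. (\<Sum>z\<in>F. X z \<omega>)\<^sup>2) = (\<Sum>z\<in>F. expectation (\<lambda>\<omega>. (X z \<omega>)\<^sup>2))"
    using expectation_square_sum_indep[OF F ind iX2 X0] by auto
  have "(\<integral>\<^sup>+\<omega>. ennreal ((\<Sum>z\<in>F. X z \<omega>)\<^sup>2) \<partial>M) = ennreal (\<Sum>z\<in>F. expectation (\<lambda>\<omega>. (X z \<omega>)\<^sup>2))"
    by (subst nn_integral_eq_integral[OF sq(1)]) (auto simp: sq(2))
  also have "\<dots> \<le> ennreal (K * (\<Sum>z\<in>F. q (S z)))"
    unfolding sum_distrib_left by (intro ennreal_leI sum_mono X2)
  finally show ?thesis by (simp add: X_def)
qed

text \<open>Chebyshev's inequality. The deviation is the displacement part \<open>A\<close> plus the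
  occupation part \<open>B\<close>; \<open>(A + B)^2 \<le> 2 A^2 + 2 B^2\<close> together with the
  common bound for both parts gives the factor 4.\<close>

lemma prob_signed_count_deviation:
  assumes F: "finite F" and s: "\<And>z. \<bar>s z\<bar> \<le> 1" and d: "0 < d"
  shows "prob {\<omega>\<in>space M. d \<le> \<bar>(\<Sum>z\<in>F. s z * cnt z (S z) \<omega>) - (\<Sum>z\<in>F. s z * (rho z * q (S z)))\<bar>} \<le> 4 * K * (\<Sum>z\<in>F. q (S z)) / d\<^sup>2"
proof -
  define A where "A \<omega> = (\<Sum>z\<in>F. s z * (cnt z (S z) \<omega> - real_of_int (e z \<omega>) * q (S z)))" for \<omega>
  define B where "B \<omega> = (\<Sum>z\<in>F. s z * ((real_of_int (e z \<omega>) - rho z) * q (S z)))" for \<omega>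
  have [measurable]: "A \<in> borel_measurable M" "B \<in> borel_measurable M"
    unfolding A_def B_def by measurable
  let ?D = "\<lambda>\<omega>. (\<Sum>z\<in>F. s z * cnt z (S z) \<omega>) - (\<Sum>z\<in>F. s z * (rho z * q (S z)))"
  have eq: "?D \<omega> = A \<omega> + B \<omega>" for \<omega>
    unfolding A_def B_def sum.distrib[symmetric] sum_subtractf[symmetric] by (intro sum.cong) (auto simp: algebra_simps)
  let ?Q = "\<Sum>z\<in>F. q (S z)"
  have Q0: "0 \<le> ?Q" by (intro sum_nonneg q_nonneg)
  have "(\<integral>\<^sup>+\<omega>. ennreal ((A \<omega> + B \<omega>)\<^sup>2) \<partial>M) \<le> (\<integral>\<^sup>+\<omega>. 2 * ennreal ((A \<omega>)\<^sup>2) + 2 * ennreal ((B \<omega>)\<^sup>2) \<partial>M)"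
  proof (intro nn_integral_mono)
    fix \<omega>
    have "(A \<omega> + B \<omega>)\<^sup>2 + (A \<omega> - B \<omega>)\<^sup>2 = 2 * (A \<omega>)\<^sup>2 + 2 * (B \<omega>)\<^sup>2" by (simp add: power2_sum power2_diff)
    hence "(A \<omega> + B \<omega>)\<^sup>2 \<le> 2 * (A \<omega>)\<^sup>2 + 2 * (B \<omega>)\<^sup>2" by (smt (verit) zero_le_power2)
    hence "ennreal ((A \<omega> + B \<omega>)\<^sup>2) \<le> ennreal (2 * (A \<omega>)\<^sup>2 + 2 * (B \<omega>)\<^sup>2)" by (rule ennreal_leI)
    thus "ennreal ((A \<omega> + B \<omega>)\<^sup>2) \<le> 2 * ennreal ((A \<omega>)\<^sup>2) + 2 * ennreal ((B \<omega>)\<^sup>2)" by (simp add: ennreal_mult)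
  qed
  also have "\<dots> = 2 * (\<integral>\<^sup>+\<omega>. ennreal ((A \<omega>)\<^sup>2) \<partial>M) + 2 * (\<integral>\<^sup>+\<omega>. ennreal ((B \<omega>)\<^sup>2) \<partial>M)"
    by (subst nn_integral_add) (auto simp: nn_integral_cmult)
  also have "\<dots> \<le> 2 * ennreal (K * ?Q) + 2 * ennreal (K * ?Q)"
    unfolding A_def B_def by (intro add_mono mult_left_mono nn_integral_marks_square nn_integral_sites_square F s) auto
  also have "\<dots> = ennreal (2 * (K * ?Q) + 2 * (K * ?Q))"
  proof -
    have "2 * ennreal (K * ?Q) = ennreal (2 * (K * ?Q))" by (metis ennreal_mult' ennreal_numeral zero_le_numeral)
    thus ?thesis using K_nonneg Q0 by (simp only:) (rule ennreal_plus[symmetric]; simp)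
  qed
  also have "2 * (K * ?Q) + 2 * (K * ?Q) = 4 * K * ?Q" by simp
  finally have "prob {\<omega>\<in>space M. d\<^sup>2 \<le> (A \<omega> + B \<omega>)\<^sup>2} \<le> 4 * K * ?Q / d\<^sup>2"
    using K_nonneg Q0 d by (intro prob_ge_le_of_nn_integral) auto
  moreover have "{\<omega>\<in>space M. d\<^sup>2 \<le> (A \<omega> + B \<omega>)\<^sup>2} = {\<omega>\<in>space M. d \<le> \<bar>?D \<omega>\<bar>}"
    unfolding eq using d by (auto simp: abs_le_square_iff[symmetric])
  ultimately show ?thesis by simp
qed

end

section \<open>Summation by parts against decreasing weights\<close>

lemma sum_inverse_squares_le:
  assumes "1 \<le> R" "R \<le> N"
  shows "(\<Sum>k=Suc R..N. 1 / (real k)\<^sup>2) \<le> 1 / real R - 1 / real N"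
  using assms(2)
proof (induction N rule: dec_induct)
  case (step N)
  have N: "real N > 0" using step assms by simp
  have "1 / (real (Suc N))\<^sup>2 \<le> 1 / (real N * real (Suc N))"
    using N by (intro divide_left_mono) (auto simp: power2_eq_square)
  also have "\<dots> = 1 / real N - 1 / real (Suc N)" using N by (simp add: field_simps)
  finally show ?case using step by (simp add: atLeastAtMostSuc_conv)
qed simp

text \<open>The terms of \<open>r\<close> may be large and only their partial sums are small. Abel
  summation moves the partial sums onto the decrements of \<open>G\<close>, whose total is at most
  \<open>G 1 \<le> 1\<close>.\<close>

lemma abel_sum_bound:
  fixes r G :: "nat \<Rightarrow> real"
  assumes G0: "\<And>k. 0 \<le> G k" and G1: "G 1 \<le> 1" and anti: "\<And>k. 1 \<le> k \<Longrightarrow> G (Suc k) \<le> G k"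
    and r: "\<And>k. k \<le> R \<Longrightarrow> \<bar>\<Sum>j=1..k. r j\<bar> \<le> e"
  shows "\<bar>\<Sum>k=1..R. r k * G k\<bar> \<le> e"
proof -
  define S where "S k = (\<Sum>j=1..k. r j)" for k
  have e0: "0 \<le> e" using r[of 0] by simp
  have eq: "(\<Sum>k=1..m. r k * G k) = S m * G (Suc m) + (\<Sum>k=1..m. S k * (G k - G (Suc k)))" for m
    by (induction m) (auto simp: S_def algebra_simps)
  have tel: "(\<Sum>k=1..m. G k - G (Suc k)) = G 1 - G (Suc m)" for m by (induction m) auto
  have "\<bar>\<Sum>k=1..R. r k * G k\<bar> \<le> \<bar>S R * G (Suc R)\<bar> + \<bar>\<Sum>k=1..R. S k * (G k - G (Suc k))\<bar>"
    unfolding eq by (rule abs_triangle_ineq)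
  also have "\<dots> \<le> e * G (Suc R) + (\<Sum>k=1..R. e * (G k - G (Suc k)))"
  proof (intro add_mono order_trans[OF sum_abs] sum_mono)
    show "\<bar>S R * G (Suc R)\<bar> \<le> e * G (Suc R)"
      using G0[of "Suc R"] r[of R] by (simp add: abs_mult S_def mult_right_mono)
    fix k assume "k \<in> {1..R}"
    thus "\<bar>S k * (G k - G (Suc k))\<bar> \<le> e * (G k - G (Suc k))"
      using anti[of k] r[of k] by (simp add: abs_mult S_def mult_right_mono)
  qed
  also have "\<dots> = e * G 1" unfolding sum_distrib_left[symmetric] tel by (simp add: algebra_simps)
  also have "\<dots> \<le> e" using G1 e0 by (simp add: mult_left_le)
  finally show ?thesis .
qed

text \<open>Partial sums of \<open>r\<close> are controlled only up to \<open>R\<close>. Beyond that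
  the quadratic decay of \<open>G\<close> takes over, since the inverse squares past
  \<open>R\<close> sum to at most \<open>1 / R\<close>.\<close>

lemma abel_sum_bound_tail:
  fixes r G :: "nat \<Rightarrow> real"
  assumes G0: "\<And>k. 0 \<le> G k" and G1: "G 1 \<le> 1" and anti: "\<And>k. 1 \<le> k \<Longrightarrow> G (Suc k) \<le> G k"
    and r: "\<And>k. k \<le> R \<Longrightarrow> \<bar>\<Sum>j=1..k. r j\<bar> \<le> e"
    and GV: "\<And>k. 1 \<le> k \<Longrightarrow> G k \<le> V / (real k)\<^sup>2" and rK: "\<And>k. \<bar>r k\<bar> \<le> C" and R: "1 \<le> R" and V: "0 \<le> V"
  shows "\<bar>\<Sum>k=1..N. r k * G k\<bar> \<le> e + C * V / real R"
proof -
  have C0: "0 \<le> C" using rK[of 0] by simp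
  show ?thesis
  proof (cases "N \<le> R")
    case True
    have "\<bar>\<Sum>k=1..N. r k * G k\<bar> \<le> e"
      by (rule abel_sum_bound[OF G0 G1 anti r]) (use True in auto)
    thus ?thesis using C0 V by (simp add: add_increasing2)
  next
    case False
    have "(\<Sum>k=1..N. r k * G k) = (\<Sum>k=1..R. r k * G k) + (\<Sum>k=Suc R..N. r k * G k)"
      using False sum.ub_add_nat[of 1 R "\<lambda>k. r k * G k" "N - R"] by simp
    moreover have "\<bar>\<Sum>k=1..R. r k * G k\<bar> \<le> e" by (rule abel_sum_bound[OF G0 G1 anti r])
    moreover have "\<bar>\<Sum>k=Suc R..N. r k * G k\<bar> \<le> C * V / real R"
    proof -
      have "\<bar>\<Sum>k=Suc R..N. r k * G k\<bar> \<le> (\<Sum>k=Suc R..N. C * V * (1 / (real k)\<^sup>2))"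
      proof (intro order_trans[OF sum_abs] sum_mono)
        fix k assume "k \<in> {Suc R..N}"
        thus "\<bar>r k * G k\<bar> \<le> C * V * (1 / (real k)\<^sup>2)"
          using mult_mono[OF rK[of k] GV[of k]] G0[of k] C0 by (simp add: abs_mult)
      qed
      also have "\<dots> = C * V * (\<Sum>k=Suc R..N. 1 / (real k)\<^sup>2)" by (simp add: sum_distrib_left)
      also have "\<dots> \<le> C * V * (1 / real R)"
      proof (intro mult_left_mono)
        have "(\<Sum>k=Suc R..N. 1 / (real k)\<^sup>2) \<le> 1 / real R - 1 / real N"
          using False R by (intro sum_inverse_squares_le) auto
        thus "(\<Sum>k=Suc R..N. 1 / (real k)\<^sup>2) \<le> 1 / real R" using zero_le_divide_1_iff[of "real N"] by linarith
      qed (use C0 V in auto)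
      finally show ?thesis by simp
    qed
    ultimately show ?thesis by linarith
  qed
qed

section \<open>Height differences as particle counts\<close>

lemma sum_int_increments:
  fixes f :: "int \<Rightarrow> 'b::ab_group_add"
  assumes "a \<le> c"
  shows "(\<Sum>z\<in>{a<..c}. f z - f (z - 1)) = f c - f a"
  using assms
proof (induction c rule: int_ge_induct)
  case (step c)
  have "{a<..c + 1} = insert (c + 1) {a<..c}" using step by auto
  thus ?case using step by simp
qed simp

text \<open>Both sides count particles relative to the two reference sites \<open>a\<close> (time \<open>0\<close>) and
  \<open>c\<close> (time \<open>t\<close>): the height difference between these space-time points is the net number of
  particles that change sides.\<close>

lemma height_difference_card:
  fixes \<sigma> :: "int \<Rightarrow> int" and w :: "int \<times> nat \<Rightarrow> int" and a c :: int
  defines "e \<equiv> \<lambda>z. nat (\<sigma> z - \<sigma> (z - 1))"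
  defines "P \<equiv> {(z, j). j < e z \<and> a < z \<and> z + w (z, j) \<le> c}"
  defines "Q \<equiv> {(z, j). j < e z \<and> z \<le> a \<and> c < z + w (z, j)}"
  assumes mono: "mono \<sigma>" and fin: "finite P" "finite Q"
  shows "\<sigma> c - (int (card {(z, j). j < e z \<and> z \<le> c \<and> c < z + w (z, j)})
      - int (card {(z, j). j < e z \<and> z + w (z, j) \<le> c \<and> c < z})) - \<sigma> a = int (card P) - int (card Q)"
proof -
  define A where "A = {(z, j). j < e z \<and> z \<le> c \<and> c < z + w (z, j)}"
  define B where "B = {(z, j). j < e z \<and> z + w (z, j) \<le> c \<and> c < z}"
  have cT: "finite {(z, j). j < e z \<and> u < z \<and> z \<le> v} \<and> int (card {(z, j). j < e z \<and> u < z \<and> z \<le> v}) = \<sigma> v - \<sigma> u"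
    if "u \<le> v" for u v
  proof -
    have eq: "{(z, j). j < e z \<and> u < z \<and> z \<le> v} = (SIGMA z:{u<..v}. {..<e z})" by auto
    have "int (card (SIGMA z:{u<..v}. {..<e z})) = (\<Sum>z\<in>{u<..v}. int (e z))" by simp
    also have "\<dots> = (\<Sum>z\<in>{u<..v}. \<sigma> z - \<sigma> (z - 1))"
      using mono by (intro sum.cong) (auto simp: e_def monoD)
    also have "\<dots> = \<sigma> v - \<sigma> u" by (rule sum_int_increments[OF that])
    finally show ?thesis unfolding eq by auto
  qed
  have "\<sigma> c - (int (card A) - int (card B)) - \<sigma> a = int (card P) - int (card Q)"
  proof (cases "a \<le> c")
    case True
    define T where "T = {(z, j). j < e z \<and> a < z \<and> z \<le> c}"
    define T1 where "T1 = {(z, j). j < e z \<and> a < z \<and> z \<le> c \<and> z + w (z, j) \<le> c}"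
    define T2 where "T2 = {(z, j). j < e z \<and> a < z \<and> z \<le> c \<and> c < z + w (z, j)}"
    have T: "finite T" "int (card T) = \<sigma> c - \<sigma> a" using cT[OF True] by (auto simp: T_def)
    have TT: "T = T1 \<union> T2" "T1 \<inter> T2 = {}" by (auto simp: T_def T1_def T2_def)
    have f12: "finite T1" "finite T2" using T(1) TT(1) by auto
    have cT12: "card T = card T1 + card T2" unfolding TT(1) by (rule card_Un_disjoint[OF f12 TT(2)])
    have "A = Q \<union> T2" "Q \<inter> T2 = {}" using True by (auto simp: A_def Q_def T2_def)
    hence cA: "card A = card Q + card T2" using card_Un_disjoint[OF fin(2) f12(2)] by simp
    have PB: "P = T1 \<union> B" "T1 \<inter> B = {}" using True by (auto simp: P_def T1_def B_def)
    have "finite B" using fin(1) PB(1) by auto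
    hence cP: "card P = card T1 + card B" using card_Un_disjoint[OF f12(1) _ PB(2)] PB(1) by simp
    show ?thesis using T(2) cT12 cA cP by simp
  next
    case False
    hence ca: "c \<le> a" by simp
    define T where "T = {(z, j). j < e z \<and> c < z \<and> z \<le> a}"
    define T1 where "T1 = {(z, j). j < e z \<and> c < z \<and> z \<le> a \<and> z + w (z, j) \<le> c}"
    define T2 where "T2 = {(z, j). j < e z \<and> c < z \<and> z \<le> a \<and> c < z + w (z, j)}"
    have T: "finite T" "int (card T) = \<sigma> a - \<sigma> c" using cT[OF ca] by (auto simp: T_def)
    have TT: "T = T1 \<union> T2" "T1 \<inter> T2 = {}" by (auto simp: T_def T1_def T2_def)
    have f12: "finite T1" "finite T2" using T(1) TT(1) by auto
    have cT12: "card T = card T1 + card T2" unfolding TT(1) by (rule card_Un_disjoint[OF f12 TT(2)])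
    have QA: "Q = A \<union> T2" "A \<inter> T2 = {}" using ca by (auto simp: A_def Q_def T2_def)
    have "finite A" using fin(2) QA(1) by auto
    hence cQ: "card Q = card A + card T2" using card_Un_disjoint[OF _ f12(2) QA(2)] QA(1) by simp
    have "B = P \<union> T1" "P \<inter> T1 = {}" using ca by (auto simp: P_def T1_def B_def)
    hence cB: "card B = card P + card T1" using card_Un_disjoint[OF fin(1) f12(1)] by simp
    show ?thesis using T(2) cT12 cQ cB by simp
  qed
  thus ?thesis by (simp add: A_def B_def)
qed

section \<open>Net number of crossings between two reference sites\<close>

context marked_particles
begin

text \<open>Reference sites: \<open>a\<close> at time 0 and \<open>c\<close> at the time of
  observation. \<open>V\<close> bounds the second moment of \<open>c - a\<close> minus the
  displacement, of order \<open>n\<close> in the application, and \<open>m\<close> bounds its mean,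
  of order 1.\<close>

context
  fixes a c :: int and V m :: real
  assumes W2: "integrable M (\<lambda>\<omega>. (real_of_int (c - a) - real_of_int (W (0,0) \<omega>))\<^sup>2)"
    and V: "expectation (\<lambda>\<omega>. (real_of_int (c - a) - real_of_int (W (0,0) \<omega>))\<^sup>2) \<le> V"
    and m: "\<bar>expectation (\<lambda>\<omega>. real_of_int (c - a) - real_of_int (W (0,0) \<omega>))\<bar> \<le> m"
begin

text \<open>The displacements by which a particle from \<open>z\<close> changes sides. Site
  \<open>a\<close> itself counts as left at time 0, and \<open>c\<close> counts as left at the
  end.\<close>

definition crossing :: "int \<Rightarrow> int set" where "crossing z = (if a < z then {..c - z} else {c - z<..})"

text \<open>A passage from right to left raises the height, the opposite one lowers it.\<close>

definition side :: "int \<Rightarrow> real" where "side z = (if a < z then 1 else - 1)"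

text \<open>Half-open because \<open>a\<close> counts as left; each side then has exactly
  \<open>N\<close> sites.\<close>

definition window :: "nat \<Rightarrow> int set" where "window N = {a - int N<..a + int N}"

lemma V_nonneg: "0 \<le> V"
proof -
  have "0 \<le> expectation (\<lambda>\<omega>. (real_of_int (c - a) - real_of_int (W (0,0) \<omega>))\<^sup>2)" by simp
  thus ?thesis using V by (rule order_trans)
qed

text \<open>Chebyshev's inequality: to change sides from \<open>z\<close>, the displacement must
  miss \<open>c - a\<close> by at least \<open>|z - a|\<close>.\<close>

lemma q_crossing_le:
  assumes "z \<noteq> a"
  shows "q (crossing z) \<le> V / (real_of_int (z - a))\<^sup>2"
proof -
  let ?X = "\<lambda>\<omega>. (real_of_int (c - a) - real_of_int (W (0,0) \<omega>))\<^sup>2"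
  have "q (crossing z) \<le> prob {\<omega>\<in>space M. (real_of_int (z - a))\<^sup>2 \<le> ?X \<omega>}"
    unfolding q_def
  proof (intro finite_measure_mono)
    show "{\<omega>\<in>space M. W (0,0) \<omega> \<in> crossing z} \<subseteq> {\<omega>\<in>space M. (real_of_int (z - a))\<^sup>2 \<le> ?X \<omega>}"
    proof safe
      fix \<omega> assume "W (0,0) \<omega> \<in> crossing z"
      hence "\<bar>z - a\<bar> \<le> \<bar>c - a - W (0,0) \<omega>\<bar>" by (auto simp: crossing_def split: if_splits)
      hence "(z - a)\<^sup>2 \<le> (c - a - W (0,0) \<omega>)\<^sup>2" by (simp add: abs_le_square_iff)
      hence "real_of_int ((z - a)\<^sup>2) \<le> real_of_int ((c - a - W (0,0) \<omega>)\<^sup>2)" by (simp only: of_int_le_iff)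
      thus "(real_of_int (z - a))\<^sup>2 \<le> ?X \<omega>" by simp
    qed
  qed simp
  also have "\<dots> \<le> expectation ?X / (real_of_int (z - a))\<^sup>2"
    by (rule integral_Markov_inequality_measure[OF W2, of "{}"]) (use assms in auto)
  also have "\<dots> \<le> V / (real_of_int (z - a))\<^sup>2" using V by (intro divide_right_mono) auto
  finally show ?thesis .
qed

text \<open>A nonzero count is at least 1, so Markov's inequality applies to its mean.\<close>

lemma prob_cnt_nonzero_le: "prob {\<omega>\<in>space M. cnt z S \<omega> \<noteq> 0} \<le> K * q S"
proof -
  have i: "cnt z S \<omega> \<in> \<int>" for \<omega> unfolding cnt_def by (intro Ints_sum) (auto simp: indicator_def)
  have "1 \<le> cnt z S \<omega>" if "cnt z S \<omega> \<noteq> 0" for \<omega>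
    using Ints_nonzero_abs_ge1[OF i that] cnt_nonneg[of z S \<omega>] by simp
  hence "prob {\<omega>\<in>space M. cnt z S \<omega> \<noteq> 0} \<le> prob {\<omega>\<in>space M. 1 \<le> cnt z S \<omega>}"
    by (intro finite_measure_mono) auto
  also have "\<dots> \<le> rho z * q S / 1"
    by (rule prob_ge_le_of_nn_integral) (auto simp: cnt_nonneg nn_integral_cnt rho_nonneg q_nonneg)
  also have "\<dots> \<le> K * q S" using rho_le q_nonneg by (simp add: mult_right_mono)
  finally show ?thesis .
qed

text \<open>Particles start on the whole lattice, and the quadratic decay of the crossing
  probabilities is what makes the union bound over the outside sites converge.\<close>

lemma prob_crossing_outside_window:
  assumes N: "2 \<le> N"
  shows "prob {\<omega>\<in>space M. \<exists>z. z \<notin> window N \<and> cnt z (crossing z) \<omega> \<noteq> 0} \<le> 2 * K * V / (real N - 1)"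
proof -
  define E where "E z = {\<omega>\<in>space M. cnt z (crossing z) \<omega> \<noteq> 0}" for z
  have [measurable]: "E z \<in> sets M" for z unfolding E_def by measurable
  \<comment> \<open>The two sites that lie \<open>i\<close> steps beyond the ends of the window;
    both have distance at least \<open>N + i\<close> from \<open>a\<close>.\<close>
  define A where "A i = E (a + int N + 1 + int i) \<union> E (a - int N - int i)" for i :: nat
  have mA: "range A \<subseteq> sets M" by (auto simp: A_def)
  have "{\<omega>\<in>space M. \<exists>z. z \<notin> window N \<and> cnt z (crossing z) \<omega> \<noteq> 0} \<subseteq> (\<Union>i. A i)"
  proof safe
    fix \<omega> z assume w: "\<omega> \<in> space M" and z: "z \<notin> window N" and nz: "cnt z (crossing z) \<omega> \<noteq> 0"
    have wE: "\<omega> \<in> E z" using w nz by (simp add: E_def)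
    from z consider "a + int N < z" | "z \<le> a - int N" by (auto simp: window_def)
    thus "\<omega> \<in> (\<Union>i. A i)"
    proof cases
      case 1
      hence "z = a + int N + 1 + int (nat (z - a - int N - 1))" by simp
      thus ?thesis using wE unfolding A_def by (metis UNIV_I UN_iff UnI1)
    next
      case 2
      hence "z = a - int N - int (nat (a - int N - z))" by simp
      thus ?thesis using wE unfolding A_def by (metis UNIV_I UN_iff UnI2)
    qed
  qed
  hence 1: "prob {\<omega>\<in>space M. \<exists>z. z \<notin> window N \<and> cnt z (crossing z) \<omega> \<noteq> 0} \<le> prob (\<Union>i. A i)"
    using mA by (intro finite_measure_mono) auto
  \<comment> \<open>A telescoping majorant of \<open>2 K V / (N + i)^2\<close>. Its denominators are
    positive because \<open>2 \<le> N\<close>.\<close>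
  define g where "g i = 2 * K * V * (1 / (real N - 1 + real i) - 1 / (real N - 1 + real (Suc i)))" for i
  have Ag: "prob (A i) \<le> g i" for i
  proof -
    have p: "real N - 1 + real i > 0" using N by simp
    have EV: "prob (E z) \<le> K * (V / (real N + real i)\<^sup>2)" if "real N + real i \<le> \<bar>real_of_int (z - a)\<bar>" for z
    proof -
      have "prob (E z) \<le> K * q (crossing z)" unfolding E_def by (rule prob_cnt_nonzero_le)
      also have "\<dots> \<le> K * (V / (real_of_int (z - a))\<^sup>2)"
        using that N by (intro mult_left_mono q_crossing_le K_nonneg) auto
      also have "\<dots> \<le> K * (V / (real N + real i)\<^sup>2)"
      proof (intro mult_left_mono divide_left_mono K_nonneg V_nonneg)
        show "(real N + real i)\<^sup>2 \<le> (real_of_int (z - a))\<^sup>2"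
          using that by (subst abs_le_square_iff[symmetric]) simp
        thus "0 < (real_of_int (z - a))\<^sup>2 * (real N + real i)\<^sup>2" using N
          by (intro mult_pos_pos less_le_trans[OF _ \<open>(real N + real i)\<^sup>2 \<le> _\<close>]) auto
      qed
      finally show ?thesis .
    qed
    have "prob (A i) \<le> prob (E (a + int N + 1 + int i)) + prob (E (a - int N - int i))"
      unfolding A_def by (intro measure_Un_le) auto
    also have "\<dots> \<le> K * (V / (real N + real i)\<^sup>2) + K * (V / (real N + real i)\<^sup>2)"
      by (intro add_mono EV) auto
    also have "\<dots> = 2 * K * V * (1 / (real N + real i)\<^sup>2)" by simp
    also have "\<dots> \<le> g i" unfolding g_def
    proof (intro mult_left_mono)
      have "1 / (real N - 1 + real i) - 1 / (real N - 1 + real (Suc i)) = 1 / ((real N - 1 + real i) * (real N + real i))"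
        using p by (simp add: field_simps)
      also have "\<dots> \<ge> 1 / (real N + real i)\<^sup>2"
        using p by (intro divide_left_mono) (auto simp: power2_eq_square intro!: mult_right_mono)
      finally show "1 / (real N + real i)\<^sup>2 \<le> 1 / (real N - 1 + real i) - 1 / (real N - 1 + real (Suc i))" .
    qed (use K_nonneg V_nonneg in auto)
    finally show ?thesis .
  qed
  have "(\<lambda>i. 1 / (real N - 1 + real i)) \<longlonglongrightarrow> 0"
    by (intro tendsto_divide_0[OF tendsto_const] filterlim_at_top_imp_at_infinity
        filterlim_tendsto_add_at_top[OF tendsto_const] filterlim_real_sequentially)
  from sums_mult[OF telescope_sums'[OF this], of "2 * K * V"]
  have gs: "g sums (2 * K * V / (real N - 1))" unfolding g_def by simp
  have sA: "summable (\<lambda>i. prob (A i))"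
    using Ag by (intro summable_comparison_test[OF _ sums_summable[OF gs]] exI[of _ 0]) auto
  have "prob (\<Union>i. A i) \<le> (\<Sum>i. prob (A i))" by (rule finite_measure_subadditive_countably[OF mA sA])
  also have "\<dots> \<le> suminf g" by (rule suminf_le[OF Ag sA sums_summable[OF gs]])
  also have "\<dots> = 2 * K * V / (real N - 1)" using gs by (rule sums_unique[symmetric])
  finally show ?thesis using 1 by linarith
qed

lemma sum_crossing_expectation:
  "(\<Sum>z\<in>F. s z * q (crossing z)) = expectation (\<lambda>\<omega>. \<Sum>z\<in>F. s z * indicator (crossing z) (W (0,0) \<omega>))"
proof -
  have "integrable M (\<lambda>\<omega>. indicator T (W (0,0) \<omega>) :: real)" for T
    by (intro integrable_const_bound[where B=1]) auto
  thus ?thesis by (subst Bochner_Integration.integral_sum) (auto simp: expectation_indicator_W)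
qed

text \<open>For one displacement the sites from which it crosses form an interval adjacent to
  \<open>a\<close>: on the right if \<open>u > 0\<close>, on the left if \<open>u < 0\<close>, with
  \<open>|u|\<close> sites before truncation to the window. Counted with signs it returns the
  truncated \<open>u\<close>.\<close>

lemma sum_crossing_indicator:
  defines "u \<equiv> \<lambda>\<omega>. c - a - W (0,0) \<omega>"
  shows "(\<Sum>z\<in>window N. indicator (crossing z) (W (0,0) \<omega>)) \<le> \<bar>real_of_int (u \<omega>)\<bar>"
    and "(\<Sum>z\<in>window N. side z * indicator (crossing z) (W (0,0) \<omega>)) = real_of_int (max (- int N) (min (int N) (u \<omega>)))"
proof -
  define P where "P = {a<..a + min (int N) (u \<omega>)}"
  define Q where "Q = {a + max (- int N) (u \<omega>)<..a}"
  have ind: "indicator (crossing z) (W (0,0) \<omega>) = (indicator P z + indicator Q z :: real)"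
    "side z * indicator (crossing z) (W (0,0) \<omega>) = (indicator P z - indicator Q z :: real)" if "z \<in> window N" for z
    using that by (auto simp: crossing_def side_def P_def Q_def u_def window_def indicator_def)
  have [simp]: "finite (window N)" by (simp add: window_def)
  have PQ: "P \<subseteq> window N" "Q \<subseteq> window N" by (auto simp: P_def Q_def window_def)
  have card: "(\<Sum>z\<in>window N. indicator T z) = real (card T)" if "T \<subseteq> window N" for T
  proof -
    have "(\<Sum>z\<in>window N. indicator T z :: real) = (\<Sum>z\<in>T. indicator T z)"
      using that by (intro sum.mono_neutral_right) (auto simp: indicator_def)
    thus ?thesis by simp
  qed
  have sP: "(\<Sum>z\<in>window N. indicator P z) = real (card P)" "(\<Sum>z\<in>window N. indicator Q z) = real (card Q)"
    using PQ by (auto intro: card)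
  have cP: "card P = nat (min (int N) (u \<omega>))" "card Q = nat (- max (- int N) (u \<omega>))" by (auto simp: P_def Q_def)
  have "(\<Sum>z\<in>window N. indicator (crossing z) (W (0,0) \<omega>)) = real (card P) + real (card Q)"
    using sP by (simp add: ind sum.distrib)
  also have "\<dots> \<le> \<bar>real_of_int (u \<omega>)\<bar>" unfolding cP by (auto simp: min_def max_def)
  finally show "(\<Sum>z\<in>window N. indicator (crossing z) (W (0,0) \<omega>)) \<le> \<bar>real_of_int (u \<omega>)\<bar>" .
  have "(\<Sum>z\<in>window N. side z * indicator (crossing z) (W (0,0) \<omega>)) = real (card P) - real (card Q)"
  proof -
    have "(\<Sum>z\<in>window N. side z * indicator (crossing z) (W (0,0) \<omega>)) = (\<Sum>z\<in>window N. indicator P z - indicator Q z)"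
      by (intro sum.cong refl ind(2))
    thus ?thesis using sP by (simp add: sum_subtractf)
  qed
  also have "\<dots> = real_of_int (max (- int N) (min (int N) (u \<omega>)))" unfolding cP by (auto simp: min_def max_def)
  finally show "(\<Sum>z\<in>window N. side z * indicator (crossing z) (W (0,0) \<omega>)) = real_of_int (max (- int N) (min (int N) (u \<omega>)))" .
qed

lemma integrable_centered_W: "integrable M (\<lambda>\<omega>. real_of_int (c - a) - real_of_int (W (0,0) \<omega>))"
  by (rule square_integrable_imp_integrable[OF _ W2]) simp

text \<open>The sum is the mean number of crossing sites, at most the mean of \<open>|X|\<close>,
  and \<open>|X| \<le> d + X^2 / d\<close>. For \<open>V\<close> of order \<open>n\<close> and
  \<open>d\<close> of order \<open>sqrt n\<close> the bound is of order
  \<open>sqrt n\<close>.\<close>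

lemma sum_q_crossing_le:
  assumes "0 < d"
  shows "(\<Sum>z\<in>window N. q (crossing z)) \<le> d + V / d"
proof -
  let ?X = "\<lambda>\<omega>. real_of_int (c - a) - real_of_int (W (0,0) \<omega>)"
  have "(\<Sum>z\<in>window N. q (crossing z)) = expectation (\<lambda>\<omega>. \<Sum>z\<in>window N. indicator (crossing z) (W (0,0) \<omega>))"
    using sum_crossing_expectation[of "\<lambda>_. 1" "window N"] by simp
  also have "\<dots> \<le> expectation (\<lambda>\<omega>. d + (?X \<omega>)\<^sup>2 / d)"
  proof (intro integral_mono)
    show "integrable M (\<lambda>\<omega>. \<Sum>z\<in>window N. indicator (crossing z) (W (0,0) \<omega>) :: real)"
      by (intro Bochner_Integration.integrable_sum integrable_const_bound[where B=1]) auto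
    show "integrable M (\<lambda>\<omega>. d + (?X \<omega>)\<^sup>2 / d)" using W2 by simp
    fix \<omega>
    have "(\<Sum>z\<in>window N. indicator (crossing z) (W (0,0) \<omega>)) \<le> \<bar>?X \<omega>\<bar>"
      using sum_crossing_indicator(1)[where \<omega>=\<omega> and N=N] by simp
    also have "\<dots> \<le> d + (?X \<omega>)\<^sup>2 / d"
    proof (cases "\<bar>?X \<omega>\<bar> \<le> d")
      case False
      hence "\<bar>?X \<omega>\<bar> * d \<le> \<bar>?X \<omega>\<bar> * \<bar>?X \<omega>\<bar>" using assms by (intro mult_left_mono) auto
      hence "\<bar>?X \<omega>\<bar> \<le> (?X \<omega>)\<^sup>2 / d" using assms by (simp add: field_simps power2_eq_square)
      thus ?thesis using assms by simp
    qed (use assms in \<open>simp add: add_increasing2\<close>)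
    finally show "(\<Sum>z\<in>window N. indicator (crossing z) (W (0,0) \<omega>)) \<le> d + (?X \<omega>)\<^sup>2 / d" .
  qed
  also have "\<dots> = d + expectation (\<lambda>\<omega>. (?X \<omega>)\<^sup>2) / d" using W2 by (simp add: prob_space)
  also have "\<dots> \<le> d + V / d" using V assms by (simp add: divide_right_mono)
  finally show ?thesis .
qed

text \<open>Cancellation between the two sides: with signs the sum is the mean of \<open>X\<close>
  truncated at \<open>N\<close>, so the mean of \<open>X\<close> enters instead of its spread, and
  truncation costs at most \<open>X^2 / N\<close>.\<close>

lemma sum_side_q_crossing_le:
  assumes N: "1 \<le> N"
  shows "\<bar>\<Sum>z\<in>window N. side z * q (crossing z)\<bar> \<le> m + V / real N"
proof -
  let ?X = "\<lambda>\<omega>. real_of_int (c - a) - real_of_int (W (0,0) \<omega>)"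
  define C where "C \<omega> = (\<Sum>z\<in>window N. side z * indicator (crossing z) (W (0,0) \<omega>))" for \<omega>
  have Ceq: "C \<omega> = max (- real N) (min (real N) (?X \<omega>))" for \<omega>
    unfolding C_def sum_crossing_indicator(2) by (simp add: of_int_max of_int_min)
  have iC: "integrable M C" unfolding C_def
    by (intro Bochner_Integration.integrable_sum integrable_mult_right integrable_const_bound[where B=1]) auto
  have e: "(\<Sum>z\<in>window N. side z * q (crossing z)) = expectation C"
    unfolding C_def by (rule sum_crossing_expectation)
  have "\<bar>expectation C - expectation ?X\<bar> = \<bar>expectation (\<lambda>\<omega>. C \<omega> - ?X \<omega>)\<bar>"
    by (subst Bochner_Integration.integral_diff[OF iC integrable_centered_W]) simp
  also have "\<dots> \<le> expectation (\<lambda>\<omega>. \<bar>C \<omega> - ?X \<omega>\<bar>)" by (rule integral_abs_bound)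
  also have "\<dots> \<le> expectation (\<lambda>\<omega>. (?X \<omega>)\<^sup>2 / real N)"
  proof (intro integral_mono)
    show "integrable M (\<lambda>\<omega>. \<bar>C \<omega> - ?X \<omega>\<bar>)" 
      by (intro integrable_abs Bochner_Integration.integrable_diff iC integrable_centered_W)
    show "integrable M (\<lambda>\<omega>. (?X \<omega>)\<^sup>2 / real N)" using W2 by simp
    fix \<omega>
    show "\<bar>C \<omega> - ?X \<omega>\<bar> \<le> (?X \<omega>)\<^sup>2 / real N"
    proof (cases "\<bar>?X \<omega>\<bar> \<le> real N")
      case True
      hence "C \<omega> = ?X \<omega>" unfolding Ceq by (auto simp: min_def max_def abs_le_iff)
      thus ?thesis by simp
    next
      case False
      hence "\<bar>C \<omega> - ?X \<omega>\<bar> \<le> \<bar>?X \<omega>\<bar>" unfolding Ceq by (auto simp: min_def max_def)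
      also have "\<dots> \<le> (?X \<omega>)\<^sup>2 / real N"
      proof -
        have "\<bar>?X \<omega>\<bar> * real N \<le> \<bar>?X \<omega>\<bar> * \<bar>?X \<omega>\<bar>" using False by (intro mult_left_mono) auto
        thus ?thesis using N by (simp add: field_simps power2_eq_square)
      qed
      finally show ?thesis .
    qed
  qed
  also have "\<dots> = expectation (\<lambda>\<omega>. (?X \<omega>)\<^sup>2) / real N" by simp
  also have "\<dots> \<le> V / real N" using V by (intro divide_right_mono) auto
  finally show ?thesis using m unfolding e by linarith
qed

text \<open>The density is split as \<open>r0 + (rho - r0)\<close>. The constant part cancels
  between the sides; the rest is summed by parts on each side separately, where the crossing
  probabilities decrease with the distance from \<open>a\<close>.\<close>

lemma mean_signed_count_le:
  assumes N: "1 \<le> N" and R: "1 \<le> R" and r0: "0 \<le> r0"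
    and up: "\<And>k. k \<le> R \<Longrightarrow> \<bar>\<Sum>j=1..k. (rho (a + int j) - r0)\<bar> \<le> d"
    and dn: "\<And>k. k \<le> R \<Longrightarrow> \<bar>\<Sum>j=1..k. (rho (a + 1 - int j) - r0)\<bar> \<le> d"
  shows "\<bar>\<Sum>z\<in>window N. side z * (rho z * q (crossing z))\<bar> \<le> r0 * (m + V / real N) + 2 * (d + (K + r0) * V / real R)"
proof -
  have win: "window N = (\<lambda>k. a + int k) ` {1..N} \<union> (\<lambda>k. a + 1 - int k) ` {1..N}"
  proof (intro set_eqI iffI)
    fix z assume z: "z \<in> window N"
    show "z \<in> (\<lambda>k. a + int k) ` {1..N} \<union> (\<lambda>k. a + 1 - int k) ` {1..N}"
    proof (cases "a < z")
      case True
      hence "z = a + int (nat (z - a))" "nat (z - a) \<in> {1..N}" using z by (auto simp: window_def)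
      thus ?thesis by blast
    next
      case False
      hence "z = a + 1 - int (nat (a + 1 - z))" "nat (a + 1 - z) \<in> {1..N}" using z by (auto simp: window_def)
      thus ?thesis by blast
    qed
  qed (auto simp: window_def)
  have split: "(\<Sum>z\<in>window N. f z) = (\<Sum>k=1..N. f (a + int k)) + (\<Sum>k=1..N. f (a + 1 - int k))" for f :: "int \<Rightarrow> real"
    unfolding win by (subst sum.union_disjoint) (auto simp: sum.reindex inj_on_def)
  have dev: "\<bar>rho z - r0\<bar> \<le> K + r0" for z using rho_nonneg[of z] rho_le[of z] r0 by auto
  have qanti: "q S \<le> q T" if "S \<subseteq> T" for S T unfolding q_def using that by (intro finite_measure_mono) (auto simp: sets_Collect_count_space)
  have G: "\<bar>\<Sum>k=1..N. (rho (a + int k) - r0) * q (crossing (a + int k))\<bar> \<le> d + (K + r0) * V / real R"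
  proof (rule abel_sum_bound_tail[OF q_nonneg q_le_1 _ up _ dev R V_nonneg])
    fix k :: nat assume k: "1 \<le> k"
    show "q (crossing (a + int (Suc k))) \<le> q (crossing (a + int k))" using k by (intro qanti) (auto simp: crossing_def)
    show "q (crossing (a + int k)) \<le> V / (real k)\<^sup>2" using q_crossing_le[of "a + int k"] k by simp
  qed
  \<comment> \<open>For the \<open>k\<close>-th site on the left, \<open>q_crossing_le\<close> would
    see only the distance \<open>k - 1\<close>, and nothing for \<open>k = 1\<close>. A particle
    from there must end strictly beyond \<open>c\<close>, and integrality gains the missing
    unit.\<close>
  have HV: "q (crossing (a + 1 - int k)) \<le> V / (real k)\<^sup>2" if k: "1 \<le> k" for k
  proof -
    let ?X = "\<lambda>\<omega>. (real_of_int (c - a) - real_of_int (W (0,0) \<omega>))\<^sup>2"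
    have "q (crossing (a + 1 - int k)) \<le> prob {\<omega>\<in>space M. (real k)\<^sup>2 \<le> ?X \<omega>}"
      unfolding q_def
    proof (intro finite_measure_mono)
      show "{\<omega>\<in>space M. W (0,0) \<omega> \<in> crossing (a + 1 - int k)} \<subseteq> {\<omega>\<in>space M. (real k)\<^sup>2 \<le> ?X \<omega>}"
      proof safe
        fix \<omega> assume "W (0,0) \<omega> \<in> crossing (a + 1 - int k)"
        hence "int k \<le> \<bar>c - a - W (0,0) \<omega>\<bar>" using k by (auto simp: crossing_def split: if_splits)
        hence "(int k)\<^sup>2 \<le> (c - a - W (0,0) \<omega>)\<^sup>2" by (subst abs_le_square_iff[symmetric]) simp
        hence "real_of_int ((int k)\<^sup>2) \<le> real_of_int ((c - a - W (0,0) \<omega>)\<^sup>2)" by (simp only: of_int_le_iff)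
        thus "(real k)\<^sup>2 \<le> ?X \<omega>" by simp
      qed
    qed simp
    also have "\<dots> \<le> expectation ?X / (real k)\<^sup>2"
      by (rule integral_Markov_inequality_measure[OF W2, of "{}"]) (use k in auto)
    also have "\<dots> \<le> V / (real k)\<^sup>2" using V by (intro divide_right_mono) auto
    finally show ?thesis .
  qed
  have H: "\<bar>\<Sum>k=1..N. (rho (a + 1 - int k) - r0) * q (crossing (a + 1 - int k))\<bar> \<le> d + (K + r0) * V / real R"
  proof (rule abel_sum_bound_tail[OF q_nonneg q_le_1 _ dn HV dev R V_nonneg])
    fix k :: nat assume k: "1 \<le> k"
    show "q (crossing (a + 1 - int (Suc k))) \<le> q (crossing (a + 1 - int k))" using k by (intro qanti) (auto simp: crossing_def)
  qed
  have "(\<Sum>z\<in>window N. side z * (rho z * q (crossing z))) =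
     r0 * (\<Sum>z\<in>window N. side z * q (crossing z)) + (\<Sum>z\<in>window N. side z * ((rho z - r0) * q (crossing z)))"
    unfolding sum_distrib_left sum.distrib[symmetric] by (intro sum.cong) (auto simp: algebra_simps)
  also have "(\<Sum>z\<in>window N. side z * ((rho z - r0) * q (crossing z))) =
     (\<Sum>k=1..N. (rho (a + int k) - r0) * q (crossing (a + int k))) - (\<Sum>k=1..N. (rho (a + 1 - int k) - r0) * q (crossing (a + 1 - int k)))"
    unfolding split by (simp add: side_def sum_negf[symmetric])
  finally have eq: "(\<Sum>z\<in>window N. side z * (rho z * q (crossing z))) =
     r0 * (\<Sum>z\<in>window N. side z * q (crossing z)) + ((\<Sum>k=1..N. (rho (a + int k) - r0) * q (crossing (a + int k))) - (\<Sum>k=1..N. (rho (a + 1 - int k) - r0) * q (crossing (a + 1 - int k))))" .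
  have "\<bar>r0 * (\<Sum>z\<in>window N. side z * q (crossing z))\<bar> \<le> r0 * (m + V / real N)"
    using sum_side_q_crossing_le[OF N] r0 by (simp add: abs_mult mult_left_mono)
  moreover have "\<bar>x\<bar> \<le> B1 \<Longrightarrow> \<bar>y\<bar> \<le> B2 \<Longrightarrow> \<bar>z\<bar> \<le> B2 \<Longrightarrow> \<bar>x + (y - z)\<bar> \<le> B1 + 2 * B2" for x y z B1 B2 :: real
    by linarith
  ultimately show ?thesis unfolding eq using G H by blast
qed

lemma cnt_eq_card: "cnt z S \<omega> = real (card {j. j < nat (e z \<omega>) \<and> W (z, j) \<omega> \<in> S})"
proof -
  have "cnt z S \<omega> = (\<Sum>j<nat (e z \<omega>). if W (z, j) \<omega> \<in> S then 1 else 0)" unfolding cnt_def by (intro sum.cong) (auto simp: indicator_def)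
  also have "\<dots> = real (card ({..<nat (e z \<omega>)} \<inter> {j. W (z, j) \<omega> \<in> S}))" by (simp add: sum.If_cases)
  also have "{..<nat (e z \<omega>)} \<inter> {j. W (z, j) \<omega> \<in> S} = {j. j < nat (e z \<omega>) \<and> W (z, j) \<omega> \<in> S}" by auto
  finally show ?thesis .
qed

text \<open>Once no particle crosses from outside the window, only finitely many cross at all. This
  is the finiteness that \<open>height_difference_card\<close> asks for, and it identifies the net
  crossing with a sum over the window.\<close>

lemma net_crossing_eq:
  assumes out: "\<And>z. z \<notin> window N \<Longrightarrow> cnt z (crossing z) \<omega> = 0"
  defines "P \<equiv> {(z, j). j < nat (e z \<omega>) \<and> a < z \<and> z + W (z, j) \<omega> \<le> c}"
  defines "Q \<equiv> {(z, j). j < nat (e z \<omega>) \<and> z \<le> a \<and> c < z + W (z, j) \<omega>}"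
  shows "finite P" "finite Q" "real (card P) - real (card Q) = (\<Sum>z\<in>window N. side z * cnt z (crossing z) \<omega>)"
proof -
  define J where "J z = {j. j < nat (e z \<omega>) \<and> W (z, j) \<omega> \<in> crossing z}" for z
  have fJ: "finite (J z)" for z by (simp add: J_def)
  have J0: "J z = {}" if "z \<notin> window N" for z
    using out[OF that] fJ[of z] unfolding cnt_eq_card J_def by simp
  have Peq: "P = (SIGMA z:window N \<inter> {a<..}. J z)"
  proof (intro set_eqI iffI)
    fix x assume "x \<in> P"
    then obtain z j where x: "x = (z, j)" "j < nat (e z \<omega>)" "a < z" "z + W (z, j) \<omega> \<le> c" by (auto simp: P_def)
    hence "j \<in> J z" by (auto simp: J_def crossing_def)
    moreover from this have "z \<in> window N" using J0 by blast
    ultimately show "x \<in> (SIGMA z:window N \<inter> {a<..}. J z)" using x by auto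
  qed (auto simp: P_def J_def crossing_def)
  have Qeq: "Q = (SIGMA z:window N \<inter> {..a}. J z)"
  proof (intro set_eqI iffI)
    fix x assume "x \<in> Q"
    then obtain z j where x: "x = (z, j)" "j < nat (e z \<omega>)" "z \<le> a" "c < z + W (z, j) \<omega>" by (auto simp: Q_def)
    hence "j \<in> J z" by (auto simp: J_def crossing_def)
    moreover from this have "z \<in> window N" using J0 by blast
    ultimately show "x \<in> (SIGMA z:window N \<inter> {..a}. J z)" using x by auto
  qed (auto simp: Q_def J_def crossing_def)
  have fw: "finite (window N)" by (simp add: window_def)
  show "finite P" "finite Q" unfolding Peq Qeq using fw fJ by auto
  have "(\<Sum>z\<in>window N. side z * cnt z (crossing z) \<omega>) = (\<Sum>z\<in>window N. side z * real (card (J z)))"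
    by (simp add: cnt_eq_card J_def)
  also have "\<dots> = (\<Sum>z\<in>window N \<inter> {a<..}. side z * real (card (J z))) + (\<Sum>z\<in>window N \<inter> {..a}. side z * real (card (J z)))"
  proof -
    have "window N = (window N \<inter> {a<..}) \<union> (window N \<inter> {..a})" by auto
    thus ?thesis using fw by (subst (1) \<open>window N = _\<close>, subst sum.union_disjoint) auto
  qed
  also have "\<dots> = (\<Sum>z\<in>window N \<inter> {a<..}. real (card (J z))) - (\<Sum>z\<in>window N \<inter> {..a}. real (card (J z)))"
  proof -
    have "(\<Sum>z\<in>window N \<inter> {a<..}. side z * real (card (J z))) = (\<Sum>z\<in>window N \<inter> {a<..}. real (card (J z)))"
      by (intro sum.cong) (auto simp: side_def)
    moreover have "(\<Sum>z\<in>window N \<inter> {..a}. side z * real (card (J z))) = (\<Sum>z\<in>window N \<inter> {..a}. - real (card (J z)))"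
      by (intro sum.cong) (auto simp: side_def)
    ultimately show ?thesis by (simp add: sum_negf)
  qed
  also have "\<dots> = real (card P) - real (card Q)"
    unfolding Peq Qeq using fw fJ by (simp add: card_SigmaI)
  finally show "real (card P) - real (card Q) = (\<Sum>z\<in>window N. side z * cnt z (crossing z) \<omega>)" ..
qed

text \<open>\<open>D\<close> is prescribed only where both crossing sets are finite. The error is
  either a crossing from outside the window or a deviation of the window count by at least
  \<open>\<epsilon> / 2\<close>, the mean using up the other half. Halving \<open>\<epsilon>\<close>
  turns the factor 4 of Chebyshev's bound into 16.\<close>

lemma prob_net_crossing_deviation:
  fixes D :: "'a \<Rightarrow> real"
  assumes D[measurable]: "D \<in> borel_measurable M"
    and Deq: "\<And>\<omega>. \<omega> \<in> space M \<Longrightarrow> finite {(z, j). j < nat (e z \<omega>) \<and> a < z \<and> z + W (z, j) \<omega> \<le> c} \<Longrightarrow>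
       finite {(z, j). j < nat (e z \<omega>) \<and> z \<le> a \<and> c < z + W (z, j) \<omega>} \<Longrightarrow>
       D \<omega> = real (card {(z, j). j < nat (e z \<omega>) \<and> a < z \<and> z + W (z, j) \<omega> \<le> c})
          - real (card {(z, j). j < nat (e z \<omega>) \<and> z \<le> a \<and> c < z + W (z, j) \<omega>})"
    and N: "2 \<le> N" and \<epsilon>: "0 < \<epsilon>" and mean: "\<bar>\<Sum>z\<in>window N. side z * (rho z * q (crossing z))\<bar> \<le> \<epsilon> / 2" and d: "0 < d"
  shows "prob {\<omega>\<in>space M. \<epsilon> < \<bar>D \<omega>\<bar>} \<le> 2 * K * V / (real N - 1) + 16 * K * (d + V / d) / \<epsilon>\<^sup>2"
proof -
  define B where "B = {\<omega>\<in>space M. \<exists>z. z \<notin> window N \<and> cnt z (crossing z) \<omega> \<noteq> 0}"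
  define mn where "mn = (\<Sum>z\<in>window N. side z * (rho z * q (crossing z)))"
  define G where "G = {\<omega>\<in>space M. \<epsilon> / 2 \<le> \<bar>(\<Sum>z\<in>window N. side z * cnt z (crossing z) \<omega>) - mn\<bar>}"
  have [measurable]: "B \<in> sets M" "G \<in> sets M" unfolding B_def G_def by measurable
  have "{\<omega>\<in>space M. \<epsilon> < \<bar>D \<omega>\<bar>} \<subseteq> B \<union> G"
  proof safe
    fix \<omega> assume w: "\<omega> \<in> space M" and De: "\<epsilon> < \<bar>D \<omega>\<bar>" and nG: "\<omega> \<notin> G"
    show "\<omega> \<in> B"
    proof (rule ccontr)
      assume "\<omega> \<notin> B"
      hence out: "cnt z (crossing z) \<omega> = 0" if "z \<notin> window N" for z using w that by (auto simp: B_def)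
      note net = net_crossing_eq[of N \<omega>, OF out]
      have "D \<omega> = (\<Sum>z\<in>window N. side z * cnt z (crossing z) \<omega>)"
        using Deq[OF w net(1,2)] net(3) by simp
      hence "\<bar>D \<omega> - mn\<bar> < \<epsilon> / 2" using nG w by (simp add: G_def)
      thus False using De mean unfolding mn_def by linarith
    qed
  qed
  hence "prob {\<omega>\<in>space M. \<epsilon> < \<bar>D \<omega>\<bar>} \<le> prob (B \<union> G)" by (intro finite_measure_mono) auto
  also have "\<dots> \<le> prob B + prob G" by (rule measure_Un_le) auto
  also have "prob B \<le> 2 * K * V / (real N - 1)" unfolding B_def by (rule prob_crossing_outside_window[OF N])
  also have "prob G \<le> 4 * K * (\<Sum>z\<in>window N. q (crossing z)) / (\<epsilon> / 2)\<^sup>2"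
    unfolding G_def mn_def using \<epsilon> by (intro prob_signed_count_deviation) (auto simp: window_def side_def)
  also have "\<dots> = 16 * K * (\<Sum>z\<in>window N. q (crossing z)) / \<epsilon>\<^sup>2" by (simp add: power_divide)
  also have "\<dots> \<le> 16 * K * (d + V / d) / \<epsilon>\<^sup>2"
    using sum_q_crossing_le[OF d] K_nonneg by (intro divide_right_mono mult_left_mono) auto
  finally show ?thesis by simp
qed

end

end

section \<open>The height along the characteristic\<close>

lemma IRW_setupD:
  assumes "IRW_setup p M sigma0 Y"
  shows "prob_space M"
    and "1 \<le> n \<Longrightarrow> sigma0 n x \<in> measurable M (count_space UNIV)"
    and "1 \<le> n \<Longrightarrow> \<omega> \<in> space M \<Longrightarrow> mono (\<lambda>x. sigma0 n x \<omega>)"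
    and "1 \<le> n \<Longrightarrow> is_rw p M (Y n i)"
    and "1 \<le> n \<Longrightarrow> prob_space.indep_vars M (\<lambda>_. Pi\<^sub>M {0..} (\<lambda>_. count_space UNIV)) (\<lambda>i \<omega>. \<lambda>t\<in>{0..}. Y n i t \<omega>) UNIV"
    and "1 \<le> n \<Longrightarrow> indep_rv M (Pi\<^sub>M UNIV (\<lambda>_. count_space UNIV)) (\<lambda>\<omega>. \<lambda>x. sigma0 n x \<omega>)
           (Pi\<^sub>M UNIV (\<lambda>_. Pi\<^sub>M {0..} (\<lambda>_. count_space UNIV))) (\<lambda>\<omega>. \<lambda>i. \<lambda>t\<in>{0..}. Y n i t \<omega>)"
  using assms unfolding IRW_setup_def by blast+

lemma measurable_diff_count_space:
  fixes f g :: "'a \<Rightarrow> int"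
  assumes f: "f \<in> measurable M (count_space UNIV)" and g: "g \<in> measurable M (count_space UNIV)"
  shows "(\<lambda>\<omega>. f \<omega> - g \<omega>) \<in> measurable M (count_space UNIV)"
  by (rule measurable_compose_countable[where f = "\<lambda>i \<omega>. i - g \<omega>", OF measurable_compose[OF g] f]) simp

lemma eta_measurable:
  "IRW_setup p M sigma0 Y \<Longrightarrow> 1 \<le> n \<Longrightarrow> eta sigma0 n z \<in> measurable M (count_space UNIV)"
  unfolding eta_def[abs_def] by (intro measurable_diff_count_space IRW_setupD(2))

lemma height_measurable:
  assumes irw: "IRW_setup p M sigma0 Y" and n: "1 \<le> n" and t: "0 \<le> t"
  shows "(\<lambda>\<omega>. real_of_int (height sigma0 Y n t x \<omega>)) \<in> borel_measurable M"
proof -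
  have Y: "Y n i t \<in> measurable M (count_space UNIV)" for i
    by (rule is_rw_measurable[OF IRW_setupD(4)[OF irw n] t])
  have s: "sigma0 n x \<in> measurable M (count_space UNIV)" for x by (rule IRW_setupD(2)[OF irw n])
  note e = eta_measurable[OF irw n]
  have m1: "{\<omega>\<in>space M. j < nat (eta sigma0 n z \<omega>)} \<in> sets M" for z j
    by (rule sets_Collect_count_space[OF e])
  have m2: "{\<omega>\<in>space M. R (Y n (z, j) t \<omega>)} \<in> sets M" for z j R
    by (rule sets_Collect_count_space[OF Y])
  have "{\<omega>\<in>space M. j < nat (eta sigma0 n z \<omega>) \<and> z \<le> x \<and> x < z + Y n (z, j) t \<omega>} \<in> sets M" for z j
    using sets.Int[OF m1[of j z] m2[of "\<lambda>y. z \<le> x \<and> x < z + y" z j]] by (simp add: Int_def conj_ac cong: conj_cong)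
  hence A: "(\<lambda>\<omega>. real (card {i. case i of (z, j) \<Rightarrow> j < nat (eta sigma0 n z \<omega>) \<and> z \<le> x \<and> x < z + Y n (z, j) t \<omega>})) \<in> borel_measurable M"
    by (intro borel_measurable_card_countable) (auto split: prod.split)
  have "{\<omega>\<in>space M. j < nat (eta sigma0 n z \<omega>) \<and> z + Y n (z, j) t \<omega> \<le> x \<and> x < z} \<in> sets M" for z j
    using sets.Int[OF m1[of j z] m2[of "\<lambda>y. z + y \<le> x \<and> x < z" z j]] by (simp add: Int_def conj_ac cong: conj_cong)
  hence B: "(\<lambda>\<omega>. real (card {i. case i of (z, j) \<Rightarrow> j < nat (eta sigma0 n z \<omega>) \<and> z + Y n (z, j) t \<omega> \<le> x \<and> x < z})) \<in> borel_measurable M"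
    by (intro borel_measurable_card_countable) (auto split: prod.split)
  have "(\<lambda>\<omega>. real_of_int (sigma0 n x \<omega>)) \<in> borel_measurable M" by (rule measurable_compose[OF s]) simp
  thus ?thesis using A B unfolding height_def current_def by simp
qed

text \<open>Taking differences of heights and evaluating paths at time \<open>t\<close> are
  measurable maps, so the independence of whole paths from heights passes to displacements and
  occupation numbers.\<close>

lemma IRW_marked_particles:
  assumes irw: "IRW_setup p M sigma0 Y" and p: "is_kernel p" and n: "1 \<le> n" and t: "0 \<le> t"
    and ind: "prob_space.indep_vars M (\<lambda>_. count_space UNIV) (\<lambda>x. eta sigma0 n x) UNIV"
    and sq: "\<And>x. integrable M (\<lambda>\<omega>. (real_of_int (eta sigma0 n x \<omega>))\<^sup>2)"
      "\<And>x. integral\<^sup>L M (\<lambda>\<omega>. (real_of_int (eta sigma0 n x \<omega>))\<^sup>2) \<le> K"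
  shows "marked_particles M (eta sigma0 n) (\<lambda>i. Y n i t) K"
proof -
  interpret prob_space M by (rule IRW_setupD(1)[OF irw])
  note rw = IRW_setupD(4)[OF irw n]
  have comp: "(\<lambda>f. f t) \<in> measurable (Pi\<^sub>M {0..} (\<lambda>_. count_space UNIV)) (count_space (UNIV :: int set))"
    using t by (intro measurable_component_singleton) simp
  show ?thesis
  proof
    show "eta sigma0 n z \<in> measurable M (count_space UNIV)" for z by (rule eta_measurable[OF irw n])
    show "0 \<le> eta sigma0 n z \<omega>" if "\<omega> \<in> space M" for z \<omega>
      using IRW_setupD(3)[OF irw n that] by (auto simp: eta_def mono_def)
    show "Y n i t \<in> measurable M (count_space UNIV)" for i by (rule is_rw_measurable[OF rw t])
    show "indep_vars (\<lambda>_. count_space UNIV) (\<lambda>i. Y n i t) UNIV"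
      using indep_vars_compose2[OF IRW_setupD(5)[OF irw n] comp] t by simp
    show "distr M (count_space UNIV) (Y n i t) = distr M (count_space UNIV) (Y n j t)" for i j
      by (simp only: is_rw_distr[OF p rw prob_space_axioms t])
    have "indep_rv M (Pi\<^sub>M UNIV (\<lambda>_. count_space UNIV)) (\<lambda>\<omega>. (\<lambda>s z. s z - s (z - 1)) (\<lambda>x. sigma0 n x \<omega>))
       (Pi\<^sub>M UNIV (\<lambda>_. count_space UNIV)) (\<lambda>\<omega>. (\<lambda>f i. f i t) (\<lambda>i. \<lambda>t\<in>{0..}. Y n i t \<omega>))"
    proof (rule indep_rv_compose[OF IRW_setupD(6)[OF irw n]])
      show "(\<lambda>s z. s z - s (z - 1)) \<in> measurable (Pi\<^sub>M UNIV (\<lambda>_. count_space UNIV)) (Pi\<^sub>M UNIV (\<lambda>_::int. count_space (UNIV::int set)))"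
        by (rule measurable_PiM_single') (auto simp: space_PiM intro!: measurable_diff_count_space measurable_component_singleton)
      show "(\<lambda>f i. f i t) \<in> measurable (Pi\<^sub>M UNIV (\<lambda>_. Pi\<^sub>M {0..} (\<lambda>_. count_space UNIV))) (Pi\<^sub>M UNIV (\<lambda>_::int\<times>nat. count_space (UNIV::int set)))"
      proof (rule measurable_PiM_single')
        fix i :: "int \<times> nat"
        show "(\<lambda>f. f i t) \<in> measurable (Pi\<^sub>M UNIV (\<lambda>_. Pi\<^sub>M {0..} (\<lambda>_. count_space UNIV))) (count_space (UNIV :: int set))"
          by (rule measurable_compose[OF _ comp, where f = "\<lambda>f. f i"]) (rule measurable_component_singleton, simp)
      qed (simp add: space_PiM)
    qed
    thus "indep_rv M (Pi\<^sub>M UNIV (\<lambda>_. count_space UNIV)) (\<lambda>\<omega> z. eta sigma0 n z \<omega>) (Pi\<^sub>M UNIV (\<lambda>_. count_space UNIV)) (\<lambda>\<omega> i. Y n i t \<omega>)"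
      using t by (simp add: eta_def)
  qed (use ind sq in auto)
qed

lemma conv_in_prob_boundI:
  assumes "\<And>n. N0 \<le> n \<Longrightarrow> X n \<in> borel_measurable M"
    and "\<And>e. 0 < e \<Longrightarrow> \<exists>g. g \<longlonglongrightarrow> 0 \<and> (\<forall>\<^sub>F n in sequentially. measure M {\<omega>\<in>space M. e < \<bar>X n \<omega> - Z \<omega>\<bar>} \<le> g n)"
  shows "conv_in_prob M X Z"
  unfolding conv_in_prob_def
proof (intro conjI allI impI)
  show "\<forall>\<^sub>F n in sequentially. X n \<in> borel_measurable M"
    using assms(1) by (auto simp: eventually_sequentially)
  fix e :: real assume "0 < e"
  then obtain g where g: "g \<longlonglongrightarrow> 0" "\<forall>\<^sub>F n in sequentially. measure M {\<omega>\<in>space M. e < \<bar>X n \<omega> - Z \<omega>\<bar>} \<le> g n" using assms(2) by blast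
  show "(\<lambda>n. measure M {\<omega>\<in>space M. e < \<bar>X n \<omega> - Z \<omega>\<bar>}) \<longlonglongrightarrow> 0"
    by (intro tendsto_sandwich[OF always_eventually g(2) tendsto_const g(1)] allI measure_nonneg)
qed

text \<open>\<open>avg\<close> asks only that sums of density deviations over
  \<open>O (sqrt n)\<close> sites be \<open>o (sqrt n)\<close>. Both Assumption C and continuity of
  the density in the example imply it, so one theorem serves both. The scales are: second moment
  \<open>n C\<close>, window \<open>n^2\<close>, summation by parts up to about
  \<open>A sqrt n\<close>.\<close>

theorem height_along_characteristic:
  assumes p: "is_kernel p" "assumptionA p" and irw: "IRW_setup p M sigma0 Y" and t: "0 \<le> t"
    and ind: "\<And>n. 1 \<le> n \<Longrightarrow> prob_space.indep_vars M (\<lambda>_. count_space UNIV) (\<lambda>x. eta sigma0 n x) UNIV"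
    and sq: "\<And>n x. 1 \<le> n \<Longrightarrow> integrable M (\<lambda>\<omega>. (real_of_int (eta sigma0 n x \<omega>))\<^sup>2)"
      "\<And>n x. 1 \<le> n \<Longrightarrow> integral\<^sup>L M (\<lambda>\<omega>. (real_of_int (eta sigma0 n x \<omega>))\<^sup>2) \<le> K"
    and r0: "0 \<le> r0"
    and avg: "\<And>A d. 0 < d \<Longrightarrow> \<forall>\<^sub>F n in sequentially. \<forall>k::nat. real k \<le> A * sqrt (real n) \<longrightarrow>
       \<bar>\<Sum>j=1..k. (mean_eta M sigma0 n (\<lfloor>real n * (x - drift p * t)\<rfloor> + int j) - r0)\<bar> \<le> d * sqrt (real n) \<and>
       \<bar>\<Sum>j=1..k. (mean_eta M sigma0 n (\<lfloor>real n * (x - drift p * t)\<rfloor> + 1 - int j) - r0)\<bar> \<le> d * sqrt (real n)"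
  shows "conv_in_prob M (\<lambda>n \<omega>. (real_of_int (height sigma0 Y n (real n * t) \<lfloor>real n * x\<rfloor> \<omega>)
      - real_of_int (sigma0 n \<lfloor>real n * (x - drift p * t)\<rfloor> \<omega>)) / sqrt (real n)) (\<lambda>_. 0)"
proof (rule conv_in_prob_boundI[of 1])
  interpret prob_space M by (rule IRW_setupD(1)[OF irw])
  define a where "a n = \<lfloor>real n * (x - drift p * t)\<rfloor>" for n :: nat
  define c where "c n = \<lfloor>real n * x\<rfloor>" for n :: nat
  define D where "D n \<omega> = real_of_int (height sigma0 Y n (real n * t) (c n) \<omega>) - real_of_int (sigma0 n (a n) \<omega>)" for n \<omega>
  have T0: "0 \<le> real n * t" for n using t by simp
  have sm: "(\<lambda>\<omega>. real_of_int (sigma0 n z \<omega>)) \<in> borel_measurable M" if "1 \<le> n" for n z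
    by (rule measurable_compose[OF IRW_setupD(2)[OF irw that]]) simp
  have Dm: "D n \<in> borel_measurable M" if "1 \<le> n" for n
    unfolding D_def using height_measurable[OF irw that T0] sm[OF that] by simp
  show "(\<lambda>\<omega>. (real_of_int (height sigma0 Y n (real n * t) \<lfloor>real n * x\<rfloor> \<omega>)
      - real_of_int (sigma0 n \<lfloor>real n * (x - drift p * t)\<rfloor> \<omega>)) / sqrt (real n)) \<in> borel_measurable M" if "1 \<le> n" for n
    using height_measurable[OF irw that T0] sm[OF that] by simp
  have K0: "0 \<le> K"
  proof -
    have "0 \<le> integral\<^sup>L M (\<lambda>\<omega>. (real_of_int (eta sigma0 1 0 \<omega>))\<^sup>2)" by simp
    also have "\<dots> \<le> K" by (rule sq(2)) simp
    finally show ?thesis .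
  qed
  \<comment> \<open>\<open>n C\<close> will bound the second moment of the centred displacement; the
    added 1 pays for rounding the two reference sites.\<close>
  define C where "C = t * kappa2 p + 1"
  have C1: "1 \<le> C" using kappa2_nonneg[of p] t by (simp add: C_def)
  fix e :: real assume e: "0 < e"
  \<comment> \<open>Beyond distance \<open>A sqrt n\<close> summation by parts is replaced by
    quadratic decay, at a cost proportional to \<open>1 / A\<close>; this \<open>A\<close> makes the
    cost a small share of \<open>e sqrt n\<close>. The \<open>+ 2\<close> keeps
    \<open>A s \<ge> 2\<close>, so that rounding down still leaves
    \<open>R \<ge> A s / 2\<close>.\<close>
  define A where "A = 32 * (K + r0) * C / e + 2"
  have A2: "2 \<le> A" using K0 r0 C1 e by (simp add: A_def)
  have AC: "4 * ((K + r0) * C) / A \<le> e / 8"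
  proof -
    have "e * A = 32 * ((K + r0) * C) + 2 * e" unfolding A_def using e by (simp add: field_simps)
    hence "4 * ((K + r0) * C) \<le> e / 8 * A" using e by linarith
    thus ?thesis using A2 by (subst pos_divide_le_eq) auto
  qed
  define g where "g n = (4 * K * C + 32 * K * C / e\<^sup>2) / sqrt (real n)" for n :: nat
  have lim: "g \<longlonglongrightarrow> 0" unfolding g_def
    by (intro tendsto_divide_0[OF tendsto_const] filterlim_at_top_imp_at_infinity
        filterlim_compose[OF sqrt_at_top filterlim_real_sequentially])
  have bd: "\<forall>\<^sub>F n in sequentially. prob {\<omega>\<in>space M. e < \<bar>D n \<omega> / sqrt (real n) - 0\<bar>} \<le> g n"
  proof -
    have e16: "0 < e / 16" using e by simp
    have "\<forall>\<^sub>F n in sequentially. 8 * (r0 * (1 + C)) / e \<le> sqrt (real n)"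
      using filterlim_compose[OF sqrt_at_top filterlim_real_sequentially] by (simp add: filterlim_at_top)
    with eventually_ge_at_top[of 2] avg[OF e16, of A]
    show ?thesis
    proof eventually_elim
      case (elim n)
      hence n1: "1 \<le> n" and n0: "0 < real n" by auto
      define s where "s = sqrt (real n)"
      have s1: "1 \<le> s" using n1 by (simp add: s_def)
      have ss: "s * s = real n" using n0 by (simp add: s_def)
      interpret mp: marked_particles M "eta sigma0 n" "\<lambda>i. Y n i (real n * t)" K
        by (rule IRW_marked_particles[OF irw p(1) n1 T0 ind[OF n1] sq[OF n1]])
      have rho: "mp.rho z = mean_eta M sigma0 n z" for z by (simp add: mp.rho_def mean_eta_def)
      note mom = is_rw_moments[OF p IRW_setupD(4)[OF irw n1] prob_space_axioms T0]
      let ?W = "\<lambda>\<omega>. Y n (0, 0) (real n * t) \<omega>"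
      have cn: "\<bar>real n * t * drift p - real_of_int (c n - a n)\<bar> \<le> 1"
      proof -
        have "real n * t * drift p = real n * x - real n * (x - drift p * t)" by (simp add: algebra_simps)
        moreover have "real_of_int (c n) \<le> real n * x" "real n * x < real_of_int (c n) + 1"
          "real_of_int (a n) \<le> real n * (x - drift p * t)" "real n * (x - drift p * t) < real_of_int (a n) + 1"
          by (simp_all add: c_def a_def)
        ultimately show ?thesis by simp
      qed
      have W2: "integrable M (\<lambda>\<omega>. (real_of_int (c n - a n) - real_of_int (?W \<omega>))\<^sup>2)"
        using mom(1,2)[of "(0,0)"] by (simp add: power2_diff)
      have V: "expectation (\<lambda>\<omega>. (real_of_int (c n - a n) - real_of_int (?W \<omega>))\<^sup>2) \<le> real n * C"
      proof -
        have "expectation (\<lambda>\<omega>. (real_of_int (c n - a n) - real_of_int (?W \<omega>))\<^sup>2) = expectation (\<lambda>\<omega>. (real_of_int (?W \<omega>) - real_of_int (c n - a n))\<^sup>2)"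
          by (intro Bochner_Integration.integral_cong refl power2_commute)
        also have "\<dots> = real n * t * kappa2 p + (real n * t * drift p - real_of_int (c n - a n))\<^sup>2" by (rule mom(3))
        also have "\<dots> \<le> real n * t * kappa2 p + 1" using cn by (simp only: add_le_cancel_left abs_square_le_1)
        also have "\<dots> \<le> real n * C" using n1 by (simp add: C_def algebra_simps)
        finally show ?thesis .
      qed
      have m: "\<bar>expectation (\<lambda>\<omega>. real_of_int (c n - a n) - real_of_int (?W \<omega>))\<bar> \<le> 1"
      proof -
        have "expectation (\<lambda>\<omega>. real_of_int (c n - a n) - real_of_int (?W \<omega>)) = real_of_int (c n - a n) - real n * t * drift p"
          using mom(2)[of "(0,0)"] by (subst Bochner_Integration.integral_diff) (auto simp: mom(4) prob_space)
        thus ?thesis using cn by (simp only: abs_minus_commute)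
      qed
      define R where "R = nat \<lfloor>A * s\<rfloor>"
      have As: "2 \<le> A * s" using mult_mono[OF A2 s1] A2 by simp
      have R: "real R \<le> A * s" "A * s / 2 \<le> real R"
        using As by (auto simp: R_def) linarith
      have R1: "1 \<le> R" using R(2) As by linarith
      \<comment> \<open>With \<open>n^2\<close> sites on each side the truncation error
        \<open>V / N\<close> stays bounded and a crossing from outside becomes improbable.\<close>
      let ?N = "n\<^sup>2"
      have N: "2 \<le> ?N" "1 \<le> ?N" using mult_le_mono[OF elim(1) n1] n1 by (simp_all add: power2_eq_square)
      have VN: "real n * C / real ?N \<le> C"
      proof -
        have "real n * C / real ?N = (real n * C) / (real n * real n)" by (simp add: power2_eq_square)
        also have "\<dots> = C / real n" using n0 by (intro mult_divide_mult_cancel_left) simp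
        also have "\<dots> \<le> C / 1" using n1 C1 by (intro divide_left_mono) auto
        finally show ?thesis by simp
      qed
      have mean: "\<bar>\<Sum>z\<in>mp.window (a n) ?N. mp.side (a n) z * (mp.rho z * mp.q (mp.crossing (a n) (c n) z))\<bar> \<le> (e * s) / 2"
      proof -
        have "\<bar>\<Sum>z\<in>mp.window (a n) ?N. mp.side (a n) z * (mp.rho z * mp.q (mp.crossing (a n) (c n) z))\<bar>
          \<le> r0 * (1 + real n * C / real ?N) + 2 * (e / 16 * s + (K + r0) * (real n * C) / real R)"
        proof (rule mp.mean_signed_count_le[OF W2 V m N(2) R1 r0])
          fix k assume "k \<le> R"
          hence "real k \<le> A * sqrt (real n)" using R(1) by (simp add: s_def)
          thus "\<bar>\<Sum>j=1..k. (mp.rho (a n + int j) - r0)\<bar> \<le> e / 16 * s" "\<bar>\<Sum>j=1..k. (mp.rho (a n + 1 - int j) - r0)\<bar> \<le> e / 16 * s"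
            using elim(2) unfolding rho a_def s_def by auto
        qed
        \<comment> \<open>The shares add up to \<open>3 e s / 8\<close>, within the
          \<open>e s / 2\<close> that the mean may use.\<close>
        also have "\<dots> \<le> e * s / 8 + 2 * (e / 16 * s + e * s / 16)"
        proof (intro add_mono mult_left_mono)
          have "r0 * (1 + real n * C / real ?N) \<le> r0 * (1 + C)" using VN r0 by (intro mult_left_mono) auto
          also have "\<dots> \<le> e * s / 8" 
          proof -
            have "8 * (r0 * (1 + C)) \<le> s * e" using elim(3) e by (simp only: s_def pos_divide_le_eq)
            thus ?thesis by (simp add: mult.commute)
          qed
          finally show "r0 * (1 + real n * C / real ?N) \<le> e * s / 8" .
          have "(K + r0) * (real n * C) / real R \<le> (K + r0) * (real n * C) / (A * s / 2)"
            using R As K0 r0 C1 R1 by (intro divide_left_mono) auto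
          also have "\<dots> = (4 * ((K + r0) * C) / A) * s / 2"
          proof -
            have "(K + r0) * (real n * C) / (A * s / 2) = (s * (2 * ((K + r0) * C) * s)) / (s * A)"
              unfolding ss[symmetric] by (simp add: mult_ac)
            also have "\<dots> = 2 * ((K + r0) * C) * s / A" using s1 by (intro mult_divide_mult_cancel_left) simp
            finally show ?thesis by simp
          qed
          also have "\<dots> \<le> (e / 8) * s / 2" using AC s1 by (intro divide_right_mono mult_right_mono) auto
          finally show "(K + r0) * (real n * C) / real R \<le> e * s / 16" by simp
        qed (use e in auto)
        also have "\<dots> \<le> (e * s) / 2"
        proof -
          have es0: "0 \<le> e * s" using e s1 by simp
          have "0 \<le> w \<Longrightarrow> w / 8 + 2 * (w / 16 + w / 16) \<le> w / 2" for w :: real by simp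
          from this[OF es0] show ?thesis unfolding times_divide_eq_left .
        qed
        finally show ?thesis .
      qed
      have "prob {\<omega>\<in>space M. e * s < \<bar>D n \<omega>\<bar>} \<le> 2 * K * (real n * C) / (real ?N - 1) + 16 * K * (s + real n * C / s) / (e * s)\<^sup>2"
      proof (rule mp.prob_net_crossing_deviation[OF W2 V m, of "D n" ?N "e * s" s, OF Dm[OF n1] _ N(1) _ mean])
        fix \<omega> assume w: "\<omega> \<in> space M"
        have mono: "mono (\<lambda>x. sigma0 n x \<omega>)" by (rule IRW_setupD(3)[OF irw n1 w])
        assume "finite {(z, j). j < nat (eta sigma0 n z \<omega>) \<and> a n < z \<and> z + Y n (z, j) (real n * t) \<omega> \<le> c n}"
          "finite {(z, j). j < nat (eta sigma0 n z \<omega>) \<and> z \<le> a n \<and> c n < z + Y n (z, j) (real n * t) \<omega>}"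
        from height_difference_card[OF mono this[unfolded eta_def]]
        have "height sigma0 Y n (real n * t) (c n) \<omega> - sigma0 n (a n) \<omega> =
          int (card {(z, j). j < nat (eta sigma0 n z \<omega>) \<and> a n < z \<and> z + Y n (z, j) (real n * t) \<omega> \<le> c n})
          - int (card {(z, j). j < nat (eta sigma0 n z \<omega>) \<and> z \<le> a n \<and> c n < z + Y n (z, j) (real n * t) \<omega>})"
          by (simp only: height_def current_def eta_def)
        hence "real_of_int (height sigma0 Y n (real n * t) (c n) \<omega> - sigma0 n (a n) \<omega>) = real_of_int (
          int (card {(z, j). j < nat (eta sigma0 n z \<omega>) \<and> a n < z \<and> z + Y n (z, j) (real n * t) \<omega> \<le> c n})
          - int (card {(z, j). j < nat (eta sigma0 n z \<omega>) \<and> z \<le> a n \<and> c n < z + Y n (z, j) (real n * t) \<omega>}))" by (simp only:)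
        thus "D n \<omega> = real (card {(z, j). j < nat (eta sigma0 n z \<omega>) \<and> a n < z \<and> z + Y n (z, j) (real n * t) \<omega> \<le> c n})
          - real (card {(z, j). j < nat (eta sigma0 n z \<omega>) \<and> z \<le> a n \<and> c n < z + Y n (z, j) (real n * t) \<omega>})"
          by (simp only: D_def of_int_diff of_int_of_nat_eq)
      qed (use e s1 in auto)
      also have "\<dots> \<le> 4 * K * C / s + 32 * K * C / e\<^sup>2 / s"
      proof (intro add_mono)
        have nn2: "2 \<le> real n * real n"
          using elim(1) mult_mono[of 2 "real n" 1 "real n"] by simp
        have "real n * real n - 1 \<ge> real n * s / 2"
        proof -
          have "s \<le> s * s" using s1 by simp
          hence "real n * s \<le> real n * real n" unfolding ss using n0 by (intro mult_left_mono) auto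
          thus ?thesis using nn2 by linarith
        qed
        hence "2 * K * (real n * C) / (real ?N - 1) \<le> 2 * K * (real n * C) / (real n * s / 2)"
          using K0 C1 n0 s1 nn2 by (intro divide_left_mono) (auto simp: power2_eq_square intro!: mult_pos_pos)
        also have "\<dots> = (real n * (4 * K * C)) / (real n * s)" by (simp add: mult_ac)
        also have "\<dots> = 4 * K * C / s" using n0 by (intro mult_divide_mult_cancel_left) simp
        finally show "2 * K * (real n * C) / (real ?N - 1) \<le> 4 * K * C / s" .
        have "real n * C / s = s * C" using s1 unfolding ss[symmetric] by simp
        hence "s + real n * C / s = s * (1 + C)" by (simp add: distrib_left)
        hence "16 * K * (s + real n * C / s) / (e * s)\<^sup>2 = 16 * K * (1 + C) / e\<^sup>2 / s"
        proof -
          have "16 * K * (s * (1 + C)) / (e * s)\<^sup>2 = (s * (16 * K * (1 + C))) / (s * (e\<^sup>2 * s))"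
            by (simp add: power2_eq_square mult_ac)
          also have "\<dots> = 16 * K * (1 + C) / (e\<^sup>2 * s)" using s1 by (intro mult_divide_mult_cancel_left) simp
          finally show ?thesis unfolding \<open>s + real n * C / s = s * (1 + C)\<close> by simp
        qed
        also have "\<dots> \<le> 32 * K * C / e\<^sup>2 / s"
        proof (intro divide_right_mono)
          have "16 * K * (1 + C) \<le> 16 * K * (2 * C)" using C1 K0 by (intro mult_left_mono) auto
          thus "16 * K * (1 + C) \<le> 32 * K * C" by simp
        qed (use s1 in auto)
        finally show "16 * K * (s + real n * C / s) / (e * s)\<^sup>2 \<le> 32 * K * C / e\<^sup>2 / s" .
      qed
      also have "\<dots> = g n" by (simp add: g_def s_def add_divide_distrib)
      also have "{\<omega>\<in>space M. e * s < \<bar>D n \<omega>\<bar>} = {\<omega>\<in>space M. e < \<bar>D n \<omega> / sqrt (real n) - 0\<bar>}"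
      proof -
        have "e * s < \<bar>y\<bar> \<longleftrightarrow> e < \<bar>y / sqrt (real n) - 0\<bar>" for y
          unfolding s_def[symmetric] using s1 by (simp add: abs_divide pos_less_divide_eq)
        thus ?thesis by (simp only:)
      qed
      finally show ?case .
    qed
  qed
  show "\<exists>g. g \<longlonglongrightarrow> 0 \<and> (\<forall>\<^sub>F n in sequentially. prob {\<omega> \<in> space M. e < \<bar>(real_of_int (height sigma0 Y n (real n * t) \<lfloor>real n * x\<rfloor> \<omega>)
      - real_of_int (sigma0 n \<lfloor>real n * (x - drift p * t)\<rfloor> \<omega>)) / sqrt (real n) - 0\<bar>} \<le> g n)"
    by (rule exI[of _ g], rule conjI[OF lim], rule bd[unfolded D_def a_def c_def])
qed

section \<open>Construction of Brownian motion\<close>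

lemma continuous_on_UNIV_if_intervals:
  fixes f :: "real \<Rightarrow> real"
  assumes "\<And>R::nat. continuous_on {- real R..real R} f"
  shows "continuous_on UNIV f"
proof (rule continuous_at_imp_continuous_on, rule ballI)
  fix x :: real
  obtain R :: nat where R: "\<bar>x\<bar> < real R" using reals_Archimedean2 by blast
  have "x \<in> interior {- real R..real R}" using R by auto
  thus "isCont f x" by (rule continuous_on_interior[OF assms])
qed

section \<open>Schauder functions and polygons on the real line\<close>

definition tent :: "real \<Rightarrow> real" where "tent x = max 0 (1 - \<bar>2 * x - 1\<bar>)"

definition ramp :: "real \<Rightarrow> real" where "ramp x = max 0 (min 1 x)"

definition schauder :: "(int \<Rightarrow> real) \<Rightarrow> real \<Rightarrow> real" where
  "schauder g t = g \<lfloor>t\<rfloor> * tent (t - of_int \<lfloor>t\<rfloor>)"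

text \<open>The piecewise linear function with slope \<open>g k\<close> on \<open>[k, k + 1]\<close>
  and value 0 at 0. Subtracting the value of each ramp at 0 makes all terms outside the finite range
  vanish, which allows a two-sided index.\<close>

definition polygon :: "(int \<Rightarrow> real) \<Rightarrow> real \<Rightarrow> real" where
  "polygon g t = (\<Sum>k\<in>{- \<lceil>\<bar>t\<bar>\<rceil>..\<lceil>\<bar>t\<bar>\<rceil>}. g k * (ramp (t - of_int k) - ramp (- of_int k)))"

lemma tent_eq_0: "x \<le> 0 \<or> 1 \<le> x \<Longrightarrow> tent x = 0"
  by (auto simp: tent_def)

lemma tent_bounds: "0 \<le> tent x" "tent x \<le> 1"
  by (auto simp: tent_def)

lemma schauder_eq:
  assumes "of_int k \<le> t" "t \<le> of_int k + 1"
  shows "schauder g t = g k * tent (t - of_int k)"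
proof (cases "t = of_int k + 1")
  case True
  thus ?thesis by (simp add: schauder_def tent_def)
next
  case False
  hence "\<lfloor>t\<rfloor> = k" using assms by (intro floor_unique) auto
  thus ?thesis by (simp add: schauder_def)
qed

lemma schauder_eq_sum:
  assumes "finite F" "\<lfloor>t\<rfloor> \<in> F"
  shows "schauder g t = (\<Sum>k\<in>F. g k * tent (t - of_int k))"
proof -
  have "(\<Sum>k\<in>F. g k * tent (t - of_int k)) = (\<Sum>k\<in>{\<lfloor>t\<rfloor>}. g k * tent (t - of_int k))"
  proof (intro sum.mono_neutral_right ballI)
    fix k assume "k \<in> F - {\<lfloor>t\<rfloor>}"
    hence "k < \<lfloor>t\<rfloor> \<or> \<lfloor>t\<rfloor> < k" by auto
    hence "t - of_int k \<le> 0 \<or> 1 \<le> t - of_int k"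
      by (auto simp: floor_less_iff less_floor_iff)
    thus "g k * tent (t - of_int k) = 0" by (simp add: tent_eq_0)
  qed (use assms in auto)
  thus ?thesis by (simp add: schauder_def)
qed

lemma continuous_on_schauder: "continuous_on UNIV (schauder g)"
proof (rule continuous_on_UNIV_if_intervals)
  fix R :: nat
  have c: "continuous_on {- real R..real R} (\<lambda>t. \<Sum>k\<in>{- int R..int R}. g k * tent (t - of_int k))"
    unfolding tent_def by (intro continuous_intros)
  have e: "schauder g t = (\<Sum>k\<in>{- int R..int R}. g k * tent (t - of_int k))" if "t \<in> {- real R..real R}" for t
    using that by (intro schauder_eq_sum) (auto simp: le_floor_iff floor_le_iff)
  show "continuous_on {- real R..real R} (schauder g)" by (rule continuous_on_eq[OF c]) (simp only: e)
qed

lemma polygon_eq: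
  assumes "\<bar>t\<bar> \<le> of_int r"
  shows "polygon g t = (\<Sum>k\<in>{- r..r}. g k * (ramp (t - of_int k) - ramp (- of_int k)))"
  unfolding polygon_def
proof (rule sum.mono_neutral_left)
  have "\<lceil>\<bar>t\<bar>\<rceil> \<le> r" using assms by (simp add: ceiling_le_iff)
  thus "{- \<lceil>\<bar>t\<bar>\<rceil>..\<lceil>\<bar>t\<bar>\<rceil>} \<subseteq> {- r..r}" by auto
  show "\<forall>k\<in>{- r..r} - {- \<lceil>\<bar>t\<bar>\<rceil>..\<lceil>\<bar>t\<bar>\<rceil>}. g k * (ramp (t - of_int k) - ramp (- of_int k)) = 0"
  proof
    fix k assume "k \<in> {- r..r} - {- \<lceil>\<bar>t\<bar>\<rceil>..\<lceil>\<bar>t\<bar>\<rceil>}"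
    hence "k \<le> - \<lceil>\<bar>t\<bar>\<rceil> - 1 \<or> \<lceil>\<bar>t\<bar>\<rceil> + 1 \<le> k" by auto
    moreover have "\<bar>t\<bar> \<le> of_int \<lceil>\<bar>t\<bar>\<rceil>" by simp
    ultimately have "(real_of_int k \<le> - \<bar>t\<bar> - 1) \<or> (\<bar>t\<bar> + 1 \<le> real_of_int k)"
      by (smt (verit) of_int_le_iff of_int_add of_int_1 of_int_minus of_int_diff)
    thus "g k * (ramp (t - of_int k) - ramp (- of_int k)) = 0" by (auto simp: ramp_def)
  qed
qed simp

lemma continuous_on_polygon: "continuous_on UNIV (polygon g)"
proof (rule continuous_on_UNIV_if_intervals)
  fix R :: nat
  have c: "continuous_on {- real R..real R} (\<lambda>t. \<Sum>k\<in>{- int R..int R}. g k * (ramp (t - of_int k) - ramp (- of_int k)))"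
    unfolding ramp_def by (intro continuous_intros)
  have e: "polygon g t = (\<Sum>k\<in>{- int R..int R}. g k * (ramp (t - of_int k) - ramp (- of_int k)))" if "t \<in> {- real R..real R}" for t
    using that by (intro polygon_eq) auto
  show "continuous_on {- real R..real R} (polygon g)" by (rule continuous_on_eq[OF c]) (simp only: e)
qed

lemma polygon_0: "polygon g 0 = 0"
  by (simp add: polygon_def)

lemma polygon_affine:
  assumes x: "0 \<le> x" "x \<le> 1"
  shows "polygon g (of_int k + x) = polygon g (of_int k) + x * g k"
proof -
  define r where "r = \<bar>k\<bar> + 1"
  have r: "\<bar>real_of_int k + x\<bar> \<le> of_int r" "\<bar>real_of_int k\<bar> \<le> of_int r" using x by (auto simp: r_def)
  have "polygon g (of_int k + x) - polygon g (of_int k) = (\<Sum>j\<in>{- r..r}. g j * (ramp (of_int k + x - of_int j) - ramp (of_int k - of_int j)))"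
    unfolding polygon_eq[OF r(1)] polygon_eq[OF r(2)] sum_subtractf[symmetric] by (intro sum.cong) (auto simp: algebra_simps)
  also have "\<dots> = (\<Sum>j\<in>{k}. g j * (ramp (of_int k + x - of_int j) - ramp (of_int k - of_int j)))"
  proof (intro sum.mono_neutral_right ballI)
    fix j assume "j \<in> {- r..r} - {k}"
    hence "j \<le> k - 1 \<or> k + 1 \<le> j" by auto
    hence "real_of_int j \<le> of_int k - 1 \<or> real_of_int k + 1 \<le> of_int j"
      by (smt (verit) of_int_le_iff of_int_add of_int_1 of_int_diff)
    thus "g j * (ramp (of_int k + x - of_int j) - ramp (of_int k - of_int j)) = 0" using x by (auto simp: ramp_def)
  qed (auto simp: r_def)
  also have "\<dots> = x * g k" using x by (simp add: ramp_def min_def max_def)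
  finally show ?thesis by simp
qed

text \<open>The Levy--Ciesielski construction from an array \<open>z\<close> of standard normal variables:
  \<open>z (0, k)\<close> is the increment over \<open>[k, k + 1]\<close> and \<open>z (Suc n, k)\<close> the displacement of the
  midpoint of the \<open>k\<close>-th dyadic interval of length \<open>2\<^sup>-\<^sup>n\<close>.\<close>

definition bm_scale :: "nat \<Rightarrow> real" where "bm_scale n = 1 / (2 * sqrt (2 ^ n))"

definition bm_partial :: "(nat \<times> int \<Rightarrow> real) \<Rightarrow> nat \<Rightarrow> real \<Rightarrow> real" where
  "bm_partial z n t = polygon (\<lambda>k. z (0, k)) t + (\<Sum>j<n. bm_scale j * schauder (\<lambda>k. z (Suc j, k)) (2 ^ j * t))"

definition bm_series :: "(nat \<times> int \<Rightarrow> real) \<Rightarrow> real \<Rightarrow> real" where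
  "bm_series z t = polygon (\<lambda>k. z (0, k)) t + (\<Sum>j. bm_scale j * schauder (\<lambda>k. z (Suc j, k)) (2 ^ j * t))"

text \<open>The increment over the \<open>k\<close>-th dyadic interval of length
  \<open>2^-n\<close>. A half gets half of its parent's increment plus or minus the displacement of
  the midpoint. For uncorrelated halves of variance \<open>2^-(n+1)\<close> that displacement must
  have variance \<open>2^-n / 4\<close>, the square of \<open>bm_scale n\<close>.\<close>

primrec bm_incr :: "(nat \<times> int \<Rightarrow> real) \<Rightarrow> nat \<Rightarrow> int \<Rightarrow> real" where
  "bm_incr z 0 k = z (0, k)"
| "bm_incr z (Suc n) k = bm_incr z n (k div 2) / 2 + (if even k then 1 else - 1) * bm_scale n * z (Suc n, k div 2)"

text \<open>On the parent interval the earlier levels are affine and the new level adds a single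
  tent with its tip at the midpoint, so each half is affine again.\<close>

lemma bm_partial_affine:
  assumes "0 \<le> x" "x \<le> 1"
  shows "bm_partial z n ((of_int k + x) / 2 ^ n) = bm_partial z n (of_int k / 2 ^ n) + x * bm_incr z n k"
  using assms
proof (induction n arbitrary: k x)
  case 0
  thus ?case by (simp add: bm_partial_def polygon_affine)
next
  case (Suc n)
  define m where "m = k div 2"
  have key: "bm_partial z (Suc n) ((of_int m + y) / 2 ^ n) =
      bm_partial z n (of_int m / 2 ^ n) + y * bm_incr z n m + bm_scale n * (z (Suc n, m) * tent y)" if "0 \<le> y" "y \<le> 1" for y
  proof -
    have "bm_partial z (Suc n) ((of_int m + y) / 2 ^ n) = bm_partial z n ((of_int m + y) / 2 ^ n) + bm_scale n * schauder (\<lambda>k. z (Suc n, k)) (of_int m + y)"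
      by (simp add: bm_partial_def)
    also have "schauder (\<lambda>k. z (Suc n, k)) (of_int m + y) = z (Suc n, m) * tent y"
      using that by (subst schauder_eq[of m]) auto
    finally show ?thesis using Suc.IH[OF that, of m] by simp
  qed
  show ?case
  proof (cases "even k")
    case True
    hence k: "k = 2 * m" by (simp add: m_def)
    have e: "(of_int k + u) / 2 ^ Suc n = (of_int m + u / 2) / (2 ^ n :: real)" for u by (simp add: k field_simps)
    have "tent (x / 2) = x" "tent 0 = 0" using Suc.prems by (auto simp: tent_def)
    thus ?thesis
      using key[of "x / 2"] key[of 0] Suc.prems e[of x] e[of 0] True by (simp add: m_def[symmetric] algebra_simps)
  next
    case False
    hence k: "k = 2 * m + 1" by (simp add: m_def)
    have e: "(of_int k + u) / 2 ^ Suc n = (of_int m + (1 + u) / 2) / (2 ^ n :: real)" for u by (simp add: k field_simps)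
    have "tent ((1 + x) / 2) = 1 - x" "tent (1 / 2) = 1" using Suc.prems by (auto simp: tent_def field_simps abs_if)
    note tents = this
    have L: "bm_partial z (Suc n) ((of_int k + x) / 2 ^ Suc n) =
        bm_partial z n (of_int m / 2 ^ n) + (1 + x) / 2 * bm_incr z n m + bm_scale n * (z (Suc n, m) * (1 - x))"
      unfolding e tents(1)[symmetric] using Suc.prems by (intro key) auto
    have R: "bm_partial z (Suc n) (of_int k / 2 ^ Suc n) =
        bm_partial z n (of_int m / 2 ^ n) + 1 / 2 * bm_incr z n m + bm_scale n * (z (Suc n, m) * 1)"
      using key[of "1 / 2"] e[of 0] tents(2) by simp
    have I: "bm_incr z (Suc n) k = bm_incr z n m / 2 - bm_scale n * z (Suc n, m)" using False by (simp add: m_def[symmetric])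
    show ?thesis unfolding L R I by (simp add: field_simps)
  qed
qed

text \<open>From level \<open>n\<close> on, \<open>2^j\<close> times the point is an integer, where
  every tent vanishes.\<close>

lemma bm_series_dyadic: "bm_series z (of_int k / 2 ^ n) = bm_partial z n (of_int k / 2 ^ n)"
proof -
  have "(\<Sum>j. bm_scale j * schauder (\<lambda>k. z (Suc j, k)) (2 ^ j * (of_int k / 2 ^ n))) =
    (\<Sum>j\<in>{..<n}. bm_scale j * schauder (\<lambda>k. z (Suc j, k)) (2 ^ j * (of_int k / 2 ^ n)))"
  proof (rule suminf_finite)
    fix j assume "j \<notin> {..<n}"
    then obtain d where "j = n + d" by (metis lessThan_iff not_less le_Suc_ex)
    hence "2 ^ j * (of_int k / 2 ^ n) = real_of_int (2 ^ d * k)"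
      by (simp add: power_add)
    hence "schauder (\<lambda>k. z (Suc j, k)) (2 ^ j * (of_int k / 2 ^ n)) = 0"
      by (simp only: schauder_def floor_of_int diff_self tent_eq_0 mult_zero_right order_refl simp_thms)
    thus "bm_scale j * schauder (\<lambda>k. z (Suc j, k)) (2 ^ j * (of_int k / 2 ^ n)) = 0" by simp
  qed simp
  thus ?thesis by (simp add: bm_series_def bm_partial_def)
qed

lemma bm_series_0: "bm_series z 0 = 0"
  using bm_series_dyadic[of z 0 0] by (simp add: bm_partial_def polygon_0)

lemma bm_series_dyadic_incr:
  assumes "k \<le> l"
  shows "bm_series z (of_int l / 2 ^ n) - bm_series z (of_int k / 2 ^ n) = (\<Sum>j\<in>{k..<l}. bm_incr z n j)"
  using assms
proof (induction l rule: int_ge_induct)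
  case (step l)
  have "{k..<l + 1} = insert l {k..<l}" using step by auto
  moreover have "bm_series z (of_int (l + 1) / 2 ^ n) = bm_series z (of_int l / 2 ^ n) + bm_incr z n l"
    using bm_partial_affine[of 1 z n l] unfolding bm_series_dyadic by simp
  ultimately show ?case using step by simp
qed simp

section \<open>Almost sure convergence of the random series\<close>

text \<open>The base \<open>5/4\<close> lies below \<open>sqrt 2\<close>, so the series of
  \<open>bm_scale n * (5/4) ^ n\<close> converges; its fourth power exceeds 2, so that fourth
  moments outweigh the number of intervals, which doubles with every level.\<close>

definition bm_good :: "(nat \<times> int \<Rightarrow> real) \<Rightarrow> bool" where
  "bm_good z \<longleftrightarrow> (\<forall>R::nat. \<exists>n0. \<forall>n\<ge>n0. \<forall>k\<in>{- int (R * 2 ^ n)..int (R * 2 ^ n)}. \<bar>z (Suc n, k)\<bar> \<le> (5 / 4) ^ n)"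

text \<open>The value 0 on the exceptional null set makes every path continuous, as
  \<open>two_sided_BM\<close> demands for all \<open>\<omega>\<close>.\<close>

definition bm_path :: "(nat \<times> int \<Rightarrow> real) \<Rightarrow> real \<Rightarrow> real" where
  "bm_path z t = (if bm_good z then bm_series z t else 0)"

lemma summable_bm_scale: "summable (\<lambda>n. bm_scale n * (5 / 4) ^ n)"
proof -
  have eq: "bm_scale n * (5 / 4) ^ n = (1 / 2) * (5 / (4 * sqrt 2)) ^ n" for n
    by (simp add: bm_scale_def real_sqrt_power power_divide power_mult_distrib)
  have "summable (\<lambda>n. (1 / 2) * (5 / (4 * sqrt 2)) ^ n)"
  proof (intro summable_mult summable_geometric)
    have "(5 / 4)\<^sup>2 < (2::real)" by (simp add: power2_eq_square)
    hence "5 / 4 < sqrt 2" by (rule real_less_rsqrt)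
    thus "norm (5 / (4 * sqrt 2) :: real) < 1" by simp
  qed
  thus ?thesis by (simp only: eq)
qed

lemma continuous_on_bm_series:
  assumes "bm_good z"
  shows "continuous_on UNIV (bm_series z)"
proof (rule continuous_on_UNIV_if_intervals)
  fix R :: nat
  let ?f = "\<lambda>j t. bm_scale j * schauder (\<lambda>k. z (Suc j, k)) (2 ^ j * t)"
  obtain n0 where n0: "\<And>n k. n \<ge> n0 \<Longrightarrow> k \<in> {- int (R * 2 ^ n)..int (R * 2 ^ n)} \<Longrightarrow> \<bar>z (Suc n, k)\<bar> \<le> (5 / 4) ^ n"
    using assms unfolding bm_good_def by blast
  have ul: "uniform_limit {- real R..real R} (\<lambda>n t. \<Sum>j<n. ?f j t) (\<lambda>t. \<Sum>j. ?f j t) sequentially"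
  proof (rule Weierstrass_m_test_ev[OF _ summable_bm_scale])
    show "\<forall>\<^sub>F n in sequentially. \<forall>t\<in>{- real R..real R}. norm (?f n t) \<le> bm_scale n * (5 / 4) ^ n"
      using eventually_ge_at_top[of n0]
    proof eventually_elim
      case (elim n)
      show ?case
      proof
        fix t assume t: "t \<in> {- real R..real R}"
        have "\<bar>2 ^ n * t\<bar> \<le> 2 ^ n * real R" using t by (auto simp: abs_mult intro!: mult_left_mono)
        hence b: "- (real R * 2 ^ n) \<le> 2 ^ n * t" "2 ^ n * t \<le> real R * 2 ^ n"
          by (auto simp: abs_le_iff mult.commute)
        have "\<lfloor>2 ^ n * t\<rfloor> \<in> {- int (R * 2 ^ n)..int (R * 2 ^ n)}"
        proof -
          have r: "real R * 2 ^ n = real_of_int (int (R * 2 ^ n))" "- (real R * 2 ^ n) = real_of_int (- int (R * 2 ^ n))" by simp_all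
          have "- int (R * 2 ^ n) \<le> \<lfloor>2 ^ n * t\<rfloor>" using floor_mono[OF b(1)] unfolding r(2) floor_of_int .
          moreover have "\<lfloor>2 ^ n * t\<rfloor> \<le> int (R * 2 ^ n)" using floor_mono[OF b(2)] unfolding r(1) floor_of_int .
          ultimately show ?thesis by simp
        qed
        hence "\<bar>z (Suc n, \<lfloor>2 ^ n * t\<rfloor>)\<bar> \<le> (5 / 4) ^ n" by (rule n0[OF elim])
        moreover have "0 \<le> bm_scale n" by (simp add: bm_scale_def)
        moreover have "\<bar>tent (2 ^ n * t - of_int \<lfloor>2 ^ n * t\<rfloor>)\<bar> \<le> 1" using tent_bounds by simp
        ultimately have "bm_scale n * (\<bar>z (Suc n, \<lfloor>2 ^ n * t\<rfloor>)\<bar> * \<bar>tent (2 ^ n * t - of_int \<lfloor>2 ^ n * t\<rfloor>)\<bar>) \<le> bm_scale n * ((5 / 4) ^ n * 1)"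
          by (intro mult_left_mono mult_mono) auto
        thus "norm (?f n t) \<le> bm_scale n * (5 / 4) ^ n" using \<open>0 \<le> bm_scale n\<close> by (simp add: schauder_def abs_mult)
      qed
    qed
  qed
  have ce: "\<forall>\<^sub>F n in sequentially. continuous_on {- real R..real R} (\<lambda>t. \<Sum>j<n. ?f j t)"
    by (intro always_eventually allI continuous_on_sum continuous_on_mult continuous_on_const
      continuous_on_compose2[OF continuous_on_schauder] continuous_on_id) auto
  have "continuous_on {- real R..real R} (\<lambda>t. \<Sum>j. ?f j t)"
    by (rule uniform_limit_theorem[OF ce ul]) simp
  thus "continuous_on {- real R..real R} (bm_series z)"
    unfolding bm_series_def by (intro continuous_on_add continuous_on_subset[OF continuous_on_polygon]) auto
qed

lemma sum_even_odd_int: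
  fixes h :: "int \<Rightarrow> real"
  assumes "a \<le> b"
  shows "(\<Sum>k\<in>{2 * a..<2 * b}. h k) = (\<Sum>m\<in>{a..<b}. h (2 * m) + h (2 * m + 1))"
  using assms
proof (induction b rule: int_ge_induct)
  case (step b)
  have "{2 * a..<2 * (b + 1)} = insert (2 * b + 1) (insert (2 * b) {2 * a..<2 * b})" using step by auto
  moreover have "{a..<b + 1} = insert b {a..<b}" using step by auto
  ultimately show ?case using step by simp
qed simp

text \<open>One Haar step per level: the parent's coefficient is the mean of its two children's, and
  the new coordinate carries \<open>bm_scale\<close> times their difference. The identity
  \<open>a^2 + b^2 = 2 ((a + b)/2)^2 + (a - b)^2 / 2\<close> propagates the sum of squares, with a
  factor 2 per level. The bound on levels in \<open>G\<close> keeps the new coordinates disjoint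
  from it.\<close>

lemma bm_incr_linear_combination:
  fixes a b :: int
  assumes ab: "a \<le> b"
  shows "\<exists>G d. finite G \<and> G \<subseteq> {..n} \<times> UNIV \<and>
    (\<forall>z. (\<Sum>k\<in>{a * 2 ^ n..<b * 2 ^ n}. c k * bm_incr z n k) = (\<Sum>x\<in>G. d x * z x)) \<and>
    (\<Sum>k\<in>{a * 2 ^ n..<b * 2 ^ n}. (c k)\<^sup>2) = 2 ^ n * (\<Sum>x\<in>G. (d x)\<^sup>2)"
proof (induction n arbitrary: c)
  case 0
  define G where "G = (\<lambda>k. (0::nat, k)) ` {a..<b}"
  have "(\<Sum>x\<in>G. f x) = (\<Sum>k\<in>{a..<b}. f (0, k))" for f :: "nat \<times> int \<Rightarrow> real"
    unfolding G_def by (subst sum.reindex) (auto simp: inj_on_def)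
  thus ?case by (intro exI[of _ G] exI[of _ "\<lambda>x. c (snd x)"]) (auto simp: G_def)
next
  case (Suc n)
  define I where "I = {a * 2 ^ n..<b * 2 ^ n}"
  have abn: "a * 2 ^ n \<le> b * 2 ^ n" using ab by (simp add: mult_right_mono)
  have split: "(\<Sum>k\<in>{a * 2 ^ Suc n..<b * 2 ^ Suc n}. h k) = (\<Sum>m\<in>I. h (2 * m) + h (2 * m + 1))" for h :: "int \<Rightarrow> real"
    using sum_even_odd_int[OF abn, of h] by (simp add: I_def mult_ac)
  define c' where "c' m = (c (2 * m) + c (2 * m + 1)) / 2" for m
  define e where "e m = bm_scale n * (c (2 * m) - c (2 * m + 1))" for m
  obtain G d where G: "finite G" "G \<subseteq> {..n} \<times> UNIV" "\<And>z. (\<Sum>k\<in>I. c' k * bm_incr z n k) = (\<Sum>x\<in>G. d x * z x)"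
    "(\<Sum>k\<in>I. (c' k)\<^sup>2) = 2 ^ n * (\<Sum>x\<in>G. (d x)\<^sup>2)"
    using Suc.IH[of c'] unfolding I_def by blast
  define H where "H = (\<lambda>k. (Suc n, k)) ` I"
  define d' where "d' x = (if fst x = Suc n then e (snd x) else d x)" for x
  have fH: "finite H" by (simp add: H_def I_def)
  have GH: "G \<inter> H = {}" using G(2) by (auto simp: H_def)
  have sH: "(\<Sum>x\<in>H. f x) = (\<Sum>k\<in>I. f (Suc n, k))" for f :: "nat \<times> int \<Rightarrow> real"
    unfolding H_def by (subst sum.reindex) (auto simp: inj_on_def)
  have dG: "(\<Sum>x\<in>G. f (d' x) x) = (\<Sum>x\<in>G. f (d x) x)" for f :: "real \<Rightarrow> nat \<times> int \<Rightarrow> real"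
    using G(2) by (intro sum.cong) (auto simp: d'_def)
  have dH: "d' (Suc n, k) = e k" for k by (simp add: d'_def)
  have un: "(\<Sum>x\<in>G \<union> H. f x) = (\<Sum>x\<in>G. f x) + (\<Sum>k\<in>I. f (Suc n, k))" for f :: "nat \<times> int \<Rightarrow> real"
    using sum.union_disjoint[OF G(1) fH GH, of f] by (simp add: sH)
  have lin: "(\<Sum>k\<in>{a * 2 ^ Suc n..<b * 2 ^ Suc n}. c k * bm_incr z (Suc n) k) = (\<Sum>x\<in>G \<union> H. d' x * z x)" for z
  proof -
    have "(\<Sum>k\<in>{a * 2 ^ Suc n..<b * 2 ^ Suc n}. c k * bm_incr z (Suc n) k) = (\<Sum>m\<in>I. c' m * bm_incr z n m + e m * z (Suc n, m))"
      unfolding split by (intro sum.cong) (auto simp: c'_def e_def algebra_simps add_divide_distrib)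
    also have "\<dots> = (\<Sum>x\<in>G. d x * z x) + (\<Sum>m\<in>I. e m * z (Suc n, m))" by (simp add: sum.distrib G(3))
    also have "\<dots> = (\<Sum>x\<in>G \<union> H. d' x * z x)" unfolding un dG[of "\<lambda>a x. a * z x"] dH ..
    finally show ?thesis .
  qed
  have sq: "(\<Sum>k\<in>{a * 2 ^ Suc n..<b * 2 ^ Suc n}. (c k)\<^sup>2) = 2 ^ Suc n * (\<Sum>x\<in>G \<union> H. (d' x)\<^sup>2)"
  proof -
    have sc: "2 ^ Suc n * (bm_scale n)\<^sup>2 = 1 / 2" by (simp add: bm_scale_def power_divide power_mult_distrib)
    have "2 ^ Suc n * (\<Sum>x\<in>G \<union> H. (d' x)\<^sup>2) = 2 * (2 ^ n * (\<Sum>x\<in>G. (d x)\<^sup>2)) + (\<Sum>m\<in>I. (2 ^ Suc n * (bm_scale n)\<^sup>2) * (c (2 * m) - c (2 * m + 1))\<^sup>2)"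
      unfolding un dG[of "\<lambda>a x. a\<^sup>2"] dH e_def power_mult_distrib by (simp add: sum_distrib_left distrib_left mult_ac)
    also have "\<dots> = (\<Sum>m\<in>I. 2 * (c' m)\<^sup>2 + 1 / 2 * (c (2 * m) - c (2 * m + 1))\<^sup>2)"
      unfolding G(4)[symmetric] sc by (simp add: sum.distrib sum_distrib_left)
    also have "\<dots> = (\<Sum>m\<in>I. (c (2 * m))\<^sup>2 + (c (2 * m + 1))\<^sup>2)"
      by (intro sum.cong) (auto simp: c'_def power2_eq_square field_simps)
    finally show ?thesis unfolding split ..
  qed
  show ?case
    using G(1,2) fH lin sq by (intro exI[of _ "G \<union> H"] exI[of _ d']) (auto simp: H_def)
qed

lemma measurable_bm_path[measurable]:
  "(\<lambda>z. bm_path z t) \<in> borel_measurable (Pi\<^sub>M UNIV (\<lambda>_. borel))"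
proof -
  have [measurable]: "(\<lambda>z::nat \<times> int \<Rightarrow> real. z x) \<in> borel_measurable (Pi\<^sub>M UNIV (\<lambda>_. borel))" for x
    by (rule measurable_component_singleton) simp
  have [measurable]: "Measurable.pred (Pi\<^sub>M UNIV (\<lambda>_. borel)) bm_good"
    unfolding bm_good_def[abs_def] by measurable
  have [measurable]: "(\<lambda>z. bm_series z t) \<in> borel_measurable (Pi\<^sub>M UNIV (\<lambda>_. borel))"
    unfolding bm_series_def[abs_def] polygon_def schauder_def by measurable
  show ?thesis unfolding bm_path_def[abs_def] by measurable
qed

section \<open>Gaussian increments of the limit\<close>

locale normal_array = prob_space M for M :: "'a measure" +
  fixes Z :: "nat \<times> int \<Rightarrow> 'a \<Rightarrow> real"
  assumes Z_indep: "indep_vars (\<lambda>_. borel) Z UNIV"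
    and Z_distr: "\<And>x. distr M borel (Z x) = std_normal_distribution"
begin

definition bm :: "real \<Rightarrow> 'a \<Rightarrow> real" where "bm t \<omega> = bm_path (\<lambda>x. Z x \<omega>) t"

lemma Z_measurable[measurable]: "Z x \<in> borel_measurable M"
  using Z_indep unfolding indep_vars_def2 by blast

lemma Z_vector_measurable: "(\<lambda>\<omega> x. Z x \<omega>) \<in> measurable M (Pi\<^sub>M UNIV (\<lambda>_. borel))"
  by (rule measurable_PiM_single') (auto simp: space_PiM)

lemma bm_measurable[measurable]: "bm t \<in> borel_measurable M"
  unfolding bm_def[abs_def] by (rule measurable_compose[OF Z_vector_measurable measurable_bm_path])

lemma prob_Z_large: assumes "0 < x" shows "prob {\<omega>\<in>space M. x < \<bar>Z i \<omega>\<bar>} \<le> 3 / x ^ 4"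
proof -
  have i: "integrable M (\<lambda>\<omega>. (Z i \<omega>) ^ 4)"
    using integrable_std_normal_distribution_moment[of 4] unfolding Z_distr[of i, symmetric]
    by (subst (asm) integrable_distr_eq) auto
  have "(LINT \<omega>|M. (Z i \<omega>) ^ 4) = (LINT y|std_normal_distribution. y ^ (2 * 2))"
    unfolding Z_distr[of i, symmetric] by (subst integral_distr) auto
  also have "\<dots> = 3" unfolding std_normal_distribution_even_moments(1) by (simp add: fact_numeral)
  finally have e: "(LINT \<omega>|M. (Z i \<omega>) ^ 4) = 3" .
  have "prob {\<omega>\<in>space M. x < \<bar>Z i \<omega>\<bar>} \<le> prob {\<omega>\<in>space M. x ^ 4 \<le> (Z i \<omega>) ^ 4}"
  proof (intro finite_measure_mono)
    show "{\<omega>\<in>space M. x < \<bar>Z i \<omega>\<bar>} \<subseteq> {\<omega>\<in>space M. x ^ 4 \<le> (Z i \<omega>) ^ 4}"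
    proof safe
      fix \<omega> assume "x < \<bar>Z i \<omega>\<bar>"
      hence "x ^ 4 \<le> \<bar>Z i \<omega>\<bar> ^ 4" using assms by (intro power_mono) auto
      thus "x ^ 4 \<le> (Z i \<omega>) ^ 4" by (simp add: power_even_abs)
    qed
  qed simp
  also have "\<dots> \<le> 3 / x ^ 4"
    using integral_Markov_inequality_measure[OF i, of "{}" "x ^ 4"] assms by (simp add: e)
  finally show ?thesis .
qed

text \<open>At level \<open>n\<close> there are \<open>2 R 2^n + 1\<close> variables to control,
  each too large with probability at most \<open>3 (256/625)^n\<close>. The total is geometric with
  ratio \<open>512/625\<close>, and the Borel-Cantelli lemma applies.\<close>

lemma AE_bm_good: "AE \<omega> in M. bm_good (\<lambda>x. Z x \<omega>)"
proof -
  have "AE \<omega> in M. \<exists>n0. \<forall>n\<ge>n0. \<forall>k\<in>{- int (R * 2 ^ n)..int (R * 2 ^ n)}. \<bar>Z (Suc n, k) \<omega>\<bar> \<le> (5 / 4) ^ n" for R :: nat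
  proof -
    define A where "A n = (\<Union>k\<in>{- int (R * 2 ^ n)..int (R * 2 ^ n)}. {\<omega>\<in>space M. (5 / 4) ^ n < \<bar>Z (Suc n, k) \<omega>\<bar>})" for n
    have Am: "A n \<in> sets M" for n unfolding A_def by measurable
    have Ap: "prob (A n) \<le> (6 * real R + 3) * (512 / 625) ^ n" for n
    proof -
      have "prob (A n) \<le> (\<Sum>k\<in>{- int (R * 2 ^ n)..int (R * 2 ^ n)}. prob {\<omega>\<in>space M. (5 / 4) ^ n < \<bar>Z (Suc n, k) \<omega>\<bar>})"
        unfolding A_def by (intro finite_measure_subadditive_finite) auto
      also have "\<dots> \<le> (\<Sum>k\<in>{- int (R * 2 ^ n)..int (R * 2 ^ n)}. 3 / ((5 / 4) ^ n) ^ 4)"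
        by (intro sum_mono prob_Z_large) simp
      also have "\<dots> = (2 * real R * 2 ^ n + 1) * (3 * (256 / 625) ^ n)"
      proof -
        have "((5 / 4) ^ n) ^ 4 = ((5 / 4) ^ 4 :: real) ^ n" by (simp only: power_mult[symmetric] mult.commute)
        also have "(5 / 4 :: real) ^ 4 = 625 / 256" by (simp add: power4_eq_xxxx)
        finally have "3 / ((5 / 4) ^ n) ^ 4 = 3 * (256 / 625 :: real) ^ n" by (simp add: power_divide)
        moreover have "real (card {- int (R * 2 ^ n)..int (R * 2 ^ n)}) = 2 * real R * 2 ^ n + 1"
          by (simp add: nat_add_distrib nat_mult_distrib)
        ultimately show ?thesis by (simp only: sum_constant)
      qed
      also have "\<dots> \<le> ((2 * real R + 1) * 2 ^ n) * (3 * (256 / 625) ^ n)"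
        by (intro mult_right_mono) (auto simp: algebra_simps)
      also have "\<dots> = (6 * real R + 3) * (2 ^ n * (256 / 625) ^ n)" by (simp add: algebra_simps)
      also have "2 ^ n * (256 / 625) ^ n = (512 / 625 :: real) ^ n" unfolding power_mult_distrib[symmetric] by simp
      finally show ?thesis .
    qed
    have "summable (\<lambda>n. (6 * real R + 3) * (512 / 625 :: real) ^ n)" by (intro summable_mult summable_geometric) simp
    hence "summable (\<lambda>n. prob (A n))"
      by (rule summable_comparison_test[rotated]) (use Ap in \<open>auto intro!: exI[of _ 0]\<close>)
    hence "AE \<omega> in M. eventually (\<lambda>n. \<omega> \<in> space M - A n) sequentially"
      by (intro borel_cantelli_AE1 Am) (auto simp: emeasure_eq_measure)
    thus ?thesis
    proof (rule AE_mp, intro AE_I2 impI)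
      fix \<omega> assume w: "\<omega> \<in> space M" "eventually (\<lambda>n. \<omega> \<in> space M - A n) sequentially"
      then obtain n0 where "\<And>n. n \<ge> n0 \<Longrightarrow> \<omega> \<notin> A n" by (auto simp: eventually_sequentially)
      thus "\<exists>n0. \<forall>n\<ge>n0. \<forall>k\<in>{- int (R * 2 ^ n)..int (R * 2 ^ n)}. \<bar>Z (Suc n, k) \<omega>\<bar> \<le> (5 / 4) ^ n"
        using w(1) unfolding A_def by (intro exI[of _ n0]) force
    qed
  qed
  thus ?thesis unfolding bm_good_def by (subst AE_all_countable) blast
qed

lemma bm_0: "bm 0 \<omega> = 0"
  by (simp add: bm_def bm_path_def bm_series_0)

lemma bm_continuous: "continuous_on UNIV (\<lambda>t. bm t \<omega>)"
  unfolding bm_def bm_path_def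
  by (cases "bm_good (\<lambda>x. Z x \<omega>)") (simp_all add: continuous_on_bm_series)

lemma char_linear_combination:
  assumes "finite G"
  shows "(CLINT \<omega>|M. iexp (\<Sum>x\<in>G. d x * Z x \<omega>)) = complex_of_real (exp (- (\<Sum>x\<in>G. (d x)\<^sup>2) / 2))"
proof -
  have ind: "indep_vars (\<lambda>_. borel) (\<lambda>x \<omega>. d x * Z x \<omega>) G"
    by (rule indep_vars_compose2[OF indep_vars_subset[OF Z_indep]]) auto
  have c: "char (distr M borel (\<lambda>\<omega>. d x * Z x \<omega>)) 1 = complex_of_real (exp (- (d x)\<^sup>2 / 2))" for x
  proof -
    have "char (distr M borel (\<lambda>\<omega>. d x * Z x \<omega>)) 1 = char (distr M borel (Z x)) (d x)"
      unfolding char_def by (simp add: integral_distr)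
    thus ?thesis unfolding Z_distr char_std_normal_distribution by simp
  qed
  have "(CLINT \<omega>|M. iexp (\<Sum>x\<in>G. d x * Z x \<omega>)) = char (distr M borel (\<lambda>\<omega>. \<Sum>x\<in>G. d x * Z x \<omega>)) 1"
    unfolding char_def by (simp add: integral_distr)
  also have "\<dots> = (\<Prod>x\<in>G. complex_of_real (exp (- (d x)\<^sup>2 / 2)))"
    by (subst char_distr_sum[OF ind]) (simp only: c)
  also have "\<dots> = complex_of_real (exp (\<Sum>x\<in>G. - (d x)\<^sup>2 / 2))"
    using assms by (simp add: exp_sum)
  also have "(\<Sum>x\<in>G. - (d x)\<^sup>2 / 2) = - (\<Sum>x\<in>G. (d x)\<^sup>2) / 2"
    by (simp add: sum_negf sum_divide_distrib)
  finally show ?thesis .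
qed

text \<open>The linear combination pairs the dyadic increments with the step function
  \<open>c\<close> that equals \<open>u j\<close> on \<open>A j\<close>. These intervals are
  disjoint, so the sum of squares of \<open>c\<close> is the sum of \<open>u j\<close> squared times
  their lengths.\<close>

lemma char_bm_dyadic:
  fixes m :: "int \<Rightarrow> int"
  assumes J: "finite J" and m: "mono m"
  shows "(CLINT \<omega>|M. iexp (\<Sum>j\<in>J. u j * (bm_series (\<lambda>x. Z x \<omega>) (of_int (m (j + 1)) / 2 ^ n) - bm_series (\<lambda>x. Z x \<omega>) (of_int (m j) / 2 ^ n))))
    = complex_of_real (exp (- (\<Sum>j\<in>J. (u j)\<^sup>2 * of_int (m (j + 1) - m j) / 2 ^ n) / 2))"
proof -
  define A where "A j = {m j..<m (j + 1)}" for j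
  have dis: "A i \<inter> A j = {}" if "i \<noteq> j" for i j
  proof -
    have "A i \<inter> A j = {}" if "i < j" for i j
      using monoD[OF m, of "i + 1" j] that by (auto simp: A_def)
    from this[of i j] this[of j i] show ?thesis using that by (cases "i < j") auto
  qed
  \<comment> \<open>A symmetric range of unit intervals that contains every \<open>A j\<close> at
    level \<open>n\<close>.\<close>
  define b where "b = (\<Sum>j\<in>J. \<bar>m j\<bar> + \<bar>m (j + 1)\<bar>) + 1"
  have bb: "\<bar>m j\<bar> \<le> b" "\<bar>m (j + 1)\<bar> \<le> b" if "j \<in> J" for j
  proof -
    have "\<bar>m j\<bar> + \<bar>m (j + 1)\<bar> \<le> (\<Sum>j\<in>J. \<bar>m j\<bar> + \<bar>m (j + 1)\<bar>)"
      by (rule member_le_sum[OF that _ J]) simp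
    thus "\<bar>m j\<bar> \<le> b" "\<bar>m (j + 1)\<bar> \<le> b" by (auto simp: b_def)
  qed
  have b0: "0 \<le> b" unfolding b_def by (simp add: sum_nonneg add_nonneg_nonneg)
  let ?I = "{- b * 2 ^ n..<b * 2 ^ n}"
  have AI: "A j \<subseteq> ?I" if "j \<in> J" for j
  proof -
    have "b \<le> b * 2 ^ n" using b0 by (simp add: mult_le_cancel_left1)
    thus ?thesis using bb[OF that] by (auto simp: A_def)
  qed
  define c where "c k = (\<Sum>j\<in>J. u j * indicator (A j) k)" for k
  have lin: "(\<Sum>k\<in>?I. c k * h k) = (\<Sum>j\<in>J. u j * (\<Sum>k\<in>A j. h k))" for h :: "int \<Rightarrow> real"
  proof -
    have "(\<Sum>k\<in>?I. c k * h k) = (\<Sum>j\<in>J. u j * (\<Sum>k\<in>?I. indicator (A j) k * h k))"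
      unfolding c_def sum_distrib_right sum_distrib_left by (subst sum.swap) (simp add: mult_ac)
    also have "\<dots> = (\<Sum>j\<in>J. u j * (\<Sum>k\<in>A j. h k))"
    proof (rule sum.cong[OF refl], rule arg_cong2[where f="(*)", OF refl])
      fix j assume "j \<in> J"
      have "(\<Sum>k\<in>?I. indicator (A j) k * h k) = (\<Sum>k\<in>A j. indicator (A j) k * h k)"
        using AI[OF \<open>j \<in> J\<close>] by (intro sum.mono_neutral_right) (auto simp: indicator_def)
      thus "(\<Sum>k\<in>?I. indicator (A j) k * h k) = (\<Sum>k\<in>A j. h k)" by simp
    qed
    finally show ?thesis .
  qed
  have sq: "(\<Sum>k\<in>?I. (c k)\<^sup>2) = (\<Sum>j\<in>J. (u j)\<^sup>2 * of_int (m (j + 1) - m j))"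
  proof -
    have "(\<Sum>k\<in>?I. (c k)\<^sup>2) = (\<Sum>j\<in>J. u j * (\<Sum>k\<in>A j. c k))"
      unfolding power2_eq_square by (rule lin)
    also have "\<dots> = (\<Sum>j\<in>J. (u j)\<^sup>2 * of_int (m (j + 1) - m j))"
    proof (intro sum.cong refl)
      fix j assume j: "j \<in> J"
      have "c k = u j" if "k \<in> A j" for k
      proof -
        have "c k = (\<Sum>i\<in>{j}. u i * indicator (A i) k)" unfolding c_def
          using J j dis that by (intro sum.mono_neutral_right) (auto simp: indicator_def)
        thus ?thesis using that by simp
      qed
      hence "(\<Sum>k\<in>A j. c k) = of_int (m (j + 1) - m j) * u j"
        using monoD[OF m, of j "j + 1"] by (simp add: A_def)
      thus "u j * (\<Sum>k\<in>A j. c k) = (u j)\<^sup>2 * of_int (m (j + 1) - m j)" by (simp add: power2_eq_square)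
    qed
    finally show ?thesis .
  qed
  have "- b \<le> b" using b0 by simp
  from bm_incr_linear_combination[OF this, of n c]
  obtain G d where G: "finite G" "\<And>z. (\<Sum>k\<in>?I. c k * bm_incr z n k) = (\<Sum>x\<in>G. d x * z x)"
    "(\<Sum>k\<in>?I. (c k)\<^sup>2) = 2 ^ n * (\<Sum>x\<in>G. (d x)\<^sup>2)" by blast
  have eq: "(\<Sum>j\<in>J. u j * (bm_series z (of_int (m (j + 1)) / 2 ^ n) - bm_series z (of_int (m j) / 2 ^ n))) = (\<Sum>x\<in>G. d x * z x)" for z
  proof -
    have "bm_series z (of_int (m (j + 1)) / 2 ^ n) - bm_series z (of_int (m j) / 2 ^ n) = (\<Sum>k\<in>A j. bm_incr z n k)" for j
      unfolding A_def by (rule bm_series_dyadic_incr) (simp add: monoD[OF m])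
    thus ?thesis by (simp only: lin[symmetric] G(2))
  qed
  have "(\<Sum>x\<in>G. (d x)\<^sup>2) = (\<Sum>j\<in>J. (u j)\<^sup>2 * of_int (m (j + 1) - m j)) / 2 ^ n"
    using G(3) unfolding sq by simp
  also have "\<dots> = (\<Sum>j\<in>J. (u j)\<^sup>2 * of_int (m (j + 1) - m j) / 2 ^ n)" by (rule sum_divide_distrib)
  finally show ?thesis unfolding eq char_linear_combination[OF G(1)] by simp
qed

lemma floor_dyadic_tendsto: "(\<lambda>n. of_int \<lfloor>2 ^ n * t\<rfloor> / 2 ^ n :: real) \<longlonglongrightarrow> t"
proof -
  have lim0: "(\<lambda>n. (1 / 2 :: real) ^ n) \<longlonglongrightarrow> 0" by (rule LIMSEQ_realpow_zero) auto
  have bnd: "norm (of_int \<lfloor>2 ^ n * t\<rfloor> / 2 ^ n - t) \<le> (1 / 2 :: real) ^ n" for n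
  proof -
    have "of_int \<lfloor>2 ^ n * t\<rfloor> \<le> 2 ^ n * t" "2 ^ n * t < of_int \<lfloor>2 ^ n * t\<rfloor> + 1" by linarith+
    hence "\<bar>of_int \<lfloor>2 ^ n * t\<rfloor> - 2 ^ n * t\<bar> \<le> 1" by linarith
    hence "\<bar>of_int \<lfloor>2 ^ n * t\<rfloor> - 2 ^ n * t\<bar> / 2 ^ n \<le> 1 / 2 ^ n" by (intro divide_right_mono) auto
    moreover have "\<bar>of_int \<lfloor>2 ^ n * t\<rfloor> / 2 ^ n - t\<bar> = \<bar>of_int \<lfloor>2 ^ n * t\<rfloor> - 2 ^ n * t\<bar> / 2 ^ n"
    proof -
      have "of_int \<lfloor>2 ^ n * t\<rfloor> / 2 ^ n - t = (of_int \<lfloor>2 ^ n * t\<rfloor> - 2 ^ n * t) / 2 ^ n" by (simp add: field_simps)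
      thus ?thesis by (simp only: abs_divide power_abs abs_numeral)
    qed
    ultimately show ?thesis by (simp add: power_one_over)
  qed
  have "(\<lambda>n. of_int \<lfloor>2 ^ n * t\<rfloor> / 2 ^ n - t) \<longlonglongrightarrow> 0"
    by (rule Lim_null_comparison[OF always_eventually[OF allI[OF bnd]] lim0])
  thus ?thesis by (simp add: LIM_zero_iff)
qed

text \<open>Path continuity and dominated convergence carry the dyadic formula over to arbitrary
  times. The times are indexed by all integers and may repeat, as the grid values of the clock will
  do.\<close>

theorem char_bm_increments:
  fixes ts :: "int \<Rightarrow> real"
  assumes J: "finite J" and ts: "mono ts"
  shows "(CLINT \<omega>|M. iexp (\<Sum>j\<in>J. u j * (bm (ts (j + 1)) \<omega> - bm (ts j) \<omega>)))
    = complex_of_real (exp (- (\<Sum>j\<in>J. (u j)\<^sup>2 * (ts (j + 1) - ts j)) / 2))"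
proof (rule LIMSEQ_unique)
  define m where "m n j = \<lfloor>2 ^ n * ts j\<rfloor>" for n :: nat and j
  have mono: "mono (m n)" for n using ts by (auto simp: m_def mono_def intro!: floor_mono)
  define X where "X n \<omega> = (\<Sum>j\<in>J. u j * (bm (of_int (m n (j + 1)) / 2 ^ n) \<omega> - bm (of_int (m n j) / 2 ^ n) \<omega>))" for n \<omega>
  have Xm[measurable]: "X n \<in> borel_measurable M" for n unfolding X_def by measurable
  show "(\<lambda>n. CLINT \<omega>|M. iexp (X n \<omega>)) \<longlonglongrightarrow> (CLINT \<omega>|M. iexp (\<Sum>j\<in>J. u j * (bm (ts (j + 1)) \<omega> - bm (ts j) \<omega>)))"
  proof (rule integral_dominated_convergence[where w = "\<lambda>_. 1"])
    show "AE \<omega> in M. (\<lambda>n. iexp (X n \<omega>)) \<longlonglongrightarrow> iexp (\<Sum>j\<in>J. u j * (bm (ts (j + 1)) \<omega> - bm (ts j) \<omega>))"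
    proof (intro AE_I2)
      fix \<omega>
      have "(\<lambda>n. bm (of_int (m n j) / 2 ^ n) \<omega>) \<longlonglongrightarrow> bm (ts j) \<omega>" for j
      proof -
        have "isCont (\<lambda>t. bm t \<omega>) (ts j)" using bm_continuous[of \<omega>] by (simp add: continuous_on_eq_continuous_at)
        thus ?thesis unfolding m_def by (rule isCont_tendsto_compose) (rule floor_dyadic_tendsto)
      qed
      thus "(\<lambda>n. iexp (X n \<omega>)) \<longlonglongrightarrow> iexp (\<Sum>j\<in>J. u j * (bm (ts (j + 1)) \<omega> - bm (ts j) \<omega>))"
        unfolding X_def by (intro tendsto_intros)
    qed
  qed auto
  \<comment> \<open>\<open>bm\<close> and \<open>bm_series\<close> differ only on the null set of
    arrays that are not good.\<close>
  have "(CLINT \<omega>|M. iexp (X n \<omega>)) = complex_of_real (exp (- (\<Sum>j\<in>J. (u j)\<^sup>2 * of_int (m n (j + 1) - m n j) / 2 ^ n) / 2))" for n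
    unfolding char_bm_dyadic[OF J mono, symmetric]
  proof (rule integral_cong_AE)
    show "AE \<omega> in M. iexp (X n \<omega>) = iexp (\<Sum>j\<in>J. u j * (bm_series (\<lambda>x. Z x \<omega>) (of_int (m n (j + 1)) / 2 ^ n) - bm_series (\<lambda>x. Z x \<omega>) (of_int (m n j) / 2 ^ n)))"
      using AE_bm_good by eventually_elim (simp add: X_def bm_def bm_path_def)
    have [measurable]: "(\<lambda>\<omega>. bm_series (\<lambda>x. Z x \<omega>) t) \<in> borel_measurable M" for t
      unfolding bm_series_def polygon_def schauder_def by measurable
    show "(\<lambda>\<omega>. iexp (\<Sum>j\<in>J. u j * (bm_series (\<lambda>x. Z x \<omega>) (of_int (m n (j + 1)) / 2 ^ n) - bm_series (\<lambda>x. Z x \<omega>) (of_int (m n j) / 2 ^ n)))) \<in> borel_measurable M"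
      by measurable
  qed simp
  moreover have "(\<lambda>n. complex_of_real (exp (- (\<Sum>j\<in>J. (u j)\<^sup>2 * of_int (m n (j + 1) - m n j) / 2 ^ n) / 2))) \<longlonglongrightarrow>
    complex_of_real (exp (- (\<Sum>j\<in>J. (u j)\<^sup>2 * (ts (j + 1) - ts j)) / 2))"
  proof -
    have "(\<lambda>n. (u j)\<^sup>2 * (of_int (m n (j + 1)) / 2 ^ n - of_int (m n j) / 2 ^ n)) \<longlonglongrightarrow> (u j)\<^sup>2 * (ts (j + 1) - ts j)" for j
      unfolding m_def by (intro tendsto_intros floor_dyadic_tendsto)
    moreover have "(u j)\<^sup>2 * of_int (m n (j + 1) - m n j) / 2 ^ n = (u j)\<^sup>2 * (of_int (m n (j + 1)) / 2 ^ n - of_int (m n j) / 2 ^ n)" for j n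
      by (simp add: diff_divide_distrib right_diff_distrib)
    ultimately have "(\<lambda>n. (u j)\<^sup>2 * of_int (m n (j + 1) - m n j) / 2 ^ n) \<longlonglongrightarrow> (u j)\<^sup>2 * (ts (j + 1) - ts j)" for j
      by (simp only:)
    thus ?thesis by (intro tendsto_intros) simp_all
  qed
  ultimately show "(\<lambda>n. CLINT \<omega>|M. iexp (X n \<omega>)) \<longlonglongrightarrow> complex_of_real (exp (- (\<Sum>j\<in>J. (u j)\<^sup>2 * (ts (j + 1) - ts j)) / 2))"
    by simp
qed

end

lemma char_scaled_std_normal:
  "char (distr std_normal_distribution borel (\<lambda>x. s * x)) u = complex_of_real (exp (- (u * s)\<^sup>2 / 2))"
proof -
  have "char (distr std_normal_distribution borel (\<lambda>x. s * x)) u = char std_normal_distribution (u * s)"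
    unfolding char_def by (simp add: integral_distr mult.assoc)
  thus ?thesis by (simp add: char_std_normal_distribution)
qed

lemma distr_scaled_std_normal:
  assumes "0 < s"
  shows "distr std_normal_distribution lborel (\<lambda>x. s * x) = density lborel (normal_density 0 s)"
proof -
  interpret prob_space std_normal_distribution by (rule prob_space_normal_density) simp
  have "distributed std_normal_distribution lborel (\<lambda>x. x) std_normal_density"
    unfolding distributed_def by (auto intro!: distr_id2)
  from normal_density_affine[OF this, of s 0] assms
  show ?thesis by (simp add: distributed_def)
qed

context normal_array
begin

lemma distr_bm_increment:
  assumes "s \<le> t"
  shows "distr M borel (\<lambda>\<omega>. bm t \<omega> - bm s \<omega>) = distr std_normal_distribution borel (\<lambda>x. sqrt (t - s) * x)"
proof (rule Levy_uniqueness)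
  interpret S: prob_space std_normal_distribution by (rule prob_space_normal_density) simp
  show "real_distribution (distr M borel (\<lambda>\<omega>. bm t \<omega> - bm s \<omega>))" by (rule real_distribution_distr) simp
  show "real_distribution (distr std_normal_distribution borel (\<lambda>x. sqrt (t - s) * x))" by (rule S.real_distribution_distr) simp
  show "char (distr M borel (\<lambda>\<omega>. bm t \<omega> - bm s \<omega>)) = char (distr std_normal_distribution borel (\<lambda>x. sqrt (t - s) * x))"
  proof
    fix u
    define ts where "ts j = (if j \<le> 0 then s else t)" for j :: int
    have "mono ts" using assms by (auto simp: ts_def mono_def)
    from char_bm_increments[OF _ this, of "{0}" "\<lambda>_. u"]
    have "(CLINT \<omega>|M. iexp (u * (bm t \<omega> - bm s \<omega>))) = complex_of_real (exp (- (u\<^sup>2 * (t - s)) / 2))"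
      by (simp add: ts_def)
    moreover have "char (distr M borel (\<lambda>\<omega>. bm t \<omega> - bm s \<omega>)) u = (CLINT \<omega>|M. iexp (u * (bm t \<omega> - bm s \<omega>)))"
      unfolding char_def by (subst integral_distr) auto
    ultimately show "char (distr M borel (\<lambda>\<omega>. bm t \<omega> - bm s \<omega>)) u = char (distr std_normal_distribution borel (\<lambda>x. sqrt (t - s) * x)) u"
      using assms by (simp add: char_scaled_std_normal power_mult_distrib)
  qed
qed

theorem two_sided_BM_bm: "two_sided_BM M bm"
  unfolding two_sided_BM_def
proof (intro conjI allI impI ballI)
  fix s t :: real assume st: "s < t"
  have "distr M lborel (\<lambda>\<omega>. bm t \<omega> - bm s \<omega>) = distr M borel (\<lambda>\<omega>. bm t \<omega> - bm s \<omega>)" by (intro distr_cong) auto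
  also have "\<dots> = distr std_normal_distribution lborel (\<lambda>x. sqrt (t - s) * x)"
    using distr_bm_increment[of s t] st by (auto intro!: distr_cong)
  also have "\<dots> = density lborel (normal_density 0 (sqrt (t - s)))" using st by (intro distr_scaled_std_normal) simp
  finally show "distributed M lborel (\<lambda>\<omega>. bm t \<omega> - bm s \<omega>) (normal_density 0 (sqrt (t - s)))"
    by (simp add: distributed_def)
next
  fix m :: nat and ts :: "nat \<Rightarrow> real" assume sm: "strict_mono_on {..m} ts"
  show "indep_vars (\<lambda>_. borel) (\<lambda>i \<omega>. bm (ts (Suc i)) \<omega> - bm (ts i) \<omega>) {..<m}"
  proof (rule indep_vars_if_char_factor)
    fix u :: "nat \<Rightarrow> real"
    \<comment> \<open>The finitely many times are continued by constants to all integers, so that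
      monotonicity holds on the whole index type.\<close>
    define ts' where "ts' j = ts (min m (nat j))" for j :: int
    have mono: "mono ts'"
    proof (rule monoI)
      fix i j :: int assume "i \<le> j"
      hence "min m (nat i) \<le> min m (nat j)" by auto
      thus "ts' i \<le> ts' j" unfolding ts'_def using strict_mono_on_leD[OF sm] by auto
    qed
    have gen: "(CLINT \<omega>|M. iexp (\<Sum>i\<in>I. u i * (bm (ts (Suc i)) \<omega> - bm (ts i) \<omega>))) =
      complex_of_real (exp (- (\<Sum>i\<in>I. (u i)\<^sup>2 * (ts (Suc i) - ts i)) / 2))" if "I \<subseteq> {..<m}" for I
    proof -
      have fin: "finite I" using that finite_subset by blast
      have re: "(\<Sum>j\<in>int ` I. f j) = (\<Sum>i\<in>I. f (int i))" for f :: "int \<Rightarrow> real" by (simp add: sum.reindex)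
      have eq: "ts' (int i + 1) = ts (Suc i)" "ts' (int i) = ts i" if "i \<in> I" for i
      proof -
        have "i < m" using that \<open>I \<subseteq> {..<m}\<close> by auto
        hence "min m (Suc i) = Suc i" "min m i = i" "nat (int i + 1) = Suc i" by auto
        thus "ts' (int i + 1) = ts (Suc i)" "ts' (int i) = ts i" by (simp_all add: ts'_def)
      qed
      show ?thesis using char_bm_increments[OF _ mono, of "int ` I" "\<lambda>j. u (nat j)"] fin unfolding re by (simp add: eq cong: sum.cong)
    qed
    have "(\<Prod>i<m. CLINT \<omega>|M. iexp (u i * (bm (ts (Suc i)) \<omega> - bm (ts i) \<omega>))) = (\<Prod>i<m. complex_of_real (exp (- ((u i)\<^sup>2 * (ts (Suc i) - ts i)) / 2)))"
    proof (intro prod.cong refl)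
      fix i assume "i \<in> {..<m}"
      thus "(CLINT \<omega>|M. iexp (u i * (bm (ts (Suc i)) \<omega> - bm (ts i) \<omega>))) = complex_of_real (exp (- ((u i)\<^sup>2 * (ts (Suc i) - ts i)) / 2))"
        using gen[of "{i}"] by simp
    qed
    also have "\<dots> = complex_of_real (exp (\<Sum>i<m. - ((u i)\<^sup>2 * (ts (Suc i) - ts i)) / 2))" by (simp add: exp_sum)
    also have "(\<Sum>i<m. - ((u i)\<^sup>2 * (ts (Suc i) - ts i)) / 2) = - (\<Sum>i<m. (u i)\<^sup>2 * (ts (Suc i) - ts i)) / 2"
      by (simp add: sum_negf sum_divide_distrib)
    finally show "(CLINT \<omega>|M. iexp (\<Sum>i<m. u i * (bm (ts (Suc i)) \<omega> - bm (ts i) \<omega>))) = (\<Prod>i<m. CLINT \<omega>|M. iexp (u i * (bm (ts (Suc i)) \<omega> - bm (ts i) \<omega>)))"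
      using gen[of "{..<m}"] by simp
  qed auto
qed (auto simp: bm_0 bm_continuous prob_space_axioms)

end

section \<open>Construction of the random walk\<close>

lemma expectation_bind_pmf_complex:
  fixes f :: "'b \<Rightarrow> complex"
  assumes f: "\<And>y. norm (f y) \<le> B"
  shows "measure_pmf.expectation (bind_pmf p g) f = measure_pmf.expectation p (\<lambda>x. measure_pmf.expectation (g x) f)"
proof -
  have real: "measure_pmf.expectation (bind_pmf p g) h = measure_pmf.expectation p (\<lambda>x. measure_pmf.expectation (g x) h)"
    if h: "\<And>y. \<bar>h y\<bar> \<le> B" for h :: "'b \<Rightarrow> real"
    unfolding measure_pmf_bind
  proof (rule integral_bind[where K = "count_space UNIV" and B = B and B' = 1])
    show "AE x in measure_pmf p. emeasure (measure_pmf (g x)) (space (measure_pmf (g x))) \<le> ennreal 1"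
      by (simp add: measure_pmf.emeasure_space_1)
    show "(\<lambda>x. measure_pmf (g x)) \<in> measurable (measure_pmf p) (subprob_algebra (count_space UNIV))"
      using measurable_measure_pmf[of g] by (simp add: measurable_pmf_measure1)
  qed (use h in \<open>auto intro: measure_pmf.finite_measure_axioms\<close>)
  have int: "integrable (measure_pmf q) f" for q :: "'b pmf"
    by (rule measure_pmf.integrable_const_bound[where B=B]) (auto simp: f)
  have intE: "integrable (measure_pmf p) (\<lambda>x. measure_pmf.expectation (g x) f)"
  proof (rule measure_pmf.integrable_const_bound[where B=B])
    have "norm (measure_pmf.expectation q f) \<le> B" for q :: "'b pmf"
    proof -
      have "norm (measure_pmf.expectation q f) \<le> measure_pmf.expectation q (\<lambda>y. norm (f y))" by (rule integral_norm_bound)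
      also have "\<dots> \<le> measure_pmf.expectation q (\<lambda>_. B)" by (intro integral_mono integrable_norm int f) simp
      finally show ?thesis by simp
    qed
    thus "AE x in measure_pmf p. norm (measure_pmf.expectation (g x) f) \<le> B" by simp
  qed simp
  have "\<bar>Re (f y)\<bar> \<le> B" "\<bar>Im (f y)\<bar> \<le> B" for y
    using order_trans[OF abs_Re_le_cmod f] order_trans[OF abs_Im_le_cmod f] by auto
  hence "measure_pmf.expectation (bind_pmf p g) (\<lambda>y. Re (f y)) = measure_pmf.expectation p (\<lambda>x. measure_pmf.expectation (g x) (\<lambda>y. Re (f y)))"
    "measure_pmf.expectation (bind_pmf p g) (\<lambda>y. Im (f y)) = measure_pmf.expectation p (\<lambda>x. measure_pmf.expectation (g x) (\<lambda>y. Im (f y)))"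
    by (auto intro!: real)
  thus ?thesis using integral_Re[OF intE] integral_Im[OF intE] by (intro complex_eqI) (simp_all add: int)
qed

lemma sums_poisson_power:
  fixes z :: complex
  shows "(\<lambda>k. complex_of_real (t ^ k / fact k * exp (- t)) * z ^ k) sums exp (of_real t * (z - 1))"
proof -
  have "(\<lambda>k. complex_of_real (exp (- t)) * ((of_real t * z) ^ k /\<^sub>R fact k)) sums (complex_of_real (exp (- t)) * exp (of_real t * z))"
    by (intro sums_mult exp_converges)
  moreover have "complex_of_real (exp (- t)) * ((of_real t * z) ^ k /\<^sub>R fact k) = complex_of_real (t ^ k / fact k * exp (- t)) * z ^ k" for k
    by (simp add: power_mult_distrib scaleR_conv_of_real divide_inverse mult_ac)
  moreover have "complex_of_real (exp (- t)) * exp (of_real t * z) = exp (of_real t * (z - 1))"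
    by (simp add: exp_of_real[symmetric] exp_add[symmetric] algebra_simps)
  ultimately show ?thesis by simp
qed

lemma expectation_poisson_power:
  fixes z :: complex
  assumes "0 < t" "norm z \<le> 1"
  shows "measure_pmf.expectation (poisson_pmf t) (\<lambda>k. z ^ k) = exp (of_real t * (z - 1))"
proof -
  have dens: "measure_pmf (poisson_pmf t) = density (count_space UNIV) (\<lambda>k. ennreal (t ^ k / fact k * exp (- t)))"
    unfolding measure_pmf_eq_density by (simp add: assms)
  have "integrable (measure_pmf (poisson_pmf t)) (\<lambda>k. z ^ k)"
    by (rule measure_pmf.integrable_const_bound[where B=1]) (auto simp: norm_power power_le_one assms)
  hence int: "integrable (count_space UNIV) (\<lambda>k. (t ^ k / fact k * exp (- t)) *\<^sub>R z ^ k)"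
    unfolding dens using assms by (subst (asm) integrable_density) auto
  have "measure_pmf.expectation (poisson_pmf t) (\<lambda>k. z ^ k) = (LINT k|count_space UNIV. (t ^ k / fact k * exp (- t)) *\<^sub>R z ^ k)"
    unfolding dens using assms by (subst integral_density) auto
  also have "\<dots> = (\<Sum>k. (t ^ k / fact k * exp (- t)) *\<^sub>R z ^ k)" by (rule integral_count_space_nat[OF int])
  also have "\<dots> = exp (of_real t * (z - 1))"
    using sums_unique[OF sums_poisson_power[of t z]] by (simp add: scaleR_conv_of_real)
  finally show ?thesis .
qed

definition kernel_char :: "(int \<Rightarrow> real) \<Rightarrow> real \<Rightarrow> complex" where
  "kernel_char p \<theta> = measure_pmf.expectation (kernel_pmf p) (\<lambda>y. iexp (\<theta> * real_of_int y))"

lemma kernel_char_0: "kernel_char p 0 = 1"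
  by (simp add: kernel_char_def)

lemma norm_kernel_char_le_1: "norm (kernel_char p \<theta>) \<le> 1"
proof -
  have "norm (kernel_char p \<theta>) \<le> measure_pmf.expectation (kernel_pmf p) (\<lambda>y. norm (iexp (\<theta> * real_of_int y)))"
    unfolding kernel_char_def by (rule integral_norm_bound)
  thus ?thesis by (simp del: of_real_mult)
qed

text \<open>Each step multiplies the characteristic function by \<open>kernel_char\<close>, and the
  generating function of the Poisson number of steps sums the powers.\<close>

lemma char_rw_pmf:
  assumes "0 < t"
  shows "measure_pmf.expectation (rw_pmf p t) (\<lambda>y. iexp (\<theta> * real_of_int y)) = exp (of_real t * (kernel_char p \<theta> - 1))"
proof -
  have b: "norm (iexp (\<theta> * real_of_int y)) \<le> 1" for y by (simp del: of_real_mult)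
  have steps: "measure_pmf.expectation (rw_steps p k) (\<lambda>y. iexp (\<theta> * real_of_int y)) = kernel_char p \<theta> ^ k" for k
  proof (induction k)
    case (Suc k)
    have "measure_pmf.expectation (rw_steps p (Suc k)) (\<lambda>y. iexp (\<theta> * real_of_int y)) =
       measure_pmf.expectation (rw_steps p k) (\<lambda>z. measure_pmf.expectation (map_pmf ((+) z) (kernel_pmf p)) (\<lambda>y. iexp (\<theta> * real_of_int y)))"
      unfolding rw_steps.simps by (rule expectation_bind_pmf_complex[OF b])
    also have "\<dots> = measure_pmf.expectation (rw_steps p k) (\<lambda>z. iexp (\<theta> * real_of_int z) * kernel_char p \<theta>)"
    proof (intro Bochner_Integration.integral_cong refl)
      fix z
      have "iexp (\<theta> * real_of_int (z + x)) = iexp (\<theta> * real_of_int z) * iexp (\<theta> * real_of_int x)" for x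
        by (simp add: exp_add[symmetric] algebra_simps)
      thus "measure_pmf.expectation (map_pmf ((+) z) (kernel_pmf p)) (\<lambda>y. iexp (\<theta> * real_of_int y)) = iexp (\<theta> * real_of_int z) * kernel_char p \<theta>"
        unfolding integral_map_pmf kernel_char_def by simp
    qed
    also have "\<dots> = kernel_char p \<theta> ^ Suc k" using Suc by simp
    finally show ?case .
  qed simp
  have "measure_pmf.expectation (rw_pmf p t) (\<lambda>y. iexp (\<theta> * real_of_int y)) = measure_pmf.expectation (poisson_pmf t) (\<lambda>k. kernel_char p \<theta> ^ k)"
    using assms by (simp only: rw_pmf_def if_True expectation_bind_pmf_complex[OF b] steps)
  also have "\<dots> = exp (of_real t * (kernel_char p \<theta> - 1))"
    by (rule expectation_poisson_power[OF assms norm_kernel_char_le_1])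
  finally show ?thesis .
qed

text \<open>A random walk is built from independent coordinates \<open>x (k, c)\<close>: on the unit time interval
  \<open>[k, k + 1)\<close> there are \<open>x (k, 0)\<close> jumps, the \<open>i\<close>-th one at time \<open>k + x (k, 2 i + 1)\<close> and of
  size \<open>x (k, 2 i + 2)\<close>.\<close>

definition rw_law :: "(int \<Rightarrow> real) \<Rightarrow> nat \<times> nat \<Rightarrow> real measure" where
  "rw_law p i = (if snd i = 0 then distr (poisson_pmf 1) borel real
     else if odd (snd i) then uniform_measure lborel {0..<1}
     else distr (kernel_pmf p) borel real_of_int)"

text \<open>\<open>frac\<close> and the floors give a value to every array; under
  \<open>rw_law\<close> they almost surely change nothing. Only jumps strictly before
  \<open>t\<close> count, so the intervals with \<open>k < \<lceil>t\<rceil>\<close> suffice and the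
  value at time 0 is 0 for every array.\<close>

definition rw_path :: "(nat \<times> nat \<Rightarrow> real) \<Rightarrow> real \<Rightarrow> int" where
  "rw_path x t = (\<Sum>k<nat \<lceil>t\<rceil>. \<Sum>i<nat \<lfloor>x (k, 0)\<rfloor>.
     if real k + frac (x (k, Suc (2 * i))) < t then \<lfloor>x (k, Suc (Suc (2 * i)))\<rfloor> else 0)"

lemma rw_law_prob_space: "prob_space (rw_law p i)"
  unfolding rw_law_def
  by (auto intro!: prob_space_uniform_measure measure_pmf.prob_space_distr)

lemma sets_rw_law: "sets (rw_law p i) = sets borel"
  by (simp add: rw_law_def)

lemma rw_path_eq:
  assumes "t \<le> real K"
  shows "rw_path x t = (\<Sum>k<K. \<Sum>i<nat \<lfloor>x (k, 0)\<rfloor>.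
     if real k + frac (x (k, Suc (2 * i))) < t then \<lfloor>x (k, Suc (Suc (2 * i)))\<rfloor> else 0)"
  unfolding rw_path_def
proof (rule sum.mono_neutral_left)
  show "{..<nat \<lceil>t\<rceil>} \<subseteq> {..<K}" using assms by (auto simp: nat_less_iff less_ceiling_iff)
  show "\<forall>k\<in>{..<K} - {..<nat \<lceil>t\<rceil>}. (\<Sum>i<nat \<lfloor>x (k, 0)\<rfloor>. if real k + frac (x (k, Suc (2 * i))) < t then \<lfloor>x (k, Suc (Suc (2 * i)))\<rfloor> else 0) = 0"
  proof
    fix k assume "k \<in> {..<K} - {..<nat \<lceil>t\<rceil>}"
    hence "t \<le> real k" by (simp add: not_less nat_le_iff ceiling_le_iff)
    hence "\<not> real k + frac y < t" for y :: real using frac_ge_0[of y] by linarith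
    thus "(\<Sum>i<nat \<lfloor>x (k, 0)\<rfloor>. if real k + frac (x (k, Suc (2 * i))) < t then \<lfloor>x (k, Suc (Suc (2 * i)))\<rfloor> else 0) = 0" by simp
  qed
qed simp

lemma rw_path_0: "t \<le> 0 \<Longrightarrow> rw_path x t = 0"
  by (simp add: rw_path_def)

lemma borel_measurable_frac: "(f :: 'a \<Rightarrow> real) \<in> borel_measurable N \<Longrightarrow> (\<lambda>x. frac (f x)) \<in> borel_measurable N"
  unfolding frac_def by (rule borel_measurable_diff, assumption, rule measurable_compose[OF _ borel_measurable_real_floor])

lemma borel_measurable_of_int_floor: "(f :: 'a \<Rightarrow> real) \<in> borel_measurable N \<Longrightarrow> (\<lambda>x. real_of_int \<lfloor>f x\<rfloor>) \<in> borel_measurable N"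
  by (rule measurable_compose[OF _ borel_measurable_real_floor])

lemma measurable_random_sum_coords:
  fixes h :: "nat \<Rightarrow> 'a \<Rightarrow> real" and N0 :: "'a \<Rightarrow> real"
  assumes "\<And>i. h i \<in> borel_measurable N" and "N0 \<in> borel_measurable N"
  shows "(\<lambda>x. \<Sum>i<nat \<lfloor>N0 x\<rfloor>. h i x) \<in> borel_measurable N"
proof (rule measurable_compose_countable[where f = "\<lambda>n x. \<Sum>i<nat n. h i x" and g = "\<lambda>x. \<lfloor>N0 x\<rfloor>"])
  show "(\<lambda>x. \<lfloor>N0 x\<rfloor>) \<in> measurable N (count_space UNIV)" by (rule measurable_compose[OF assms(2) measurable_real_floor])
qed (use assms(1) in auto)

lemma rw_path_measurable:
  "(\<lambda>x. rw_path x t) \<in> measurable (Pi\<^sub>M UNIV (\<lambda>_. borel)) (count_space UNIV)"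
proof -
  have c[measurable]: "(\<lambda>x::nat \<times> nat \<Rightarrow> real. x i) \<in> borel_measurable (Pi\<^sub>M UNIV (\<lambda>_. borel))" for i
    by (rule measurable_component_singleton) simp
  have "(\<lambda>x. \<Sum>k<nat \<lceil>t\<rceil>. \<Sum>i<nat \<lfloor>x (k, 0)\<rfloor>.
     if real k + frac (x (k, Suc (2 * i))) < t then real_of_int \<lfloor>x (k, Suc (Suc (2 * i)))\<rfloor> else 0) \<in> borel_measurable (Pi\<^sub>M UNIV (\<lambda>_. borel))"
    by (intro borel_measurable_sum measurable_random_sum_coords measurable_If borel_measurable_less borel_measurable_add
      borel_measurable_const borel_measurable_frac borel_measurable_of_int_floor c)
  also have "(\<lambda>x. \<Sum>k<nat \<lceil>t\<rceil>. \<Sum>i<nat \<lfloor>x (k, 0)\<rfloor>.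
     if real k + frac (x (k, Suc (2 * i))) < t then real_of_int \<lfloor>x (k, Suc (Suc (2 * i)))\<rfloor> else 0) = (\<lambda>x. real_of_int (rw_path x t))"
    unfolding rw_path_def by (intro ext) (simp only: of_int_sum if_distrib[of real_of_int] of_int_0)
  finally have "(\<lambda>x. \<lfloor>real_of_int (rw_path x t)\<rfloor>) \<in> measurable (Pi\<^sub>M UNIV (\<lambda>_. borel)) (count_space UNIV)"
    by (rule measurable_compose[OF _ measurable_real_floor])
  thus ?thesis by simp
qed

lemma sum_ramp: "0 \<le> t \<Longrightarrow> (\<Sum>k<K. ramp (t - real k)) = min t (real K)"
  by (induction K) (auto simp: ramp_def)

section \<open>Joint law of the increments of the constructed walk\<close>

locale rw_coordinates = prob_space M for M :: "'a measure" +
  fixes p :: "int \<Rightarrow> real" and w :: "nat \<times> nat \<Rightarrow> 'a \<Rightarrow> real"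
  assumes kernel: "is_kernel p"
    and w_indep: "indep_vars (\<lambda>_. borel) w UNIV"
    and w_distr: "\<And>i. distr M borel (w i) = rw_law p i"
begin

lemma w_measurable[measurable]: "w i \<in> borel_measurable M"
  using w_indep unfolding indep_vars_def2 by blast

text \<open>The jump time is uniform on \<open>[k, k + 1)\<close>, and the difference of ramps is
  the length of the overlap with \<open>[a, b)\<close>.\<close>

lemma prob_jump_time:
  assumes "a \<le> b"
  shows "prob {\<omega>\<in>space M. a \<le> real k + frac (w (k, Suc (2 * i)) \<omega>) \<and> real k + frac (w (k, Suc (2 * i)) \<omega>) < b}
    = ramp (b - real k) - ramp (a - real k)"
proof -
  let ?S = "{x. a \<le> real k + frac x \<and> real k + frac x < b}"
  have S: "?S \<in> sets borel" unfolding frac_def by measurable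
  have "prob {\<omega>\<in>space M. a \<le> real k + frac (w (k, Suc (2 * i)) \<omega>) \<and> real k + frac (w (k, Suc (2 * i)) \<omega>) < b}
    = measure (distr M borel (w (k, Suc (2 * i)))) ?S"
    using S by (subst measure_distr) (auto intro!: arg_cong[where f=prob])
  also have "\<dots> = measure (uniform_measure lborel {0..<1}) ?S" unfolding w_distr by (simp add: rw_law_def)
  also have "\<dots> = measure lborel ({0..<1} \<inter> ?S)" using S by (subst measure_uniform_measure) auto
  also have "{0..<1} \<inter> ?S = {max 0 (a - real k)..<min 1 (b - real k)}"
    by (auto simp: frac_eq)
  also have "measure lborel \<dots> = ramp (b - real k) - ramp (a - real k)"
    using assms by (auto simp: measure_lborel_Ico ramp_def min_def max_def measure_def)
  finally show ?thesis .
qed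

lemma expectation_jump_size:
  "(CLINT \<omega>|M. iexp (\<theta> * real_of_int \<lfloor>w (k, Suc (Suc (2 * i))) \<omega>\<rfloor>)) = kernel_char p \<theta>"
proof -
  have "(CLINT \<omega>|M. iexp (\<theta> * real_of_int \<lfloor>w (k, Suc (Suc (2 * i))) \<omega>\<rfloor>)) = (CLINT x|distr M borel (w (k, Suc (Suc (2 * i)))). iexp (\<theta> * real_of_int \<lfloor>x\<rfloor>))"
    by (subst integral_distr) auto
  also have "\<dots> = (CLINT x|distr (kernel_pmf p) borel real_of_int. iexp (\<theta> * real_of_int \<lfloor>x\<rfloor>))"
    unfolding w_distr by (simp add: rw_law_def)
  also have "\<dots> = kernel_char p \<theta>" unfolding kernel_char_def by (subst integral_distr) auto
  finally show ?thesis .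
qed

context
  fixes m :: nat and ts u :: "nat \<Rightarrow> real"
  assumes ts0: "0 \<le> ts 0" and ts: "\<And>i j. i \<le> j \<Longrightarrow> j \<le> m \<Longrightarrow> ts i \<le> ts j"
begin

text \<open>The weight that a jump at time \<open>\<tau>\<close> receives in the linear combination
  of increments with coefficients \<open>u\<close>.\<close>

definition step_fun :: "real \<Rightarrow> real" where
  "step_fun \<tau> = (\<Sum>j<m. u j * indicator {ts j..<ts (Suc j)} \<tau>)"

definition block :: "nat \<Rightarrow> (nat \<times> nat \<Rightarrow> real) \<Rightarrow> real" where
  "block k x = (\<Sum>i<nat \<lfloor>x (k, 0)\<rfloor>. step_fun (real k + frac (x (k, Suc (2 * i)))) * real_of_int \<lfloor>x (k, Suc (Suc (2 * i)))\<rfloor>)"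

text \<open>The logarithm of the characteristic function of \<open>block k\<close>: for each
  \<open>j\<close>, the part of the unit interval covered by the \<open>j\<close>-th time interval,
  times \<open>kernel_char - 1\<close>.\<close>

definition exponent :: "nat \<Rightarrow> complex" where
  "exponent k = (\<Sum>j<m. complex_of_real (ramp (ts (Suc j) - real k) - ramp (ts j - real k)) * (kernel_char p (u j) - 1))"

lemma measurable_step_fun[measurable]: "step_fun \<in> borel_measurable borel"
  unfolding step_fun_def by measurable

lemma rw_increments_eq_blocks:
  assumes "ts m \<le> real K"
  shows "(\<Sum>j<m. u j * real_of_int (rw_path x (ts (Suc j)) - rw_path x (ts j))) = (\<Sum>k<K. block k x)"
proof -
  have "u j * real_of_int (rw_path x (ts (Suc j)) - rw_path x (ts j)) =
    (\<Sum>k<K. \<Sum>i<nat \<lfloor>x (k, 0)\<rfloor>. u j * indicator {ts j..<ts (Suc j)} (real k + frac (x (k, Suc (2 * i)))) * real_of_int \<lfloor>x (k, Suc (Suc (2 * i)))\<rfloor>)"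
    if j: "j < m" for j
  proof -
    have le: "ts j \<le> ts (Suc j)" "ts j \<le> real K" "ts (Suc j) \<le> real K"
      using ts[of j "Suc j"] ts[of j m] ts[of "Suc j" m] j assms by auto
    show ?thesis unfolding rw_path_eq[OF le(2)] rw_path_eq[OF le(3)] sum_subtractf[symmetric] of_int_sum sum_distrib_left
      by (intro sum.cong) (use le(1) in \<open>auto simp: indicator_def\<close>)
  qed
  hence "(\<Sum>j<m. u j * real_of_int (rw_path x (ts (Suc j)) - rw_path x (ts j))) =
    (\<Sum>j<m. \<Sum>k<K. \<Sum>i<nat \<lfloor>x (k, 0)\<rfloor>. u j * indicator {ts j..<ts (Suc j)} (real k + frac (x (k, Suc (2 * i)))) * real_of_int \<lfloor>x (k, Suc (Suc (2 * i)))\<rfloor>)"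
    by simp
  also have "\<dots> = (\<Sum>k<K. \<Sum>j<m. \<Sum>i<nat \<lfloor>x (k, 0)\<rfloor>. u j * indicator {ts j..<ts (Suc j)} (real k + frac (x (k, Suc (2 * i)))) * real_of_int \<lfloor>x (k, Suc (Suc (2 * i)))\<rfloor>)"
    by (rule sum.swap)
  also have "\<dots> = (\<Sum>k<K. \<Sum>i<nat \<lfloor>x (k, 0)\<rfloor>. \<Sum>j<m. u j * indicator {ts j..<ts (Suc j)} (real k + frac (x (k, Suc (2 * i)))) * real_of_int \<lfloor>x (k, Suc (Suc (2 * i)))\<rfloor>)"
    by (rule sum.cong[OF refl], rule sum.swap)
  finally show ?thesis unfolding block_def step_fun_def sum_distrib_right .
qed

text \<open>The time intervals are disjoint, so at most one indicator is nonzero. The right side is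
  linear in the indicators, and time and size of a jump separate into factors.\<close>

lemma iexp_step_fun:
  "iexp (step_fun \<tau> * y) = 1 + (\<Sum>j<m. complex_of_real (indicator {ts j..<ts (Suc j)} \<tau>) * (iexp (u j * y) - 1))"
proof (cases "\<exists>j<m. \<tau> \<in> {ts j..<ts (Suc j)}")
  case True
  then obtain j where j: "j < m" "\<tau> \<in> {ts j..<ts (Suc j)}" by blast
  have other: "indicator {ts i..<ts (Suc i)} \<tau> = (0::real)" if "i < m" "i \<noteq> j" for i
    using ts[of "Suc i" j] ts[of "Suc j" i] j that by (cases "i < j") (auto simp: indicator_def)
  have "step_fun \<tau> = (\<Sum>i<m. if i = j then u j else 0)"
    unfolding step_fun_def
  proof (intro sum.cong refl)
    fix i assume "i \<in> {..<m}"
    thus "u i * indicator {ts i..<ts (Suc i)} \<tau> = (if i = j then u j else 0)"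
      using other[of i] j(2) by (cases "i = j") simp_all
  qed
  hence "step_fun \<tau> = u j" using j(1) by simp
  moreover have "(\<Sum>i<m. complex_of_real (indicator {ts i..<ts (Suc i)} \<tau>) * (iexp (u i * y) - 1)) =
     (\<Sum>i\<in>{j}. complex_of_real (indicator {ts i..<ts (Suc i)} \<tau>) * (iexp (u i * y) - 1))"
    using j other by (intro sum.mono_neutral_right) auto
  ultimately show ?thesis using j(2) by simp
next
  case False
  hence "step_fun \<tau> = 0" "(\<Sum>j<m. complex_of_real (indicator {ts j..<ts (Suc j)} \<tau>) * (iexp (u j * y) - 1)) = 0"
    by (auto simp: step_fun_def indicator_def intro!: sum.neutral)
  thus ?thesis by simp
qed

lemma expectation_single_jump:
  "(CLINT \<omega>|M. iexp (step_fun (real k + frac (w (k, Suc (2 * i)) \<omega>)) * real_of_int \<lfloor>w (k, Suc (Suc (2 * i))) \<omega>\<rfloor>)) = 1 + exponent k"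
proof -
  let ?T = "\<lambda>\<omega>. real k + frac (w (k, Suc (2 * i)) \<omega>)"
  let ?Y = "\<lambda>\<omega>. real_of_int \<lfloor>w (k, Suc (Suc (2 * i))) \<omega>\<rfloor>"
  have [measurable]: "?T \<in> borel_measurable M" unfolding frac_def by measurable
  have fac: "integrable M (\<lambda>\<omega>. complex_of_real (indicator {ts j..<ts (Suc j)} (?T \<omega>)) * (iexp (u j * ?Y \<omega>) - 1)) \<and>
    (CLINT \<omega>|M. complex_of_real (indicator {ts j..<ts (Suc j)} (?T \<omega>)) * (iexp (u j * ?Y \<omega>) - 1)) =
     complex_of_real (ramp (ts (Suc j) - real k) - ramp (ts j - real k)) * (kernel_char p (u j) - 1)" if j: "j < m" for j
  proof -
    \<comment> \<open>The parity of the second coordinate tells jump times (odd) from jump sizes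
      (even), so one family of functions describes both factors.\<close>
    define F where "F c x = (if odd (snd c) then complex_of_real (indicator {ts j..<ts (Suc j)} (real k + frac x)) else iexp (u j * real_of_int \<lfloor>x\<rfloor>) - 1)" for c :: "nat \<times> nat" and x :: real
    have Fm: "F c \<in> borel_measurable borel" for c unfolding F_def frac_def by (cases "odd (snd c)") simp_all
    let ?I = "{(k, Suc (2 * i)), (k, Suc (Suc (2 * i)))}"
    have ind: "indep_vars (\<lambda>_. borel) (\<lambda>c \<omega>. F c (w c \<omega>)) ?I"
      by (rule indep_vars_compose2[OF indep_vars_subset[OF w_indep]]) (auto simp: Fm)
    have Fb: "norm (F c x) \<le> 2" for c x
    proof (cases "odd (snd c)")
      case False
      have "norm (iexp (u j * real_of_int \<lfloor>x\<rfloor>) - 1) \<le> norm (iexp (u j * real_of_int \<lfloor>x\<rfloor>)) + norm (1::complex)" by (rule norm_triangle_ineq4)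
      thus ?thesis using False by (simp add: F_def del: of_real_mult)
    qed (simp add: F_def indicator_def)
    have int: "integrable M (\<lambda>\<omega>. F c (w c \<omega>))" for c
      by (intro complex_integrable_bounded[where B=2] measurable_compose[OF w_measurable Fm] Fb)
    have prod2: "(\<Prod>c\<in>?I. F c (w c \<omega>)) = complex_of_real (indicator {ts j..<ts (Suc j)} (?T \<omega>)) * (iexp (u j * ?Y \<omega>) - 1)" for \<omega>
      by (simp add: F_def)
    have E1: "(CLINT \<omega>|M. F (k, Suc (2 * i)) (w (k, Suc (2 * i)) \<omega>)) = complex_of_real (ramp (ts (Suc j) - real k) - ramp (ts j - real k))"
    proof -
      have "(CLINT \<omega>|M. F (k, Suc (2 * i)) (w (k, Suc (2 * i)) \<omega>)) = complex_of_real (LINT \<omega>|M. indicator {\<omega>\<in>space M. ts j \<le> ?T \<omega> \<and> ?T \<omega> < ts (Suc j)} \<omega>)"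
        unfolding integral_complex_of_real[symmetric] by (intro Bochner_Integration.integral_cong) (auto simp: F_def indicator_def)
      also have "(LINT \<omega>|M. indicator {\<omega>\<in>space M. ts j \<le> ?T \<omega> \<and> ?T \<omega> < ts (Suc j)} \<omega>) = prob {\<omega>\<in>space M. ts j \<le> ?T \<omega> \<and> ?T \<omega> < ts (Suc j)}"
        by simp
      also have "\<dots> = ramp (ts (Suc j) - real k) - ramp (ts j - real k)"
        using ts[of j "Suc j"] j by (intro prob_jump_time) auto
      finally show ?thesis .
    qed
    have E2: "(CLINT \<omega>|M. F (k, Suc (Suc (2 * i))) (w (k, Suc (Suc (2 * i))) \<omega>)) = kernel_char p (u j) - 1"
    proof -
      have "integrable M (\<lambda>\<omega>. iexp (u j * ?Y \<omega>))" by (intro complex_integrable_bounded[where B=1]) auto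
      hence "(CLINT \<omega>|M. iexp (u j * ?Y \<omega>) - 1) = kernel_char p (u j) - 1"
        by (subst Bochner_Integration.integral_diff) (simp_all only: expectation_jump_size integrable_const, simp add: prob_space)
      thus ?thesis by (simp add: F_def)
    qed
    show ?thesis
      using indep_vars_integrable[OF _ ind int] indep_vars_lebesgue_integral[OF _ ind int]
      unfolding prod2 by (simp add: E1 E2)
  qed
  have "(CLINT \<omega>|M. iexp (step_fun (?T \<omega>) * ?Y \<omega>)) = 1 + (\<Sum>j<m. CLINT \<omega>|M. complex_of_real (indicator {ts j..<ts (Suc j)} (?T \<omega>)) * (iexp (u j * ?Y \<omega>) - 1))"
    unfolding iexp_step_fun using fac
    by (subst Bochner_Integration.integral_add, simp, intro Bochner_Integration.integrable_sum, simp, subst Bochner_Integration.integral_sum) (simp_all add: prob_space)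
  also have "\<dots> = 1 + exponent k" unfolding exponent_def using fac by simp
  finally show ?thesis .
qed

lemma prob_jump_count: "prob {\<omega>\<in>space M. nat \<lfloor>w (k, 0) \<omega>\<rfloor> = n} = 1 ^ n / fact n * exp (- 1)"
proof -
  have S: "{x::real. nat \<lfloor>x\<rfloor> = n} \<in> sets borel" by measurable
  have "prob {\<omega>\<in>space M. nat \<lfloor>w (k, 0) \<omega>\<rfloor> = n} = measure (distr M borel (w (k, 0))) {x. nat \<lfloor>x\<rfloor> = n}"
    using S by (subst measure_distr) (auto intro!: arg_cong[where f=prob])
  also have "\<dots> = measure (distr (poisson_pmf 1) borel real) {x. nat \<lfloor>x\<rfloor> = n}" unfolding w_distr by (simp add: rw_law_def)
  also have "\<dots> = measure (measure_pmf (poisson_pmf 1)) {n}" using S by (subst measure_distr) (auto intro!: arg_cong[where f="measure (measure_pmf (poisson_pmf 1))"])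
  finally show ?thesis by (simp add: measure_pmf_single)
qed

lemma block_measurable: "(\<And>i. (k, i) \<in> I) \<Longrightarrow> block k \<in> borel_measurable (Pi\<^sub>M I (\<lambda>_. borel))"
proof -
  assume I: "\<And>i. (k, i) \<in> I"
  have c[measurable]: "(\<lambda>x. x (k, i)) \<in> borel_measurable (Pi\<^sub>M I (\<lambda>_. borel :: real measure))" for i
    by (rule measurable_component_singleton) (rule I)
  show "block k \<in> borel_measurable (Pi\<^sub>M I (\<lambda>_. borel))"
    unfolding block_def[abs_def]
    by (intro measurable_random_sum_coords c borel_measurable_times measurable_compose[OF _ measurable_step_fun]
      borel_measurable_add borel_measurable_const borel_measurable_frac borel_measurable_of_int_floor)
qed

text \<open>Splitting by the number \<open>n\<close> of jumps leaves a product of \<open>n\<close>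
  identically distributed independent factors with mean \<open>1 + exponent k\<close>; the Poisson
  weights sum the powers to an exponential.\<close>

lemma char_block: "(CLINT \<omega>|M. iexp (block k (\<lambda>i. w i \<omega>))) = exp (exponent k)"
proof -
  define g where "g i \<omega> = iexp (step_fun (real k + frac (w (k, Suc (2 * i)) \<omega>)) * real_of_int \<lfloor>w (k, Suc (Suc (2 * i))) \<omega>\<rfloor>)" for i \<omega>
  have gm[measurable]: "g i \<in> borel_measurable M" for i unfolding g_def frac_def by measurable
  have gb: "norm (g i \<omega>) = 1" for i \<omega> by (simp add: g_def del: of_real_mult)
  define E where "E n = {\<omega>\<in>space M. nat \<lfloor>w (k, 0) \<omega>\<rfloor> = n}" for n
  have [measurable]: "E n \<in> sets M" for n unfolding E_def by measurable
  define f where "f n \<omega> = complex_of_real (indicator (E n) \<omega>) * (\<Prod>i<n. g i \<omega>)" for n \<omega>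
  have fm: "f n \<in> borel_measurable M" for n unfolding f_def by measurable
  have fn: "norm (f n \<omega>) = indicator (E n) \<omega>" for n \<omega> by (simp add: f_def norm_mult prod_norm[symmetric] gb indicator_def)
  have fi: "integrable M (f n)" for n
    by (rule complex_integrable_bounded[OF fm, where B=1]) (simp add: fn indicator_def)
  have fE: "(CLINT \<omega>|M. f n \<omega>) = complex_of_real (1 ^ n / fact n * exp (- 1)) * (1 + exponent k) ^ n" for n
  proof -
    \<comment> \<open>Coordinates are grouped by role: group 0 is the number of jumps, group
      \<open>i + 1\<close> holds time and size of jump \<open>i\<close>. Disjoint groups are
      independent.\<close>
    define Kx where "Kx j = (case j of 0 \<Rightarrow> {(k, 0::nat)} | Suc i \<Rightarrow> {(k, Suc (2 * i)), (k, Suc (Suc (2 * i)))})" for j :: nat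
    define V where "V j x = (case j of 0 \<Rightarrow> complex_of_real (indicator {n} (nat \<lfloor>x (k, 0)\<rfloor>))
       | Suc i \<Rightarrow> iexp (step_fun (real k + frac (x (k, Suc (2 * i)))) * real_of_int \<lfloor>x (k, Suc (Suc (2 * i)))\<rfloor>))" for j :: nat and x :: "nat \<times> nat \<Rightarrow> real"
    have dis: "disjoint_family_on Kx {..<Suc n}"
      unfolding disjoint_family_on_def Kx_def by (auto split: nat.splits)
    have Vm: "V j \<in> borel_measurable (Pi\<^sub>M (Kx j) (\<lambda>_. borel))" for j
    proof (cases j)
      case 0
      have [measurable]: "(\<lambda>x. x (k, 0)) \<in> borel_measurable (Pi\<^sub>M (Kx 0) (\<lambda>_. borel :: real measure))"
        by (rule measurable_component_singleton) (simp add: Kx_def)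
      have "V 0 \<in> borel_measurable (Pi\<^sub>M (Kx 0) (\<lambda>_. borel))" unfolding V_def[abs_def] nat.case by measurable
      thus ?thesis using 0 by simp
    next
      case (Suc i)
      have c: "(\<lambda>x. x (k, Suc (2 * i))) \<in> borel_measurable (Pi\<^sub>M (Kx (Suc i)) (\<lambda>_. borel :: real measure))"
        "(\<lambda>x. x (k, Suc (Suc (2 * i)))) \<in> borel_measurable (Pi\<^sub>M (Kx (Suc i)) (\<lambda>_. borel :: real measure))"
        by (rule measurable_component_singleton; simp add: Kx_def)+
      note [measurable] = borel_measurable_frac[OF c(1)] borel_measurable_of_int_floor[OF c(2)]
      have "V (Suc i) \<in> borel_measurable (Pi\<^sub>M (Kx (Suc i)) (\<lambda>_. borel))" unfolding V_def[abs_def] nat.case by measurable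
      thus ?thesis using Suc by simp
    qed
    have ind: "indep_vars (\<lambda>_. borel) (\<lambda>j \<omega>. V j (restrict (\<lambda>i. w i \<omega>) (Kx j))) {..<Suc n}"
      by (rule indep_vars_compose2[OF indep_vars_restrict[OF w_indep _ dis] Vm]) simp
    have V0: "V 0 (restrict (\<lambda>i. w i \<omega>) (Kx 0)) = complex_of_real (indicator (E n) \<omega>)" if "\<omega> \<in> space M" for \<omega>
      using that by (simp add: V_def Kx_def E_def indicator_def)
    have VS: "V (Suc i) (restrict (\<lambda>i. w i \<omega>) (Kx (Suc i))) = g i \<omega>" for i \<omega>
      by (simp add: V_def Kx_def g_def)
    have Vb: "norm (V j x) \<le> 1" for j x by (cases j) (simp_all add: V_def indicator_def del: of_real_mult)
    have Vi: "integrable M (\<lambda>\<omega>. V j (restrict (\<lambda>i. w i \<omega>) (Kx j)))" if "j \<in> {..<Suc n}" for j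
      using ind that Vb by (intro complex_integrable_bounded[where B=1]) (auto simp: indep_vars_def2)
    have "(CLINT \<omega>|M. f n \<omega>) = (CLINT \<omega>|M. (\<Prod>j<Suc n. V j (restrict (\<lambda>i. w i \<omega>) (Kx j))))"
      by (intro Bochner_Integration.integral_cong refl) (simp only: prod.lessThan_Suc_shift V0 VS f_def)
    also have "\<dots> = (\<Prod>j<Suc n. CLINT \<omega>|M. V j (restrict (\<lambda>i. w i \<omega>) (Kx j)))"
      by (rule indep_vars_lebesgue_integral[OF _ ind Vi]) auto
    also have "\<dots> = (CLINT \<omega>|M. V 0 (restrict (\<lambda>i. w i \<omega>) (Kx 0))) * (\<Prod>i<n. CLINT \<omega>|M. g i \<omega>)"
      by (simp only: prod.lessThan_Suc_shift VS)
    also have "(CLINT \<omega>|M. V 0 (restrict (\<lambda>i. w i \<omega>) (Kx 0))) = (CLINT \<omega>|M. complex_of_real (indicator (E n) \<omega>))"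
      by (intro Bochner_Integration.integral_cong refl V0)
    also have "\<dots> = complex_of_real (1 ^ n / fact n * exp (- 1))"
      unfolding integral_complex_of_real prob_jump_count[of k n, folded E_def, symmetric] by simp
    also have "(\<Prod>i<n. CLINT \<omega>|M. g i \<omega>) = (1 + exponent k) ^ n"
      unfolding g_def expectation_single_jump by simp
    finally show ?thesis .
  qed
  have sum1: "(\<lambda>n. f n \<omega>) sums iexp (block k (\<lambda>i. w i \<omega>))" if w: "\<omega> \<in> space M" for \<omega>
  proof -
    define N where "N = nat \<lfloor>w (k, 0) \<omega>\<rfloor>"
    have "(\<lambda>n. f n \<omega>) sums (\<Sum>n\<in>{N}. f n \<omega>)"
      by (rule sums_finite) (use w in \<open>auto simp: f_def E_def N_def\<close>)
    moreover have "f N \<omega> = iexp (block k (\<lambda>i. w i \<omega>))"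
    proof -
      have "iexp (\<Sum>i<N. h i) = (\<Prod>i<N. iexp (h i))" for h :: "nat \<Rightarrow> real"
        by (simp add: exp_sum[symmetric] sum_distrib_left)
      thus ?thesis using w by (simp only: f_def block_def N_def[symmetric] g_def) (simp add: E_def N_def)
    qed
    ultimately show ?thesis by simp
  qed
  have "(CLINT \<omega>|M. iexp (block k (\<lambda>i. w i \<omega>))) = (CLINT \<omega>|M. (\<Sum>n. f n \<omega>))"
    by (intro Bochner_Integration.integral_cong refl sums_unique sum1)
  also have "\<dots> = (\<Sum>n. CLINT \<omega>|M. f n \<omega>)"
  proof (rule integral_suminf[OF fi])
    show "AE \<omega> in M. summable (\<lambda>n. norm (f n \<omega>))"
    proof (intro AE_I2)
      fix \<omega>
      show "summable (\<lambda>n. norm (f n \<omega>))" unfolding fn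
        by (rule summable_finite[of "{nat \<lfloor>w (k, 0) \<omega>\<rfloor>}"]) (auto simp: E_def)
    qed
    have "(LINT \<omega>|M. norm (f n \<omega>)) = 1 ^ n / fact n * exp (- 1)" for n
      unfolding fn prob_jump_count[of k n, folded E_def, symmetric] by simp
    thus "summable (\<lambda>n. LINT \<omega>|M. norm (f n \<omega>))" using sums_poisson_moments(1)[of 1] by (simp add: sums_iff)
  qed
  also have "\<dots> = exp (exponent k)"
    unfolding fE using sums_unique[OF sums_poisson_power[of 1 "1 + exponent k"]] by simp
  finally show ?thesis .
qed

text \<open>Blocks use disjoint coordinates, so their exponents add up. The overlaps of one time
  interval with the unit intervals below \<open>K\<close> add up to its length.\<close>

lemma char_rw_increments_aux:
  "(CLINT \<omega>|M. iexp (\<Sum>j<m. u j * real_of_int (rw_path (\<lambda>i. w i \<omega>) (ts (Suc j)) - rw_path (\<lambda>i. w i \<omega>) (ts j))))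
   = exp (\<Sum>j<m. of_real (ts (Suc j) - ts j) * (kernel_char p (u j) - 1))"
proof -
  obtain K :: nat where K: "ts m \<le> real K" using real_arch_simple by blast
  have dis: "disjoint_family_on (\<lambda>k::nat. {k} \<times> (UNIV :: nat set)) {..<K}" by (auto simp: disjoint_family_on_def)
  have ind: "indep_vars (\<lambda>_. borel) (\<lambda>k \<omega>. block k (restrict (\<lambda>i. w i \<omega>) ({k} \<times> UNIV))) {..<K}"
    by (rule indep_vars_compose2[OF indep_vars_restrict[OF w_indep _ dis] block_measurable]) auto
  have res: "block k (restrict (\<lambda>i. w i \<omega>) ({k} \<times> UNIV)) = block k (\<lambda>i. w i \<omega>)" for k \<omega>
    by (simp add: block_def)
  have bm[measurable]: "(\<lambda>\<omega>. block k (\<lambda>i. w i \<omega>)) \<in> borel_measurable M" for k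
    by (rule measurable_compose[OF _ block_measurable[of k UNIV]]) (auto intro!: measurable_PiM_single' simp: space_PiM)
  have "(CLINT \<omega>|M. iexp (\<Sum>j<m. u j * real_of_int (rw_path (\<lambda>i. w i \<omega>) (ts (Suc j)) - rw_path (\<lambda>i. w i \<omega>) (ts j))))
     = (CLINT \<omega>|M. iexp (\<Sum>k<K. block k (\<lambda>i. w i \<omega>)))"
    by (simp only: rw_increments_eq_blocks[OF K])
  also have "\<dots> = char (distr M borel (\<lambda>\<omega>. \<Sum>k<K. block k (\<lambda>i. w i \<omega>))) 1"
    unfolding char_def by (simp add: integral_distr)
  also have "\<dots> = (\<Prod>k<K. char (distr M borel (\<lambda>\<omega>. block k (\<lambda>i. w i \<omega>))) 1)"
    using char_distr_sum[OF ind] unfolding res by simp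
  also have "\<dots> = (\<Prod>k<K. exp (exponent k))"
    unfolding char_def by (intro prod.cong refl) (simp add: integral_distr char_block[symmetric])
  also have "\<dots> = exp (\<Sum>k<K. exponent k)" by (simp add: exp_sum)
  also have "(\<Sum>k<K. exponent k) = (\<Sum>j<m. (\<Sum>k<K. complex_of_real (ramp (ts (Suc j) - real k) - ramp (ts j - real k))) * (kernel_char p (u j) - 1))"
    unfolding exponent_def sum_distrib_right by (rule sum.swap)
  also have "\<dots> = (\<Sum>j<m. of_real (ts (Suc j) - ts j) * (kernel_char p (u j) - 1))"
  proof (intro sum.cong refl)
    fix j assume "j \<in> {..<m}"
    hence b: "0 \<le> ts j" "0 \<le> ts (Suc j)" "ts j \<le> real K" "ts (Suc j) \<le> real K"
      using ts[of 0 j] ts[of 0 "Suc j"] ts[of j m] ts[of "Suc j" m] ts0 K by auto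
    have "(\<Sum>k<K. complex_of_real (ramp (ts (Suc j) - real k) - ramp (ts j - real k))) = complex_of_real ((\<Sum>k<K. ramp (ts (Suc j) - real k)) - (\<Sum>k<K. ramp (ts j - real k)))"
      by (simp add: sum_subtractf)
    also have "\<dots> = of_real (ts (Suc j) - ts j)" using b by (simp add: sum_ramp min_def)
    finally show "(\<Sum>k<K. complex_of_real (ramp (ts (Suc j) - real k) - ramp (ts j - real k))) * (kernel_char p (u j) - 1) = of_real (ts (Suc j) - ts j) * (kernel_char p (u j) - 1)"
      by (simp only:)
  qed
  finally show ?thesis .
qed

end

text \<open>The joint characteristic function determines everything: it factorizes, which gives
  independent increments, and each factor is that of the compound Poisson law
  \<open>rw_pmf\<close>.\<close>

theorem is_rw_rw_path: "is_rw p M (\<lambda>t \<omega>. rw_path (\<lambda>i. w i \<omega>) t)"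
  unfolding is_rw_def
proof (intro conjI allI impI ballI)
  have wv: "(\<lambda>\<omega> i. w i \<omega>) \<in> measurable M (Pi\<^sub>M UNIV (\<lambda>_. borel))"
    by (rule measurable_PiM_single') (auto simp: space_PiM)
  have Ym: "(\<lambda>\<omega>. rw_path (\<lambda>i. w i \<omega>) t) \<in> measurable M (count_space UNIV)" for t
    by (rule measurable_compose[OF wv rw_path_measurable])
  thus "(\<lambda>\<omega>. rw_path (\<lambda>i. w i \<omega>) t) \<in> measurable M (count_space UNIV)" for t .
  show "rw_path (\<lambda>i. w i \<omega>) 0 = 0" for \<omega> by (simp add: rw_path_0)
  fix m :: nat and ts :: "nat \<Rightarrow> real" and ys :: "nat \<Rightarrow> int"
  assume "0 \<le> ts 0 \<and> strict_mono_on {..m} ts"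
  hence ts0: "0 \<le> ts 0" and sm: "strict_mono_on {..m} ts" by auto
  have tsm: "ts i \<le> ts j" if "i \<le> j" "j \<le> m" for i j
    using strict_mono_on_leD[OF sm, of i j] that by auto
  define X where "X j \<omega> = real_of_int (rw_path (\<lambda>i. w i \<omega>) (ts (Suc j)) - rw_path (\<lambda>i. w i \<omega>) (ts j))" for j \<omega>
  have Xm[measurable]: "X j \<in> borel_measurable M" for j
    unfolding X_def by (rule measurable_compose[OF measurable_diff_count_space[OF Ym Ym]]) simp
  have all: "(CLINT \<omega>|M. iexp (\<Sum>j<m. u j * X j \<omega>)) = exp (\<Sum>j<m. of_real (ts (Suc j) - ts j) * (kernel_char p (u j) - 1))" for u
    unfolding X_def by (rule char_rw_increments_aux[where m = m and ts = ts, OF ts0 tsm])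
  \<comment> \<open>All coefficients but one are set to 0; the others drop out because
    \<open>kernel_char\<close> is 1 at 0.\<close>
  have one: "(CLINT \<omega>|M. iexp (v * X j \<omega>)) = exp (of_real (ts (Suc j) - ts j) * (kernel_char p v - 1))" if j: "j < m" for j v
  proof -
    have "(\<Sum>i<m. (if i = j then v else 0) * X i \<omega>) = v * X j \<omega>" for \<omega>
      using j by (simp add: if_distrib[of "\<lambda>x. x * _"] sum.If_cases cong: if_cong)
    moreover have "(\<Sum>i<m. of_real (ts (Suc i) - ts i) * (kernel_char p (if i = j then v else 0) - 1)) = of_real (ts (Suc j) - ts j) * (kernel_char p v - 1)"
    proof -
      have "(\<Sum>i<m. of_real (ts (Suc i) - ts i) * (kernel_char p (if i = j then v else 0) - 1)) = (\<Sum>i\<in>{j}. of_real (ts (Suc i) - ts i) * (kernel_char p (if i = j then v else 0) - 1))"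
        using j by (intro sum.mono_neutral_right) (auto simp: kernel_char_0)
      thus ?thesis by simp
    qed
    ultimately show ?thesis using all[of "\<lambda>i. if i = j then v else 0"] by (simp only:)
  qed
  have ind: "indep_vars (\<lambda>_. borel) X {..<m}"
  proof (rule indep_vars_if_char_factor)
    fix u :: "nat \<Rightarrow> real"
    have "(\<Prod>j<m. CLINT \<omega>|M. iexp (u j * X j \<omega>)) = (\<Prod>j<m. exp (of_real (ts (Suc j) - ts j) * (kernel_char p (u j) - 1)))"
      by (intro prod.cong refl one) simp
    thus "(CLINT \<omega>|M. iexp (\<Sum>j<m. u j * X j \<omega>)) = (\<Prod>j<m. CLINT \<omega>|M. iexp (u j * X j \<omega>))"
      unfolding all by (simp add: exp_sum)
  qed auto
  have law: "prob {\<omega>\<in>space M. X j \<omega> = real_of_int y} = trans_prob p (ts (Suc j) - ts j) 0 y" if j: "j < m" for j y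
  proof -
    define T where "T = ts (Suc j) - ts j"
    have T: "0 < T" using strict_mono_onD[OF sm, of j "Suc j"] j by (simp add: T_def)
    have "distr M borel (X j) = distr (rw_pmf p T) borel real_of_int"
    proof (rule Levy_uniqueness)
      show "real_distribution (distr M borel (X j))" by (rule real_distribution_distr) simp
      show "real_distribution (distr (rw_pmf p T) borel real_of_int)" by (rule prob_space.real_distribution_distr[OF measure_pmf.prob_space_axioms]) simp
      show "char (distr M borel (X j)) = char (distr (rw_pmf p T) borel real_of_int)"
      proof
        fix v
        have "char (distr M borel (X j)) v = (CLINT \<omega>|M. iexp (v * X j \<omega>))" unfolding char_def by (simp add: integral_distr)
        also have "\<dots> = measure_pmf.expectation (rw_pmf p T) (\<lambda>y. iexp (v * real_of_int y))"
          unfolding one[OF j] char_rw_pmf[OF T] by (simp add: T_def)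
        also have "\<dots> = char (distr (rw_pmf p T) borel real_of_int) v" unfolding char_def by (simp add: integral_distr)
        finally show "char (distr M borel (X j)) v = char (distr (rw_pmf p T) borel real_of_int) v" .
      qed
    qed
    hence "measure (distr M borel (X j)) {real_of_int y} = measure (distr (rw_pmf p T) borel real_of_int) {real_of_int y}" by simp
    hence "prob (X j -` {real_of_int y} \<inter> space M) = measure (measure_pmf (rw_pmf p T)) (real_of_int -` {real_of_int y})"
      by (simp add: measure_distr)
    moreover have "real_of_int -` {real_of_int y} = {y}" by auto
    moreover have "X j -` {real_of_int y} \<inter> space M = {\<omega>\<in>space M. X j \<omega> = real_of_int y}" by auto
    ultimately show ?thesis using pmf_rw_pmf[OF kernel T, of y] by (simp add: measure_pmf_single T_def)
  qed
  have "{\<omega>\<in>space M. \<forall>i<m. rw_path (\<lambda>i. w i \<omega>) (ts (Suc i)) - rw_path (\<lambda>i. w i \<omega>) (ts i) = ys i} = {\<omega>\<in>space M. \<forall>i<m. X i \<omega> = real_of_int (ys i)}"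
    unfolding X_def of_int_eq_iff ..
  also have "prob \<dots> = (\<Prod>i<m. prob {\<omega>\<in>space M. X i \<omega> = real_of_int (ys i)})"
  proof (cases "m = 0")
    case False
    have "{\<omega>\<in>space M. \<forall>i<m. X i \<omega> = real_of_int (ys i)} = (\<Inter>i\<in>{..<m}. X i -` {real_of_int (ys i)} \<inter> space M)"
      using False by auto
    also have "prob \<dots> = (\<Prod>i<m. prob (X i -` {real_of_int (ys i)} \<inter> space M))"
      using False by (intro indep_varsD_finite[OF ind]) auto
    also have "\<dots> = (\<Prod>i<m. prob {\<omega>\<in>space M. X i \<omega> = real_of_int (ys i)})"
      by (intro prod.cong refl arg_cong[where f=prob]) auto
    finally show ?thesis .
  qed (simp add: prob_space)
  also have "\<dots> = (\<Prod>i<m. trans_prob p (ts (Suc i) - ts i) 0 (ys i))" by (intro prod.cong refl law) simp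
  finally show "prob {\<omega>\<in>space M. \<forall>i<m. rw_path (\<lambda>i. w i \<omega>) (ts (Suc i)) - rw_path (\<lambda>i. w i \<omega>) (ts i) = ys i}
     = (\<Prod>i<m. trans_prob p (ts (Suc i) - ts i) 0 (ys i))" .
qed

end

section \<open>Central limit theorem and quantile coupling\<close>

lemma exp_minus_first_order_bound:
  fixes a :: real
  assumes "0 \<le> a"
  shows "\<bar>exp (- a) - (1 - a)\<bar> \<le> a\<^sup>2 / 2"
proof -
  have lower: "1 - a \<le> exp (- a)" using exp_ge_add_one_self[of "- a"] by simp
  have "exp (- a) \<le> 1 - a + a\<^sup>2 / 2"
  proof -
    let ?f = "\<lambda>x::real. 1 - x + x\<^sup>2 / 2 - exp (- x)"
    have "?f 0 \<le> ?f a"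
    proof (rule DERIV_nonneg_imp_nondecreasing[OF assms])
      fix x :: real
      have "(?f has_real_derivative (- 1 + x + exp (- x))) (at x)"
        by (auto intro!: derivative_eq_intros)
      moreover have "0 \<le> - 1 + x + exp (- x)" using exp_ge_add_one_self[of "- x"] by simp
      ultimately show "\<exists>y. (?f has_real_derivative y) (at x) \<and> 0 \<le> y" by blast
    qed
    thus ?thesis by simp
  qed
  with lower show ?thesis by simp
qed

text \<open>Both characteristic functions are compared with the second-order polynomial
  \<open>1 - u^2 \<sigma> / 2\<close>. The variance is at most \<open>1 + B\<close> because
  \<open>x^2 \<le> 1 + |x|^3\<close>.\<close>

lemma (in prob_space) char_third_moment_bound:
  assumes [measurable]: "X \<in> borel_measurable M"
    and i3: "integrable M (\<lambda>\<omega>. \<bar>X \<omega>\<bar> ^ 3)" and B: "expectation (\<lambda>\<omega>. \<bar>X \<omega>\<bar> ^ 3) \<le> B"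
    and mean: "expectation X = 0"
  shows "cmod (char (distr M borel X) u - of_real (exp (- (u\<^sup>2 * expectation (\<lambda>\<omega>. (X \<omega>)\<^sup>2) / 2))))
     \<le> \<bar>u\<bar> ^ 3 * B / 6 + u ^ 4 * (1 + B)\<^sup>2 / 8"
proof -
  have b1: "\<bar>x\<bar> \<le> 1 + \<bar>x\<bar> ^ 3" and b2: "x\<^sup>2 \<le> 1 + \<bar>x\<bar> ^ 3" for x :: real
  proof -
    show "\<bar>x\<bar> \<le> 1 + \<bar>x\<bar> ^ 3"
      using power_increasing[of 1 3 "\<bar>x\<bar>"] by (cases "\<bar>x\<bar> \<le> 1") (auto intro: add_increasing2)
    show "x\<^sup>2 \<le> 1 + \<bar>x\<bar> ^ 3"
      using power_increasing[of 2 3 "\<bar>x\<bar>"] power_le_one[of "\<bar>x\<bar>" 2]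
      by (cases "\<bar>x\<bar> \<le> 1") (auto intro: add_increasing2)
  qed
  have i: "integrable M (\<lambda>\<omega>. 1 + \<bar>X \<omega>\<bar> ^ 3)" using i3 by simp
  have i1: "integrable M X" by (rule Bochner_Integration.integrable_bound[OF i]) (use b1 in \<open>auto intro: order_trans\<close>)
  have i2: "integrable M (\<lambda>\<omega>. (X \<omega>)\<^sup>2)"
    by (rule Bochner_Integration.integrable_bound[OF i]) (use b2 in \<open>auto intro: order_trans\<close>)
  define \<sigma> where "\<sigma> = expectation (\<lambda>\<omega>. (X \<omega>)\<^sup>2)"
  have "0 \<le> \<sigma>" unfolding \<sigma>_def by simp
  have "\<sigma> \<le> expectation (\<lambda>\<omega>. 1 + \<bar>X \<omega>\<bar> ^ 3)" unfolding \<sigma>_def by (intro integral_mono i2 i b2)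
  also have "\<dots> \<le> 1 + B" using i3 B by (simp add: prob_space)
  finally have \<sigma>: "\<sigma> \<le> 1 + B" .
  have "cmod (char (distr M borel X) u - complex_of_real (1 - u\<^sup>2 * \<sigma> / 2))
      \<le> (u\<^sup>2 / 6) * expectation (\<lambda>\<omega>. min (6 * (X \<omega>)\<^sup>2) (\<bar>u\<bar> * \<bar>X \<omega>\<bar> ^ 3))"
    by (rule char_approx3') (auto simp: i1 i2 mean \<sigma>_def)
  also have "\<dots> \<le> (u\<^sup>2 / 6) * expectation (\<lambda>\<omega>. \<bar>u\<bar> * \<bar>X \<omega>\<bar> ^ 3)"
  proof (intro mult_left_mono integral_mono)
    show "integrable M (\<lambda>\<omega>. min (6 * (X \<omega>)\<^sup>2) (\<bar>u\<bar> * \<bar>X \<omega>\<bar> ^ 3))"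
      using i2 i3 by (intro integrable_min) auto
  qed (use i3 in auto)
  also have "\<dots> \<le> (u\<^sup>2 / 6) * (\<bar>u\<bar> * B)" using B by (intro mult_left_mono) (auto intro!: mult_left_mono)
  also have "\<dots> = \<bar>u\<bar> ^ 3 * B / 6" by (simp add: power3_eq_cube power2_eq_square)
  finally have A: "cmod (char (distr M borel X) u - complex_of_real (1 - u\<^sup>2 * \<sigma> / 2)) \<le> \<bar>u\<bar> ^ 3 * B / 6" .
  have "cmod (of_real (exp (- (u\<^sup>2 * \<sigma> / 2))) - complex_of_real (1 - u\<^sup>2 * \<sigma> / 2)) = \<bar>exp (- (u\<^sup>2 * \<sigma> / 2)) - (1 - u\<^sup>2 * \<sigma> / 2)\<bar>"
    by (simp only: of_real_diff[symmetric] norm_of_real)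
  also have "\<dots> \<le> (u\<^sup>2 * \<sigma> / 2)\<^sup>2 / 2" using \<open>0 \<le> \<sigma>\<close> by (intro exp_minus_first_order_bound) auto
  also have "\<dots> = u ^ 4 * \<sigma>\<^sup>2 / 8" by (simp add: power2_eq_square power4_eq_xxxx)
  also have "\<dots> \<le> u ^ 4 * (1 + B)\<^sup>2 / 8" using \<sigma> \<open>0 \<le> \<sigma>\<close> by (intro divide_right_mono mult_left_mono power_mono) auto
  finally have D: "cmod (of_real (exp (- (u\<^sup>2 * \<sigma> / 2))) - complex_of_real (1 - u\<^sup>2 * \<sigma> / 2)) \<le> u ^ 4 * (1 + B)\<^sup>2 / 8" .
  show ?thesis
    using norm_triangle_ineq4[of "char (distr M borel X) u - complex_of_real (1 - u\<^sup>2 * \<sigma> / 2)"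
        "of_real (exp (- (u\<^sup>2 * \<sigma> / 2))) - complex_of_real (1 - u\<^sup>2 * \<sigma> / 2)"] A D
    unfolding \<sigma>_def by (simp add: algebra_simps)
qed

lemma norm_char_le_1:
  assumes "real_distribution \<mu>" shows "cmod (char \<mu> u) \<le> 1"
  using real_distribution.cmod_char_le_1[OF assms] .

text \<open>Lyapunov's theorem with each summand replaced by a normal variable of the same variance.
  All factors have modulus at most 1, so products differ by at most the sum of the differences:
  \<open>O (n)\<close> terms of order \<open>n^(-3/2)\<close>. The limit variance \<open>v\<close>
  may be 0.\<close>

lemma (in prob_space) triangular_array_char_tendsto:
  fixes X :: "nat \<Rightarrow> 'i \<Rightarrow> 'a \<Rightarrow> real"
  assumes fin: "\<And>n. 1 \<le> n \<Longrightarrow> finite (I n)"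
    and indep: "\<And>n. 1 \<le> n \<Longrightarrow> indep_vars (\<lambda>_. borel) (X n) (I n)"
    and i3: "\<And>n z. 1 \<le> n \<Longrightarrow> z \<in> I n \<Longrightarrow> integrable M (\<lambda>\<omega>. \<bar>X n z \<omega>\<bar> ^ 3)"
    and B: "\<And>n z. 1 \<le> n \<Longrightarrow> z \<in> I n \<Longrightarrow> expectation (\<lambda>\<omega>. \<bar>X n z \<omega>\<bar> ^ 3) \<le> B"
    and mean: "\<And>n z. 1 \<le> n \<Longrightarrow> z \<in> I n \<Longrightarrow> expectation (X n z) = 0"
    and card: "\<And>n. 1 \<le> n \<Longrightarrow> real (card (I n)) \<le> C * real n" and "0 \<le> B"
    and var: "(\<lambda>n. (\<Sum>z\<in>I n. expectation (\<lambda>\<omega>. (X n z \<omega>)\<^sup>2)) / real n) \<longlonglongrightarrow> v"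
  shows "(\<lambda>n. char (distr M borel (\<lambda>\<omega>. (\<Sum>z\<in>I n. X n z \<omega>) / sqrt (real n))) t) \<longlonglongrightarrow> of_real (exp (- (t\<^sup>2 * v / 2)))"
proof -
  define F where "F n = char (distr M borel (\<lambda>\<omega>. (\<Sum>z\<in>I n. X n z \<omega>) / sqrt (real n))) t" for n
  define G where "G n = exp (- (t\<^sup>2 * ((\<Sum>z\<in>I n. expectation (\<lambda>\<omega>. (X n z \<omega>)\<^sup>2)) / real n) / 2))" for n
  define e where "e n = C * \<bar>t\<bar> ^ 3 * B / 6 * (1 / sqrt (real n)) + C * t ^ 4 * (1 + B)\<^sup>2 / 8 * (1 / real n)" for n
  have "e \<longlonglongrightarrow> C * \<bar>t\<bar> ^ 3 * B / 6 * 0 + C * t ^ 4 * (1 + B)\<^sup>2 / 8 * 0"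
  proof -
    have "(\<lambda>n. 1 / sqrt (real n)) \<longlonglongrightarrow> 0" by real_asymp
    moreover have "(\<lambda>n. 1 / real n) \<longlonglongrightarrow> 0" by real_asymp
    ultimately show ?thesis unfolding e_def by (intro tendsto_add tendsto_mult tendsto_const)
  qed
  hence e: "e \<longlonglongrightarrow> 0" by simp
  have bound: "cmod (F n - of_real (G n)) \<le> e n" if n: "1 \<le> n" for n
  proof -
    note [simp] = fin[OF n]
    define u where "u = t / sqrt (real n)"
    have u2: "u\<^sup>2 = t\<^sup>2 / real n" unfolding u_def using n by (simp add: power_divide)
    have [measurable]: "X n z \<in> borel_measurable M" if "z \<in> I n" for z
      using indep[OF n] that by (simp add: indep_vars_def2)
    have "F n = char (distr M borel (\<lambda>\<omega>. \<Sum>z\<in>I n. X n z \<omega>)) u"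
      unfolding F_def char_def u_def by (simp add: integral_distr)
    also have "\<dots> = (\<Prod>z\<in>I n. char (distr M borel (X n z)) u)" by (rule char_distr_sum[OF indep[OF n]])
    finally have F: "F n = (\<Prod>z\<in>I n. char (distr M borel (X n z)) u)" .
    have "G n = exp (\<Sum>z\<in>I n. - (u\<^sup>2 * expectation (\<lambda>\<omega>. (X n z \<omega>)\<^sup>2) / 2))"
      unfolding G_def u2 by (simp add: sum_negf sum_divide_distrib sum_distrib_left)
    also have "\<dots> = (\<Prod>z\<in>I n. exp (- (u\<^sup>2 * expectation (\<lambda>\<omega>. (X n z \<omega>)\<^sup>2) / 2)))" by (rule exp_sum) simp
    finally have G: "G n = \<dots>" .
    have "cmod (F n - of_real (G n)) \<le> (\<Sum>z\<in>I n. cmod (char (distr M borel (X n z)) u - of_real (exp (- (u\<^sup>2 * expectation (\<lambda>\<omega>. (X n z \<omega>)\<^sup>2) / 2)))))"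
      unfolding F G of_real_prod
      by (rule norm_prod_diff) (auto intro!: norm_char_le_1)
    also have "\<dots> \<le> (\<Sum>z\<in>I n. \<bar>u\<bar> ^ 3 * B / 6 + u ^ 4 * (1 + B)\<^sup>2 / 8)"
      using n by (intro sum_mono char_third_moment_bound i3 B mean) auto
    also have "\<dots> = real (card (I n)) * (\<bar>u\<bar> ^ 3 * B / 6 + u ^ 4 * (1 + B)\<^sup>2 / 8)" by simp
    also have "\<dots> \<le> (C * real n) * (\<bar>u\<bar> ^ 3 * B / 6 + u ^ 4 * (1 + B)\<^sup>2 / 8)"
      using card[OF n] \<open>0 \<le> B\<close> by (intro mult_right_mono) auto
    also have "\<dots> = e n"
    proof -
      have u3: "\<bar>u\<bar> ^ 3 = \<bar>t\<bar> ^ 3 / (real n * sqrt (real n))"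
        unfolding u_def by (simp add: power_divide power3_eq_cube)
      have u4: "u ^ 4 = t ^ 4 / (real n * real n)"
        unfolding u_def by (simp add: power_divide power4_eq_xxxx)
      show ?thesis unfolding e_def u3 u4 using n by (simp add: field_simps)
    qed
    finally show ?thesis .
  qed
  have "(\<lambda>n. F n - of_real (G n)) \<longlonglongrightarrow> 0"
    by (rule Lim_null_comparison[OF _ e]) (use bound in \<open>auto simp: eventually_sequentially\<close>)
  moreover have "G \<longlonglongrightarrow> exp (- (t\<^sup>2 * v / 2))" unfolding G_def by (intro tendsto_intros var) simp
  hence "(\<lambda>n. complex_of_real (G n)) \<longlonglongrightarrow> of_real (exp (- (t\<^sup>2 * v / 2)))" by (rule tendsto_of_real)
  ultimately have "(\<lambda>n. (F n - of_real (G n)) + of_real (G n)) \<longlonglongrightarrow> 0 + of_real (exp (- (t\<^sup>2 * v / 2)))" by (rule tendsto_add)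
  thus ?thesis by (simp add: F_def)
qed

text \<open>The map \<open>x\<close> to \<open>iexp (t x)\<close> is Lipschitz with constant
  \<open>|t|\<close>.\<close>

lemma (in prob_space) char_perturbation:
  assumes [measurable]: "X \<in> borel_measurable M" "Y \<in> borel_measurable M"
    and d: "\<And>\<omega>. \<omega> \<in> space M \<Longrightarrow> \<bar>X \<omega> - Y \<omega>\<bar> \<le> d"
  shows "cmod (char (distr M borel X) t - char (distr M borel Y) t) \<le> \<bar>t\<bar> * d"
proof -
  have iX: "integrable M (\<lambda>\<omega>. iexp (t * X \<omega>))" and iY: "integrable M (\<lambda>\<omega>. iexp (t * Y \<omega>))"
    by (intro complex_integrable_bounded[where B = 1]; simp)+
  have "char (distr M borel X) t - char (distr M borel Y) t = (CLINT \<omega>|M. iexp (t * X \<omega>) - iexp (t * Y \<omega>))"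
    unfolding char_def using iX iY by (simp add: integral_distr)
  also have "cmod \<dots> \<le> (LINT \<omega>|M. cmod (iexp (t * X \<omega>) - iexp (t * Y \<omega>)))" by (rule integral_norm_bound)
  also have "\<dots> \<le> (LINT \<omega>|M. \<bar>t\<bar> * d)"
  proof (rule integral_mono)
    show "integrable M (\<lambda>\<omega>. cmod (iexp (t * X \<omega>) - iexp (t * Y \<omega>)))" using iX iY by auto
    fix \<omega> assume \<omega>: "\<omega> \<in> space M"
    have "iexp (t * X \<omega>) - iexp (t * Y \<omega>) = iexp (t * Y \<omega>) * (iexp (t * X \<omega> - t * Y \<omega>) - 1)"
      by (simp add: algebra_simps flip: exp_add)
    hence "cmod (iexp (t * X \<omega>) - iexp (t * Y \<omega>)) = cmod (iexp (t * X \<omega> - t * Y \<omega>) - 1)"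
      by (simp add: norm_mult)
    also have "\<dots> \<le> \<bar>t * X \<omega> - t * Y \<omega>\<bar>"
      using iexp_approx1[of "t * X \<omega> - t * Y \<omega>" 0] by simp
    also have "\<dots> = \<bar>t\<bar> * \<bar>X \<omega> - Y \<omega>\<bar>" by (simp add: abs_mult right_diff_distrib[symmetric])
    also have "\<dots> \<le> \<bar>t\<bar> * d" using d[OF \<omega>] by (intro mult_left_mono) auto
    finally show "cmod (iexp (t * X \<omega>) - iexp (t * Y \<omega>)) \<le> \<bar>t\<bar> * d" .
  qed simp
  finally show ?thesis by (simp add: prob_space)
qed

section \<open>Quantile transform of a normal variable\<close>

definition quantile :: "real measure \<Rightarrow> real \<Rightarrow> real" where
  "quantile \<mu> u = Inf {x. u \<le> cdf \<mu> x}"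

lemma quantile_le_iff:
  assumes "real_distribution \<mu>" "0 < u" "u < 1"
  shows "quantile \<mu> u \<le> x \<longleftrightarrow> u \<le> cdf \<mu> x"
proof -
  interpret cdf_distribution \<mu> unfolding cdf_distribution_def by fact
  show ?thesis using pseudoinverse[of u x] assms unfolding quantile_def by auto
qed

definition normal_cdf :: "real \<Rightarrow> real" where
  "normal_cdf = cdf std_normal_distribution"

interpretation std_normal: real_distribution std_normal_distribution
  by (rule real_dist_normal_dist)

lemma normal_measure_Ioc_pos:
  assumes "a < b" shows "0 < measure std_normal_distribution {a<..b}"
proof (rule ccontr)
  assume "\<not> ?thesis"
  hence "measure std_normal_distribution {a<..b} = 0" using measure_nonneg[of std_normal_distribution "{a<..b}"] by linarith
  hence "emeasure std_normal_distribution {a<..b} = 0" by (simp add: std_normal.emeasure_eq_measure)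
  hence "(\<integral>\<^sup>+ x. ennreal (std_normal_density x) * indicator {a<..b} x \<partial>lborel) = 0"
    by (subst (asm) emeasure_density) auto
  hence "AE x in lborel. ennreal (std_normal_density x) * indicator {a<..b} x = 0"
    by (subst (asm) nn_integral_0_iff_AE) auto
  hence "AE x in lborel. x \<notin> {a<..b}"
  proof eventually_elim
    case (elim x)
    have "std_normal_density x > 0" by (rule normal_density_pos) simp
    thus ?case using elim by (auto simp: indicator_def split: if_splits)
  qed
  hence "emeasure lborel {a<..b} = 0" by (subst (asm) AE_iff_measurable[where N = "{a<..b}"]) auto
  thus False using assms by simp
qed

lemma normal_measure_singleton: "measure std_normal_distribution {x} = 0"
proof -
  have "emeasure std_normal_distribution {x} = (\<integral>\<^sup>+ y. ennreal (std_normal_density y) * indicator {x} y \<partial>lborel)"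
    by (rule emeasure_density) auto
  also have "\<dots> = 0" by simp
  finally show ?thesis by (simp add: measure_def)
qed

lemma normal_cdf_strict_mono: "a < b \<Longrightarrow> normal_cdf a < normal_cdf b"
  using std_normal.cdf_diff_eq[of a b] normal_measure_Ioc_pos[of a b] unfolding normal_cdf_def by linarith

lemma normal_cdf_bounds: "0 < normal_cdf x" "normal_cdf x < 1"
  using normal_cdf_strict_mono[of "x - 1" x] std_normal.cdf_nonneg[of "x - 1"]
    normal_cdf_strict_mono[of x "x + 1"] std_normal.cdf_bounded_prob[of "x + 1"]
  unfolding normal_cdf_def by linarith+

lemma isCont_normal_cdf: "isCont normal_cdf x"
  unfolding normal_cdf_def std_normal.isCont_cdf by (rule normal_measure_singleton)

lemma normal_cdf_le_iff: "normal_cdf a \<le> normal_cdf b \<longleftrightarrow> a \<le> b"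
  using normal_cdf_strict_mono[of a b] normal_cdf_strict_mono[of b a] by (cases a b rule: linorder_cases) auto

lemma borel_measurable_normal_quantile[measurable]:
  assumes "real_distribution \<mu>"
  shows "(\<lambda>x. quantile \<mu> (normal_cdf x)) \<in> borel_measurable borel"
proof (rule borel_measurable_mono, rule monoI)
  fix x y :: real assume "x \<le> y"
  hence "normal_cdf x \<le> normal_cdf y" by (simp add: normal_cdf_le_iff)
  also have "\<dots> \<le> cdf \<mu> (quantile \<mu> (normal_cdf y))"
    using quantile_le_iff[OF assms normal_cdf_bounds, of y] by blast
  finally show "quantile \<mu> (normal_cdf x) \<le> quantile \<mu> (normal_cdf y)"
    using quantile_le_iff[OF assms normal_cdf_bounds] by blast
qed

text \<open>The probability integral transform: the normal distribution function maps a normal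
  variable to a uniform one, and the quantile function maps that to the law \<open>\<mu>\<close>.
  Values of \<open>cdf\<close> strictly between 0 and 1 are attained by \<open>normal_cdf\<close>;
  the values 0 and 1 are not and are treated apart.\<close>

lemma distr_normal_quantile:
  assumes \<mu>: "real_distribution \<mu>"
  shows "distr std_normal_distribution borel (\<lambda>x. quantile \<mu> (normal_cdf x)) = \<mu>"
proof (rule cdf_unique)
  interpret \<mu>: real_distribution \<mu> by fact
  note [measurable] = borel_measurable_normal_quantile[OF \<mu>]
  show "real_distribution (distr std_normal_distribution borel (\<lambda>x. quantile \<mu> (normal_cdf x)))" by simp
  show "cdf (distr std_normal_distribution borel (\<lambda>x. quantile \<mu> (normal_cdf x))) = cdf \<mu>"
  proof
    fix y
    have "cdf (distr std_normal_distribution borel (\<lambda>x. quantile \<mu> (normal_cdf x))) y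
        = measure std_normal_distribution {x. quantile \<mu> (normal_cdf x) \<le> y}"
      unfolding cdf_def by (subst measure_distr) (auto intro!: arg_cong[where f = "measure _"])
    also have "{x. quantile \<mu> (normal_cdf x) \<le> y} = {x. normal_cdf x \<le> cdf \<mu> y}"
      by (simp add: quantile_le_iff[OF \<mu> normal_cdf_bounds])
    also have "measure std_normal_distribution \<dots> = cdf \<mu> y"
    proof -
      consider "cdf \<mu> y \<le> 0" | "1 \<le> cdf \<mu> y" | "0 < cdf \<mu> y" "cdf \<mu> y < 1" by linarith
      thus ?thesis
      proof cases
        case 1
        hence z: "cdf \<mu> y = 0" using \<mu>.cdf_nonneg[of y] by simp
        have "{x. normal_cdf x \<le> cdf \<mu> y} = {}" using normal_cdf_bounds(1) by (auto simp: z not_le)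
        thus ?thesis by (simp add: z)
      next
        case 2
        hence z: "cdf \<mu> y = 1" using \<mu>.cdf_bounded_prob[of y] by simp
        have "{x. normal_cdf x \<le> cdf \<mu> y} = UNIV" using normal_cdf_bounds(2) by (auto simp: z less_imp_le)
        thus ?thesis using std_normal.prob_space by (simp add: z)
      next
        case 3
        obtain a where a: "normal_cdf a < cdf \<mu> y"
          using order_tendstoD(2)[OF std_normal.cdf_lim_at_bot 3(1), folded normal_cdf_def] eventually_happens' trivial_limit_at_bot_linorder by blast
        obtain b where b: "cdf \<mu> y < normal_cdf b"
          using order_tendstoD(1)[OF std_normal.cdf_lim_at_top_prob 3(2), folded normal_cdf_def] eventually_happens' trivial_limit_at_top_linorder by blast
        have "a \<le> b" using a b normal_cdf_le_iff[of a b] by linarith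
        obtain x where x: "normal_cdf x = cdf \<mu> y"
          using IVT[of normal_cdf a "cdf \<mu> y" b] a b \<open>a \<le> b\<close> isCont_normal_cdf by force
        have "{z. normal_cdf z \<le> cdf \<mu> y} = {..x}" by (auto simp: x[symmetric] normal_cdf_le_iff)
        moreover have "measure std_normal_distribution {..x} = normal_cdf x" by (simp add: normal_cdf_def cdf_def)
        ultimately show ?thesis by (simp only: x)
      qed
    qed
    finally show "cdf (distr std_normal_distribution borel (\<lambda>x. quantile \<mu> (normal_cdf x))) y = cdf \<mu> y" .
  qed
qed (fact \<mu>)

text \<open>Weak convergence is used at the two points \<open>s * x + h\<close> and
  \<open>s * x - h\<close>. They are not atoms of the limit even if \<open>s = 0\<close>, whose only
  atom is then \<open>0 = s * x\<close>. This degenerate case arises for blocks on which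
  \<open>v0\<close> vanishes.\<close>

lemma normal_quantile_tendsto:
  assumes \<mu>: "\<And>n. real_distribution (\<mu> n)" and s: "0 \<le> s"
    and char: "\<And>t. (\<lambda>n. char (\<mu> n) t) \<longlonglongrightarrow> of_real (exp (- (t\<^sup>2 * s\<^sup>2 / 2)))"
  shows "(\<lambda>n. quantile (\<mu> n) (normal_cdf x)) \<longlonglongrightarrow> s * x"
proof -
  define G where "G = distr std_normal_distribution borel (\<lambda>x. s * x)"
  have G: "real_distribution G" unfolding G_def by simp
  interpret G: real_distribution G by (rule G)
  have "weak_conv_m \<mu> G"
    using char char_scaled_std_normal[of s] by (intro levy_continuity \<mu> G) (simp add: G_def power_mult_distrib)
  hence conv: "(\<lambda>n. cdf (\<mu> n) y) \<longlonglongrightarrow> cdf G y" if "measure G {y} = 0" for y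
    using that G.isCont_cdf[of y] by (simp add: weak_conv_m_def weak_conv_def)
  have mG: "measure G A = measure std_normal_distribution {x. s * x \<in> A}" if "A \<in> sets borel" for A
    unfolding G_def using that by (subst measure_distr) (auto simp: vimage_def)
  have at: "measure G {s * x + h} = 0" if "h \<noteq> 0" for h
  proof (cases "s = 0")
    case True
    thus ?thesis using that by (simp add: mG)
  next
    case False
    hence "{z. s * z = s * x + h} = {x + h / s}" by (auto simp: field_simps)
    thus ?thesis by (simp add: mG normal_measure_singleton)
  qed
  show ?thesis
  proof (rule LIMSEQ_I)
    fix e :: real assume "0 < e"
    define h where "h = e / 2"
    \<comment> \<open>Chosen so that \<open>s * \<delta> < h\<close>; the denominator
      \<open>s + 1\<close> stays positive for \<open>s = 0\<close>.\<close>
    define \<delta> where "\<delta> = h / (s + 1)"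
    have "0 < h" "0 < \<delta>" "s * \<delta> < h" using \<open>0 < e\<close> s by (auto simp: h_def \<delta>_def field_simps)
    have "normal_cdf x < normal_cdf (x + \<delta>)" using \<open>0 < \<delta>\<close> by (intro normal_cdf_strict_mono) simp
    also have "\<dots> \<le> cdf G (s * x + h)"
      unfolding cdf_def normal_cdf_def
    proof (subst mG)
      show "measure std_normal_distribution {..x + \<delta>} \<le> measure std_normal_distribution {z. s * z \<in> {..s * x + h}}"
      proof (rule std_normal.finite_measure_mono)
        show "{..x + \<delta>} \<subseteq> {z. s * z \<in> {..s * x + h}}"
        proof clarsimp
          fix z assume "z \<le> x + \<delta>"
          hence "s * z \<le> s * (x + \<delta>)" using s by (rule mult_left_mono)
          thus "s * z \<le> s * x + h" using \<open>s * \<delta> < h\<close> by (simp add: algebra_simps)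
        qed
        show "{z. s * z \<in> {..s * x + h}} \<in> sets std_normal_distribution" by simp
      qed
    qed simp
    finally have up: "normal_cdf x < cdf G (s * x + h)" .
    have "cdf G (s * x - h) \<le> normal_cdf (x - \<delta>)"
      unfolding cdf_def normal_cdf_def
    proof (subst mG)
      show "measure std_normal_distribution {z. s * z \<in> {..s * x - h}} \<le> measure std_normal_distribution {..x - \<delta>}"
      proof (rule std_normal.finite_measure_mono)
        show "{z. s * z \<in> {..s * x - h}} \<subseteq> {..x - \<delta>}"
        proof (clarsimp, rule ccontr)
          fix z assume a: "s * z \<le> s * x - h" "\<not> z \<le> x - \<delta>"
          hence "s * (x - \<delta>) \<le> s * z" using s by (intro mult_left_mono) auto
          thus False using a \<open>s * \<delta> < h\<close> by (simp add: algebra_simps)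
        qed
      qed simp
    qed simp
    also have "\<dots> < normal_cdf x" using \<open>0 < \<delta>\<close> by (intro normal_cdf_strict_mono) simp
    finally have low: "cdf G (s * x - h) < normal_cdf x" .
    have "eventually (\<lambda>n. normal_cdf x < cdf (\<mu> n) (s * x + h)) sequentially"
      using conv[OF at[of h]] up \<open>0 < h\<close> by (intro order_tendstoD) auto
    moreover have "eventually (\<lambda>n. cdf (\<mu> n) (s * x - h) < normal_cdf x) sequentially"
      using conv[of "s * x - h"] at[of "- h"] low \<open>0 < h\<close> by (intro order_tendstoD) auto
    ultimately have "eventually (\<lambda>n. norm (quantile (\<mu> n) (normal_cdf x) - s * x) < e) sequentially"
    proof eventually_elim
      case (elim n)
      have "quantile (\<mu> n) (normal_cdf x) \<le> s * x + h"
        using elim(1) quantile_le_iff[OF \<mu> normal_cdf_bounds] by (simp add: less_imp_le)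
      moreover have "\<not> quantile (\<mu> n) (normal_cdf x) \<le> s * x - h"
        using elim(2) by (simp add: quantile_le_iff[OF \<mu> normal_cdf_bounds])
      ultimately show ?case using \<open>0 < e\<close> unfolding h_def by simp
    qed
    thus "\<exists>no. \<forall>n\<ge>no. norm (quantile (\<mu> n) (normal_cdf x) - s * x) < e"
      by (simp add: eventually_sequentially)
  qed
qed

section \<open>Diagonal choice and Riemann sums\<close>

text \<open>\<open>K n\<close> is the largest \<open>k \<le> n\<close> for which the property holds
  from \<open>n\<close> on. Each fixed \<open>k\<close> is admissible eventually, which forces
  \<open>K\<close> to infinity; where no \<open>k\<close> is admissible, 1 serves as a
  default.\<close>

lemma diagonal_sequence:
  fixes Q :: "nat \<Rightarrow> nat \<Rightarrow> bool"
  assumes "\<And>K. 1 \<le> K \<Longrightarrow> eventually (\<lambda>n. Q n K) sequentially"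
  obtains K :: "nat \<Rightarrow> nat" where "\<And>n. 1 \<le> K n" "filterlim K at_top sequentially"
    "eventually (\<lambda>n. Q n (K n)) sequentially"
proof -
  define S where "S n = {k. 1 \<le> k \<and> k \<le> n \<and> (\<forall>n'\<ge>n. Q n' k)}" for n
  define K where "K n = (if S n = {} then 1 else Max (S n))" for n
  have fin: "finite (S n)" for n by (rule finite_subset[of _ "{..n}"]) (auto simp: S_def)
  have in_S: "eventually (\<lambda>n. k \<in> S n) sequentially" if k: "1 \<le> k" for k
  proof -
    obtain N where "\<forall>n\<ge>N. Q n k" using assms[OF k] by (auto simp: eventually_sequentially)
    thus ?thesis unfolding eventually_sequentially S_def
      using k by (intro exI[of _ "max N k"]) auto
  qed
  have mem: "K n \<in> S n" if "S n \<noteq> {}" for n using Max_in[OF fin that] that by (simp add: K_def)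
  show thesis
  proof
    show "1 \<le> K n" for n using mem[of n] by (cases "S n = {}") (auto simp: K_def S_def)
    show "filterlim K at_top sequentially" unfolding filterlim_at_top
    proof
      fix Z :: nat
      have "eventually (\<lambda>n. max 1 Z \<in> S n) sequentially" by (rule in_S) simp
      thus "eventually (\<lambda>n. Z \<le> K n) sequentially"
      proof eventually_elim
        case (elim n)
        hence "max 1 Z \<le> Max (S n)" using Max_ge[OF fin] by blast
        thus ?case using elim by (auto simp: K_def)
      qed
    qed
    have "eventually (\<lambda>n. 1 \<in> S n) sequentially" by (rule in_S) simp
    thus "eventually (\<lambda>n. Q n (K n)) sequentially"
    proof eventually_elim
      case (elim n)
      hence "K n \<in> S n" using mem by auto
      thus ?case by (auto simp: S_def)
    qed
  qed
qed

text \<open>By the mean value theorem each term differs from an increment of \<open>n f\<close> by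
  the oscillation of \<open>g\<close> over a distance \<open>1 / n\<close>. About \<open>n\<close>
  such errors of size \<open>n powr - \<beta>\<close> are \<open>o (sqrt n)\<close> exactly because
  \<open>\<beta> > 1/2\<close>; rounding the end points costs at most \<open>2 * G\<close>. It
  serves the mean height as well as the clock.\<close>

lemma riemann_sum_error:
  fixes f g :: "real \<Rightarrow> real"
  assumes deriv: "\<And>y. (f has_real_derivative g y) (at y)"
    and bdd: "\<And>y. \<bar>g y\<bar> \<le> G"
    and holder: "\<And>a b. \<exists>\<beta>>1/2. \<exists>C. \<forall>x\<in>{a..b}. \<forall>y\<in>{a..b}. \<bar>g x - g y\<bar> \<le> C * \<bar>x - y\<bar> powr \<beta>"
    and "a \<le> b"
  shows "(\<lambda>n. ((\<Sum>z\<in>{\<lfloor>real n * a\<rfloor><..\<lfloor>real n * b\<rfloor>}. g (real_of_int z / real n)) - real n * (f b - f a)) / sqrt (real n)) \<longlonglongrightarrow> 0"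
proof -
  have "0 \<le> G" using bdd[of 0] by linarith
  have lip: "\<bar>f y - f x\<bar> \<le> G * \<bar>y - x\<bar>" for x y
  proof -
    have *: "\<bar>f y - f x\<bar> \<le> G * \<bar>y - x\<bar>" if xy: "x < y" for x y
    proof -
      obtain z where "f y - f x = (y - x) * g z" using MVT2[OF xy, of f g] deriv by blast
      thus ?thesis using bdd[of z] xy by (simp add: abs_mult mult.commute mult_left_mono)
    qed
    show ?thesis using *[of x y] *[of y x] by (cases x y rule: linorder_cases) (auto simp: abs_minus_commute)
  qed
  \<comment> \<open>Rounding can move the points out of \<open>[a, b]\<close> by at most
    \<open>1 / n\<close>, hence the margin 1.\<close>
  obtain \<beta> C where \<beta>: "1/2 < \<beta>" and C: "\<And>x y. x \<in> {a - 1..b + 1} \<Longrightarrow> y \<in> {a - 1..b + 1} \<Longrightarrow> \<bar>g x - g y\<bar> \<le> C * \<bar>x - y\<bar> powr \<beta>"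
    using holder[of "a - 1" "b + 1"] by blast
  define D where "D = max C 0"
  have D: "0 \<le> D" "\<And>x y. x \<in> {a - 1..b + 1} \<Longrightarrow> y \<in> {a - 1..b + 1} \<Longrightarrow> \<bar>g x - g y\<bar> \<le> D * \<bar>x - y\<bar> powr \<beta>"
    using C by (force simp: D_def intro: order_trans[OF _ mult_right_mono])+
  define e where "e n = ((real n * (b - a) + 1) * (D * (1 / real n) powr \<beta>) + 2 * G) / sqrt (real n)" for n
  have "e \<longlonglongrightarrow> 0"
  proof -
    have "(\<lambda>n. real n * (1 / real n) powr \<beta> / sqrt (real n)) \<longlonglongrightarrow> 0" using \<beta> by real_asymp
    moreover have "(\<lambda>n. (1 / real n) powr \<beta> / sqrt (real n)) \<longlonglongrightarrow> 0" using \<beta> by real_asymp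
    moreover have "(\<lambda>n. 1 / sqrt (real n)) \<longlonglongrightarrow> 0" by real_asymp
    ultimately have "(\<lambda>n. (b - a) * D * (real n * (1 / real n) powr \<beta> / sqrt (real n)) + D * ((1 / real n) powr \<beta> / sqrt (real n))
        + 2 * G * (1 / sqrt (real n))) \<longlonglongrightarrow> (b - a) * D * 0 + D * 0 + 2 * G * 0"
      by (intro tendsto_add tendsto_mult tendsto_const)
    moreover have "e = (\<lambda>n. (b - a) * D * (real n * (1 / real n) powr \<beta> / sqrt (real n)) + D * ((1 / real n) powr \<beta> / sqrt (real n))
        + 2 * G * (1 / sqrt (real n)))"
      unfolding e_def by (intro ext) (simp add: add_divide_distrib ring_distribs mult_ac)
    ultimately show ?thesis by (simp only: mult_zero_right add_0_right)
  qed
  show ?thesis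
  proof (rule Lim_null_comparison[OF _ \<open>e \<longlonglongrightarrow> 0\<close>])
    have "norm (((\<Sum>z\<in>{\<lfloor>real n * a\<rfloor><..\<lfloor>real n * b\<rfloor>}. g (real_of_int z / real n)) - real n * (f b - f a)) / sqrt (real n)) \<le> e n"
      if n: "1 \<le> n" for n
    proof -
      define l r where "l = \<lfloor>real n * a\<rfloor>" and "r = \<lfloor>real n * b\<rfloor>"
      define F where "F z = real n * f (real_of_int z / real n)" for z
      have "l \<le> r" unfolding l_def r_def using \<open>a \<le> b\<close> by (intro floor_mono mult_left_mono) auto
      have la: "real_of_int l \<le> real n * a" "real n * a < real_of_int l + 1"
        and rb: "real_of_int r \<le> real n * b" "real n * b < real_of_int r + 1"
        unfolding l_def r_def by linarith+
      have la': "a - 1 / n < l / n" "l / n \<le> a" and rb': "b - 1 / n < r / n" "r / n \<le> b"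
      proof -
        have *: "y - 1 / n < k / n \<and> k / n \<le> y" if "k \<le> real n * y" "real n * y < k + 1" for k y :: real
        proof -
          have "y < (k + 1) / n" using that n by (simp add: pos_less_divide_eq mult.commute)
          moreover have "k / n \<le> y" using that n by (simp add: pos_divide_le_eq mult.commute)
          ultimately show ?thesis by (simp add: add_divide_distrib)
        qed
        show "a - 1 / n < l / n" "l / n \<le> a" "b - 1 / n < r / n" "r / n \<le> b" using *[OF la] *[OF rb] by auto
      qed
      have step: "\<bar>g (real_of_int z / real n) - (F z - F (z - 1))\<bar> \<le> D * (1 / real n) powr \<beta>" if z: "z \<in> {l<..r}" for z
      proof -
        have lt: "real_of_int (z - 1) / real n < real_of_int z / real n" using n by (simp add: divide_strict_right_mono)
        obtain \<xi> where \<xi>: "real_of_int (z - 1) / real n < \<xi>" "\<xi> < real_of_int z / real n"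
          "f (real_of_int z / real n) - f (real_of_int (z - 1) / real n) = (real_of_int z / real n - real_of_int (z - 1) / real n) * g \<xi>"
          using MVT2[OF lt, of f g] deriv by blast
        have "F z - F (z - 1) = real n * ((real_of_int z / real n - real_of_int (z - 1) / real n) * g \<xi>)"
          unfolding F_def \<xi>(3)[symmetric] by (simp add: right_diff_distrib)
        also have "\<dots> = g \<xi>" using n by (simp add: field_simps)
        finally have Fz: "F z - F (z - 1) = g \<xi>" .
        have zl: "real_of_int l / n \<le> real_of_int (z - 1) / n" using z by (intro divide_right_mono) auto
        have zr: "real_of_int z / n \<le> real_of_int r / n" using z by (intro divide_right_mono) auto
        have n1: "1 / real n \<le> 1" using n by simp
        have "z / n \<in> {a - 1..b + 1}" "\<xi> \<in> {a - 1..b + 1}"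
          using zl zr la' rb' \<xi> n1 lt by (auto)
        from D(2)[OF this] have "\<bar>g (z / n) - g \<xi>\<bar> \<le> D * \<bar>z / n - \<xi>\<bar> powr \<beta>" .
        also have "\<dots> \<le> D * (1 / real n) powr \<beta>"
        proof (intro mult_left_mono powr_mono2)
          have "real_of_int (z - 1) / n = z / n - 1 / n" by (simp add: diff_divide_distrib)
          thus "\<bar>z / n - \<xi>\<bar> \<le> 1 / n" using \<xi> by simp
        qed (use \<beta> D(1) in auto)
        finally show ?thesis by (simp add: Fz)
      qed
      have "(\<Sum>z\<in>{l<..r}. g (z / n)) - (F r - F l) = (\<Sum>z\<in>{l<..r}. g (z / n) - (F z - F (z - 1)))"
        unfolding sum_int_increments[OF \<open>l \<le> r\<close>, of F, symmetric] by (rule sum_subtractf[symmetric])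
      hence "\<bar>(\<Sum>z\<in>{l<..r}. g (z / n)) - (F r - F l)\<bar> \<le> (\<Sum>z\<in>{l<..r}. D * (1 / real n) powr \<beta>)"
        using step by (simp only:) (intro order_trans[OF sum_abs] sum_mono)
      also have "\<dots> = real_of_int (r - l) * (D * (1 / real n) powr \<beta>)" using \<open>l \<le> r\<close> by simp
      also have "\<dots> \<le> (real n * (b - a) + 1) * (D * (1 / real n) powr \<beta>)"
        using la rb D(1) by (intro mult_right_mono) (auto simp: algebra_simps)
      finally have A: "\<bar>(\<Sum>z\<in>{l<..r}. g (z / n)) - (F r - F l)\<bar> \<le> (real n * (b - a) + 1) * (D * (1 / real n) powr \<beta>)" .
      have edge: "\<bar>real n * f y - F k\<bar> \<le> G" if "y - 1 / n < k / n" "k / n \<le> y" for y :: real and k :: int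
      proof -
        have "\<bar>real n * f y - F k\<bar> = real n * \<bar>f y - f (k / n)\<bar>" unfolding F_def by (simp add: abs_mult right_diff_distrib[symmetric])
        also have "\<dots> \<le> real n * (G * \<bar>y - k / n\<bar>)" using lip by (intro mult_left_mono) auto
        also have "\<dots> \<le> real n * (G * (1 / n))" using that \<open>0 \<le> G\<close> by (intro mult_left_mono) auto
        finally show ?thesis using n by simp
      qed
      have "\<bar>(\<Sum>z\<in>{l<..r}. g (z / n)) - real n * (f b - f a)\<bar> \<le> (real n * (b - a) + 1) * (D * (1 / real n) powr \<beta>) + 2 * G"
        using A edge[OF la'] edge[OF rb'] by (simp add: right_diff_distrib)
      thus ?thesis unfolding e_def l_def r_def by (simp add: divide_right_mono)
    qed
    thus "eventually (\<lambda>n. norm (((\<Sum>z\<in>{\<lfloor>real n * a\<rfloor><..\<lfloor>real n * b\<rfloor>}. g (real_of_int z / real n)) - real n * (f b - f a)) / sqrt (real n)) \<le> e n) sequentially"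
      by (auto simp: eventually_sequentially)
  qed
qed

section \<open>Occupation numbers of a block\<close>

text \<open>Inverts a statistic \<open>T\<close> that is injective on \<open>S\<close>. The default
  \<open>d\<close> makes the map total.\<close>

definition decode :: "('l \<Rightarrow> real) \<Rightarrow> 'l set \<Rightarrow> 'l \<Rightarrow> real \<Rightarrow> 'l" where
  "decode T S d y = (if y \<in> T ` S then inv_into S T y else d)"

lemma decode_image: "inj_on T S \<Longrightarrow> l \<in> S \<Longrightarrow> decode T S d (T l) = l"
  by (simp add: decode_def)

lemma decode_inverse: "y \<in> T ` S \<Longrightarrow> T (decode T S d y) = y"
  by (simp add: decode_def f_inv_into_f)

lemma decode_mem: "d \<in> S \<Longrightarrow> decode T S d y \<in> S"
  by (auto simp: decode_def inv_into_into)

lemma decode_measurable[measurable]: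
  fixes T :: "'l::countable \<Rightarrow> real"
  shows "decode T S d \<in> measurable borel (count_space UNIV)"
proof -
  have TS: "countable (T ` S)" by (intro countable_image countableI_type)
  have "decode T S d -` {l} \<in> sets borel" for l
  proof -
    have "countable {y \<in> T ` S. inv_into S T y = l}" using TS by (rule countable_subset[rotated]) auto
    hence "{y \<in> T ` S. inv_into S T y = l} \<in> sets borel" by (rule sets.countable[rotated]) auto
    moreover have "- (T ` S) \<in> sets (borel :: real measure)"
      using sets.countable[OF _ TS, of borel] by auto
    moreover have "decode T S d -` {l} = {y \<in> T ` S. inv_into S T y = l} \<union> (if d = l then - (T ` S) else {})"
      by (auto simp: decode_def split: if_splits)
    ultimately show ?thesis by auto
  qed
  thus ?thesis by (subst measurable_count_space_eq2_countable) auto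
qed

lemma distr_decode:
  fixes T :: "'l::countable \<Rightarrow> real"
  assumes X: "X \<in> measurable M (count_space UNIV)" and "inj_on T S" and "\<And>\<omega>. \<omega> \<in> space M \<Longrightarrow> X \<omega> \<in> S"
  shows "distr (distr M borel (\<lambda>\<omega>. T (X \<omega>))) (count_space UNIV) (decode T S d) = distr M (count_space UNIV) X"
proof -
  have [measurable]: "(\<lambda>\<omega>. T (X \<omega>)) \<in> borel_measurable M" using X by (rule measurable_compose) simp
  have "distr (distr M borel (\<lambda>\<omega>. T (X \<omega>))) (count_space UNIV) (decode T S d)
      = distr M (count_space UNIV) (decode T S d \<circ> (\<lambda>\<omega>. T (X \<omega>)))" by (rule distr_distr) simp_all
  also have "\<dots> = distr M (count_space UNIV) X"
    using assms by (intro distr_cong) (auto simp: decode_image)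
  finally show ?thesis .
qed

lemma measurable_map_count_space:
  fixes f :: "'i \<Rightarrow> 'a \<Rightarrow> 'b::countable"
  assumes "\<And>z. z \<in> set zs \<Longrightarrow> f z \<in> measurable M (count_space UNIV)"
  shows "(\<lambda>\<omega>. map (\<lambda>z. f z \<omega>) zs) \<in> measurable M (count_space UNIV)"
  using assms
proof (induction zs)
  case (Cons z zs)
  have "(\<lambda>\<omega>. x # map (\<lambda>z. f z \<omega>) zs) \<in> measurable M (count_space UNIV)" for x
    by (rule measurable_compose[OF Cons.IH]) (use Cons.prems in auto)
  from measurable_compose_countable[OF this, of "f z"] Cons.prems show ?case by simp
qed simp

lemma sum_list_upto: "sum_list (map f [a + 1..c]) = (\<Sum>z\<in>{a<..c}. f z)" for a c :: int and f :: "int \<Rightarrow> int"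
proof -
  have "sum_list (map f [a + 1..c]) = sum f (set [a + 1..c])" by (rule sum_list_distinct_conv_sum_set) simp
  moreover have "set [a + 1..c] = {a<..c}" by auto
  ultimately show ?thesis by simp
qed

text \<open>Near \<open>y\<close> the signed integral is an ordinary integral from the fixed point
  \<open>- R\<close> minus a constant, so no case distinction on the sign of \<open>y\<close> is
  left.\<close>

lemma signed_integral_has_derivative:
  assumes "continuous_on UNIV v"
  shows "(signed_integral v has_real_derivative v y) (at y)"
proof -
  define R where "R = \<bar>y\<bar> + 1"
  have R: "- R < y" "y < R" "0 < R" by (auto simp: R_def)
  have cont: "continuous_on {c..d} v" for c d using assms by (rule continuous_on_subset) simp
  have int: "v integrable_on {c..d}" for c d by (rule integrable_continuous_interval[OF cont])
  have eq: "signed_integral v x = integral {- R..x} v - integral {- R..0} v" if "x \<in> {- R..R}" for x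
  proof (cases "0 \<le> x")
    case True
    have "integral {- R..0} v + integral {0..x} v = integral {- R..x} v"
      using True R by (intro Henstock_Kurzweil_Integration.integral_combine int) auto
    thus ?thesis using True by (simp add: signed_integral_def)
  next
    case False
    have "integral {- R..x} v + integral {x..0} v = integral {- R..0} v"
      using False that by (intro Henstock_Kurzweil_Integration.integral_combine int) auto
    thus ?thesis using False by (simp add: signed_integral_def)
  qed
  have "((\<lambda>x. integral {- R..x} v - integral {- R..0} v) has_real_derivative v y - 0) (at y within {- R..R})"
    by (intro DERIV_diff integral_has_real_derivative cont) (use R in auto)
  hence "(signed_integral v has_real_derivative v y) (at y within {- R..R})"
    by (simp only: diff_0_right, elim has_field_derivative_transform_within[where d = 1]) (use eq R in auto)
  thus ?thesis using R at_within_interior[of y "{- R..R}"] by simp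
qed

section \<open>Statistics of the blocks in the example\<close>

locale example = prob_space M for M :: "'a measure" +
  fixes sigma0 :: "nat \<Rightarrow> int \<Rightarrow> 'a \<Rightarrow> int" and u0 rho0 v0 :: "real \<Rightarrow> real"
  assumes ex: "example21 M sigma0 u0 rho0 v0"
begin

lemma eta_count_measurable: "1 \<le> n \<Longrightarrow> eta sigma0 n z \<in> measurable M (count_space UNIV)"
  using ex unfolding example21_def indep_vars_def2 by blast

lemma eta_borel_measurable: "1 \<le> n \<Longrightarrow> (\<lambda>\<omega>. real_of_int (eta sigma0 n z \<omega>)) \<in> borel_measurable M"
  by (rule measurable_compose[OF eta_count_measurable]) simp_all

lemma eta_nonneg: "1 \<le> n \<Longrightarrow> \<omega> \<in> space M \<Longrightarrow> 0 \<le> eta sigma0 n z \<omega>"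
  using ex unfolding example21_def eta_def mono_def by simp

lemma eta_indep: "1 \<le> n \<Longrightarrow> indep_vars (\<lambda>_. count_space UNIV) (\<lambda>z. eta sigma0 n z) UNIV"
  using ex unfolding example21_def by blast

lemma mean_eta_eq: "1 \<le> n \<Longrightarrow> expectation (\<lambda>\<omega>. real_of_int (eta sigma0 n z \<omega>)) = rho0 (real_of_int z / real n)"
  using ex unfolding example21_def mean_eta_def by blast

lemma var_eta_eq: "1 \<le> n \<Longrightarrow> expectation (\<lambda>\<omega>. (real_of_int (eta sigma0 n z \<omega>) - rho0 (real_of_int z / real n))\<^sup>2) = v0 (real_of_int z / real n)"
proof -
  assume n: "1 \<le> n"
  have "var_eta M sigma0 n z = v0 (real_of_int z / real n)" using ex n unfolding example21_def by blast
  moreover have "mean_eta M sigma0 n z = rho0 (real_of_int z / real n)" using ex n unfolding example21_def by blast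
  ultimately show ?thesis by (simp only: var_eta_def)
qed

lemma sixth_moment_bound:
  "\<exists>K\<ge>0. \<forall>n\<ge>1. \<forall>x. integrable M (\<lambda>\<omega>. real_of_int (eta sigma0 n x \<omega>) ^ 6) \<and>
    expectation (\<lambda>\<omega>. real_of_int (eta sigma0 n x \<omega>) ^ 6) \<le> K"
proof -
  obtain K where K: "\<And>n x. 1 \<le> n \<Longrightarrow> integrable M (\<lambda>\<omega>. real_of_int (eta sigma0 n x \<omega>) ^ 6) \<and>
      expectation (\<lambda>\<omega>. real_of_int (eta sigma0 n x \<omega>) ^ 6) \<le> K"
    using ex unfolding example21_def by blast
  have "0 \<le> expectation (\<lambda>\<omega>. real_of_int (eta sigma0 1 0 \<omega>) ^ 6)" by (intro integral_nonneg_AE) auto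
  also have "\<dots> \<le> K" using K[of 1 0] by simp
  finally show ?thesis using K by blast
qed

lemma rho0_bound: "\<exists>G\<ge>0. \<forall>y. \<bar>rho0 y\<bar> \<le> G"
proof -
  have "bounded (range rho0)" using ex unfolding example21_def by blast
  then obtain G where G: "\<And>y. \<bar>rho0 y\<bar> \<le> G" unfolding bounded_iff by auto
  have "0 \<le> G" using G[of 0] by linarith
  thus ?thesis using G by blast
qed

lemma v0_bound: "\<exists>G\<ge>0. \<forall>y. \<bar>v0 y\<bar> \<le> G"
proof -
  have "bounded (range v0)" using ex unfolding example21_def by blast
  then obtain G where G: "\<And>y. \<bar>v0 y\<bar> \<le> G" unfolding bounded_iff by auto
  have "0 \<le> G" using G[of 0] by linarith
  thus ?thesis using G by blast
qed

lemma v0_nonneg: "0 \<le> v0 y" and rho0_nonneg: "0 \<le> rho0 y"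
  using ex unfolding example21_def by auto

lemma holder:
  obtains \<beta> C where "1/2 < \<beta>" "0 \<le> C" "\<forall>x\<in>{a..b}. \<forall>y\<in>{a..b}. \<bar>rho0 x - rho0 y\<bar> + \<bar>v0 x - v0 y\<bar> \<le> C * \<bar>x - y\<bar> powr \<beta>"
proof -
  obtain \<beta> C where C: "1/2 < \<beta>" "\<forall>x\<in>{a..b}. \<forall>y\<in>{a..b}. \<bar>rho0 x - rho0 y\<bar> + \<bar>v0 x - v0 y\<bar> \<le> C * \<bar>x - y\<bar> powr \<beta>"
    using ex unfolding example21_def by blast
  show thesis
  proof
    show "1/2 < \<beta>" "0 \<le> max C 0" using C by auto
    have "\<bar>rho0 x - rho0 y\<bar> + \<bar>v0 x - v0 y\<bar> \<le> max C 0 * \<bar>x - y\<bar> powr \<beta>" if "x \<in> {a..b}" "y \<in> {a..b}" for x y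
    proof -
    have "\<bar>rho0 x - rho0 y\<bar> + \<bar>v0 x - v0 y\<bar> \<le> C * \<bar>x - y\<bar> powr \<beta>" using C that by blast
    also have "\<dots> \<le> max C 0 * \<bar>x - y\<bar> powr \<beta>" by (intro mult_right_mono) auto
    finally show ?thesis .
    qed
    thus "\<forall>x\<in>{a..b}. \<forall>y\<in>{a..b}. \<bar>rho0 x - rho0 y\<bar> + \<bar>v0 x - v0 y\<bar> \<le> max C 0 * \<bar>x - y\<bar> powr \<beta>" by blast
  qed
qed

lemma rho0_holder: "\<exists>\<beta>>1/2. \<exists>C. \<forall>x\<in>{a..b}. \<forall>y\<in>{a..b}. \<bar>rho0 x - rho0 y\<bar> \<le> C * \<bar>x - y\<bar> powr \<beta>"
  and v0_holder: "\<exists>\<beta>>1/2. \<exists>C. \<forall>x\<in>{a..b}. \<forall>y\<in>{a..b}. \<bar>v0 x - v0 y\<bar> \<le> C * \<bar>x - y\<bar> powr \<beta>"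
proof -
  obtain \<beta> C where C: "1/2 < \<beta>" "0 \<le> C" "\<forall>x\<in>{a..b}. \<forall>y\<in>{a..b}. \<bar>rho0 x - rho0 y\<bar> + \<bar>v0 x - v0 y\<bar> \<le> C * \<bar>x - y\<bar> powr \<beta>"
    by (rule holder[of a b])
  have "\<bar>rho0 x - rho0 y\<bar> \<le> C * \<bar>x - y\<bar> powr \<beta>" "\<bar>v0 x - v0 y\<bar> \<le> C * \<bar>x - y\<bar> powr \<beta>"
    if "x \<in> {a..b}" "y \<in> {a..b}" for x y using C(3)[rule_format, OF that] by linarith+
  thus "\<exists>\<beta>>1/2. \<exists>C. \<forall>x\<in>{a..b}. \<forall>y\<in>{a..b}. \<bar>rho0 x - rho0 y\<bar> \<le> C * \<bar>x - y\<bar> powr \<beta>"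
    "\<exists>\<beta>>1/2. \<exists>C. \<forall>x\<in>{a..b}. \<forall>y\<in>{a..b}. \<bar>v0 x - v0 y\<bar> \<le> C * \<bar>x - y\<bar> powr \<beta>"
    using C(1) by blast+
qed

lemma isCont_rho0: "isCont rho0 y" and isCont_v0: "isCont v0 y"
proof -
  obtain \<beta> C where C: "1/2 < \<beta>" "0 \<le> C" "\<forall>x\<in>{y - 1..y + 1}. \<forall>z\<in>{y - 1..y + 1}. \<bar>rho0 x - rho0 z\<bar> + \<bar>v0 x - v0 z\<bar> \<le> C * \<bar>x - z\<bar> powr \<beta>"
    by (rule holder[of "y - 1" "y + 1"])
  have "((\<lambda>x. \<bar>x - y\<bar> powr \<beta>) \<longlongrightarrow> 0 powr \<beta>) (at y)"
  proof (rule tendsto_powr')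
    show "((\<lambda>x. \<bar>x - y\<bar>) \<longlongrightarrow> 0) (at y)"
      using tendsto_rabs[OF tendsto_diff[OF tendsto_ident_at tendsto_const[of y]], of y UNIV] by simp
  qed (use C in auto)
  hence lim: "((\<lambda>x. C * \<bar>x - y\<bar> powr \<beta>) \<longlongrightarrow> 0) (at y)" using tendsto_mult_right_zero by fastforce
  have near: "eventually (\<lambda>x. x \<in> {y - 1..y + 1}) (at y)"
    unfolding eventually_at by (intro exI[of _ 1]) (auto simp: dist_real_def)
  have cont: "isCont f y" if "\<And>x. x \<in> {y - 1..y + 1} \<Longrightarrow> \<bar>f x - f y\<bar> \<le> C * \<bar>x - y\<bar> powr \<beta>" for f :: "real \<Rightarrow> real"
  proof -
    have "((\<lambda>x. f x - f y) \<longlongrightarrow> 0) (at y)"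
      by (rule Lim_null_comparison[OF _ lim]) (use near that in \<open>auto elim: eventually_mono\<close>)
    thus ?thesis unfolding isCont_def using LIM_zero_cancel by blast
  qed
  have b: "\<bar>rho0 x - rho0 y\<bar> \<le> C * \<bar>x - y\<bar> powr \<beta>" "\<bar>v0 x - v0 y\<bar> \<le> C * \<bar>x - y\<bar> powr \<beta>"
    if "x \<in> {y - 1..y + 1}" for x using C(3)[rule_format, OF that, of y] by auto
  show "isCont rho0 y" using b(1) by (rule cont)
  show "isCont v0 y" using b(2) by (rule cont)
qed

text \<open>The Brownian clock: the limit height at \<open>y\<close> is the Brownian motion at time
  \<open>V y\<close>.\<close>

abbreviation V :: "real \<Rightarrow> real" where "V \<equiv> signed_integral v0"

lemma V_deriv: "(V has_real_derivative v0 y) (at y)"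
  by (intro signed_integral_has_derivative continuous_at_imp_continuous_on ballI isCont_v0)

lemma V_0: "V 0 = 0" by (simp add: signed_integral_def)

lemma V_mono: "x \<le> y \<Longrightarrow> V x \<le> V y"
  by (rule DERIV_nonneg_imp_nondecreasing) (auto intro!: exI[of _ "v0 _"] V_deriv v0_nonneg)

lemma u0_deriv: "(u0 has_real_derivative rho0 y) (at y)" and u0_0: "u0 0 = 0"
  using ex unfolding example21_def by auto

text \<open>Block \<open>i\<close> covers the macroscopic interval from \<open>i / K\<close> to
  \<open>(i + 1) / K\<close>, with \<open>i\<close> ranging over all integers. Rounding down makes
  consecutive blocks tile the lattice.\<close>

definition blk_start :: "nat \<Rightarrow> nat \<Rightarrow> int \<Rightarrow> int" where
  "blk_start n K i = \<lfloor>real n * (real_of_int i / real K)\<rfloor>"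

abbreviation blk :: "nat \<Rightarrow> nat \<Rightarrow> int \<Rightarrow> int set" where
  "blk n K i \<equiv> {blk_start n K i<..blk_start n K (i + 1)}"

definition blk_lists :: "nat \<Rightarrow> nat \<Rightarrow> int \<Rightarrow> int list set" where
  "blk_lists n K i = {l. length l = nat (blk_start n K (i + 1) - blk_start n K i) \<and> (\<forall>x\<in>set l. 0 \<le> x)}"

definition blk_obs :: "nat \<Rightarrow> nat \<Rightarrow> int \<Rightarrow> 'a \<Rightarrow> int list" where
  "blk_obs n K i \<omega> = map (\<lambda>z. eta sigma0 n z \<omega>) [blk_start n K i + 1..blk_start n K (i + 1)]"

text \<open>The last summand makes the statistic injective, so that the whole list of occupation
  numbers of a block can be recovered from it; it is negligible on the scale \<open>sqrt n\<close>.\<close>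
definition blk_stat :: "nat \<Rightarrow> nat \<Rightarrow> int \<Rightarrow> int list \<Rightarrow> real" where
  "blk_stat n K i l = (real_of_int (sum_list l) - (\<Sum>z\<in>blk n K i. rho0 (real_of_int z / real n))
     + 1 / (2 + real (to_nat l))) / sqrt (real n)"

definition blk_law :: "nat \<Rightarrow> nat \<Rightarrow> int \<Rightarrow> real measure" where
  "blk_law n K i = distr M borel (\<lambda>\<omega>. blk_stat n K i (blk_obs n K i \<omega>))"

text \<open>At once the limiting standard deviation of the normalized block sum and that of the
  Brownian increment over the corresponding stretch of the clock; this agreement is what the
  coupling exploits.\<close>

definition blk_sd :: "nat \<Rightarrow> int \<Rightarrow> real" where
  "blk_sd K i = sqrt (V ((real_of_int i + 1) / real K) - V (real_of_int i / real K))"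

lemma blk_sd_nonneg: "0 \<le> blk_sd K i" and blk_sd_square: "(blk_sd K i)\<^sup>2 = V ((real_of_int i + 1) / real K) - V (real_of_int i / real K)"
  unfolding blk_sd_def by (auto intro!: V_mono divide_right_mono)

text \<open>The sum of a list is an integer and the extra summand lies strictly between 0 and 1, so
  both can be recovered, and the summand determines the code of the list.\<close>

lemma blk_stat_inj:
  assumes "1 \<le> n" shows "inj_on (blk_stat n K i) S"
proof (rule inj_onI)
  fix l m assume eq: "blk_stat n K i l = blk_stat n K i m"
  define x y where "x = 1 / (2 + real (to_nat l))" and "y = 1 / (2 + real (to_nat m))"
  have b: "0 < x" "x < 1" "0 < y" "y < 1" by (auto simp: x_def y_def)
  have "real_of_int (sum_list l) + x = real_of_int (sum_list m) + y"
    using eq assms unfolding blk_stat_def x_def[symmetric] y_def[symmetric] by simp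
  hence "real_of_int (sum_list l - sum_list m) = y - x" by simp
  hence "\<bar>real_of_int (sum_list l - sum_list m)\<bar> < 1" using b by linarith
  hence "sum_list l = sum_list m" by linarith
  hence "x = y" using \<open>real_of_int (sum_list l) + x = _\<close> by simp
  hence "to_nat l = to_nat m" unfolding x_def y_def by (simp add: field_simps)
  thus "l = m" by simp
qed

lemma blk_start_mono: "1 \<le> K \<Longrightarrow> i \<le> j \<Longrightarrow> blk_start n K i \<le> blk_start n K j"
  unfolding blk_start_def by (intro floor_mono mult_left_mono divide_right_mono) auto

lemma blk_obs_measurable: "1 \<le> n \<Longrightarrow> blk_obs n K i \<in> measurable M (count_space UNIV)"
  unfolding blk_obs_def by (intro measurable_map_count_space eta_count_measurable)

lemma blk_obs_mem: "1 \<le> n \<Longrightarrow> \<omega> \<in> space M \<Longrightarrow> blk_obs n K i \<omega> \<in> blk_lists n K i"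
  unfolding blk_obs_def blk_lists_def using eta_nonneg by auto

lemma blk_stat_obs_measurable: "(\<lambda>\<omega>. blk_stat n K i (blk_obs n K i \<omega>)) \<in> borel_measurable M"
proof (cases "n = 0")
  case True thus ?thesis by (simp add: blk_stat_def)
next
  case False
  hence "blk_obs n K i \<in> measurable M (count_space UNIV)" by (intro blk_obs_measurable) simp
  thus ?thesis by (rule measurable_compose) simp
qed

lemma real_distribution_blk_law: "real_distribution (blk_law n K i)"
  unfolding blk_law_def using blk_stat_obs_measurable by simp

lemma card_blk:
  assumes "1 \<le> K" shows "real (card (blk n K i)) \<le> real n / real K + 1"
proof -
  have "real (card (blk n K i)) = real_of_int (blk_start n K (i + 1)) - real_of_int (blk_start n K i)"
    using blk_start_mono[OF assms, of i "i + 1" n] by simp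
  also have "\<dots> \<le> real n * ((real_of_int i + 1) / real K) - (real n * (real_of_int i / real K) - 1)"
    unfolding blk_start_def by simp linarith
  also have "\<dots> = real n / real K + 1" by (simp add: algebra_simps add_divide_distrib)
  finally show ?thesis .
qed

text \<open>\<open>2 |x|^3 \<le> 1 + x^6\<close> lets the uniform sixth moments control the third
  moments that the central limit theorem consumes.\<close>

lemma centered_third_moment:
  "\<exists>B\<ge>0. \<forall>n\<ge>1. \<forall>z. integrable M (\<lambda>\<omega>. \<bar>real_of_int (eta sigma0 n z \<omega>) - rho0 (real_of_int z / real n)\<bar> ^ 3) \<and>
    expectation (\<lambda>\<omega>. \<bar>real_of_int (eta sigma0 n z \<omega>) - rho0 (real_of_int z / real n)\<bar> ^ 3) \<le> B"
proof -
  obtain K where K: "0 \<le> K" "\<And>n x. 1 \<le> n \<Longrightarrow> integrable M (\<lambda>\<omega>. real_of_int (eta sigma0 n x \<omega>) ^ 6)"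
    "\<And>n x. 1 \<le> n \<Longrightarrow> expectation (\<lambda>\<omega>. real_of_int (eta sigma0 n x \<omega>) ^ 6) \<le> K"
    using sixth_moment_bound by blast
  obtain G where G: "0 \<le> G" "\<And>y. \<bar>rho0 y\<bar> \<le> G" using rho0_bound by blast
  have pt: "\<bar>x - r\<bar> ^ 3 \<le> 8 * (1 + x ^ 6) + 8 * G ^ 3" if "\<bar>r\<bar> \<le> G" for x r :: real
  proof -
    have x3: "\<bar>x\<bar> ^ 3 \<le> 1 + x ^ 6"
    proof -
      have "0 \<le> (\<bar>x\<bar> ^ 3 - 1)\<^sup>2" by simp
      hence "2 * \<bar>x\<bar> ^ 3 \<le> (\<bar>x\<bar> ^ 3)\<^sup>2 + 1" by (simp add: power2_diff)
      moreover have "(\<bar>x\<bar> ^ 3)\<^sup>2 = x ^ 6" by (simp flip: power_mult add: power_even_abs)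
      moreover have "0 \<le> \<bar>x\<bar> ^ 3" by simp
      ultimately show ?thesis by linarith
    qed
    define m where "m = max \<bar>x\<bar> G"
    have "\<bar>x - r\<bar> ^ 3 \<le> (2 * m) ^ 3" unfolding m_def using that by (intro power_mono) auto
    also have "\<dots> = 8 * m ^ 3" by (simp add: power_mult_distrib)
    also have "m ^ 3 \<le> \<bar>x\<bar> ^ 3 + G ^ 3" using G(1) by (auto simp: m_def max_def)
    finally show ?thesis using x3 by simp
  qed
  have i: "integrable M (\<lambda>\<omega>. 8 * (1 + real_of_int (eta sigma0 n z \<omega>) ^ 6) + 8 * G ^ 3)" if "1 \<le> n" for n z
    by (intro Bochner_Integration.integrable_add integrable_mult_right integrable_const K(2)[OF that])
  have i3: "integrable M (\<lambda>\<omega>. \<bar>real_of_int (eta sigma0 n z \<omega>) - rho0 (real_of_int z / real n)\<bar> ^ 3)" if n: "1 \<le> n" for n z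
  proof (rule Bochner_Integration.integrable_bound[OF i[OF n]])
    note [measurable] = eta_borel_measurable[OF n]
    show "(\<lambda>\<omega>. \<bar>real_of_int (eta sigma0 n z \<omega>) - rho0 (real_of_int z / real n)\<bar> ^ 3) \<in> borel_measurable M" by simp
    show "AE \<omega> in M. norm (\<bar>real_of_int (eta sigma0 n z \<omega>) - rho0 (real_of_int z / real n)\<bar> ^ 3)
        \<le> norm (8 * (1 + real_of_int (eta sigma0 n z \<omega>) ^ 6) + 8 * G ^ 3)"
    proof (intro AE_I2)
      fix \<omega>
      have le: "norm a \<le> norm b" if "0 \<le> a" "a \<le> b" for a b :: real using that by simp
      show "norm (\<bar>real_of_int (eta sigma0 n z \<omega>) - rho0 (real_of_int z / real n)\<bar> ^ 3)
        \<le> norm (8 * (1 + real_of_int (eta sigma0 n z \<omega>) ^ 6) + 8 * G ^ 3)"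
        by (rule le[OF _ pt]) (use G in auto)
    qed
  qed
  show ?thesis
  proof (intro exI conjI allI impI)
    show "0 \<le> 8 * (1 + K) + 8 * G ^ 3" using K(1) G(1) by simp
    fix n :: nat and z assume n: "1 \<le> n"
    show "integrable M (\<lambda>\<omega>. \<bar>real_of_int (eta sigma0 n z \<omega>) - rho0 (real_of_int z / real n)\<bar> ^ 3)" by (rule i3[OF n])
    have "expectation (\<lambda>\<omega>. \<bar>real_of_int (eta sigma0 n z \<omega>) - rho0 (real_of_int z / real n)\<bar> ^ 3)
        \<le> expectation (\<lambda>\<omega>. 8 * (1 + real_of_int (eta sigma0 n z \<omega>) ^ 6) + 8 * G ^ 3)"
      by (intro integral_mono i3 i n pt G(2))
    also have "\<dots> = 8 * (1 + expectation (\<lambda>\<omega>. real_of_int (eta sigma0 n z \<omega>) ^ 6)) + 8 * G ^ 3"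
      using K(2)[OF n] by (simp add: prob_space)
    also have "\<dots> \<le> 8 * (1 + K) + 8 * G ^ 3" using K(3)[OF n, of z] by simp
    finally show "expectation (\<lambda>\<omega>. \<bar>real_of_int (eta sigma0 n z \<omega>) - rho0 (real_of_int z / real n)\<bar> ^ 3) \<le> 8 * (1 + K) + 8 * G ^ 3" .
  qed
qed

lemma eta_integrable: "1 \<le> n \<Longrightarrow> integrable M (\<lambda>\<omega>. real_of_int (eta sigma0 n z \<omega>))"
  and eta_square_integrable: "1 \<le> n \<Longrightarrow> integrable M (\<lambda>\<omega>. (real_of_int (eta sigma0 n z \<omega>))\<^sup>2)"
proof -
  assume n: "1 \<le> n"
  note [measurable] = eta_borel_measurable[OF n]
  have i: "integrable M (\<lambda>\<omega>. real_of_int (eta sigma0 n z \<omega>) ^ 6)" using sixth_moment_bound n by blast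
  have pw: "\<bar>real_of_int k\<bar> ^ m \<le> real_of_int k ^ 6" if "1 \<le> m" "m \<le> 6" for k :: int and m :: nat
  proof (cases "k = 0")
    case True thus ?thesis using that by (simp add: power_0_left)
  next
    case False
    hence "1 \<le> \<bar>real_of_int k\<bar>" by linarith
    from power_increasing[OF that(2) this] show ?thesis by (simp add: power_even_abs)
  qed
  show "integrable M (\<lambda>\<omega>. real_of_int (eta sigma0 n z \<omega>))"
    using pw[of 1] by (intro Bochner_Integration.integrable_bound[OF i]) auto
  show "integrable M (\<lambda>\<omega>. (real_of_int (eta sigma0 n z \<omega>))\<^sup>2)"
    using pw[of 2] by (intro Bochner_Integration.integrable_bound[OF i]) auto
qed

lemma centered_indep:
  assumes n: "1 \<le> n"
  shows "indep_vars (\<lambda>_. borel) (\<lambda>z \<omega>. real_of_int (eta sigma0 n z \<omega>) - rho0 (real_of_int z / real n)) S"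
  by (rule indep_vars_compose2[OF indep_vars_subset[OF eta_indep[OF n]], where Y = "\<lambda>z k. real_of_int k - rho0 (real_of_int z / real n)"]) auto

lemma V_riemann:
  assumes "1 \<le> K"
  shows "(\<lambda>n. (\<Sum>z\<in>blk n K i. v0 (real_of_int z / real n)) / real n) \<longlonglongrightarrow> (blk_sd K i)\<^sup>2"
proof -
  obtain G where "0 \<le> G" and G: "\<And>y. \<bar>v0 y\<bar> \<le> G" using v0_bound by blast
  define c where "c = V ((real_of_int i + 1) / real K) - V (real_of_int i / real K)"
  define S where "S n = (\<Sum>z\<in>blk n K i. v0 (real_of_int z / real n))" for n
  have "(\<lambda>n. (S n - real n * c) / sqrt (real n)) \<longlonglongrightarrow> 0"
    using riemann_sum_error[OF V_deriv G v0_holder, of "real_of_int i / real K" "(real_of_int i + 1) / real K"]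
    by (simp add: S_def c_def blk_start_def divide_right_mono)
  moreover have "(\<lambda>n. 1 / sqrt (real n)) \<longlonglongrightarrow> 0" by real_asymp
  ultimately have "(\<lambda>n. (S n - real n * c) / sqrt (real n) * (1 / sqrt (real n)) + c) \<longlonglongrightarrow> 0 * 0 + c"
    by (intro tendsto_add tendsto_mult tendsto_const)
  moreover have "eventually (\<lambda>n. (S n - real n * c) / sqrt (real n) * (1 / sqrt (real n)) + c = S n / real n) sequentially"
    using eventually_ge_at_top[of 1]
  proof eventually_elim
    case (elim n)
    have "sqrt (real n) * sqrt (real n) = real n" by simp
    hence "(S n - real n * c) / sqrt (real n) * (1 / sqrt (real n)) = (S n - real n * c) / real n"
      by (metis mult.right_neutral times_divide_times_eq)
    thus ?case using elim by (simp add: diff_divide_distrib)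
  qed
  ultimately have "(\<lambda>n. S n / real n) \<longlonglongrightarrow> c" using Lim_transform_eventually by fastforce
  thus ?thesis by (simp add: S_def c_def blk_sd_square)
qed

text \<open>The central limit theorem for the centred block sum; the summand that makes the
  statistic injective moves it by at most \<open>1 / sqrt n\<close> and disappears in the
  limit.\<close>

lemma blk_quantile_tendsto:
  assumes K: "1 \<le> K"
  shows "(\<lambda>n. quantile (blk_law n K i) (normal_cdf x)) \<longlonglongrightarrow> blk_sd K i * x"
proof (rule normal_quantile_tendsto[OF real_distribution_blk_law blk_sd_nonneg])
  fix t :: real
  define X where "X n z \<omega> = real_of_int (eta sigma0 n z \<omega>) - rho0 (real_of_int z / real n)" for n z \<omega>
  obtain B where B: "0 \<le> B" "\<And>n z. 1 \<le> n \<Longrightarrow> integrable M (\<lambda>\<omega>. \<bar>X n z \<omega>\<bar> ^ 3)"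
    "\<And>n z. 1 \<le> n \<Longrightarrow> expectation (\<lambda>\<omega>. \<bar>X n z \<omega>\<bar> ^ 3) \<le> B"
    unfolding X_def using centered_third_moment by blast
  define F where "F n = char (distr M borel (\<lambda>\<omega>. (\<Sum>z\<in>blk n K i. X n z \<omega>) / sqrt (real n))) t" for n
  have F: "F \<longlonglongrightarrow> of_real (exp (- (t\<^sup>2 * (blk_sd K i)\<^sup>2 / 2)))"
    unfolding F_def
  proof (rule triangular_array_char_tendsto[where B = B and C = 2])
    fix n :: nat and z :: int assume n: "1 \<le> n"
    show "indep_vars (\<lambda>_. borel) (X n) (blk n K i)" unfolding X_def by (rule centered_indep[OF n])
    show "expectation (X n z) = 0" unfolding X_def using eta_integrable[OF n] mean_eta_eq[OF n] by (simp add: prob_space)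
    have "real n / real K \<le> real n" using K by (simp add: divide_le_eq mult_le_cancel_left1)
    thus "real (card (blk n K i)) \<le> 2 * real n" using card_blk[OF K, of n i] n by linarith
  next
    have "eventually (\<lambda>n. (\<Sum>z\<in>blk n K i. v0 (real_of_int z / real n)) / real n = (\<Sum>z\<in>blk n K i. expectation (\<lambda>\<omega>. (X n z \<omega>)\<^sup>2)) / real n) sequentially"
      using eventually_ge_at_top[of 1] by eventually_elim (simp add: X_def var_eta_eq)
    from Lim_transform_eventually[OF V_riemann[OF K] this]
    show "(\<lambda>n. (\<Sum>z\<in>blk n K i. expectation (\<lambda>\<omega>. (X n z \<omega>)\<^sup>2)) / real n) \<longlonglongrightarrow> (blk_sd K i)\<^sup>2" .
  qed (use B in auto)
  have "(\<lambda>n. char (blk_law n K i) t - F n) \<longlonglongrightarrow> 0"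
  proof (rule Lim_null_comparison)
    show "(\<lambda>n. \<bar>t\<bar> * (1 / sqrt (real n))) \<longlonglongrightarrow> 0"
    proof -
      have "(\<lambda>n. 1 / sqrt (real n)) \<longlonglongrightarrow> 0" by real_asymp
      thus ?thesis by (rule tendsto_mult_right_zero)
    qed
    show "eventually (\<lambda>n. norm (char (blk_law n K i) t - F n) \<le> \<bar>t\<bar> * (1 / sqrt (real n))) sequentially"
      using eventually_ge_at_top[of 1]
    proof eventually_elim
      case (elim n)
      have [measurable]: "X n z \<in> borel_measurable M" for z
        unfolding X_def using eta_borel_measurable[OF elim] by simp
      show ?case unfolding blk_law_def F_def
      proof (rule char_perturbation[OF blk_stat_obs_measurable])
        fix \<omega>
        have "blk_stat n K i (blk_obs n K i \<omega>) = ((\<Sum>z\<in>blk n K i. X n z \<omega>) + 1 / (2 + real (to_nat (blk_obs n K i \<omega>)))) / sqrt (real n)"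
          unfolding blk_stat_def blk_obs_def sum_list_upto X_def by (simp add: sum_subtractf)
        hence "\<bar>blk_stat n K i (blk_obs n K i \<omega>) - (\<Sum>z\<in>blk n K i. X n z \<omega>) / sqrt (real n)\<bar>
          = (1 / (2 + real (to_nat (blk_obs n K i \<omega>)))) / sqrt (real n)" by (simp add: add_divide_distrib)
        also have "\<dots> \<le> 1 / sqrt (real n)" by (intro divide_right_mono) auto
        finally show "\<bar>blk_stat n K i (blk_obs n K i \<omega>) - (\<Sum>z\<in>blk n K i. X n z \<omega>) / sqrt (real n)\<bar> \<le> 1 / sqrt (real n)" .
      qed simp
    qed
  qed
  from tendsto_add[OF this F] show "(\<lambda>n. char (blk_law n K i) t) \<longlonglongrightarrow> of_real (exp (- (t\<^sup>2 * (blk_sd K i)\<^sup>2 / 2)))"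
    by simp
qed

text \<open>Pointwise convergence becomes convergence in measure under the normal law. In this form
  it can be applied to random block variables.\<close>

lemma blk_quantile_measure_tendsto:
  assumes K: "1 \<le> K" and e: "0 < e"
  shows "(\<lambda>n. measure std_normal_distribution {x. e < \<bar>quantile (blk_law n K i) (normal_cdf x) - blk_sd K i * x\<bar>}) \<longlonglongrightarrow> 0"
proof -
  define S where "S n = {x. e < \<bar>quantile (blk_law n K i) (normal_cdf x) - blk_sd K i * x\<bar>}" for n
  have [measurable]: "(\<lambda>x. quantile (blk_law n K i) (normal_cdf x)) \<in> borel_measurable borel" for n
    by (rule borel_measurable_normal_quantile[OF real_distribution_blk_law])
  have S[measurable]: "S n \<in> sets borel" for n unfolding S_def by measurable
  have "(\<lambda>n. LINT x|std_normal_distribution. indicat_real (S n) x) \<longlonglongrightarrow> (LINT x|std_normal_distribution. 0)"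
  proof (rule integral_dominated_convergence[where w = "\<lambda>_. 1"])
    show "AE x in std_normal_distribution. (\<lambda>n. indicat_real (S n) x) \<longlonglongrightarrow> 0"
    proof (intro always_eventually allI)
      fix x
      have "eventually (\<lambda>n. dist (quantile (blk_law n K i) (normal_cdf x)) (blk_sd K i * x) < e) sequentially"
        using blk_quantile_tendsto[OF K] e by (rule tendstoD)
      hence "eventually (\<lambda>n. indicat_real (S n) x = 0) sequentially"
        by eventually_elim (auto simp: S_def dist_real_def indicator_def)
      thus "(\<lambda>n. indicat_real (S n) x) \<longlonglongrightarrow> 0" by (rule tendsto_eventually)
    qed
  qed auto
  thus ?thesis by (simp add: S_def[symmetric])
qed

lemma distr_decode_blk_law:
  assumes "1 \<le> n"
  shows "distr (blk_law n K i) (count_space UNIV) (decode (blk_stat n K i) (blk_lists n K i) d) = distr M (count_space UNIV) (blk_obs n K i)"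
  unfolding blk_law_def
  by (rule distr_decode[OF blk_obs_measurable[OF assms] blk_stat_inj[OF assms] blk_obs_mem[OF assms]])

lemma AE_blk_law:
  assumes "1 \<le> n"
  shows "AE y in blk_law n K i. y \<in> blk_stat n K i ` blk_lists n K i"
proof -
  have "countable (blk_stat n K i ` blk_lists n K i)" by (intro countable_image countableI_type)
  hence "blk_stat n K i ` blk_lists n K i \<in> sets borel" by (rule sets.countable[rotated]) auto
  thus ?thesis unfolding blk_law_def using blk_obs_mem[OF assms]
    by (subst AE_distr_iff[OF blk_stat_obs_measurable]) (auto intro!: AE_I2)
qed

end

section \<open>Coupling occupation numbers with Brownian increments\<close>

lemma vector_measurable:
  assumes "\<And>i. X i \<in> borel_measurable M"
  shows "(\<lambda>\<omega> i. X i \<omega>) \<in> measurable M (Pi\<^sub>M UNIV (\<lambda>_. borel))"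
  by (rule measurable_PiM_single') (use assms in \<open>auto simp: space_PiM\<close>)

lemma reindex_measurable:
  "(\<lambda>x i. x (f i)) \<in> measurable (Pi\<^sub>M (range f) (\<lambda>_. borel)) (Pi\<^sub>M UNIV (\<lambda>_. borel :: real measure))"
  by (rule measurable_PiM_single') (auto simp: space_PiM intro!: measurable_component_singleton)

text \<open>Disjoint groups of independent coordinates are independent. Each group is renamed to a
  common index type, so that all members have the same range.\<close>

lemma (in prob_space) indep_vars_vectors:
  fixes W :: "'c \<Rightarrow> 'a \<Rightarrow> real" and f :: "'q \<Rightarrow> 'd \<Rightarrow> 'c"
  assumes W: "indep_vars (\<lambda>_. borel) W UNIV" and disj: "\<And>q r. q \<noteq> r \<Longrightarrow> range (f q) \<inter> range (f r) = {}"
  shows "indep_vars (\<lambda>_. Pi\<^sub>M UNIV (\<lambda>_. borel)) (\<lambda>q \<omega> d. W (f q d) \<omega>) UNIV"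
proof -
  have "indep_vars (\<lambda>q. Pi\<^sub>M (range (f q)) (\<lambda>_. borel)) (\<lambda>q \<omega>. restrict (\<lambda>i. W i \<omega>) (range (f q))) UNIV"
    by (rule indep_vars_restrict[OF W]) (use disj in \<open>auto simp: disjoint_family_on_def\<close>)
  from indep_vars_compose2[OF this, where Y = "\<lambda>q x d. x (f q d)" and N = "\<lambda>_. Pi\<^sub>M UNIV (\<lambda>_. borel)", OF reindex_measurable]
  show ?thesis by simp
qed

lemma (in prob_space) indep_rv_vectors:
  fixes W :: "'c \<Rightarrow> 'a \<Rightarrow> real"
  assumes W: "indep_vars (\<lambda>_. borel) W UNIV" and disj: "range f \<inter> range g = {}"
  shows "indep_rv M (Pi\<^sub>M UNIV (\<lambda>_. borel)) (\<lambda>\<omega> i. W (f i) \<omega>) (Pi\<^sub>M UNIV (\<lambda>_. borel)) (\<lambda>\<omega> i. W (g i) \<omega>)"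
proof -
  have "indep_var (Pi\<^sub>M (range f) (\<lambda>_. borel)) (\<lambda>\<omega>. restrict (\<lambda>i. W i \<omega>) (range f))
      (Pi\<^sub>M (range g) (\<lambda>_. borel)) (\<lambda>\<omega>. restrict (\<lambda>i. W i \<omega>) (range g))"
    using indep_var_restrict[OF W disj] by simp
  hence "indep_rv M (Pi\<^sub>M (range f) (\<lambda>_. borel)) (\<lambda>\<omega>. restrict (\<lambda>i. W i \<omega>) (range f))
      (Pi\<^sub>M (range g) (\<lambda>_. borel)) (\<lambda>\<omega>. restrict (\<lambda>i. W i \<omega>) (range g))"
    by (simp add: indep_rv_def indep_var_eq)
  from indep_rv_compose[OF this reindex_measurable reindex_measurable] show ?thesis by simp
qed

lemma (in prob_space) indep_vars_reindex:
  fixes W :: "'c \<Rightarrow> 'a \<Rightarrow> real"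
  assumes W: "indep_vars (\<lambda>_. borel) W UNIV" and "inj f"
  shows "indep_vars (\<lambda>_. borel) (\<lambda>i. W (f i)) UNIV"
proof -
  have "indep_vars (\<lambda>_. Pi\<^sub>M UNIV (\<lambda>_. borel)) (\<lambda>q \<omega> (d::unit). W (f q) \<omega>) UNIV"
    by (rule indep_vars_vectors[OF W]) (use \<open>inj f\<close> in \<open>auto dest: injD\<close>)
  thus ?thesis by (rule indep_vars_compose2[where Y = "\<lambda>q x. x ()"]) (auto intro!: measurable_component_singleton)
qed

lemma (in prob_space) conv_in_prob_add:
  assumes X: "conv_in_prob M X Z" and Y: "conv_in_prob M Y W" and [measurable]: "Z \<in> borel_measurable M" "W \<in> borel_measurable M"
  shows "conv_in_prob M (\<lambda>n \<omega>. X n \<omega> + Y n \<omega>) (\<lambda>\<omega>. Z \<omega> + W \<omega>)"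
proof -
  have ev: "eventually (\<lambda>n. X n \<in> borel_measurable M \<and> Y n \<in> borel_measurable M) sequentially"
    using X Y by (auto simp: conv_in_prob_def intro: eventually_conj)
  then obtain N0 where N0: "\<And>n. N0 \<le> n \<Longrightarrow> X n \<in> borel_measurable M" "\<And>n. N0 \<le> n \<Longrightarrow> Y n \<in> borel_measurable M"
    by (auto simp: eventually_sequentially)
  show ?thesis
  proof (rule conv_in_prob_boundI[of N0])
    show "(\<lambda>\<omega>. X n \<omega> + Y n \<omega>) \<in> borel_measurable M" if "N0 \<le> n" for n using N0[OF that] by simp
    fix e :: real assume e: "0 < e"
    define g where "g n = prob {\<omega>\<in>space M. e / 2 < \<bar>X n \<omega> - Z \<omega>\<bar>} + prob {\<omega>\<in>space M. e / 2 < \<bar>Y n \<omega> - W \<omega>\<bar>}" for n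
    have "g \<longlonglongrightarrow> 0 + 0" unfolding g_def
    proof (intro tendsto_add)
      have e2: "0 < e / 2" using e by simp
      show "(\<lambda>n. prob {\<omega>\<in>space M. e / 2 < \<bar>X n \<omega> - Z \<omega>\<bar>}) \<longlonglongrightarrow> 0" using X e2 unfolding conv_in_prob_def by blast
      show "(\<lambda>n. prob {\<omega>\<in>space M. e / 2 < \<bar>Y n \<omega> - W \<omega>\<bar>}) \<longlonglongrightarrow> 0" using Y e2 unfolding conv_in_prob_def by blast
    qed
    moreover have "eventually (\<lambda>n. prob {\<omega>\<in>space M. e < \<bar>X n \<omega> + Y n \<omega> - (Z \<omega> + W \<omega>)\<bar>} \<le> g n) sequentially"
      using ev
    proof eventually_elim
      case (elim n)
      hence [measurable]: "X n \<in> borel_measurable M" "Y n \<in> borel_measurable M" by auto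
      have "prob {\<omega>\<in>space M. e < \<bar>X n \<omega> + Y n \<omega> - (Z \<omega> + W \<omega>)\<bar>}
        \<le> prob ({\<omega>\<in>space M. e / 2 < \<bar>X n \<omega> - Z \<omega>\<bar>} \<union> {\<omega>\<in>space M. e / 2 < \<bar>Y n \<omega> - W \<omega>\<bar>})"
      proof (rule finite_measure_mono)
        have "e / 2 < \<bar>X n \<omega> - Z \<omega>\<bar> \<or> e / 2 < \<bar>Y n \<omega> - W \<omega>\<bar>" if "e < \<bar>X n \<omega> + Y n \<omega> - (Z \<omega> + W \<omega>)\<bar>" for \<omega>
          using that by linarith
        thus "{\<omega>\<in>space M. e < \<bar>X n \<omega> + Y n \<omega> - (Z \<omega> + W \<omega>)\<bar>}
          \<subseteq> {\<omega>\<in>space M. e / 2 < \<bar>X n \<omega> - Z \<omega>\<bar>} \<union> {\<omega>\<in>space M. e / 2 < \<bar>Y n \<omega> - W \<omega>\<bar>}" by blast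
      qed measurable
      also have "\<dots> \<le> g n" unfolding g_def by (rule measure_Un_le) measurable
      finally show ?case .
    qed
    ultimately show "\<exists>g. g \<longlonglongrightarrow> 0 \<and> (\<forall>\<^sub>F n in sequentially. prob {\<omega>\<in>space M. e < \<bar>X n \<omega> + Y n \<omega> - (Z \<omega> + W \<omega>)\<bar>} \<le> g n)"
      by auto
  qed
qed

lemma (in prob_space) conv_in_prob_pointwise:
  assumes X: "\<And>n. X n \<in> borel_measurable M" and [measurable]: "Z \<in> borel_measurable M"
    and lim: "\<And>\<omega>. \<omega> \<in> space M \<Longrightarrow> (\<lambda>n. X n \<omega>) \<longlonglongrightarrow> Z \<omega>"
  shows "conv_in_prob M X Z"
  unfolding conv_in_prob_def
proof (intro conjI allI impI)
  note [measurable] = X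
  show "eventually (\<lambda>n. X n \<in> borel_measurable M) sequentially" by simp
  fix e :: real assume e: "0 < e"
  define S where "S n = {\<omega>\<in>space M. e < \<bar>X n \<omega> - Z \<omega>\<bar>}" for n
  have [measurable]: "S n \<in> sets M" for n unfolding S_def by measurable
  have "(\<lambda>n. LINT \<omega>|M. indicat_real (S n) \<omega>) \<longlonglongrightarrow> (LINT \<omega>|M. 0)"
  proof (rule integral_dominated_convergence[where w = "\<lambda>_. 1"])
    show "AE \<omega> in M. (\<lambda>n. indicat_real (S n) \<omega>) \<longlonglongrightarrow> 0"
    proof (rule AE_I2)
      fix \<omega> assume "\<omega> \<in> space M"
      from tendstoD[OF lim[OF this] e] have "eventually (\<lambda>n. indicat_real (S n) \<omega> = 0) sequentially"
        by eventually_elim (auto simp: S_def dist_real_def indicator_def)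
      thus "(\<lambda>n. indicat_real (S n) \<omega>) \<longlonglongrightarrow> 0" by (rule tendsto_eventually)
    qed
  qed auto
  moreover have "(LINT \<omega>|M. indicat_real (S n) \<omega>) = prob (S n)" for n by simp
  ultimately show "(\<lambda>n. prob {\<omega>\<in>space M. e < \<bar>X n \<omega> - Z \<omega>\<bar>}) \<longlonglongrightarrow> 0" by (simp add: S_def)
qed

section \<open>Normalized Brownian increments on a grid\<close>

text \<open>Where the grid times coincide there is nothing to normalize, yet the block still needs a
  normal variable to generate its occupation numbers; the auxiliary array \<open>a\<close> supplies
  it.\<close>

definition unit_increment :: "(int \<Rightarrow> real) \<Rightarrow> (nat \<times> int \<Rightarrow> real) \<Rightarrow> (nat \<times> int \<Rightarrow> real) \<Rightarrow> int \<Rightarrow> real" where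
  "unit_increment ts z a i = (if ts i < ts (i + 1)
     then (bm_path z (ts (i + 1)) - bm_path z (ts i)) / sqrt (ts (i + 1) - ts i) else a (0, i))"

locale normal_pair = normal_array M Z for M :: "'a measure" and Z +
  fixes A :: "nat \<times> int \<Rightarrow> 'a \<Rightarrow> real"
  assumes A: "normal_array M A"
    and ZA_indep: "indep_rv M (Pi\<^sub>M UNIV (\<lambda>_. borel)) (\<lambda>\<omega> i. Z i \<omega>) (Pi\<^sub>M UNIV (\<lambda>_. borel)) (\<lambda>\<omega> i. A i \<omega>)"
begin

definition increment :: "(int \<Rightarrow> real) \<Rightarrow> int \<Rightarrow> 'a \<Rightarrow> real" where
  "increment ts i \<omega> = unit_increment ts (\<lambda>i. Z i \<omega>) (\<lambda>i. A i \<omega>) i"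

lemma increment_measurable[measurable]: "increment ts i \<in> borel_measurable M"
proof -
  interpret A: normal_array M A by (rule A)
  have "increment ts i = (if ts i < ts (i + 1) then (\<lambda>\<omega>. (bm (ts (i + 1)) \<omega> - bm (ts i) \<omega>) / sqrt (ts (i + 1) - ts i)) else A (0, i))"
    by (auto simp: fun_eq_iff increment_def unit_increment_def bm_def)
  thus ?thesis by simp
qed

lemma bm_increment_eq:
  assumes "mono ts"
  shows "bm (ts (i + 1)) \<omega> - bm (ts i) \<omega> = sqrt (ts (i + 1) - ts i) * increment ts i \<omega>"
proof -
  have "ts i \<le> ts (i + 1)" using assms by (simp add: mono_def)
  thus ?thesis by (cases "ts i = ts (i + 1)") (auto simp: increment_def unit_increment_def bm_def)
qed

text \<open>\<open>J1\<close> collects the indices where time advances and \<open>J2\<close> those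
  where it stands still. The two parts come from the independent arrays \<open>Z\<close> and
  \<open>A\<close>, so their characteristic functions multiply, and each is standard normal after
  rescaling.\<close>

lemma char_increments:
  assumes J: "finite J" and ts: "mono ts"
  shows "(CLINT \<omega>|M. iexp (\<Sum>j\<in>J. u j * increment ts j \<omega>)) = complex_of_real (exp (- (\<Sum>j\<in>J. (u j)\<^sup>2) / 2))"
proof -
  interpret A: normal_array M A by (rule A)
  define J1 J2 where "J1 = {j\<in>J. ts j < ts (j + 1)}" and "J2 = {j\<in>J. \<not> ts j < ts (j + 1)}"
  have fin: "finite J1" "finite J2" and Jeq: "J = J1 \<union> J2" "J1 \<inter> J2 = {}" using J by (auto simp: J1_def J2_def)
  define s where "s j = sqrt (ts (j + 1) - ts j)" for j
  have s: "0 < s j" "(s j)\<^sup>2 = ts (j + 1) - ts j" if "j \<in> J1" for j using that by (auto simp: s_def J1_def)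
  define f where "f z = (\<Sum>j\<in>J1. u j / s j * (bm_path z (ts (j + 1)) - bm_path z (ts j)))" for z
  define g where "g a = (\<Sum>j\<in>J2. u j * a (0, j))" for a :: "nat \<times> int \<Rightarrow> real"
  have f: "f \<in> borel_measurable (Pi\<^sub>M UNIV (\<lambda>_. borel))" unfolding f_def[abs_def] by measurable
  have [measurable]: "(\<lambda>a::nat \<times> int \<Rightarrow> real. a i) \<in> borel_measurable (Pi\<^sub>M UNIV (\<lambda>_. borel))" for i
    by (rule measurable_component_singleton) simp
  have g: "g \<in> borel_measurable (Pi\<^sub>M UNIV (\<lambda>_. borel))" unfolding g_def[abs_def] by measurable
  define F G where "F \<omega> = f (\<lambda>i. Z i \<omega>)" and "G \<omega> = g (\<lambda>i. A i \<omega>)" for \<omega>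
  have ind: "indep_rv M borel F borel G" unfolding F_def G_def by (rule indep_rv_compose[OF ZA_indep f g])
  hence iv: "indep_var borel F borel G" by (simp add: indep_rv_def indep_var_eq)
  have [measurable]: "F \<in> borel_measurable M" "G \<in> borel_measurable M" using ind by (auto simp: indep_rv_def)
  have "(\<Sum>j\<in>J. u j * increment ts j \<omega>) = F \<omega> + G \<omega>" for \<omega>
  proof -
    have "(\<Sum>j\<in>J. u j * increment ts j \<omega>) = (\<Sum>j\<in>J1. u j * increment ts j \<omega>) + (\<Sum>j\<in>J2. u j * increment ts j \<omega>)"
      unfolding Jeq(1) by (rule sum.union_disjoint[OF fin Jeq(2)])
    also have "(\<Sum>j\<in>J1. u j * increment ts j \<omega>) = F \<omega>" unfolding F_def f_def
      by (intro sum.cong) (auto simp: J1_def increment_def unit_increment_def s_def)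
    also have "(\<Sum>j\<in>J2. u j * increment ts j \<omega>) = G \<omega>" unfolding G_def g_def
      by (intro sum.cong) (auto simp: J2_def increment_def unit_increment_def)
    finally show ?thesis .
  qed
  hence "(CLINT \<omega>|M. iexp (\<Sum>j\<in>J. u j * increment ts j \<omega>)) = char (distr M borel (\<lambda>\<omega>. F \<omega> + G \<omega>)) 1"
    unfolding char_def by (simp add: integral_distr)
  also have "\<dots> = char (distr M borel F) 1 * char (distr M borel G) 1" by (rule char_distr_add[OF iv])
  also have "char (distr M borel F) 1 = (CLINT \<omega>|M. iexp (F \<omega>))" unfolding char_def by (simp add: integral_distr)
  also have "\<dots> = complex_of_real (exp (- (\<Sum>j\<in>J1. (u j / s j)\<^sup>2 * (ts (j + 1) - ts j)) / 2))"
    unfolding F_def f_def bm_def[symmetric] by (rule char_bm_increments[OF fin(1) ts])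
  also have "(\<Sum>j\<in>J1. (u j / s j)\<^sup>2 * (ts (j + 1) - ts j)) = (\<Sum>j\<in>J1. (u j)\<^sup>2)"
  proof (intro sum.cong refl)
    fix j assume j: "j \<in> J1"
    have "(u j / s j)\<^sup>2 * (s j)\<^sup>2 = (u j)\<^sup>2" using s(1)[OF j] by (simp add: power_divide)
    thus "(u j / s j)\<^sup>2 * (ts (j + 1) - ts j) = (u j)\<^sup>2" by (simp only: s(2)[OF j])
  qed
  also have "char (distr M borel G) 1 = (CLINT \<omega>|M. iexp (G \<omega>))" unfolding char_def by (simp add: integral_distr)
  also have "\<dots> = (CLINT \<omega>|M. iexp (\<Sum>x\<in>Pair 0 ` J2. u (snd x) * A x \<omega>))"
    unfolding G_def g_def by (subst sum.reindex) (auto simp: inj_on_def)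
  also have "\<dots> = complex_of_real (exp (- (\<Sum>x\<in>Pair (0::nat) ` J2. (u (snd x))\<^sup>2) / 2))"
    using fin by (intro A.char_linear_combination) auto
  also have "(\<Sum>x\<in>Pair (0::nat) ` J2. (u (snd x))\<^sup>2) = (\<Sum>j\<in>J2. (u j)\<^sup>2)" by (subst sum.reindex) (auto simp: inj_on_def)
  also have "complex_of_real (exp (- (\<Sum>j\<in>J1. (u j)\<^sup>2) / 2)) * complex_of_real (exp (- (\<Sum>j\<in>J2. (u j)\<^sup>2) / 2))
      = complex_of_real (exp (- ((\<Sum>j\<in>J1. (u j)\<^sup>2) + (\<Sum>j\<in>J2. (u j)\<^sup>2)) / 2))"
    unfolding of_real_mult[symmetric] exp_add[symmetric] by (simp add: add_divide_distrib)
  also have "(\<Sum>j\<in>J1. (u j)\<^sup>2) + (\<Sum>j\<in>J2. (u j)\<^sup>2) = (\<Sum>j\<in>J. (u j)\<^sup>2)"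
    unfolding Jeq(1) by (rule sum.union_disjoint[OF fin Jeq(2), symmetric])
  finally show ?thesis .
qed

lemma distr_increment: "mono ts \<Longrightarrow> distr M borel (increment ts i) = std_normal_distribution"
proof (rule Levy_uniqueness)
  assume ts: "mono ts"
  show "char (distr M borel (increment ts i)) = char std_normal_distribution"
  proof
    fix t
    have "char (distr M borel (increment ts i)) t = (CLINT \<omega>|M. iexp (\<Sum>j\<in>{i}. t * increment ts j \<omega>))"
      unfolding char_def by (simp add: integral_distr)
    also have "\<dots> = char std_normal_distribution t"
      by (subst char_increments[OF _ ts]) (simp_all add: char_std_normal_distribution)
    finally show "char (distr M borel (increment ts i)) t = char std_normal_distribution t" .
  qed
qed (simp_all add: real_dist_normal_dist)

lemma indep_increment:
  assumes ts: "mono ts" shows "indep_vars (\<lambda>_. borel) (increment ts) UNIV"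
proof -
  have "indep_vars (\<lambda>_. borel) (increment ts) J" if J: "finite J" for J
  proof (rule indep_vars_if_char_factor[OF J])
    fix u
    have single: "(CLINT \<omega>|M. iexp (u j * increment ts j \<omega>)) = complex_of_real (exp (- (u j)\<^sup>2 / 2))" for j
      using char_increments[OF _ ts, of "{j}" u] by simp
    show "(CLINT \<omega>|M. iexp (\<Sum>i\<in>J. u i * increment ts i \<omega>)) = (\<Prod>i\<in>J. CLINT \<omega>|M. iexp (u i * increment ts i \<omega>))"
      unfolding single char_increments[OF J ts] of_real_prod[symmetric]
      by (simp add: exp_sum[OF J, symmetric] sum_negf sum_divide_distrib)
  qed simp
  thus ?thesis unfolding indep_vars_def2 by (subst indep_sets_finite_index_sets) auto
qed

end

section \<open>Occupation numbers rebuilt from normal variables\<close>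

context example
begin

text \<open>Ceiling minus 1 rather than floor, because blocks are open on the left.\<close>

definition blk_idx :: "nat \<Rightarrow> nat \<Rightarrow> int \<Rightarrow> int" where
  "blk_idx n K z = \<lceil>real_of_int z * real K / real n\<rceil> - 1"

lemma mem_blk_iff:
  assumes n: "1 \<le> n" and K: "1 \<le> K"
  shows "z \<in> blk n K i \<longleftrightarrow> blk_idx n K z = i"
proof -
  have "z \<in> blk n K i \<longleftrightarrow> real n * (real_of_int i / real K) < real_of_int z \<and> real_of_int z \<le> real n * (real_of_int (i + 1) / real K)"
    unfolding blk_start_def greaterThanAtMost_iff floor_less_iff le_floor_iff ..
  also have "\<dots> \<longleftrightarrow> real_of_int i < real_of_int z * real K / real n \<and> real_of_int z * real K / real n \<le> real_of_int (i + 1)"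
    using n K by (simp add: field_simps)
  also have "\<dots> \<longleftrightarrow> \<lceil>real_of_int z * real K / real n\<rceil> = i + 1" by (simp add: ceiling_eq_iff)
  finally show ?thesis by (auto simp: blk_idx_def)
qed

text \<open>Normal variable, uniform variable, block statistic, list of occupation numbers. The
  default list of zeros has the right length and sign, so every value is an admissible list.\<close>

definition blk_vec :: "nat \<Rightarrow> nat \<Rightarrow> int \<Rightarrow> real \<Rightarrow> int list" where
  "blk_vec n K i y = decode (blk_stat n K i) (blk_lists n K i) (replicate (nat (blk_start n K (i + 1) - blk_start n K i)) 0)
     (quantile (blk_law n K i) (normal_cdf y))"

text \<open>The list of a block begins at the site after \<open>blk_start\<close>, hence the offset
  1 in the position.\<close>

definition blk_eta :: "nat \<Rightarrow> nat \<Rightarrow> (int \<Rightarrow> real) \<Rightarrow> int \<Rightarrow> int" where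
  "blk_eta n K c z = blk_vec n K (blk_idx n K z) (c (blk_idx n K z)) ! nat (z - blk_start n K (blk_idx n K z) - 1)"

lemma blk_vec_mem: "blk_vec n K i y \<in> blk_lists n K i"
  unfolding blk_vec_def by (rule decode_mem) (simp add: blk_lists_def)

lemma blk_vec_measurable[measurable]: "blk_vec n K i \<in> measurable borel (count_space UNIV)"
  unfolding blk_vec_def[abs_def]
  by (rule measurable_compose[OF borel_measurable_normal_quantile[OF real_distribution_blk_law] decode_measurable])

lemma distr_blk_vec:
  assumes "1 \<le> n"
  shows "distr std_normal_distribution (count_space UNIV) (blk_vec n K i) = distr M (count_space UNIV) (blk_obs n K i)"
proof -
  let ?q = "\<lambda>y. quantile (blk_law n K i) (normal_cdf y)"
  let ?d = "decode (blk_stat n K i) (blk_lists n K i) (replicate (nat (blk_start n K (i + 1) - blk_start n K i)) 0)"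
  note [measurable] = borel_measurable_normal_quantile[OF real_distribution_blk_law]
  have "distr M (count_space UNIV) (blk_obs n K i) = distr (distr std_normal_distribution borel ?q) (count_space UNIV) ?d"
    unfolding distr_normal_quantile[OF real_distribution_blk_law] distr_decode_blk_law[OF assms] ..
  also have "\<dots> = distr std_normal_distribution (count_space UNIV) (?d \<circ> ?q)" by (rule distr_distr) simp_all
  also have "?d \<circ> ?q = blk_vec n K i" by (simp add: fun_eq_iff blk_vec_def)
  finally show ?thesis ..
qed

text \<open>The quantile has the law of the block statistic and so almost surely falls into the
  countable set of attained values, where decoding is inverted exactly.\<close>

lemma AE_blk_vec:
  assumes "1 \<le> n"
  shows "AE y in std_normal_distribution. blk_stat n K i (blk_vec n K i y) = quantile (blk_law n K i) (normal_cdf y)"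
proof -
  note [measurable] = borel_measurable_normal_quantile[OF real_distribution_blk_law]
  have "AE y in distr std_normal_distribution borel (\<lambda>y. quantile (blk_law n K i) (normal_cdf y)). y \<in> blk_stat n K i ` blk_lists n K i"
    unfolding distr_normal_quantile[OF real_distribution_blk_law] by (rule AE_blk_law[OF assms])
  hence "AE y in std_normal_distribution. quantile (blk_law n K i) (normal_cdf y) \<in> blk_stat n K i ` blk_lists n K i"
    by (rule AE_distrD[rotated]) simp
  thus ?thesis by eventually_elim (simp add: blk_vec_def decode_inverse)
qed

lemma sum_blk_eta:
  assumes n: "1 \<le> n" and K: "1 \<le> K"
  shows "(\<Sum>z\<in>blk n K i. blk_eta n K c z) = sum_list (blk_vec n K i (c i))"
proof -
  define a b l where "a = blk_start n K i" and "b = blk_start n K (i + 1)" and "l = blk_vec n K i (c i)"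
  have "length l = nat (b - a)" using blk_vec_mem[of n K i "c i"] by (simp add: blk_lists_def a_def b_def l_def)
  hence "l = map (\<lambda>z. l ! nat (z - a - 1)) [a + 1..b]" by (intro nth_equalityI) auto
  hence "sum_list l = (\<Sum>z\<in>{a<..b}. l ! nat (z - a - 1))" using sum_list_upto[of "\<lambda>z. l ! nat (z - a - 1)" a b] by argo
  also have "\<dots> = (\<Sum>z\<in>{a<..b}. blk_eta n K c z)"
    using mem_blk_iff[OF n K] by (intro sum.cong refl) (simp add: blk_eta_def a_def b_def l_def)
  finally show ?thesis by (simp add: a_def b_def l_def)
qed

lemma blk_nth_index:
  assumes "z \<in> blk n K i"
  shows "nat (z - blk_start n K i - 1) < nat (blk_start n K (i + 1) - blk_start n K i)"
  using assms by auto

lemma blk_obs_nth: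
  assumes "z \<in> blk n K i"
  shows "blk_obs n K i \<omega> ! nat (z - blk_start n K i - 1) = eta sigma0 n z \<omega>"
  unfolding blk_obs_def using assms by (subst nth_map) auto

lemma blk_eta_nonneg:
  assumes n: "1 \<le> n" and K: "1 \<le> K"
  shows "0 \<le> blk_eta n K c z"
proof -
  have "z \<in> blk n K (blk_idx n K z)" using mem_blk_iff[OF n K] by simp
  thus ?thesis using blk_vec_mem[of n K "blk_idx n K z" "c (blk_idx n K z)"] blk_nth_index
    unfolding blk_eta_def blk_lists_def by auto
qed

end

text \<open>One fixed \<open>n\<close> and \<open>K\<close>. The driving variables
  \<open>chi\<close> are abstract; the rebuilt occupation numbers live on \<open>N\<close>, the
  originals on \<open>M\<close>.\<close>

locale block_coupling = example M sigma0 u0 rho0 v0 + N: prob_space N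
  for M :: "'a measure" and sigma0 u0 rho0 v0 and N :: "'b measure" +
  fixes n K :: nat and chi :: "int \<Rightarrow> 'b \<Rightarrow> real"
  assumes n: "1 \<le> n" and K: "1 \<le> K"
    and chi_indep: "N.indep_vars (\<lambda>_. borel) chi UNIV"
    and chi_distr: "\<And>i. distr N borel (chi i) = std_normal_distribution"
begin

lemma chi_measurable[measurable]: "chi i \<in> borel_measurable N"
  using chi_indep unfolding N.indep_vars_def2 by blast

abbreviation new_eta :: "int \<Rightarrow> 'b \<Rightarrow> int" where
  "new_eta z \<omega> \<equiv> blk_eta n K (\<lambda>i. chi i \<omega>) z"

lemma new_vec_measurable: "(\<lambda>\<omega>. blk_vec n K i (chi i \<omega>)) \<in> measurable N (count_space UNIV)"
  by (rule measurable_compose[OF chi_measurable blk_vec_measurable])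

lemma new_eta_measurable: "new_eta z \<in> measurable N (count_space UNIV)"
  unfolding blk_eta_def by (rule measurable_compose[OF new_vec_measurable]) simp

lemma prob_new_vec: "N.prob {\<omega>\<in>space N. blk_vec n K i (chi i \<omega>) \<in> E} = prob {\<omega>\<in>space M. blk_obs n K i \<omega> \<in> E}"
proof -
  have "distr N (count_space UNIV) (\<lambda>\<omega>. blk_vec n K i (chi i \<omega>)) = distr (distr N borel (chi i)) (count_space UNIV) (blk_vec n K i)"
    by (subst distr_distr) (auto simp: comp_def)
  also have "\<dots> = distr M (count_space UNIV) (blk_obs n K i)" unfolding chi_distr by (rule distr_blk_vec[OF n])
  finally have eq: "distr N (count_space UNIV) (\<lambda>\<omega>. blk_vec n K i (chi i \<omega>)) = distr M (count_space UNIV) (blk_obs n K i)" .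
  have "N.prob {\<omega>\<in>space N. blk_vec n K i (chi i \<omega>) \<in> E} = measure (distr N (count_space UNIV) (\<lambda>\<omega>. blk_vec n K i (chi i \<omega>))) E"
    by (subst measure_distr[OF new_vec_measurable]) (auto intro!: arg_cong[where f = "measure N"])
  also have "\<dots> = prob {\<omega>\<in>space M. blk_obs n K i \<omega> \<in> E}"
    unfolding eq by (subst measure_distr[OF blk_obs_measurable[OF n]]) (auto intro!: arg_cong[where f = "measure M"])
  finally show ?thesis .
qed

text \<open>Within a block the whole list has the law of the original list, so any joint event at
  sites of that block keeps its probability.\<close>

lemma prob_new_eta_block:
  assumes J: "\<And>z. z \<in> J \<Longrightarrow> blk_idx n K z = i"
  shows "N.prob {\<omega>\<in>space N. \<forall>z\<in>J. new_eta z \<omega> \<in> B z} = prob {\<omega>\<in>space M. \<forall>z\<in>J. eta sigma0 n z \<omega> \<in> B z}"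
proof -
  define E where "E = {l. \<forall>z\<in>J. l ! nat (z - blk_start n K i - 1) \<in> B z}"
  have "{\<omega>\<in>space N. \<forall>z\<in>J. new_eta z \<omega> \<in> B z} = {\<omega>\<in>space N. blk_vec n K i (chi i \<omega>) \<in> E}"
    using J by (auto simp: E_def blk_eta_def)
  moreover have "{\<omega>\<in>space M. \<forall>z\<in>J. eta sigma0 n z \<omega> \<in> B z} = {\<omega>\<in>space M. blk_obs n K i \<omega> \<in> E}"
  proof -
    have "blk_obs n K i \<omega> ! nat (z - blk_start n K i - 1) = eta sigma0 n z \<omega>" if "z \<in> J" for z \<omega>
      using J[OF that] mem_blk_iff[OF n K] by (intro blk_obs_nth) simp
    thus ?thesis by (auto simp: E_def)
  qed
  ultimately show ?thesis by (simp only: prob_new_vec)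
qed

lemma prob_new_eta: "N.prob {\<omega>\<in>space N. new_eta z \<omega> \<in> B} = prob {\<omega>\<in>space M. eta sigma0 n z \<omega> \<in> B}"
  using prob_new_eta_block[of "{z}" "blk_idx n K z" "\<lambda>_. B"] by simp

lemma distr_new_eta: "distr N (count_space UNIV) (new_eta z) = distr M (count_space UNIV) (eta sigma0 n z)"
proof (rule measure_eqI)
  fix B :: "int set"
  show "emeasure (distr N (count_space UNIV) (new_eta z)) B = emeasure (distr M (count_space UNIV) (eta sigma0 n z)) B"
    using prob_new_eta[of z B]
    by (simp add: emeasure_distr new_eta_measurable eta_count_measurable[OF n] N.emeasure_eq_measure emeasure_eq_measure
        vimage_def Int_def conj_commute)
qed simp

lemma prob_eta_Int:
  assumes "finite J"
  shows "prob {\<omega>\<in>space M. \<forall>z\<in>J. eta sigma0 n z \<omega> \<in> B z} = (\<Prod>z\<in>J. prob {\<omega>\<in>space M. eta sigma0 n z \<omega> \<in> B z})"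
proof (cases "J = {}")
  case True thus ?thesis by (simp add: prob_space)
next
  case False
  have "prob (\<Inter>z\<in>J. eta sigma0 n z -` B z \<inter> space M) = (\<Prod>z\<in>J. prob (eta sigma0 n z -` B z \<inter> space M))"
    using eta_indep[OF n] False assms unfolding indep_vars_def2 by (intro indep_setsD[where I = UNIV]) auto
  moreover have "(\<Inter>z\<in>J. eta sigma0 n z -` B z \<inter> space M) = {\<omega>\<in>space M. \<forall>z\<in>J. eta sigma0 n z \<omega> \<in> B z}" using False by auto
  ultimately show ?thesis by (simp add: vimage_def Int_def conj_commute)
qed

lemma new_vec_indep: "N.indep_vars (\<lambda>_. count_space UNIV) (\<lambda>i \<omega>. blk_vec n K i (chi i \<omega>)) UNIV"
  by (rule N.indep_vars_compose2[OF chi_indep blk_vec_measurable])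

text \<open>Sites of different blocks are independent because the variables \<open>chi\<close> are;
  within a block independence is inherited from the original occupation numbers. Grouping the sites
  of \<open>J\<close> by block combines the two.\<close>

lemma new_eta_indep: "N.indep_vars (\<lambda>_. count_space UNIV) new_eta UNIV"
  unfolding N.indep_vars_def2
proof (intro conjI ballI N.indep_setsI)
  show "new_eta z \<in> measurable N (count_space UNIV)" for z by (rule new_eta_measurable)
  show "{new_eta z -` B \<inter> space N |B. B \<in> sets (count_space UNIV)} \<subseteq> sets N" for z
    using measurable_sets[OF new_eta_measurable] by auto
  fix A J assume J: "J \<noteq> {}" "finite J" and "\<forall>z\<in>J. A z \<in> {new_eta z -` B \<inter> space N |B. B \<in> sets (count_space UNIV)}"
  then obtain B where B: "\<And>z. z \<in> J \<Longrightarrow> A z = new_eta z -` B z \<inter> space N" by (auto dest!: bchoice)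
  define I where "I = blk_idx n K ` J"
  define L where "L i = {z\<in>J. blk_idx n K z = i}" for i
  define E where "E i = {l. \<forall>z\<in>L i. l ! nat (z - blk_start n K i - 1) \<in> B z}" for i
  have fin: "finite (L i)" for i using J by (simp add: L_def)
  have "(\<Inter>z\<in>J. A z) = (\<Inter>i\<in>I. (\<lambda>\<omega>. blk_vec n K i (chi i \<omega>)) -` E i \<inter> space N)"
  proof -
    have "(\<Inter>z\<in>J. A z) = {\<omega>\<in>space N. \<forall>z\<in>J. new_eta z \<omega> \<in> B z}" using J B by auto
    also have "\<dots> = {\<omega>\<in>space N. \<forall>i\<in>I. blk_vec n K i (chi i \<omega>) \<in> E i}"
      by (auto simp: I_def E_def L_def blk_eta_def)
    also have "\<dots> = (\<Inter>i\<in>I. (\<lambda>\<omega>. blk_vec n K i (chi i \<omega>)) -` E i \<inter> space N)" using J by (auto simp: I_def)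
    finally show ?thesis .
  qed
  also have "N.prob \<dots> = (\<Prod>i\<in>I. N.prob ((\<lambda>\<omega>. blk_vec n K i (chi i \<omega>)) -` E i \<inter> space N))"
    using new_vec_indep J unfolding N.indep_vars_def2 by (intro N.indep_setsD[where I = UNIV]) (auto simp: I_def)
  also have "\<dots> = (\<Prod>i\<in>I. \<Prod>z\<in>L i. N.prob (A z))"
  proof (rule prod.cong[OF refl])
    fix i assume "i \<in> I"
    have "(\<lambda>\<omega>. blk_vec n K i (chi i \<omega>)) -` E i \<inter> space N = {\<omega>\<in>space N. \<forall>z\<in>L i. new_eta z \<omega> \<in> B z}"
      by (auto simp: E_def L_def blk_eta_def)
    hence "N.prob ((\<lambda>\<omega>. blk_vec n K i (chi i \<omega>)) -` E i \<inter> space N) = prob {\<omega>\<in>space M. \<forall>z\<in>L i. eta sigma0 n z \<omega> \<in> B z}"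
      using prob_new_eta_block[of "L i" i B] by (simp add: L_def)
    also have "\<dots> = (\<Prod>z\<in>L i. prob {\<omega>\<in>space M. eta sigma0 n z \<omega> \<in> B z})" by (rule prob_eta_Int[OF fin])
    also have "\<dots> = (\<Prod>z\<in>L i. N.prob (A z))"
    proof (rule prod.cong[OF refl])
      fix z assume "z \<in> L i"
      hence "A z = {\<omega>\<in>space N. new_eta z \<omega> \<in> B z}" using B by (auto simp: L_def)
      thus "prob {\<omega>\<in>space M. eta sigma0 n z \<omega> \<in> B z} = N.prob (A z)" by (simp only: prob_new_eta)
    qed
    finally show "N.prob ((\<lambda>\<omega>. blk_vec n K i (chi i \<omega>)) -` E i \<inter> space N) = (\<Prod>z\<in>L i. N.prob (A z))" .
  qed
  also have "\<dots> = (\<Prod>z\<in>J. N.prob (A z))" unfolding L_def by (rule prod.group) (use J in \<open>auto simp: I_def\<close>)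
  finally show "N.prob (\<Inter>z\<in>J. A z) = (\<Prod>z\<in>J. N.prob (A z))" .
qed

end

section \<open>Deviation of the coupled height from its mean\<close>

text \<open>The discrete antiderivative of \<open>f\<close> that vanishes at 0, on both
  half-lines.\<close>

definition signed_sum :: "(int \<Rightarrow> 'b::ab_group_add) \<Rightarrow> int \<Rightarrow> 'b" where
  "signed_sum f x = (if 0 \<le> x then \<Sum>z\<in>{0<..x}. f z else - (\<Sum>z\<in>{x<..0}. f z))"

lemma signed_sum_0: "signed_sum f 0 = 0"
  by (simp add: signed_sum_def)

lemma signed_sum_step: "signed_sum f x - signed_sum f (x - 1) = f x"
proof (cases "0 < x")
  case True
  hence "{0<..x} = insert x {0<..x - 1}" by auto
  thus ?thesis using True by (simp add: signed_sum_def)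
next
  case False
  hence "{x - 1<..0} = insert x {x<..0}" by auto
  thus ?thesis using False by (cases "x = 0") (auto simp: signed_sum_def)
qed

lemma signed_sum_diff:
  assumes "a \<le> c"
  shows "signed_sum f c - signed_sum f a = (\<Sum>z\<in>{a<..c}. f z)"
  using sum_int_increments[OF assms, of "signed_sum f"] by (simp add: signed_sum_step)

lemma abs_le_of_small_steps:
  fixes E :: "int \<Rightarrow> real"
  assumes E0: "E 0 = 0" and step: "\<And>i. \<bar>i\<bar> \<le> m \<Longrightarrow> \<bar>E (i + 1) - E i\<bar> \<le> d" and i: "\<bar>i\<bar> \<le> m"
  shows "\<bar>E i\<bar> \<le> real_of_int \<bar>i\<bar> * d"
proof -
  have "\<bar>E (int k)\<bar> \<le> real k * d \<and> \<bar>E (- int k)\<bar> \<le> real k * d" if "int k \<le> m" for k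
    using that
  proof (induction k)
    case (Suc k)
    hence IH: "\<bar>E (int k)\<bar> \<le> real k * d" "\<bar>E (- int k)\<bar> \<le> real k * d" by auto
    have "\<bar>E (int k + 1) - E (int k)\<bar> \<le> d" using Suc.prems by (intro step) auto
    hence up: "\<bar>E (int k + 1)\<bar> \<le> real k * d + d" using IH by linarith
    have "\<bar>E (- int k - 1 + 1) - E (- int k - 1)\<bar> \<le> d" using Suc.prems by (intro step) auto
    hence down: "\<bar>E (- int k - 1)\<bar> \<le> real k * d + d" using IH by (simp only: diff_add_cancel)
    have eq: "int (Suc k) = int k + 1" "- int (Suc k) = - int k - 1" "real (Suc k) * d = real k * d + d"
      by (auto simp: ring_distribs)
    show ?case unfolding eq using up down by simp
  qed (simp add: E0)
  from this[of "nat \<bar>i\<bar>"] i show ?thesis by (cases "0 \<le> i") auto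
qed

definition (in example) blk_height :: "nat \<Rightarrow> nat \<Rightarrow> (int \<Rightarrow> real) \<Rightarrow> int \<Rightarrow> int" where
  "blk_height n K c = signed_sum (blk_eta n K c)"

context block_coupling
begin

text \<open>The coupled height minus its mean.\<close>

definition dev :: "int \<Rightarrow> 'b \<Rightarrow> real" where
  "dev x \<omega> = real_of_int (blk_height n K (\<lambda>i. chi i \<omega>) x) - signed_sum (\<lambda>z. rho0 (real_of_int z / real n)) x"

lemma dev_diff:
  assumes "a \<le> c"
  shows "dev c \<omega> - dev a \<omega> = (\<Sum>z\<in>{a<..c}. real_of_int (new_eta z \<omega>) - rho0 (real_of_int z / real n))"
proof -
  have "real_of_int (blk_height n K (\<lambda>i. chi i \<omega>) c) - real_of_int (blk_height n K (\<lambda>i. chi i \<omega>) a)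
      = real_of_int (\<Sum>z\<in>{a<..c}. new_eta z \<omega>)"
    unfolding blk_height_def signed_sum_diff[OF assms, symmetric] by simp
  thus ?thesis using signed_sum_diff[OF assms, of "\<lambda>z. rho0 (real_of_int z / real n)"]
    by (simp add: dev_def sum_subtractf)
qed

lemma dev_0: "dev 0 \<omega> = 0"
  by (simp add: dev_def blk_height_def signed_sum_0)

lemma new_eta_borel: "(\<lambda>\<omega>. real_of_int (new_eta z \<omega>)) \<in> borel_measurable N"
  by (rule measurable_compose[OF new_eta_measurable]) simp

lemma blk_height_measurable: "(\<lambda>\<omega>. real_of_int (blk_height n K (\<lambda>i. chi i \<omega>) x)) \<in> borel_measurable N"
proof -
  note [measurable] = new_eta_borel
  show ?thesis unfolding blk_height_def signed_sum_def by (cases "0 \<le> x") simp_all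
qed

lemma dev_measurable[measurable]: "dev x \<in> borel_measurable N"
  unfolding dev_def[abs_def] using blk_height_measurable by simp

lemma integral_new_eta:
  fixes f :: "int \<Rightarrow> real"
  shows "integral\<^sup>L N (\<lambda>\<omega>. f (new_eta z \<omega>)) = integral\<^sup>L M (\<lambda>\<omega>. f (eta sigma0 n z \<omega>))"
    and "integrable N (\<lambda>\<omega>. f (new_eta z \<omega>)) \<longleftrightarrow> integrable M (\<lambda>\<omega>. f (eta sigma0 n z \<omega>))"
proof -
  have f: "f \<in> borel_measurable (count_space UNIV)" by simp
  have "integral\<^sup>L N (\<lambda>\<omega>. f (new_eta z \<omega>)) = integral\<^sup>L (distr N (count_space UNIV) (new_eta z)) f"
    by (rule integral_distr[OF new_eta_measurable f, symmetric])
  also have "\<dots> = integral\<^sup>L M (\<lambda>\<omega>. f (eta sigma0 n z \<omega>))"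
    unfolding distr_new_eta by (rule integral_distr[OF eta_count_measurable[OF n] f])
  finally show "integral\<^sup>L N (\<lambda>\<omega>. f (new_eta z \<omega>)) = integral\<^sup>L M (\<lambda>\<omega>. f (eta sigma0 n z \<omega>))" .
  have "integrable N (\<lambda>\<omega>. f (new_eta z \<omega>)) \<longleftrightarrow> integrable (distr N (count_space UNIV) (new_eta z)) f"
    by (rule integrable_distr_eq[OF new_eta_measurable f, symmetric])
  also have "\<dots> \<longleftrightarrow> integrable M (\<lambda>\<omega>. f (eta sigma0 n z \<omega>))"
    unfolding distr_new_eta by (rule integrable_distr_eq[OF eta_count_measurable[OF n] f])
  finally show "integrable N (\<lambda>\<omega>. f (new_eta z \<omega>)) \<longleftrightarrow> integrable M (\<lambda>\<omega>. f (eta sigma0 n z \<omega>))" .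
qed

text \<open>Chebyshev's inequality for independent sites of variance at most \<open>G\<close>. It
  disposes of the part of a block between its left end and the site of interest.\<close>

lemma prob_dev_diff:
  assumes "a \<le> c" and e: "0 < e" and G: "\<And>y. \<bar>v0 y\<bar> \<le> G"
  shows "N.prob {\<omega>\<in>space N. e < \<bar>(dev c \<omega> - dev a \<omega>) / sqrt (real n)\<bar>} \<le> G * real_of_int (c - a) / (real n * e\<^sup>2)"
proof -
  define X where "X z \<omega> = real_of_int (new_eta z \<omega>) - rho0 (real_of_int z / real n)" for z \<omega>
  have ind: "N.indep_vars (\<lambda>_. borel) X {a<..c}"
    unfolding X_def[abs_def]
    by (rule N.indep_vars_compose2[OF N.indep_vars_subset[OF new_eta_indep], where Y = "\<lambda>z k. real_of_int k - rho0 (real_of_int z / real n)"]) auto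
  have mean: "N.expectation (X z) = 0" for z
  proof -
    have "N.expectation (X z) = expectation (\<lambda>\<omega>. real_of_int (eta sigma0 n z \<omega>) - rho0 (real_of_int z / real n))"
      unfolding X_def by (rule integral_new_eta(1))
    thus ?thesis using eta_integrable[OF n] mean_eta_eq[OF n] by (simp add: prob_space)
  qed
  have sq: "integrable N (\<lambda>\<omega>. (X z \<omega>)\<^sup>2)" for z
    unfolding X_def using eta_integrable[OF n, of z] eta_square_integrable[OF n, of z]
    by (subst integral_new_eta(2)) (simp add: power2_diff)
  have var: "N.expectation (\<lambda>\<omega>. (X z \<omega>)\<^sup>2) = v0 (real_of_int z / real n)" for z
    unfolding X_def var_eta_eq[OF n, symmetric] by (rule integral_new_eta(1))
  have S: "integrable N (\<lambda>\<omega>. (\<Sum>z\<in>{a<..c}. X z \<omega>)\<^sup>2)"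
      "N.expectation (\<lambda>\<omega>. (\<Sum>z\<in>{a<..c}. X z \<omega>)\<^sup>2) = (\<Sum>z\<in>{a<..c}. v0 (real_of_int z / real n))"
    using N.expectation_square_sum_indep[OF _ ind sq mean] by (auto simp: var)
  have [measurable]: "X z \<in> borel_measurable N" for z unfolding X_def[abs_def] using new_eta_borel by simp
  define d where "d = e * sqrt (real n)"
  have d: "0 < d" "d\<^sup>2 = real n * e\<^sup>2" using e n by (auto simp: d_def power_mult_distrib)
  have "N.prob {\<omega>\<in>space N. e < \<bar>(dev c \<omega> - dev a \<omega>) / sqrt (real n)\<bar>} \<le> N.prob {\<omega>\<in>space N. \<bar>\<Sum>z\<in>{a<..c}. X z \<omega>\<bar> \<ge> d}"
  proof (rule N.finite_measure_mono)
    have "d \<le> \<bar>\<Sum>z\<in>{a<..c}. X z \<omega>\<bar>" if "e < \<bar>(dev c \<omega> - dev a \<omega>) / sqrt (real n)\<bar>" for \<omega>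
    proof -
      have "e < \<bar>\<Sum>z\<in>{a<..c}. X z \<omega>\<bar> / sqrt (real n)" using that unfolding dev_diff[OF assms(1)] X_def[symmetric] by simp
      thus ?thesis using n by (simp add: d_def pos_less_divide_eq)
    qed
    thus "{\<omega>\<in>space N. e < \<bar>(dev c \<omega> - dev a \<omega>) / sqrt (real n)\<bar>} \<subseteq> {\<omega>\<in>space N. \<bar>\<Sum>z\<in>{a<..c}. X z \<omega>\<bar> \<ge> d}" by blast
  qed measurable
  also have "\<dots> \<le> (\<Sum>z\<in>{a<..c}. v0 (real_of_int z / real n)) / d\<^sup>2"
    unfolding S(2)[symmetric] by (rule N.second_moment_method) (use S d in auto)
  also have "(\<Sum>z\<in>{a<..c}. v0 (real_of_int z / real n)) \<le> (\<Sum>z\<in>{a<..c}. G)" by (intro sum_mono) (use G abs_le_D1 in blast)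
  also have "(\<Sum>z\<in>{a<..c}. G) = G * real_of_int (c - a)" using assms(1) by simp
  finally show ?thesis using d by (simp add: divide_right_mono)
qed

text \<open>Almost surely the statistic of the decoded list is the quantile itself, so the only
  discrepancy is the summand that makes the statistic injective, divided by
  \<open>sqrt n\<close>.\<close>

lemma AE_block_sum_error:
  "AE \<omega> in N. \<forall>i. \<bar>(dev (blk_start n K (i + 1)) \<omega> - dev (blk_start n K i) \<omega>) / sqrt (real n)
      - quantile (blk_law n K i) (normal_cdf (chi i \<omega>))\<bar> \<le> 1 / sqrt (real n)"
proof (subst AE_all_countable, intro allI)
  fix i
  have "AE y in distr N borel (chi i). blk_stat n K i (blk_vec n K i y) = quantile (blk_law n K i) (normal_cdf y)"
    unfolding chi_distr by (rule AE_blk_vec[OF n])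
  hence "AE \<omega> in N. blk_stat n K i (blk_vec n K i (chi i \<omega>)) = quantile (blk_law n K i) (normal_cdf (chi i \<omega>))"
    by (rule AE_distrD[rotated]) simp
  thus "AE \<omega> in N. \<bar>(dev (blk_start n K (i + 1)) \<omega> - dev (blk_start n K i) \<omega>) / sqrt (real n)
      - quantile (blk_law n K i) (normal_cdf (chi i \<omega>))\<bar> \<le> 1 / sqrt (real n)"
  proof eventually_elim
    case (elim \<omega>)
    define r where "r = 1 / (2 + real (to_nat (blk_vec n K i (chi i \<omega>))))"
    have r: "0 \<le> r" "r \<le> 1" by (auto simp: r_def)
    have "(\<Sum>z\<in>blk n K i. real_of_int (new_eta z \<omega>)) = real_of_int (sum_list (blk_vec n K i (chi i \<omega>)))"
      using sum_blk_eta[OF n K, of "\<lambda>i. chi i \<omega>" i] by (metis of_int_sum)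
    hence "dev (blk_start n K (i + 1)) \<omega> - dev (blk_start n K i) \<omega>
        = real_of_int (sum_list (blk_vec n K i (chi i \<omega>))) - (\<Sum>z\<in>blk n K i. rho0 (real_of_int z / real n))"
      using dev_diff[OF blk_start_mono[OF K, of i "i + 1" n], of \<omega>] by (simp add: sum_subtractf)
    hence "quantile (blk_law n K i) (normal_cdf (chi i \<omega>))
        = (dev (blk_start n K (i + 1)) \<omega> - dev (blk_start n K i) \<omega>) / sqrt (real n) + r / sqrt (real n)"
      unfolding elim[symmetric] blk_stat_def r_def by (simp add: add_divide_distrib)
    hence "\<bar>(dev (blk_start n K (i + 1)) \<omega> - dev (blk_start n K i) \<omega>) / sqrt (real n) - quantile (blk_law n K i) (normal_cdf (chi i \<omega>))\<bar>
        = r / sqrt (real n)" using r by simp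
    also have "\<dots> \<le> 1 / sqrt (real n)" using r by (intro divide_right_mono) auto
    finally show ?case .
  qed
qed

text \<open>Unless one of \<open>2 m + 1\<close> bad events occurs, every block contributes an error
  of at most \<open>\<delta> + 1 / sqrt n\<close>. Both processes vanish at block 0, and the errors
  accumulate over the \<open>|i|\<close> blocks in between.\<close>

lemma prob_dev_blk_start:
  assumes b0: "\<And>\<omega>. b 0 \<omega> = 0" and b: "\<And>i \<omega>. b (i + 1) \<omega> - b i \<omega> = blk_sd K i * chi i \<omega>"
    and [measurable]: "\<And>i. b i \<in> borel_measurable N"
    and q: "\<And>j. \<bar>j\<bar> \<le> int m \<Longrightarrow> measure std_normal_distribution {x. \<delta> < \<bar>quantile (blk_law n K j) (normal_cdf x) - blk_sd K j * x\<bar>} \<le> r"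
    and i: "\<bar>i\<bar> \<le> int m"
  shows "N.prob {\<omega>\<in>space N. real_of_int \<bar>i\<bar> * (\<delta> + 1 / sqrt (real n)) < \<bar>dev (blk_start n K i) \<omega> / sqrt (real n) - b i \<omega>\<bar>}
    \<le> real (2 * m + 1) * r"
proof -
  define J where "J = {- int m..int m}"
  define S where "S j = {x. \<delta> < \<bar>quantile (blk_law n K j) (normal_cdf x) - blk_sd K j * x\<bar>}" for j
  define U where "U j = chi j -` S j \<inter> space N" for j
  note [measurable] = borel_measurable_normal_quantile[OF real_distribution_blk_law]
  have S: "S j \<in> sets borel" for j unfolding S_def by measurable
  have U: "U j \<in> sets N" for j unfolding U_def by (rule measurable_sets[OF chi_measurable S])
  have UJ: "(\<Union>j\<in>J. U j) \<in> sets N" using U by (intro sets.finite_UN) (auto simp: J_def)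
  have PU: "N.prob (U j) \<le> r" if "j \<in> J" for j
  proof -
    have "N.prob (U j) = measure (distr N borel (chi j)) (S j)"
      unfolding U_def by (rule measure_distr[OF chi_measurable S, symmetric])
    thus ?thesis using q[of j] that by (auto simp: chi_distr S_def J_def)
  qed
  have "N.prob {\<omega>\<in>space N. real_of_int \<bar>i\<bar> * (\<delta> + 1 / sqrt (real n)) < \<bar>dev (blk_start n K i) \<omega> / sqrt (real n) - b i \<omega>\<bar>} \<le> N.prob (\<Union>j\<in>J. U j)"
  proof (rule N.finite_measure_mono_AE[OF _ UJ])
    show "AE \<omega> in N. \<omega> \<in> {\<omega>\<in>space N. real_of_int \<bar>i\<bar> * (\<delta> + 1 / sqrt (real n)) < \<bar>dev (blk_start n K i) \<omega> / sqrt (real n) - b i \<omega>\<bar>}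
        \<longrightarrow> \<omega> \<in> (\<Union>j\<in>J. U j)"
      using AE_block_sum_error
    proof eventually_elim
      case (elim \<omega>)
      show ?case
      proof (rule impI, rule ccontr)
        assume \<omega>: "\<omega> \<in> {\<omega>\<in>space N. real_of_int \<bar>i\<bar> * (\<delta> + 1 / sqrt (real n)) < \<bar>dev (blk_start n K i) \<omega> / sqrt (real n) - b i \<omega>\<bar>}"
          and "\<omega> \<notin> (\<Union>j\<in>J. U j)"
        hence nU: "\<bar>quantile (blk_law n K j) (normal_cdf (chi j \<omega>)) - blk_sd K j * chi j \<omega>\<bar> \<le> \<delta>" if "\<bar>j\<bar> \<le> int m" for j
        proof -
          have "j \<in> J" using that by (auto simp: J_def)
          thus ?thesis using \<omega> \<open>\<omega> \<notin> (\<Union>j\<in>J. U j)\<close> by (auto simp: U_def S_def not_less)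
        qed
        define E where "E j = dev (blk_start n K j) \<omega> / sqrt (real n) - b j \<omega>" for j
        have "\<bar>E i\<bar> \<le> real_of_int \<bar>i\<bar> * (\<delta> + 1 / sqrt (real n))"
        proof (rule abs_le_of_small_steps[where m = "int m"])
          show "E 0 = 0" by (simp add: E_def b0 blk_start_def dev_0)
          fix j assume j: "\<bar>j\<bar> \<le> int m"
          have "E (j + 1) - E j = (dev (blk_start n K (j + 1)) \<omega> - dev (blk_start n K j) \<omega>) / sqrt (real n) - blk_sd K j * chi j \<omega>"
            unfolding E_def b[symmetric] by (simp add: diff_divide_distrib)
          thus "\<bar>E (j + 1) - E j\<bar> \<le> \<delta> + 1 / sqrt (real n)" using elim[rule_format, of j] nU[OF j] by linarith
        qed (rule i)
        thus False using \<omega> by (simp add: E_def)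
      qed
    qed
  qed
  also have "\<dots> \<le> (\<Sum>j\<in>J. N.prob (U j))" using U by (intro N.finite_measure_subadditive_finite) (auto simp: J_def)
  also have "\<dots> \<le> (\<Sum>j\<in>J. r)" by (intro sum_mono PU)
  also have "\<dots> = real (2 * m + 1) * r" by (simp add: J_def nat_add_distrib)
  finally show ?thesis .
qed

end

section \<open>Convergence of the coupled initial heights\<close>

context example
begin

lemma signed_sum_rho0_error:
  "(\<lambda>n. (signed_sum (\<lambda>z. rho0 (real_of_int z / real n)) \<lfloor>real n * y\<rfloor> - real n * u0 y) / sqrt (real n)) \<longlonglongrightarrow> 0"
proof -
  obtain G where G: "\<And>y. \<bar>rho0 y\<bar> \<le> G" using rho0_bound by blast
  define S where "S n = signed_sum (\<lambda>z. rho0 (real_of_int z / real n)) \<lfloor>real n * y\<rfloor>" for n :: nat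
  show ?thesis
  proof (cases "0 \<le> y")
    case True
    have "S n = (\<Sum>z\<in>{\<lfloor>real n * 0\<rfloor><..\<lfloor>real n * y\<rfloor>}. rho0 (real_of_int z / real n))" for n
      using signed_sum_diff[of 0 "\<lfloor>real n * y\<rfloor>" "\<lambda>z. rho0 (real_of_int z / real n)"] True
      by (simp add: S_def signed_sum_0)
    thus ?thesis using riemann_sum_error[OF u0_deriv G rho0_holder True] u0_0 by (simp add: S_def)
  next
    case False
    hence y: "y \<le> 0" by simp
    have "- S n = (\<Sum>z\<in>{\<lfloor>real n * y\<rfloor><..\<lfloor>real n * 0\<rfloor>}. rho0 (real_of_int z / real n))" for n
    proof -
      have "\<lfloor>real n * y\<rfloor> \<le> 0" using floor_mono[of "real n * y" 0] y by (simp add: mult_nonneg_nonpos)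
      from signed_sum_diff[OF this, of "\<lambda>z. rho0 (real_of_int z / real n)"] show ?thesis
        by (simp add: S_def signed_sum_0)
    qed
    hence "(\<lambda>n. (- S n - real n * (u0 0 - u0 y)) / sqrt (real n)) \<longlonglongrightarrow> 0"
      using riemann_sum_error[OF u0_deriv G rho0_holder y] by simp
    from tendsto_minus[OF this] show ?thesis using u0_0 by (simp add: S_def minus_divide_left algebra_simps)
  qed
qed

text \<open>With \<open>K^2\<close> blocks on each side the grid reaches macroscopic distance
  \<open>K\<close>, so every point is covered eventually. Precision \<open>1 / K^4\<close> beats the
  accumulation over \<open>O (K)\<close> blocks and, as a probability, the union over about
  \<open>2 K^2\<close> blocks; \<open>K^4 \<le> n\<close> bounds the decoding error
  \<open>1 / sqrt n\<close> by \<open>1 / K^2\<close>.\<close>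

lemma blk_scale_exists:
  obtains K :: "nat \<Rightarrow> nat" where "\<And>n. 1 \<le> K n" "filterlim K at_top sequentially"
    "eventually (\<lambda>n. (\<forall>i\<in>{- int ((K n)\<^sup>2)..int ((K n)\<^sup>2)}. measure std_normal_distribution
        {x. 1 / real (K n) ^ 4 < \<bar>quantile (blk_law n (K n) i) (normal_cdf x) - blk_sd (K n) i * x\<bar>} \<le> 1 / real (K n) ^ 4)
      \<and> (K n) ^ 4 \<le> n) sequentially"
proof (rule diagonal_sequence[of "\<lambda>n K. (\<forall>i\<in>{- int (K\<^sup>2)..int (K\<^sup>2)}. measure std_normal_distribution
        {x. 1 / real K ^ 4 < \<bar>quantile (blk_law n K i) (normal_cdf x) - blk_sd K i * x\<bar>} \<le> 1 / real K ^ 4) \<and> K ^ 4 \<le> n"])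
  fix K :: nat assume K: "1 \<le> K"
  hence pos: "0 < 1 / real K ^ 4" by simp
  show "eventually (\<lambda>n. (\<forall>i\<in>{- int (K\<^sup>2)..int (K\<^sup>2)}. measure std_normal_distribution
        {x. 1 / real K ^ 4 < \<bar>quantile (blk_law n K i) (normal_cdf x) - blk_sd K i * x\<bar>} \<le> 1 / real K ^ 4) \<and> K ^ 4 \<le> n) sequentially"
  proof (intro eventually_conj eventually_ball_finite ballI)
    fix i
    show "eventually (\<lambda>n. measure std_normal_distribution
        {x. 1 / real K ^ 4 < \<bar>quantile (blk_law n K i) (normal_cdf x) - blk_sd K i * x\<bar>} \<le> 1 / real K ^ 4) sequentially"
      using order_tendstoD(2)[OF blk_quantile_measure_tendsto[OF K pos] pos] by eventually_elim (rule less_imp_le)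
  qed (simp_all add: eventually_ge_at_top)
qed (rule that)

abbreviation V_grid :: "nat \<Rightarrow> int \<Rightarrow> real" where
  "V_grid K \<equiv> \<lambda>j. V (real_of_int j / real K)"

lemma mono_V_grid: "mono (V_grid K)"
  by (intro monoI V_mono divide_right_mono) auto

lemma isCont_V: "isCont V y"
  using V_deriv by (rule DERIV_isCont)

text \<open>Four errors: the coupling at the last block boundary before \<open>y\<close>, the
  Brownian motion between the clock values of that boundary and of \<open>y\<close>, the sites of
  the incomplete block, and the centring by a Riemann sum. The third is small because a block holds
  only about \<open>n / K\<close> sites with \<open>K\<close> tending to infinity.\<close>

theorem coupled_height_limit:
  fixes N :: "'b measure"
  assumes pair: "normal_pair N Z A"
    and K_ge: "\<And>n. 1 \<le> K n" "filterlim K at_top sequentially"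
    and scale: "eventually (\<lambda>n. (\<forall>i\<in>{- int ((K n)\<^sup>2)..int ((K n)\<^sup>2)}. measure std_normal_distribution
        {x. 1 / real (K n) ^ 4 < \<bar>quantile (blk_law n (K n) i) (normal_cdf x) - blk_sd (K n) i * x\<bar>} \<le> 1 / real (K n) ^ 4)
      \<and> (K n) ^ 4 \<le> n) sequentially"
  shows "conv_in_prob N (\<lambda>n \<omega>. (real_of_int (blk_height n (K n)
      (\<lambda>i. unit_increment (V_grid (K n)) (\<lambda>j. Z j \<omega>) (\<lambda>j. A j \<omega>) i) \<lfloor>real n * y\<rfloor>) - real n * u0 y) / sqrt (real n))
    (\<lambda>\<omega>. bm_path (\<lambda>j. Z j \<omega>) (V y))"
proof -
  interpret pair: normal_pair N Z A by (rule pair)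
  obtain G where G: "0 \<le> G" "\<And>y. \<bar>v0 y\<bar> \<le> G" using v0_bound by blast
  define chi where "chi n = pair.increment (V_grid (K n))" for n
  have bc: "block_coupling M sigma0 u0 rho0 v0 N n (K n) (chi n)" if "1 \<le> n" for n
    using that K_ge(1) pair.indep_increment[OF mono_V_grid] pair.distr_increment[OF mono_V_grid]
      example_axioms pair.prob_space_axioms
    by (intro block_coupling.intro block_coupling_axioms.intro) (auto simp: chi_def)
  \<comment> \<open>\<open>i n\<close> is the block containing \<open>n y\<close>,
    \<open>a n\<close> the boundary to its left and \<open>c n\<close> the site of interest.\<close>
  define i a c where "i n = \<lfloor>y * real (K n)\<rfloor>" and "a n = blk_start n (K n) (i n)" and "c n = \<lfloor>real n * y\<rfloor>" for n
  define b where "b n j = pair.bm (V_grid (K n) j)" for n j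
  define H where "H n x \<omega> = real_of_int (blk_height n (K n) (\<lambda>i. chi n i \<omega>) x) - signed_sum (\<lambda>z. rho0 (real_of_int z / real n)) x" for n x \<omega>
  have dev_H: "block_coupling.dev M sigma0 rho0 n (K n) (chi n) = H n" if "1 \<le> n" for n
  proof -
    interpret block_coupling M sigma0 u0 rho0 v0 N n "K n" "chi n" by (rule bc[OF that])
    show ?thesis by (simp add: fun_eq_iff dev_def H_def)
  qed
  have Hm: "H n x \<in> borel_measurable N" if "1 \<le> n" for n x
    using block_coupling.dev_measurable[OF bc[OF that], of x] dev_H[OF that] by simp
  have Kpos: "0 < real (K n)" for n using K_ge(1)[of n] by simp
  have Kinf: "filterlim (\<lambda>n. real (K n)) at_top sequentially"
    by (rule filterlim_compose[OF filterlim_real_sequentially K_ge(2)])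
  have invK: "(\<lambda>n. 1 / real (K n)) \<longlonglongrightarrow> 0"
    by (rule filterlim_compose[OF _ Kinf, of "\<lambda>x. 1 / x"]) real_asymp
  have iK: "real_of_int (i n) \<le> y * real (K n)" "y * real (K n) < real_of_int (i n) + 1" for n unfolding i_def by linarith+
  have iK': "\<bar>real_of_int (i n) / real (K n) - y\<bar> \<le> 1 / real (K n)" for n
  proof -
    have "real_of_int (i n) / real (K n) - y = (real_of_int (i n) - y * real (K n)) / real (K n)"
      using Kpos[of n] by (simp add: diff_divide_distrib)
    also have "\<bar>\<dots>\<bar> = \<bar>real_of_int (i n) - y * real (K n)\<bar> / real (K n)" by simp
    also have "\<dots> \<le> 1 / real (K n)" using iK[of n] by (intro divide_right_mono) auto
    finally show ?thesis .
  qed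
  have i_lim: "(\<lambda>n. real_of_int (i n) / real (K n)) \<longlonglongrightarrow> y"
  proof (rule LIM_zero_cancel, rule Lim_null_comparison[OF _ invK])
    show "eventually (\<lambda>n. norm (real_of_int (i n) / real (K n) - y) \<le> 1 / real (K n)) sequentially"
      using iK' by (intro always_eventually allI) simp
  qed
  have ac: "a n \<le> c n" for n
    unfolding a_def c_def blk_start_def
  proof (intro floor_mono mult_left_mono)
    show "real_of_int (i n) / real (K n) \<le> y" using iK(1)[of n] Kpos[of n] by (simp add: pos_divide_le_eq)
  qed simp
  have ca: "real_of_int (c n - a n) \<le> real n / real (K n) + 1" for n
  proof -
    have "real_of_int (c n) \<le> real n * y" unfolding c_def by linarith
    moreover have "real n * (real_of_int (i n) / real (K n)) < real_of_int (a n) + 1" unfolding a_def blk_start_def by linarith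
    moreover have "real n * (y - real_of_int (i n) / real (K n)) \<le> real n * (1 / real (K n))"
      using iK'[of n] by (intro mult_left_mono) auto
    ultimately show ?thesis by (simp add: right_diff_distrib)
  qed
  have c1: "conv_in_prob N (\<lambda>n \<omega>. H n (a n) \<omega> / sqrt (real n) - b n (i n) \<omega>) (\<lambda>_. 0)"
  proof (rule conv_in_prob_boundI[of 1])
    show "(\<lambda>\<omega>. H n (a n) \<omega> / sqrt (real n) - b n (i n) \<omega>) \<in> borel_measurable N" if "1 \<le> n" for n
      using Hm[OF that] by (simp add: b_def)
    fix e :: real assume e: "0 < e"
    define g where "g n = real (2 * (K n)\<^sup>2 + 1) * (1 / real (K n) ^ 4)" for n
    have "((\<lambda>x::real. (2 * x\<^sup>2 + 1) * (1 / x ^ 4)) \<longlongrightarrow> 0) at_top" by real_asymp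
    from filterlim_compose[OF this Kinf] have g: "g \<longlonglongrightarrow> 0" unfolding g_def by (simp add: add.commute)
    have Kbig: "eventually (\<lambda>n. max (\<bar>y\<bar> + 1) (2 * (\<bar>y\<bar> + 1) / e) < real (K n)) sequentially"
      using Kinf unfolding filterlim_at_top_dense by blast
    have "eventually (\<lambda>n. measure N {\<omega>\<in>space N. e < \<bar>H n (a n) \<omega> / sqrt (real n) - b n (i n) \<omega> - 0\<bar>} \<le> g n) sequentially"
      using Kbig scale eventually_ge_at_top[of 1]
    proof eventually_elim
      case (elim n)
      interpret block_coupling M sigma0 u0 rho0 v0 N n "K n" "chi n" by (rule bc[OF elim(3)])
      have kb: "\<bar>y\<bar> + 1 < real (K n)" "2 * (\<bar>y\<bar> + 1) / e < real (K n)"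
        using elim(1) unfolding max_less_iff_conj by blast+
      have i1: "real_of_int \<bar>i n\<bar> \<le> (\<bar>y\<bar> + 1) * real (K n)"
      proof -
        have "real_of_int \<bar>i n\<bar> \<le> \<bar>y * real (K n)\<bar> + 1" using iK[of n] by linarith
        also have "\<dots> \<le> (\<bar>y\<bar> + 1) * real (K n)" using K_ge(1)[of n] by (simp add: abs_mult ring_distribs)
        finally show ?thesis .
      qed
      also have "\<dots> \<le> real (K n) * real (K n)" using kb(1) by (intro mult_right_mono) auto
      finally have "real_of_int \<bar>i n\<bar> \<le> real_of_int (int ((K n)\<^sup>2))" by (simp add: power2_eq_square)
      hence im: "\<bar>i n\<bar> \<le> int ((K n)\<^sup>2)" by linarith
      have sn: "1 / sqrt (real n) \<le> 1 / real (K n) ^ 2"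
      proof -
        have "real (K n ^ 4) \<le> real n" using elim(2) by (intro of_nat_mono) simp
        hence "(real (K n) ^ 2)\<^sup>2 \<le> real n" by (simp flip: power_mult)
        hence "real (K n) ^ 2 \<le> sqrt (real n)" by (rule real_le_rsqrt)
        thus ?thesis using Kpos[of n] by (intro frac_le) auto
      qed
      have k4: "1 / real (K n) ^ 4 \<le> 1 / real (K n) ^ 2"
        using K_ge(1)[of n] by (intro frac_le power_increasing) auto
      \<comment> \<open>At most \<open>(|y| + 1) K\<close> blocks, each with error at most
        \<open>2 / K^2\<close>.\<close>
      have "real_of_int \<bar>i n\<bar> * (1 / real (K n) ^ 4 + 1 / sqrt (real n)) \<le> ((\<bar>y\<bar> + 1) * real (K n)) * (2 / real (K n) ^ 2)"
        using i1 sn k4 by (intro mult_mono) auto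
      also have "\<dots> = 2 * (\<bar>y\<bar> + 1) / real (K n)" using Kpos[of n] by (simp add: power2_eq_square)
      also have "\<dots> \<le> e" unfolding pos_divide_le_eq[OF Kpos]
        using kb(2) unfolding pos_divide_less_eq[OF e] by (simp only: mult.commute less_imp_le)
      finally have le: "real_of_int \<bar>i n\<bar> * (1 / real (K n) ^ 4 + 1 / sqrt (real n)) \<le> e" .
      have "measure N {\<omega>\<in>space N. real_of_int \<bar>i n\<bar> * (1 / real (K n) ^ 4 + 1 / sqrt (real n)) < \<bar>dev (blk_start n (K n) (i n)) \<omega> / sqrt (real n) - b n (i n) \<omega>\<bar>}
          \<le> real (2 * (K n)\<^sup>2 + 1) * (1 / real (K n) ^ 4)"
      proof (rule prob_dev_blk_start[OF _ _ _ _ im])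
        show "b n 0 \<omega> = 0" for \<omega> by (simp add: b_def V_0 pair.bm_0)
        show "b n (j + 1) \<omega> - b n j \<omega> = blk_sd (K n) j * chi n j \<omega>" for j \<omega>
          unfolding b_def chi_def blk_sd_def using pair.bm_increment_eq[OF mono_V_grid[of "K n"], of j \<omega>] by simp
        show "b n j \<in> borel_measurable N" for j by (simp add: b_def)
        show "measure std_normal_distribution {x. 1 / real (K n) ^ 4 < \<bar>quantile (blk_law n (K n) j) (normal_cdf x) - blk_sd (K n) j * x\<bar>} \<le> 1 / real (K n) ^ 4"
          if "\<bar>j\<bar> \<le> int ((K n)\<^sup>2)" for j
        proof -
          have "- int ((K n)\<^sup>2) \<le> j" "j \<le> int ((K n)\<^sup>2)" using that by linarith+
          hence "j \<in> {- int ((K n)\<^sup>2)..int ((K n)\<^sup>2)}" unfolding atLeastAtMost_iff by blast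
          thus ?thesis using elim(2) by blast
        qed
      qed
      moreover have "measure N {\<omega>\<in>space N. e < \<bar>H n (a n) \<omega> / sqrt (real n) - b n (i n) \<omega> - 0\<bar>}
        \<le> measure N {\<omega>\<in>space N. real_of_int \<bar>i n\<bar> * (1 / real (K n) ^ 4 + 1 / sqrt (real n)) < \<bar>dev (blk_start n (K n) (i n)) \<omega> / sqrt (real n) - b n (i n) \<omega>\<bar>}"
      proof (rule pair.finite_measure_mono)
        show "{\<omega>\<in>space N. e < \<bar>H n (a n) \<omega> / sqrt (real n) - b n (i n) \<omega> - 0\<bar>}
          \<subseteq> {\<omega>\<in>space N. real_of_int \<bar>i n\<bar> * (1 / real (K n) ^ 4 + 1 / sqrt (real n)) < \<bar>dev (blk_start n (K n) (i n)) \<omega> / sqrt (real n) - b n (i n) \<omega>\<bar>}"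
          using le dev_H[OF elim(3)] by (auto simp: a_def)
        have [measurable]: "b n j \<in> borel_measurable N" for j by (simp add: b_def)
        show "{\<omega>\<in>space N. real_of_int \<bar>i n\<bar> * (1 / real (K n) ^ 4 + 1 / sqrt (real n)) < \<bar>dev (blk_start n (K n) (i n)) \<omega> / sqrt (real n) - b n (i n) \<omega>\<bar>} \<in> sets N"
          by measurable
      qed
      ultimately show ?case unfolding g_def by linarith
    qed
    thus "\<exists>g. g \<longlonglongrightarrow> 0 \<and> (\<forall>\<^sub>F n in sequentially. measure N {\<omega>\<in>space N. e < \<bar>H n (a n) \<omega> / sqrt (real n) - b n (i n) \<omega> - 0\<bar>} \<le> g n)"
      using g by blast
  qed
  have c2: "conv_in_prob N (\<lambda>n. b n (i n)) (pair.bm (V y))"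
  proof (rule pair.conv_in_prob_pointwise)
    fix \<omega>
    have "isCont (\<lambda>t. pair.bm t \<omega>) (V y)" using pair.bm_continuous[of \<omega>] by (simp add: continuous_on_eq_continuous_at)
    moreover have "(\<lambda>n. V_grid (K n) (i n)) \<longlonglongrightarrow> V y" by (rule isCont_tendsto_compose[OF isCont_V i_lim])
    ultimately show "(\<lambda>n. b n (i n) \<omega>) \<longlonglongrightarrow> pair.bm (V y) \<omega>" unfolding b_def by (rule isCont_tendsto_compose)
  qed (simp_all add: b_def)
  have c3: "conv_in_prob N (\<lambda>n \<omega>. (H n (c n) \<omega> - H n (a n) \<omega>) / sqrt (real n)) (\<lambda>_. 0)"
  proof (rule conv_in_prob_boundI[of 1])
    show "(\<lambda>\<omega>. (H n (c n) \<omega> - H n (a n) \<omega>) / sqrt (real n)) \<in> borel_measurable N" if "1 \<le> n" for n using Hm[OF that] by simp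
    fix e :: real assume e: "0 < e"
    define g where "g n = (G / e\<^sup>2) * (1 / real (K n) + 1 / real n)" for n
    have "(\<lambda>n. 1 / real n) \<longlonglongrightarrow> 0" by real_asymp
    hence "g \<longlonglongrightarrow> (G / e\<^sup>2) * (0 + 0)" unfolding g_def by (intro tendsto_mult tendsto_add tendsto_const invK)
    hence g: "g \<longlonglongrightarrow> 0" by simp
    have "eventually (\<lambda>n. measure N {\<omega>\<in>space N. e < \<bar>(H n (c n) \<omega> - H n (a n) \<omega>) / sqrt (real n) - 0\<bar>} \<le> g n) sequentially"
      using eventually_ge_at_top[of 1]
    proof eventually_elim
      case (elim n)
      have "measure N {\<omega>\<in>space N. e < \<bar>(H n (c n) \<omega> - H n (a n) \<omega>) / sqrt (real n) - 0\<bar>} \<le> G * real_of_int (c n - a n) / (real n * e\<^sup>2)"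
        using block_coupling.prob_dev_diff[OF bc[OF elim] ac e G(2)] dev_H[OF elim] by simp
      also have "\<dots> \<le> G * (real n / real (K n) + 1) / (real n * e\<^sup>2)"
        using ca G by (intro divide_right_mono mult_left_mono) auto
      also have "\<dots> = g n" unfolding g_def using elim e Kpos[of n] by (simp add: field_simps)
      finally show ?case .
    qed
    thus "\<exists>g. g \<longlonglongrightarrow> 0 \<and> (\<forall>\<^sub>F n in sequentially. measure N {\<omega>\<in>space N. e < \<bar>(H n (c n) \<omega> - H n (a n) \<omega>) / sqrt (real n) - 0\<bar>} \<le> g n)"
      using g by blast
  qed
  have c4: "conv_in_prob N (\<lambda>n \<omega>. (signed_sum (\<lambda>z. rho0 (real_of_int z / real n)) (c n) - real n * u0 y) / sqrt (real n)) (\<lambda>_. 0)"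
    by (rule pair.conv_in_prob_pointwise) (simp_all add: c_def signed_sum_rho0_error)
  have c5: "conv_in_prob N (\<lambda>n \<omega>. ((H n (a n) \<omega> / sqrt (real n) - b n (i n) \<omega>) + b n (i n) \<omega>)
      + ((H n (c n) \<omega> - H n (a n) \<omega>) / sqrt (real n) + (signed_sum (\<lambda>z. rho0 (real_of_int z / real n)) (c n) - real n * u0 y) / sqrt (real n)))
      (\<lambda>\<omega>. (0 + pair.bm (V y) \<omega>) + (0 + 0))"
    by (intro pair.conv_in_prob_add c1 c2 c3 c4) simp_all
  have "(\<lambda>\<omega>. (0 + pair.bm (V y) \<omega>) + (0 + 0)) = (\<lambda>\<omega>. bm_path (\<lambda>j. Z j \<omega>) (V y))" by (simp add: pair.bm_def)
  moreover have "(\<lambda>n \<omega>. ((H n (a n) \<omega> / sqrt (real n) - b n (i n) \<omega>) + b n (i n) \<omega>)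
      + ((H n (c n) \<omega> - H n (a n) \<omega>) / sqrt (real n) + (signed_sum (\<lambda>z. rho0 (real_of_int z / real n)) (c n) - real n * u0 y) / sqrt (real n)))
    = (\<lambda>n \<omega>. (real_of_int (blk_height n (K n) (\<lambda>i. unit_increment (V_grid (K n)) (\<lambda>j. Z j \<omega>) (\<lambda>j. A j \<omega>) i) \<lfloor>real n * y\<rfloor>) - real n * u0 y) / sqrt (real n))"
    by (intro ext) (simp add: H_def c_def chi_def pair.increment_def diff_divide_distrib)
  ultimately show ?thesis using c5 by simp
qed

end

section \<open>The limit theorems\<close>

text \<open>Stretches of \<open>L\<close> sites are split off one after another, each costing
  \<open>L * q\<close>; fewer than \<open>L\<close> sites remain and are bounded trivially. The
  argument \<open>s * int j + (1 - s) div 2\<close> is \<open>j\<close> for \<open>s = 1\<close> and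
  \<open>1 - j\<close> for \<open>s = - 1\<close>, so both sides of the reference site are treated
  at once.\<close>

lemma block_average_deviation:
  fixes f :: "int \<Rightarrow> real"
  assumes L: "0 < L" and q: "0 \<le> q" and G: "\<And>z. \<bar>f z\<bar> \<le> G"
    and avg: "\<And>m. \<bar>m\<bar> \<le> W \<Longrightarrow> \<bar>\<Sum>j=1..L. f (m + int j)\<bar> \<le> real L * q"
    and k: "int k \<le> W" and sgn: "s = 1 \<or> s = - 1"
  shows "\<bar>\<Sum>j=1..k. f (s * int j + (1 - s) div 2)\<bar> \<le> real k * q + real L * G"
  using k
proof (induction k rule: less_induct)
  case (less k)
  have G0: "0 \<le> G" using G[of 0] by linarith
  show ?case
  proof (cases "k < L")
    case True
    have "\<bar>\<Sum>j=1..k. f (s * int j + (1 - s) div 2)\<bar> \<le> (\<Sum>j=1..k. G)"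
      by (rule order_trans[OF sum_abs]) (intro sum_mono G)
    also have "\<dots> = real k * G" by simp
    also have "\<dots> \<le> real L * G" using True G0 by (intro mult_right_mono) auto
    finally show ?thesis using q by (simp add: add_increasing)
  next
    case False
    define h where "h = k - L"
    have h: "k = h + L" "h < k" "int h \<le> W" using False L less.prems by (auto simp: h_def)
    have IH: "\<bar>\<Sum>j=1..h. f (s * int j + (1 - s) div 2)\<bar> \<le> real h * q + real L * G"
      by (rule less.IH[OF h(2,3)])
    have "{1..k} = {1..h} \<union> {h + 1..h + L}" "{1..h} \<inter> {h + 1..h + L} = {}" using h(1) by auto
    hence split: "(\<Sum>j=1..k. f (s * int j + (1 - s) div 2))
      = (\<Sum>j=1..h. f (s * int j + (1 - s) div 2)) + (\<Sum>j=h+1..h+L. f (s * int j + (1 - s) div 2))"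
      by (simp add: sum.union_disjoint)
    have "\<bar>\<Sum>j=h+1..h+L. f (s * int j + (1 - s) div 2)\<bar> \<le> real L * q"
    proof (cases "s = 1")
      case True
      have "(\<Sum>j=h+1..h+L. f (s * int j + (1 - s) div 2)) = (\<Sum>j=1..L. f (int h + int j))"
        using True by (intro sum.reindex_bij_witness[of _ "\<lambda>j. j + h" "\<lambda>j. j - h"]) (auto simp: of_nat_diff)
      moreover have "\<bar>int h\<bar> \<le> W" using h by simp
      ultimately show ?thesis using avg[of "int h"] by simp
    next
      case False
      hence s: "s = - 1" using sgn by simp
      \<comment> \<open>Read from left to right, the last \<open>L\<close> sites on the left are
        \<open>- k + 1\<close> to \<open>- k + L\<close>, a stretch that starts after
        \<open>- k\<close>.\<close>
      have "(\<Sum>j=h+1..h+L. f (s * int j + (1 - s) div 2)) = (\<Sum>j=1..L. f (- int k + int j))"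
        using s h(1) by (intro sum.reindex_bij_witness[of _ "\<lambda>j. k + 1 - j" "\<lambda>j. k + 1 - j"]) (auto simp: of_nat_diff)
      moreover have "\<bar>- int k\<bar> \<le> W" using less.prems by simp
      ultimately show ?thesis using avg[of "- int k"] by simp
    qed
    hence "\<bar>\<Sum>j=1..k. f (s * int j + (1 - s) div 2)\<bar> \<le> (real h * q + real L * G) + real L * q"
      unfolding split using IH by linarith
    also have "\<dots> = real k * q + real L * G" using h(1) by (simp add: ring_distribs)
    finally show ?thesis .
  qed
qed

lemma int_power_le_sixth:
  assumes "1 \<le> m" "m \<le> 6" shows "\<bar>real_of_int k\<bar> ^ m \<le> real_of_int k ^ 6"
proof (cases "k = 0")
  case True thus ?thesis using assms by (simp add: power_0_left)
next
  case False
  hence "1 \<le> \<bar>real_of_int k\<bar>" by linarith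
  from power_increasing[OF assms(2) this] show ?thesis by (simp add: power_even_abs)
qed

text \<open>For integers every lower absolute power is at most the sixth, so the bound
  \<open>K\<close> is inherited unchanged.\<close>

lemma moments_le_sixth:
  fixes X :: "'a \<Rightarrow> int"
  assumes X: "X \<in> measurable M (count_space UNIV)" and i: "integrable M (\<lambda>\<omega>. real_of_int (X \<omega>) ^ 6)"
    and K: "integral\<^sup>L M (\<lambda>\<omega>. real_of_int (X \<omega>) ^ 6) \<le> K"
  shows "integrable M (\<lambda>\<omega>. (real_of_int (X \<omega>))\<^sup>2)" "integral\<^sup>L M (\<lambda>\<omega>. (real_of_int (X \<omega>))\<^sup>2) \<le> K"
    "\<bar>integral\<^sup>L M (\<lambda>\<omega>. real_of_int (X \<omega>))\<bar> \<le> K"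
proof -
  have [measurable]: "(\<lambda>\<omega>. real_of_int (X \<omega>)) \<in> borel_measurable M" by (rule measurable_compose[OF X]) simp
  have le2: "(real_of_int k)\<^sup>2 \<le> real_of_int k ^ 6" and le1: "\<bar>real_of_int k\<bar> \<le> real_of_int k ^ 6" for k
    using int_power_le_sixth[of 2 k] int_power_le_sixth[of 1 k] by auto
  show i2: "integrable M (\<lambda>\<omega>. (real_of_int (X \<omega>))\<^sup>2)"
    using le2 by (intro Bochner_Integration.integrable_bound[OF i]) auto
  have i1: "integrable M (\<lambda>\<omega>. real_of_int (X \<omega>))"
    using le1 by (intro Bochner_Integration.integrable_bound[OF i]) auto
  have "integral\<^sup>L M (\<lambda>\<omega>. (real_of_int (X \<omega>))\<^sup>2) \<le> integral\<^sup>L M (\<lambda>\<omega>. real_of_int (X \<omega>) ^ 6)"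
    by (intro integral_mono i i2 le2)
  thus "integral\<^sup>L M (\<lambda>\<omega>. (real_of_int (X \<omega>))\<^sup>2) \<le> K" using K by linarith
  have "\<bar>integral\<^sup>L M (\<lambda>\<omega>. real_of_int (X \<omega>))\<bar> \<le> integral\<^sup>L M (\<lambda>\<omega>. \<bar>real_of_int (X \<omega>)\<bar>)" by (rule integral_abs_bound)
  also have "\<dots> \<le> integral\<^sup>L M (\<lambda>\<omega>. real_of_int (X \<omega>) ^ 6)" using i1 by (intro integral_mono i le1) auto
  finally show "\<bar>integral\<^sup>L M (\<lambda>\<omega>. real_of_int (X \<omega>))\<bar> \<le> K" using K by linarith
qed

text \<open>Over \<open>k = O (sqrt n)\<close> sites the averages contribute at most
  \<open>k n^(-1/4) = O (n^(1/4))\<close>, and the incomplete stretch at most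
  \<open>L G = o (n^(1/4))\<close>; both are \<open>o (sqrt n)\<close>.\<close>

lemma assumptionC_partial_sums:
  fixes y :: real
  assumes irw: "IRW_setup p M sigma0 Y" and C: "assumptionC_at M sigma0 rho0 v0 y" and d: "0 < d"
  shows "\<forall>\<^sub>F n in sequentially. \<forall>k::nat. real k \<le> A * sqrt (real n) \<longrightarrow>
       \<bar>\<Sum>j=1..k. (mean_eta M sigma0 n (\<lfloor>real n * y\<rfloor> + int j) - rho0 y)\<bar> \<le> d * sqrt (real n) \<and>
       \<bar>\<Sum>j=1..k. (mean_eta M sigma0 n (\<lfloor>real n * y\<rfloor> + 1 - int j) - rho0 y)\<bar> \<le> d * sqrt (real n)"
proof -
  obtain L where L: "\<And>n. 0 < L n" "(\<lambda>n. real (L n) / real n powr (1/4)) \<longlonglongrightarrow> 0"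
    and avg: "\<And>B e. 0 < e \<Longrightarrow> \<forall>\<^sub>F n in sequentially. \<forall>m::int. \<bar>real_of_int m\<bar> \<le> B * sqrt (real n * ln (real n)) \<longrightarrow>
             real n powr (1/4) * \<bar>(\<Sum>j=1..L n. mean_eta M sigma0 n (\<lfloor>real n * y\<rfloor> + m + int j)) / real (L n) - rho0 y\<bar> \<le> e"
  proof -
    obtain L where L: "\<forall>n. 0 < L n" "(\<lambda>n. real (L n) / real n powr (1/4)) \<longlonglongrightarrow> 0"
      and avg: "\<forall>B. \<forall>e>0. \<forall>\<^sub>F n in sequentially. \<forall>m::int. \<bar>real_of_int m\<bar> \<le> B * sqrt (real n * ln (real n)) \<longrightarrow>
             real n powr (1/4) * \<bar>(\<Sum>j=1..L n. mean_eta M sigma0 n (\<lfloor>real n * y\<rfloor> + m + int j)) / real (L n) - rho0 y\<bar> \<le> e \<and>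
             real n powr (1/4) * \<bar>(\<Sum>j=1..L n. var_eta M sigma0 n (\<lfloor>real n * y\<rfloor> + m + int j)) / real (L n) - v0 y\<bar> \<le> e"
      using C unfolding assumptionC_at_def by blast
    show thesis
    proof (rule that[of L])
      fix B e :: real assume "0 < e"
      thus "\<forall>\<^sub>F n in sequentially. \<forall>m::int. \<bar>real_of_int m\<bar> \<le> B * sqrt (real n * ln (real n)) \<longrightarrow>
             real n powr (1/4) * \<bar>(\<Sum>j=1..L n. mean_eta M sigma0 n (\<lfloor>real n * y\<rfloor> + m + int j)) / real (L n) - rho0 y\<bar> \<le> e"
        using avg[rule_format, of e B] by (auto elim: eventually_mono)
    qed (use L in auto)
  qed
  obtain K where K: "\<And>n x. 1 \<le> n \<Longrightarrow> integrable M (\<lambda>\<omega>. real_of_int (eta sigma0 n x \<omega>) ^ 6) \<and> integral\<^sup>L M (\<lambda>\<omega>. real_of_int (eta sigma0 n x \<omega>) ^ 6) \<le> K"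
    using C unfolding assumptionC_at_def assumptionC_base_def by blast
  define G where "G = K + \<bar>rho0 y\<bar>"
  have mG: "\<bar>mean_eta M sigma0 n x - rho0 y\<bar> \<le> G" if "1 \<le> n" for n x
  proof -
    have "\<bar>mean_eta M sigma0 n x\<bar> \<le> K" unfolding mean_eta_def
      using K[OF that, of x] by (intro moments_le_sixth(3)[OF eta_measurable[OF irw that]]) auto
    thus ?thesis unfolding G_def by linarith
  qed
  \<comment> \<open>A positive constant above \<open>A\<close>, which may be negative. The range of
    \<open>m\<close> in Assumption C is wider than \<open>A' sqrt n\<close> once
    \<open>ln n \<ge> 1\<close>.\<close>
  define A' where "A' = max A 0 + 1"
  have A': "0 < A'" "A < A'" by (auto simp: A'_def)
  have "(\<lambda>n. A' * (1 / real n powr (1/4)) + (real (L n) / real n powr (1/4)) * (real n powr (1/4) / sqrt (real n)) * G) \<longlonglongrightarrow> A' * 0 + 0 * 0 * G"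
    by (intro tendsto_add tendsto_mult tendsto_const L(2)) real_asymp+
  hence lim: "(\<lambda>n. A' * (1 / real n powr (1/4)) + (real (L n) / real n powr (1/4)) * (real n powr (1/4) / sqrt (real n)) * G) \<longlonglongrightarrow> 0" by simp
  have l3: "eventually (\<lambda>n::nat. 1 \<le> ln (real n)) sequentially" by real_asymp
  from order_tendstoD(2)[OF lim d] avg[of 1 "A'", OF zero_less_one] l3 eventually_ge_at_top[of 1]
  show ?thesis
  proof eventually_elim
    case (elim n)
    define a where "a = \<lfloor>real n * y\<rfloor>"
    define q where "q = 1 / real n powr (1/4)"
    have n: "0 < real n powr (1/4)" "0 < sqrt (real n)" using elim(4) by auto
    define f where "f z = mean_eta M sigma0 n (a + z) - rho0 y" for z
    have fsum: "\<bar>\<Sum>j=1..L n. f (m + int j)\<bar> \<le> real (L n) * q" if m: "\<bar>m\<bar> \<le> \<lfloor>A' * sqrt (real n)\<rfloor>" for m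
    proof -
      have "\<bar>real_of_int m\<bar> \<le> A' * sqrt (real n)" using m by linarith
      also have "\<dots> \<le> A' * sqrt (real n * ln (real n))"
        using A'(1) elim(3) elim(4) by (intro mult_left_mono real_sqrt_le_mono) (auto simp: mult_le_cancel_left1)
      finally have "real n powr (1/4) * \<bar>(\<Sum>j=1..L n. mean_eta M sigma0 n (a + m + int j)) / real (L n) - rho0 y\<bar> \<le> 1"
        using elim(2) unfolding a_def by blast
      hence "\<bar>(\<Sum>j=1..L n. mean_eta M sigma0 n (a + m + int j)) / real (L n) - rho0 y\<bar> \<le> q"
        using n(1) unfolding q_def by (simp add: pos_le_divide_eq mult.commute)
      moreover have "(\<Sum>j=1..L n. f (m + int j)) = real (L n) * ((\<Sum>j=1..L n. mean_eta M sigma0 n (a + m + int j)) / real (L n) - rho0 y)"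
        using L(1)[of n] by (simp add: f_def sum_subtractf right_diff_distrib add.assoc)
      ultimately show ?thesis by (simp add: abs_mult mult_left_mono)
    qed
    have q0: "0 \<le> q" by (simp add: q_def)
    have bound: "\<bar>\<Sum>j=1..k. f (s * int j + (1 - s) div 2)\<bar> \<le> d * sqrt (real n)"
      if k: "real k \<le> A * sqrt (real n)" and s: "s = 1 \<or> s = - 1" for k s
    proof -
      have kA: "real k \<le> A' * sqrt (real n)" using k A'(2) n(2) by (meson less_imp_le mult_right_mono order_trans)
      hence "int k \<le> \<lfloor>A' * sqrt (real n)\<rfloor>" by (simp add: le_floor_iff)
      hence "\<bar>\<Sum>j=1..k. f (s * int j + (1 - s) div 2)\<bar> \<le> real k * q + real (L n) * G"
        using mG[OF elim(4)] by (intro block_average_deviation[OF L(1) q0 _ fsum _ s]) (auto simp: f_def)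
      also have "\<dots> \<le> A' * sqrt (real n) * q + real (L n) * G" using kA q0 by (intro add_right_mono mult_right_mono) auto
      also have "\<dots> = (A' * (1 / real n powr (1/4)) + (real (L n) / real n powr (1/4)) * (real n powr (1/4) / sqrt (real n)) * G) * sqrt (real n)"
        using n unfolding q_def by (simp add: field_simps)
      also have "\<dots> \<le> d * sqrt (real n)" using elim(1) n(2) by (intro mult_right_mono) auto
      finally show ?thesis .
    qed
    show ?case
    proof (intro allI impI)
      fix k :: nat assume k: "real k \<le> A * sqrt (real n)"
      show "\<bar>\<Sum>j=1..k. (mean_eta M sigma0 n (\<lfloor>real n * y\<rfloor> + int j) - rho0 y)\<bar> \<le> d * sqrt (real n) \<and>
       \<bar>\<Sum>j=1..k. (mean_eta M sigma0 n (\<lfloor>real n * y\<rfloor> + 1 - int j) - rho0 y)\<bar> \<le> d * sqrt (real n)"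
        using bound[OF k, of 1] bound[OF k, of "- 1"] by (simp add: f_def a_def algebra_simps)
    qed
  qed
qed

theorem height_fluctuation_along_characteristic:
  assumes p: "is_kernel p" "assumptionA p" and irw: "IRW_setup p M sigma0 Y" and t: "0 \<le> t"
    and C: "assumptionC_at M sigma0 rho0 v0 (x - drift p * t)"
  shows "conv_in_prob M (\<lambda>n \<omega>. (real_of_int (height sigma0 Y n (real n * t) \<lfloor>real n * x\<rfloor> \<omega>)
      - real_of_int (sigma0 n \<lfloor>real n * (x - drift p * t)\<rfloor> \<omega>)) / sqrt (real n)) (\<lambda>_. 0)"
proof -
  have base: "assumptionC_base M sigma0 rho0 v0" using C by (simp add: assumptionC_at_def)
  obtain K where K: "\<And>n x. 1 \<le> n \<Longrightarrow> integrable M (\<lambda>\<omega>. real_of_int (eta sigma0 n x \<omega>) ^ 6) \<and> integral\<^sup>L M (\<lambda>\<omega>. real_of_int (eta sigma0 n x \<omega>) ^ 6) \<le> K"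
    using base unfolding assumptionC_base_def by blast
  show ?thesis
  proof (rule height_along_characteristic[OF p irw t])
    fix n :: nat and x :: int assume n: "1 \<le> n"
    show "prob_space.indep_vars M (\<lambda>_. count_space UNIV) (\<lambda>x. eta sigma0 n x) UNIV"
      using base n unfolding assumptionC_base_def by blast
    show "integrable M (\<lambda>\<omega>. (real_of_int (eta sigma0 n x \<omega>))\<^sup>2)" "integral\<^sup>L M (\<lambda>\<omega>. (real_of_int (eta sigma0 n x \<omega>))\<^sup>2) \<le> K"
      using moments_le_sixth[OF eta_measurable[OF irw n]] K[OF n] by blast+
  next
    show "0 \<le> rho0 (x - drift p * t)" using base unfolding assumptionC_base_def by blast
  qed (rule assumptionC_partial_sums[OF irw C])
qed

text \<open>The fluctuation theorem divided by a further \<open>sqrt n\<close>, plus the law of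
  large numbers for the initial height at the foot of the characteristic.\<close>

theorem height_law_of_large_numbers:
  assumes p: "is_kernel p" "assumptionA p" and irw: "IRW_setup p M sigma0 Y" and t: "0 \<le> t"
    and B: "assumptionB M sigma0 u0" and C: "assumptionC_at M sigma0 rho0 v0 (x - drift p * t)"
  shows "conv_in_prob M (\<lambda>n \<omega>. real_of_int (height sigma0 Y n (real n * t) \<lfloor>real n * x\<rfloor> \<omega>) / real n)
     (\<lambda>_. u0 (x - drift p * t))"
proof -
  interpret prob_space M by (rule IRW_setupD(1)[OF irw])
  define D where "D n \<omega> = (real_of_int (height sigma0 Y n (real n * t) \<lfloor>real n * x\<rfloor> \<omega>)
      - real_of_int (sigma0 n \<lfloor>real n * (x - drift p * t)\<rfloor> \<omega>)) / sqrt (real n)" for n \<omega>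
  have D: "conv_in_prob M D (\<lambda>_. 0)" unfolding D_def by (rule height_fluctuation_along_characteristic[OF p irw t C])
  have D': "conv_in_prob M (\<lambda>n \<omega>. D n \<omega> / sqrt (real n)) (\<lambda>_. 0)"
  proof -
    obtain N0 where N0: "\<And>n. N0 \<le> n \<Longrightarrow> D n \<in> borel_measurable M"
      using D unfolding conv_in_prob_def eventually_sequentially by blast
    show ?thesis
    proof (rule conv_in_prob_boundI[of N0])
      show "(\<lambda>\<omega>. D n \<omega> / sqrt (real n)) \<in> borel_measurable M" if "N0 \<le> n" for n using N0[OF that] by simp
      fix e :: real assume e: "0 < e"
      have "eventually (\<lambda>n. prob {\<omega>\<in>space M. e < \<bar>D n \<omega> / sqrt (real n) - 0\<bar>} \<le> prob {\<omega>\<in>space M. e < \<bar>D n \<omega> - 0\<bar>}) sequentially"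
        using eventually_ge_at_top[of "max 1 N0"]
      proof eventually_elim
        case (elim n)
        have [measurable]: "D n \<in> borel_measurable M" using N0 elim by simp
        have "\<bar>D n \<omega> / sqrt (real n)\<bar> \<le> \<bar>D n \<omega>\<bar>" for \<omega>
          using elim by (simp add: divide_le_eq mult_le_cancel_left1)
        thus ?case by (intro finite_measure_mono) (auto intro: less_le_trans)
      qed
      moreover have "(\<lambda>n. prob {\<omega>\<in>space M. e < \<bar>D n \<omega> - 0\<bar>}) \<longlonglongrightarrow> 0" using D e unfolding conv_in_prob_def by blast
      ultimately show "\<exists>g. g \<longlonglongrightarrow> 0 \<and> (\<forall>\<^sub>F n in sequentially. prob {\<omega>\<in>space M. e < \<bar>D n \<omega> / sqrt (real n) - 0\<bar>} \<le> g n)" by blast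
    qed
  qed
  have "conv_in_prob M (\<lambda>n \<omega>. real_of_int (sigma0 n \<lfloor>real n * (x - drift p * t)\<rfloor> \<omega>) / real n) (\<lambda>_. u0 (x - drift p * t))"
    using B unfolding assumptionB_def by blast
  from conv_in_prob_add[OF D' this]
  have "conv_in_prob M (\<lambda>n \<omega>. D n \<omega> / sqrt (real n) + real_of_int (sigma0 n \<lfloor>real n * (x - drift p * t)\<rfloor> \<omega>) / real n)
     (\<lambda>_. u0 (x - drift p * t))" by simp
  moreover have "(\<lambda>n \<omega>. D n \<omega> / sqrt (real n) + real_of_int (sigma0 n \<lfloor>real n * (x - drift p * t)\<rfloor> \<omega>) / real n)
    = (\<lambda>n \<omega>. real_of_int (height sigma0 Y n (real n * t) \<lfloor>real n * x\<rfloor> \<omega>) / real n)"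
  proof (intro ext)
    fix n \<omega>
    have "sqrt (real n) * sqrt (real n) = real n" by simp
    thus "D n \<omega> / sqrt (real n) + real_of_int (sigma0 n \<lfloor>real n * (x - drift p * t)\<rfloor> \<omega>) / real n
      = real_of_int (height sigma0 Y n (real n * t) \<lfloor>real n * x\<rfloor> \<omega>) / real n"
      unfolding D_def by (simp add: diff_divide_distrib)
  qed
  ultimately show ?thesis by simp
qed

section \<open>One probability space for heights, walks and Brownian motion\<close>

lemma rw_path_process_measurable:
  "(\<lambda>x. \<lambda>t\<in>{0..}. rw_path x t) \<in> measurable (Pi\<^sub>M UNIV (\<lambda>_. borel)) (Pi\<^sub>M {0::real..} (\<lambda>_. count_space UNIV))"
  by (rule measurable_restrict) (rule rw_path_measurable)

text \<open>\<open>Inl\<close> indexes two normal arrays, the Boolean telling the Brownian array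
  from the auxiliary one; \<open>Inr\<close> pairs a particle with a coordinate of its walk.\<close>

type_synonym coord = "(bool \<times> nat \<times> int) + (int \<times> nat) \<times> nat \<times> nat"

context example
begin

lemma blk_height_space_measurable:
  "(\<lambda>c x. blk_height n K c x) \<in> measurable (Pi\<^sub>M UNIV (\<lambda>_. borel)) (Pi\<^sub>M UNIV (\<lambda>_. count_space UNIV))"
proof (rule measurable_PiM_single')
  fix x :: int
  have [measurable]: "(\<lambda>c::int \<Rightarrow> real. c i) \<in> borel_measurable (Pi\<^sub>M UNIV (\<lambda>_. borel))" for i
    by (rule measurable_component_singleton) simp
  have e: "(\<lambda>c. blk_eta n K c z) \<in> measurable (Pi\<^sub>M UNIV (\<lambda>_. borel)) (count_space UNIV)" for z
    unfolding blk_eta_def by (rule measurable_compose[OF measurable_compose[OF _ blk_vec_measurable]]) simp_all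
  have s: "(\<lambda>c. \<Sum>z\<in>S. blk_eta n K c z) \<in> measurable (Pi\<^sub>M UNIV (\<lambda>_. borel)) (count_space UNIV)" for S
  proof (induction S rule: infinite_finite_induct)
    case (insert z S)
    from measurable_diff_count_space[OF e[of z] measurable_diff_count_space[OF measurable_const[of 0] insert.IH]] insert.hyps
    show ?case by simp
  qed simp_all
  show "(\<lambda>c. blk_height n K c x) \<in> measurable (Pi\<^sub>M UNIV (\<lambda>_. borel)) (count_space UNIV)"
    unfolding blk_height_def signed_sum_def
    by (cases "0 \<le> x") (auto intro!: s measurable_compose[OF s])
qed (simp add: space_PiM)

lemma blk_height_eta: "blk_height n K c x - blk_height n K c (x - 1) = blk_eta n K c x"
  unfolding blk_height_def by (rule signed_sum_step)

lemma blk_height_0: "blk_height n K c 0 = 0"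
  unfolding blk_height_def by (rule signed_sum_0)

text \<open>Sites within \<open>O (sqrt n)\<close> are macroscopically only
  \<open>O (1 / sqrt n)\<close> apart, so continuity of \<open>rho0\<close> makes every single term
  small.\<close>

lemma rho0_partial_sums:
  assumes d: "0 < d"
  shows "\<forall>\<^sub>F n in sequentially. \<forall>k::nat. real k \<le> A * sqrt (real n) \<longrightarrow>
       \<bar>\<Sum>j=1..k. (rho0 (real_of_int (\<lfloor>real n * y\<rfloor> + int j) / real n) - rho0 y)\<bar> \<le> d * sqrt (real n) \<and>
       \<bar>\<Sum>j=1..k. (rho0 (real_of_int (\<lfloor>real n * y\<rfloor> + 1 - int j) / real n) - rho0 y)\<bar> \<le> d * sqrt (real n)"
proof -
  define A' where "A' = max A 0 + 1"
  have A': "0 < A'" "A \<le> A'" by (auto simp: A'_def)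
  have "0 < d / A'" using d A'(1) by simp
  from isCont_rho0[of y, unfolded continuous_at_eps_delta, rule_format, OF this]
  obtain h where h: "0 < h" "\<forall>z. \<bar>z - y\<bar> < h \<longrightarrow> \<bar>rho0 z - rho0 y\<bar> < d / A'"
    unfolding dist_real_def by blast
  have "(\<lambda>n. A' * (1 / sqrt (real n)) + 1 / real n) \<longlonglongrightarrow> A' * 0 + 0"
    by (intro tendsto_add tendsto_mult tendsto_const) real_asymp+
  hence "(\<lambda>n. A' * (1 / sqrt (real n)) + 1 / real n) \<longlonglongrightarrow> 0" by simp
  from order_tendstoD(2)[OF this h(1)] eventually_ge_at_top[of 1]
  show ?thesis
  proof eventually_elim
    case (elim n)
    have n: "0 < real n" using elim(2) by simp
    have near: "\<bar>rho0 (real_of_int (\<lfloor>real n * y\<rfloor> + z) / real n) - rho0 y\<bar> \<le> d / A'"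
      if z: "\<bar>real_of_int z\<bar> \<le> A' * sqrt (real n)" for z
    proof -
      define w where "w = real_of_int (\<lfloor>real n * y\<rfloor> + z) - real n * y"
      have w: "\<bar>w\<bar> \<le> A' * sqrt (real n) + 1" using z unfolding w_def by linarith
      have "real_of_int (\<lfloor>real n * y\<rfloor> + z) / real n - y = w / real n" unfolding w_def using n by (simp add: diff_divide_distrib)
      hence "\<bar>real_of_int (\<lfloor>real n * y\<rfloor> + z) / real n - y\<bar> = \<bar>w\<bar> / real n" using n by simp
      also have "\<dots> \<le> (A' * sqrt (real n) + 1) / real n" using w n by (intro divide_right_mono) auto
      also have "\<dots> = A' * (sqrt (real n) / real n) + 1 / real n" by (simp only: add_divide_distrib times_divide_eq_right)
      also have "sqrt (real n) / real n = 1 / sqrt (real n)" using real_sqrt_mult_self[of "real n"] n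
        by (metis abs_of_pos divide_divide_eq_left div_self order_less_irrefl real_sqrt_gt_zero)
      finally show ?thesis using h(2)[rule_format, of "real_of_int (\<lfloor>real n * y\<rfloor> + z) / real n"] elim(1) by linarith
    qed
    have bnd: "\<bar>\<Sum>j=1..k. (rho0 (real_of_int (\<lfloor>real n * y\<rfloor> + g j) / real n) - rho0 y)\<bar> \<le> d * sqrt (real n)"
      if k: "real k \<le> A * sqrt (real n)" and g: "\<And>j. 1 \<le> j \<Longrightarrow> j \<le> k \<Longrightarrow> \<bar>g j\<bar> \<le> int k" for k g
    proof -
      have kA: "real k \<le> A' * sqrt (real n)" using k A'(2) by (meson mult_right_mono order_trans real_sqrt_ge_zero of_nat_0_le_iff)
      have "\<bar>\<Sum>j=1..k. (rho0 (real_of_int (\<lfloor>real n * y\<rfloor> + g j) / real n) - rho0 y)\<bar> \<le> (\<Sum>j=1..k. d / A')"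
      proof (rule order_trans[OF sum_abs], rule sum_mono)
        fix j assume j: "j \<in> {1..k}"
        hence "\<bar>g j\<bar> \<le> int k" using g by simp
        hence "\<bar>real_of_int (g j)\<bar> \<le> real k" by linarith
        with kA show "\<bar>rho0 (real_of_int (\<lfloor>real n * y\<rfloor> + g j) / real n) - rho0 y\<bar> \<le> d / A'"
          by (intro near) linarith
      qed
      also have "\<dots> = real k * (d / A')" by simp
      also have "\<dots> \<le> (A' * sqrt (real n)) * (d / A')" using kA d A'(1) by (intro mult_right_mono) auto
      also have "\<dots> = d * sqrt (real n)" using A'(1) by simp
      finally show ?thesis .
    qed
    show ?case
    proof (intro allI impI conjI)
      fix k :: nat assume k: "real k \<le> A * sqrt (real n)"
      show "\<bar>\<Sum>j=1..k. (rho0 (real_of_int (\<lfloor>real n * y\<rfloor> + int j) / real n) - rho0 y)\<bar> \<le> d * sqrt (real n)"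
        by (rule bnd[OF k]) simp
      show "\<bar>\<Sum>j=1..k. (rho0 (real_of_int (\<lfloor>real n * y\<rfloor> + 1 - int j) / real n) - rho0 y)\<bar> \<le> d * sqrt (real n)"
        using bnd[OF k, of "\<lambda>j. 1 - int j"] by (simp add: algebra_simps)
    qed
  qed
qed

text \<open>Initial heights and Brownian motion are functions of the \<open>Inl\<close> coordinates
  and the walks of the \<open>Inr\<close> coordinates, so heights and walks are independent while
  the heights stay tied to the Brownian motion. The limit combines the coupling at time 0 with the
  theorem along the characteristic, applied to the rebuilt heights.\<close>

theorem brownian_construction:
  assumes p: "is_kernel p" "assumptionA p"
  shows "\<exists>(N::(nat \<Rightarrow> real) measure) sigma0' Y' B.
          IRW_setup p N sigma0' Y' \<and>
          (\<forall>n\<ge>1. \<forall>\<omega>\<in>space N. sigma0' n 0 \<omega> = 0) \<and>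
          (\<forall>n\<ge>1. prob_space.indep_vars N (\<lambda>_. count_space UNIV) (\<lambda>x. eta sigma0' n x) UNIV) \<and>
          (\<forall>n\<ge>1. \<forall>x. distr N (count_space UNIV) (eta sigma0' n x)
                       = distr M (count_space UNIV) (eta sigma0 n x)) \<and>
          two_sided_BM N B \<and>
          (\<forall>x t. 0 \<le> t \<longrightarrow>
             conv_in_prob N
               (\<lambda>n \<omega>. (real_of_int (height sigma0' Y' n (real n * t) \<lfloor>real n * x\<rfloor> \<omega>)
                           - real n * u0 (x - drift p * t)) / sqrt (real n))
               (\<lambda>\<omega>. B (signed_integral v0 (x - drift p * t)) \<omega>))"
proof -
  define \<mu> where "\<mu> c = (case c of Inl _ \<Rightarrow> std_normal_distribution | Inr (q, i) \<Rightarrow> rw_law p i)" for c :: coord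
  obtain N :: "(nat \<Rightarrow> real) measure" and W :: "coord \<Rightarrow> (nat \<Rightarrow> real) \<Rightarrow> real"
    where N: "prob_space N" "space N = UNIV" and W: "prob_space.indep_vars N (\<lambda>_. borel) W UNIV"
      and WD: "\<And>c. distr N borel (W c) = \<mu> c"
  proof (rule ex_indep_coordinates[of \<mu>])
    show "prob_space (\<mu> c)" for c
      using std_normal.prob_space_axioms rw_law_prob_space by (auto simp: \<mu>_def split: sum.split)
    show "sets (\<mu> c) = sets borel" for c
      using sets_rw_law by (auto simp: \<mu>_def split: sum.split)
  qed (rule that)
  interpret N: prob_space N by (rule N(1))
  have [measurable]: "W c \<in> borel_measurable N" for c using W unfolding N.indep_vars_def2 by blast
  define Z where "Z i = W (Inl (True, i))" for i
  define A where "A i = W (Inl (False, i))" for i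
  have norm: "normal_array N (\<lambda>i. W (Inl (b, i)))" for b
  proof unfold_locales
    show "N.indep_vars (\<lambda>_. borel) (\<lambda>i. W (Inl (b, i))) UNIV" by (rule N.indep_vars_reindex[OF W]) (auto simp: inj_on_def)
    show "distr N borel (W (Inl (b, x))) = std_normal_distribution" for x by (simp add: WD \<mu>_def)
  qed
  have pair: "normal_pair N Z A"
    unfolding normal_pair_def normal_pair_axioms_def
  proof (intro conjI)
    show "normal_array N Z" "normal_array N A" using norm unfolding Z_def A_def by auto
    show "indep_rv N (Pi\<^sub>M UNIV (\<lambda>_. borel)) (\<lambda>\<omega> i. Z i \<omega>) (Pi\<^sub>M UNIV (\<lambda>_. borel)) (\<lambda>\<omega> i. A i \<omega>)"
      unfolding Z_def A_def by (rule N.indep_rv_vectors[OF W]) auto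
  qed
  interpret pair: normal_pair N Z A by (rule pair)
  obtain K :: "nat \<Rightarrow> nat" where K: "\<And>n. 1 \<le> K n" "filterlim K at_top sequentially"
    and scale: "eventually (\<lambda>n. (\<forall>i\<in>{- int ((K n)\<^sup>2)..int ((K n)\<^sup>2)}. measure std_normal_distribution
        {x. 1 / real (K n) ^ 4 < \<bar>quantile (blk_law n (K n) i) (normal_cdf x) - blk_sd (K n) i * x\<bar>} \<le> 1 / real (K n) ^ 4)
      \<and> (K n) ^ 4 \<le> n) sequentially"
    by (rule blk_scale_exists) (rule that)
  define C where "C n \<omega> i = unit_increment (V_grid (K n)) (\<lambda>j. Z j \<omega>) (\<lambda>j. A j \<omega>) i" for n \<omega> i
  define S where "S n x \<omega> = blk_height n (K n) (C n \<omega>) x" for n x \<omega>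
  \<comment> \<open>The same walks are used for every \<open>n\<close>; independence is demanded
    only within each \<open>n\<close>.\<close>
  define Y where "Y (n::nat) q t \<omega> = rw_path (\<lambda>i. W (Inr (q, i)) \<omega>) t" for n q t \<omega>
  have bc: "block_coupling M sigma0 u0 rho0 v0 N n (K n) (\<lambda>i \<omega>. C n \<omega> i)" if "1 \<le> n" for n
    using that K(1) pair.indep_increment[OF mono_V_grid] pair.distr_increment[OF mono_V_grid]
      example_axioms N.prob_space_axioms
    by (intro block_coupling.intro block_coupling_axioms.intro) (auto simp: C_def pair.increment_def[abs_def])
  have etaS: "eta S n x = (\<lambda>\<omega>. blk_eta n (K n) (C n \<omega>) x)" for n x
    by (simp add: fun_eq_iff eta_def S_def blk_height_eta)
  have eta_indep': "N.indep_vars (\<lambda>_. count_space UNIV) (\<lambda>x. eta S n x) UNIV" if "1 \<le> n" for n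
    unfolding etaS using block_coupling.new_eta_indep[OF bc[OF that]] .
  have eta_distr': "distr N (count_space UNIV) (eta S n x) = distr M (count_space UNIV) (eta sigma0 n x)" if "1 \<le> n" for n x
    unfolding etaS using block_coupling.distr_new_eta[OF bc[OF that]] .
  have Cm: "(\<lambda>v. unit_increment (V_grid (K n)) (\<lambda>j. v (True, j)) (\<lambda>j. v (False, j)))
      \<in> measurable (Pi\<^sub>M UNIV (\<lambda>_. borel)) (Pi\<^sub>M UNIV (\<lambda>_. borel))" for n
  proof (rule measurable_PiM_single')
    fix i
    have [measurable]: "(\<lambda>v::bool \<times> nat \<times> int \<Rightarrow> real. v j) \<in> borel_measurable (Pi\<^sub>M UNIV (\<lambda>_. borel))" for j
      by (rule measurable_component_singleton) simp
    have vec: "(\<lambda>v::bool \<times> nat \<times> int \<Rightarrow> real. \<lambda>j. v (b, j)) \<in> measurable (Pi\<^sub>M UNIV (\<lambda>_. borel)) (Pi\<^sub>M UNIV (\<lambda>_. borel))" for b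
      by (rule vector_measurable) simp
    have [measurable]: "(\<lambda>v::bool \<times> nat \<times> int \<Rightarrow> real. bm_path (\<lambda>j. v (True, j)) s) \<in> borel_measurable (Pi\<^sub>M UNIV (\<lambda>_. borel))" for s
      by (rule measurable_compose[OF vec measurable_bm_path])
    show "(\<lambda>v. unit_increment (V_grid (K n)) (\<lambda>j. v (True, j)) (\<lambda>j. v (False, j)) i) \<in> borel_measurable (Pi\<^sub>M UNIV (\<lambda>_. borel))"
      unfolding unit_increment_def by (cases "V_grid (K n) i < V_grid (K n) (i + 1)") simp_all
  qed (simp add: space_PiM)
  have Sm: "(\<lambda>v x. blk_height n (K n) (unit_increment (V_grid (K n)) (\<lambda>j. v (True, j)) (\<lambda>j. v (False, j))) x)
      \<in> measurable (Pi\<^sub>M UNIV (\<lambda>_. borel)) (Pi\<^sub>M UNIV (\<lambda>_. count_space UNIV))" for n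
    by (rule measurable_compose[OF Cm blk_height_space_measurable])
  have C_eq: "C n \<omega> = unit_increment (V_grid (K n)) (\<lambda>j. W (Inl (True, j)) \<omega>) (\<lambda>j. W (Inl (False, j)) \<omega>)" for n \<omega>
    by (simp add: fun_eq_iff C_def Z_def A_def)
  have irw: "IRW_setup p N S Y"
    unfolding IRW_setup_def
  proof (intro conjI allI impI ballI)
    fix n :: nat assume n: "1 \<le> n"
    show "mono (\<lambda>x. S n x \<omega>)" for \<omega>
    proof (rule monoI)
      fix a c :: int assume "a \<le> c"
      hence "S n c \<omega> - S n a \<omega> = (\<Sum>z\<in>{a<..c}. blk_eta n (K n) (C n \<omega>) z)"
        unfolding S_def blk_height_def by (rule signed_sum_diff)
      also have "0 \<le> \<dots>" by (intro sum_nonneg blk_eta_nonneg[OF n K(1)])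
      finally show "S n a \<omega> \<le> S n c \<omega>" by simp
    qed
    have ind: "indep_rv N (Pi\<^sub>M UNIV (\<lambda>_. borel)) (\<lambda>\<omega> i. W (Inl i) \<omega>) (Pi\<^sub>M UNIV (\<lambda>_. borel)) (\<lambda>\<omega> i. W (Inr i) \<omega>)"
      by (rule N.indep_rv_vectors[OF W]) auto
    have paths: "(\<lambda>v (q::int \<times> nat). \<lambda>t\<in>{0::real..}. rw_path (\<lambda>i. v (q, i)) t) \<in> measurable (Pi\<^sub>M UNIV (\<lambda>_. borel)) (Pi\<^sub>M UNIV (\<lambda>_. Pi\<^sub>M {0..} (\<lambda>_. count_space UNIV)))"
    proof (rule measurable_PiM_single')
      fix q :: "int \<times> nat"
      have "(\<lambda>v::(int \<times> nat) \<times> nat \<times> nat \<Rightarrow> real. \<lambda>i. v (q, i)) \<in> measurable (Pi\<^sub>M UNIV (\<lambda>_. borel)) (Pi\<^sub>M UNIV (\<lambda>_. borel))"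
        by (rule vector_measurable) (rule measurable_component_singleton, simp)
      from measurable_compose[OF this rw_path_process_measurable]
      show "(\<lambda>v. \<lambda>t\<in>{0::real..}. rw_path (\<lambda>i. v (q, i)) t) \<in> measurable (Pi\<^sub>M UNIV (\<lambda>_. borel)) (Pi\<^sub>M {0..} (\<lambda>_. count_space UNIV))" .
    qed (auto simp: space_PiM PiE_def extensional_def)
    from N.indep_rv_compose[OF ind Sm[of n] paths]
    have irv: "indep_rv N (Pi\<^sub>M UNIV (\<lambda>_. count_space UNIV)) (\<lambda>\<omega> x. S n x \<omega>)
           (Pi\<^sub>M UNIV (\<lambda>_. Pi\<^sub>M {0..} (\<lambda>_. count_space UNIV))) (\<lambda>\<omega> i. \<lambda>t\<in>{0..}. Y n i t \<omega>)"
      by (simp add: S_def C_eq Y_def)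
    thus "indep_rv N (Pi\<^sub>M UNIV (\<lambda>_. count_space UNIV)) (\<lambda>\<omega>. \<lambda>x. S n x \<omega>)
           (Pi\<^sub>M UNIV (\<lambda>_. Pi\<^sub>M {0..} (\<lambda>_. count_space UNIV))) (\<lambda>\<omega>. \<lambda>i. \<lambda>t\<in>{0..}. Y n i t \<omega>)" .
    have "(\<lambda>\<omega> x. S n x \<omega>) \<in> measurable N (Pi\<^sub>M UNIV (\<lambda>_. count_space UNIV))" using irv by (simp add: indep_rv_def)
    from measurable_compose[OF this measurable_component_singleton[of _ UNIV]]
    show "S n x \<in> measurable N (count_space UNIV)" for x by simp
    show "is_rw p N (Y n q)" for q
    proof -
      interpret rw: rw_coordinates N p "\<lambda>i. W (Inr (q, i))"
      proof unfold_locales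
        show "N.indep_vars (\<lambda>_. borel) (\<lambda>i. W (Inr (q, i))) UNIV" by (rule N.indep_vars_reindex[OF W]) (auto simp: inj_on_def)
        show "distr N borel (W (Inr (q, i))) = rw_law p i" for i by (simp add: WD \<mu>_def)
      qed (rule p(1))
      show ?thesis using rw.is_rw_rw_path by (simp add: Y_def[abs_def])
    qed
    have vec: "N.indep_vars (\<lambda>_. Pi\<^sub>M UNIV (\<lambda>_. borel)) (\<lambda>q \<omega> i. W (Inr (q, i)) \<omega>) UNIV"
      by (rule N.indep_vars_vectors[OF W, of "\<lambda>q i. Inr (q, i)"]) auto
    show "N.indep_vars (\<lambda>_. Pi\<^sub>M {0..} (\<lambda>_. count_space UNIV)) (\<lambda>i \<omega>. \<lambda>t\<in>{0..}. Y n i t \<omega>) UNIV"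
      unfolding Y_def by (rule N.indep_vars_compose2[OF vec rw_path_process_measurable])
  qed (rule N(1))
  have lim: "conv_in_prob N (\<lambda>n \<omega>. (real_of_int (height S Y n (real n * t) \<lfloor>real n * x\<rfloor> \<omega>) - real n * u0 (x - drift p * t)) / sqrt (real n))
      (\<lambda>\<omega>. pair.bm (V (x - drift p * t)) \<omega>)" if t: "0 \<le> t" for x t
  proof -
    define y where "y = x - drift p * t"
    have c1: "conv_in_prob N (\<lambda>n \<omega>. (real_of_int (S n \<lfloor>real n * y\<rfloor> \<omega>) - real n * u0 y) / sqrt (real n)) (\<lambda>\<omega>. pair.bm (V y) \<omega>)"
      using coupled_height_limit[OF pair K scale, of y] by (simp add: S_def C_def[abs_def] pair.bm_def)
    obtain B where B: "\<And>n x. 1 \<le> n \<Longrightarrow> integrable M (\<lambda>\<omega>. real_of_int (eta sigma0 n x \<omega>) ^ 6) \<and> expectation (\<lambda>\<omega>. real_of_int (eta sigma0 n x \<omega>) ^ 6) \<le> B"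
      using sixth_moment_bound by blast
    have mean: "mean_eta N S n z = rho0 (real_of_int z / real n)" if "1 \<le> n" for n z
      \<comment> \<open>The rebuilt occupation numbers have the original laws, so means and moment
        bounds carry over.\<close>
      unfolding mean_eta_def etaS block_coupling.integral_new_eta(1)[OF bc[OF that], of real_of_int] by (rule mean_eta_eq[OF that])
    have c2: "conv_in_prob N (\<lambda>n \<omega>. (real_of_int (height S Y n (real n * t) \<lfloor>real n * x\<rfloor> \<omega>)
      - real_of_int (S n \<lfloor>real n * (x - drift p * t)\<rfloor> \<omega>)) / sqrt (real n)) (\<lambda>_. 0)"
    proof (rule height_along_characteristic[OF p irw t eta_indep'])
      fix n :: nat and z :: int assume n: "1 \<le> n"
      note m = moments_le_sixth[OF eta_count_measurable[OF n] B[OF n, THEN conjunct1] B[OF n, THEN conjunct2]]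
      show "integrable N (\<lambda>\<omega>. (real_of_int (eta S n z \<omega>))\<^sup>2)"
        unfolding etaS block_coupling.integral_new_eta(2)[OF bc[OF n], of "\<lambda>k. (real_of_int k)\<^sup>2"] by (rule m)
      show "integral\<^sup>L N (\<lambda>\<omega>. (real_of_int (eta S n z \<omega>))\<^sup>2) \<le> B"
        unfolding etaS block_coupling.integral_new_eta(1)[OF bc[OF n], of "\<lambda>k. (real_of_int k)\<^sup>2"] by (rule m)
    next
      show "0 \<le> rho0 y" by (rule rho0_nonneg)
      fix A d :: real assume "0 < d"
      from rho0_partial_sums[OF this, of A y] eventually_ge_at_top[of 1]
      show "\<forall>\<^sub>F n in sequentially. \<forall>k::nat. real k \<le> A * sqrt (real n) \<longrightarrow>
         \<bar>\<Sum>j=1..k. (mean_eta N S n (\<lfloor>real n * (x - drift p * t)\<rfloor> + int j) - rho0 y)\<bar> \<le> d * sqrt (real n) \<and>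
         \<bar>\<Sum>j=1..k. (mean_eta N S n (\<lfloor>real n * (x - drift p * t)\<rfloor> + 1 - int j) - rho0 y)\<bar> \<le> d * sqrt (real n)"
        by eventually_elim (simp only: mean y_def)
    qed
    have "conv_in_prob N (\<lambda>n \<omega>. (real_of_int (height S Y n (real n * t) \<lfloor>real n * x\<rfloor> \<omega>) - real_of_int (S n \<lfloor>real n * y\<rfloor> \<omega>)) / sqrt (real n)
      + (real_of_int (S n \<lfloor>real n * y\<rfloor> \<omega>) - real n * u0 y) / sqrt (real n)) (\<lambda>\<omega>. 0 + pair.bm (V y) \<omega>)"
      using c2 c1 by (intro N.conv_in_prob_add) (simp_all add: y_def)
    moreover have "(\<lambda>n \<omega>. (real_of_int (height S Y n (real n * t) \<lfloor>real n * x\<rfloor> \<omega>) - real_of_int (S n \<lfloor>real n * y\<rfloor> \<omega>)) / sqrt (real n)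
      + (real_of_int (S n \<lfloor>real n * y\<rfloor> \<omega>) - real n * u0 y) / sqrt (real n))
      = (\<lambda>n \<omega>. (real_of_int (height S Y n (real n * t) \<lfloor>real n * x\<rfloor> \<omega>) - real n * u0 y) / sqrt (real n))"
      by (intro ext) (simp add: diff_divide_distrib)
    ultimately show ?thesis by (simp add: y_def)
  qed
  show ?thesis
  proof (intro exI conjI allI impI ballI)
    show "IRW_setup p N S Y" by (rule irw)
    show "S n 0 \<omega> = 0" for n \<omega> by (simp add: S_def blk_height_0)
    show "two_sided_BM N pair.bm" by (rule pair.two_sided_BM_bm)
  qed (use eta_indep' eta_distr' lim in auto)
qed

end

lemma example_if_example21:
  assumes "example21 M sigma0 u0 rho0 v0" shows "example M sigma0 u0 rho0 v0"
proof (intro example.intro example_axioms.intro)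
  show "prob_space M" using assms unfolding example21_def by blast
qed (rule assms)

theorem theorem2p1:
  fixes p :: "int \<Rightarrow> real"
  assumes "is_kernel p" and "assumptionA p"
  shows
   "(\<forall>(M::'a measure) sigma0 Y u0 rho0 v0.
       IRW_setup p M sigma0 Y \<and> assumptionB M sigma0 u0 \<and>
       (\<forall>y. (u0 has_real_derivative rho0 y) (at y)) \<and> continuous_on UNIV rho0 \<and>
       (\<forall>y. assumptionC_at M sigma0 rho0 v0 y) \<longrightarrow>
       (\<forall>x t. 0 \<le> t \<longrightarrow>
          conv_in_prob M
            (\<lambda>n \<omega>. real_of_int (height sigma0 Y n (real n * t) \<lfloor>real n * x\<rfloor> \<omega>) / real n)
            (\<lambda>_. u0 (x - drift p * t)) \<and>
          conv_in_prob M
            (\<lambda>n \<omega>. (real_of_int (height sigma0 Y n (real n * t) \<lfloor>real n * x\<rfloor> \<omega>)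
                        - real n * u0 (x - drift p * t)) / sqrt (real n)
                   - (real_of_int (sigma0 n \<lfloor>real n * (x - drift p * t)\<rfloor> \<omega>)
                        - real n * u0 (x - drift p * t)) / sqrt (real n))
            (\<lambda>_. 0)))
    \<and>
    (\<forall>(M::'a measure) sigma0 u0 rho0 v0.
       example21 M sigma0 u0 rho0 v0 \<longrightarrow>
       (\<exists>(N::(nat \<Rightarrow> real) measure) sigma0' Y' B.
          IRW_setup p N sigma0' Y' \<and>
          (\<forall>n\<ge>1. \<forall>\<omega>\<in>space N. sigma0' n 0 \<omega> = 0) \<and>
          (\<forall>n\<ge>1. prob_space.indep_vars N (\<lambda>_. count_space UNIV) (\<lambda>x. eta sigma0' n x) UNIV) \<and>
          (\<forall>n\<ge>1. \<forall>x. distr N (count_space UNIV) (eta sigma0' n x)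
                       = distr M (count_space UNIV) (eta sigma0 n x)) \<and>
          two_sided_BM N B \<and>
          (\<forall>x t. 0 \<le> t \<longrightarrow>
             conv_in_prob N
               (\<lambda>n \<omega>. (real_of_int (height sigma0' Y' n (real n * t) \<lfloor>real n * x\<rfloor> \<omega>)
                           - real n * u0 (x - drift p * t)) / sqrt (real n))
               (\<lambda>\<omega>. B (signed_integral v0 (x - drift p * t)) \<omega>))))"
proof (intro conjI allI impI)
  \<comment> \<open>Both heights carry the same centring, which cancels in the difference.\<close>
  have eq: "(\<lambda>n \<omega>. (a n \<omega> - c n) / s n - (b n \<omega> - c n) / s n) = (\<lambda>n \<omega>. (a n \<omega> - b n \<omega>) / s n)"
    for a b :: "nat \<Rightarrow> 'a \<Rightarrow> real" and c s :: "nat \<Rightarrow> real"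
    by (intro ext) (simp add: diff_divide_distrib)
  fix M :: "'a measure" and sigma0 Y u0 rho0 v0 x and t :: real
  assume H: "IRW_setup p M sigma0 Y \<and> assumptionB M sigma0 u0 \<and>
     (\<forall>y. (u0 has_real_derivative rho0 y) (at y)) \<and> continuous_on UNIV rho0 \<and>
     (\<forall>y. assumptionC_at M sigma0 rho0 v0 y)" and t: "0 \<le> t"
  hence irw: "IRW_setup p M sigma0 Y" and B: "assumptionB M sigma0 u0"
    and C: "assumptionC_at M sigma0 rho0 v0 (x - drift p * t)" by blast+
  show "conv_in_prob M (\<lambda>n \<omega>. real_of_int (height sigma0 Y n (real n * t) \<lfloor>real n * x\<rfloor> \<omega>) / real n) (\<lambda>_. u0 (x - drift p * t))"
    by (rule height_law_of_large_numbers[OF assms irw t B C])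
  show "conv_in_prob M
          (\<lambda>n \<omega>. (real_of_int (height sigma0 Y n (real n * t) \<lfloor>real n * x\<rfloor> \<omega>)
                      - real n * u0 (x - drift p * t)) / sqrt (real n)
                 - (real_of_int (sigma0 n \<lfloor>real n * (x - drift p * t)\<rfloor> \<omega>)
                      - real n * u0 (x - drift p * t)) / sqrt (real n))
          (\<lambda>_. 0)"
    unfolding eq by (rule height_fluctuation_along_characteristic[OF assms irw t C])
qed (rule example.brownian_construction[OF example_if_example21 assms])

end
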